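(* Let $\mathcal{P}$ be a pure logic program, $\mathcal{R}_{\mathcal{P}}$ its associated tile system, and $G$ a goal, viewed as a configuration $G\colon\mathsf{t}^n\to\mathsf{p}$ over its variables. Then: (1) if $\mathcal{P}\Vdash G\Rightarrow_\sigma G'$ (one SLD-resolution step), then $\mathcal{R}_{\mathcal{P}}\vdash\langle G,\ id,\ \theta,\ G'\rangle$ with $\theta=\sigma_{|\mathit{Var}(G)}$; (2) if $\mathcal{R}_{\mathcal{P}}\vdash\langle G,\ id,\ \theta,\ G'\rangle$, then there exists $\sigma$ with $\theta=\sigma_{|\mathit{Var}(G)}$ such that $\mathcal{P}\Vdash G\Rightarrow^*_\sigma G'$.
   Context: SLD-resolution: a clause is $H\mathrel{:-}B_1,\dots,B_n$ ($H$, $B_i$ atomic formulas); a goal is a conjunction $A_1,\dots,A_k$ of atoms ($\Box$ is the empty goal). A resolution step $G\Rightarrow_\theta G'$ selects an atom $A_i$ of $G$ and a clause of $\mathcal{P}$ with variables renamed apart to be fresh, whose head $H$ unifies with $A_i$ with most general unifier $\theta$, and yields $G'=\theta;(A_1,\dots,A_{i-1},B_1,\dots,B_n,A_{i+1},\dots,A_k)$; $\Box,G$ and $G,\Box$ step to $G$ with the identity. $G\Rightarrow^*_\sigma G'$ is a finite sequence of steps with $\sigma$ the composition of the mgu's. Substitutions are identified with arrows of the term theory; goals with configurations built from atoms by $\wedge$ and variable sharing. Arrows: sorts $\mathsf{t}$ (terms) and $\mathsf{p}$ (predicates); function symbols $f\colon\mathsf{t}^n\to\mathsf{t}$, predicate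 symbols $p\colon\mathsf{t}^k\to\mathsf{p}$; arrows of the free cartesian theory are tuples of terms over typed variables, with diagrammatic composition $;$ (substitution), juxtaposition $\otimes$, symmetries $\gamma$, duplicators $\nabla_{\underline n}=\langle x_1..x_n,x_1..x_n\rangle$, dischargers $!_{\underline n}$. The tile system $\mathcal{R}_{\mathcal{P}}$: configurations are arrows of the free cartesian category generated by function symbols, predicate symbols, $\Box\colon\epsilon\to\mathsf{p}$ and $\wedge\colon\mathsf{pp}\to\mathsf{p}$ (associative, unit $\Box$); observations are arrows of the free cartesian category on the function symbols. A tile $\langle s,u,v,r\rangle$ has initial configuration $s\colon o_1\to o_0$, trigger $u\colon o_2\to o_0$, effect $v\colon o_3\to o_1$, final configuration $r\colon o_3\to o_2$. Basic tiles: for each clause $p(t_1,\dots,t_k)\mathrel{:-}q_1(\vec s_1),\dots,q_m(\vec s_m)$ over $x_1..x_n$, the tile $\langle p,id_{\mathsf p},\langle t_1,\dots,t_k\rangle,q_1(\vec s_1)\wedge\dots\wedge q_m(\vec s_m)\rangle$; and the pullback tiles, for each $n$-ary function symbol $f$: $\langle f,f,id,id\rangle$, $\langle f\otimes id_{\underline1},\nabla_{\underline1},\nabla_{\underline n};(id_{\underline n}\otimes f),f\rangle$, $\langle\nabla_{\underline1},f\otimes id_{\underline1},f,\nabla_{\underline n};(id_{\underline n}\otimes f)\rangle$, plus $\langle\nabla_{\underline1},\nabla_{\underline1},id_{\underline1},id_{\underline1}\rangle$, $\langle\gamma_{\underline1,\underline1},\gamma_{\underline1,\underline1},id_{\underline2},id_{\underline2}\rangle$,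 $\langle\nabla_{\underline1}\otimes id_{\underline1},id_{\underline1}\otimes\nabla_{\underline1},\nabla_{\underline1},\nabla_{\underline1}\rangle$. Entailed tiles ($\mathcal{R}_{\mathcal{P}}\vdash$) are those obtained from basic tiles and identity tiles $\langle h,id,id,h\rangle$, $\langle id,v,v,id\rangle$ by horizontal composition $\langle s_1,u_1,v_1,r_1\rangle*\langle s_2,v_1,v_2,r_2\rangle=\langle s_2;s_1,u_1,v_2,r_2;r_1\rangle$, vertical composition $\langle s_1,u_1,v_1,r_1\rangle\cdot\langle r_1,u_2,v_2,r_2\rangle=\langle s_1,u_2;u_1,v_2;v_1,r_2\rangle$, and parallel composition $\otimes$.
   Formalization: Configurations may duplicate or discard only variables of sort t (each variable of sort p occurs exactly once); with ∇ and ! at sort p part (2) fails, e.g. for the program {p(c)} one gets the tile ⟨q, id, c, q(c)⟩ though q(x) has no such SLD derivation. *)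

theory Defs
  imports "HOL-Library.Infinite_Typeclass"
begin

subsection \<open>First-order syntax\<close>

record ('p, 'f) signature =
  farity :: "'f \<Rightarrow> nat"
  parity :: "'p \<Rightarrow> nat"

datatype ('f, vars_trm: 'v) trm = Var 'v | Fun 'f "('f, 'v) trm list"

primrec subst_trm :: "('f, 'v) trm \<Rightarrow> ('v \<Rightarrow> ('f, 'w) trm) \<Rightarrow> ('f, 'w) trm"  (infixl "\<cdot>\<^sub>t" 67) where
  "Var x \<cdot>\<^sub>t \<sigma> = \<sigma> x"
| "Fun f ts \<cdot>\<^sub>t \<sigma> = Fun f (map (\<lambda>t. t \<cdot>\<^sub>t \<sigma>) ts)"

primrec wf_trm :: "('p, 'f) signature \<Rightarrow> ('f, 'v) trm \<Rightarrow> bool" where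
  "wf_trm S (Var x) \<longleftrightarrow> True"
| "wf_trm S (Fun f ts) \<longleftrightarrow> length ts = farity S f \<and> list_all id (map (wf_trm S) ts)"

datatype ('p, 'f, 'v) atom = Atom (pred: 'p) (args: "('f, 'v) trm list")

text \<open>A goal is the list of its conjuncts, and \<open>[]\<close> is \<open>\<box>\<close>.\<close>

type_synonym ('p, 'f, 'v) goal = "('p, 'f, 'v) atom list"

datatype ('p, 'f, 'v) clause = Clause (head: "('p, 'f, 'v) atom") (body: "('p, 'f, 'v) goal")

definition vars_atom :: "('p, 'f, 'v) atom \<Rightarrow> 'v set" where
  "vars_atom A = (\<Union>t\<in>set (args A). vars_trm t)"

definition vars_goal :: "('p, 'f, 'v) goal \<Rightarrow> 'v set" where
  "vars_goal G = (\<Union>A\<in>set G. vars_atom A)"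

definition vars_clause :: "('p, 'f, 'v) clause \<Rightarrow> 'v set" where
  "vars_clause C = vars_atom (head C) \<union> vars_goal (body C)"

definition subst_atom :: "('p, 'f, 'v) atom \<Rightarrow> ('v \<Rightarrow> ('f, 'w) trm) \<Rightarrow> ('p, 'f, 'w) atom" where
  "subst_atom A \<sigma> = Atom (pred A) (map (\<lambda>t. t \<cdot>\<^sub>t \<sigma>) (args A))"

definition subst_goal :: "('p, 'f, 'v) goal \<Rightarrow> ('v \<Rightarrow> ('f, 'w) trm) \<Rightarrow> ('p, 'f, 'w) goal" where
  "subst_goal G \<sigma> = map (\<lambda>A. subst_atom A \<sigma>) G"

definition subst_clause :: "('p, 'f, 'v) clause \<Rightarrow> ('v \<Rightarrow> ('f, 'w) trm) \<Rightarrow> ('p, 'f, 'w) clause" where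
  "subst_clause C \<sigma> = Clause (subst_atom (head C) \<sigma>) (subst_goal (body C) \<sigma>)"

definition wf_atom :: "('p, 'f) signature \<Rightarrow> ('p, 'f, 'v) atom \<Rightarrow> bool" where
  "wf_atom S A \<longleftrightarrow> length (args A) = parity S (pred A) \<and> (\<forall>t\<in>set (args A). wf_trm S t)"

definition wf_goal :: "('p, 'f) signature \<Rightarrow> ('p, 'f, 'v) goal \<Rightarrow> bool" where
  "wf_goal S G \<longleftrightarrow> (\<forall>A\<in>set G. wf_atom S A)"

definition wf_program :: "('p, 'f) signature \<Rightarrow> ('p, 'f, 'v) clause set \<Rightarrow> bool" where
  "wf_program S P \<longleftrightarrow> (\<forall>C\<in>P. wf_atom S (head C) \<and> wf_goal S (body C))"


subsection \<open>Substitutions and SLD-resolution\<close>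

definition is_subst :: "('p, 'f) signature \<Rightarrow> ('v \<Rightarrow> ('f, 'v) trm) \<Rightarrow> bool" where
  "is_subst S \<sigma> \<longleftrightarrow> finite {x. \<sigma> x \<noteq> Var x} \<and> (\<forall>x. wf_trm S (\<sigma> x))"

text \<open>Composition in diagrammatic order.\<close>

definition subst_comp ::
  "('v \<Rightarrow> ('f, 'v) trm) \<Rightarrow> ('v \<Rightarrow> ('f, 'v) trm) \<Rightarrow> 'v \<Rightarrow> ('f, 'v) trm"  (infixl "\<circ>\<^sub>s" 75) where
  "(\<sigma> \<circ>\<^sub>s \<tau>) x = \<sigma> x \<cdot>\<^sub>t \<tau>"

definition vars_subst :: "('v \<Rightarrow> ('f, 'v) trm) \<Rightarrow> 'v set" where
  "vars_subst \<sigma> = (\<Union>x\<in>{x. \<sigma> x \<noteq> Var x}. insert x (vars_trm (\<sigma> x)))"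

definition is_mgu ::
  "('p, 'f) signature \<Rightarrow> ('v \<Rightarrow> ('f, 'v) trm) \<Rightarrow> ('p, 'f, 'v) atom \<Rightarrow> ('p, 'f, 'v) atom \<Rightarrow> bool" where
  "is_mgu S \<theta> A B \<longleftrightarrow>
     is_subst S \<theta> \<and> subst_atom A \<theta> = subst_atom B \<theta> \<and>
     (\<forall>\<tau>. is_subst S \<tau> \<and> subst_atom A \<tau> = subst_atom B \<tau> \<longrightarrow>
        (\<exists>\<gamma>. is_subst S \<gamma> \<and> \<tau> = \<theta> \<circ>\<^sub>s \<gamma>))"

definition variant_of :: "('p, 'f, 'v) clause \<Rightarrow> ('p, 'f, 'v) clause \<Rightarrow> bool" where
  "variant_of C' C \<longleftrightarrow> (\<exists>\<rho>. inj_on \<rho> (vars_clause C) \<and> C' = subst_clause C (Var \<circ> \<rho>))"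

text \<open>
  \<open>resolution S P W G \<theta> G' W'\<close>: a resolution step from \<open>G\<close> to \<open>G'\<close> in a derivation whose variables
  so far are \<open>W\<close>; the clause variant must be fresh for \<open>W\<close>, and \<open>W'\<close> extends \<open>W\<close> by the variables
  that the step brings in.
\<close>

inductive resolution ::
  "('p, 'f) signature \<Rightarrow> ('p, 'f, 'v) clause set \<Rightarrow> 'v set \<Rightarrow> ('p, 'f, 'v) goal \<Rightarrow>
   ('v \<Rightarrow> ('f, 'v) trm) \<Rightarrow> ('p, 'f, 'v) goal \<Rightarrow> 'v set \<Rightarrow> bool"
  for S P where
  resolve: "\<lbrakk>C \<in> P; variant_of C' C; vars_clause C' \<inter> W = {}; is_mgu S \<theta> A (head C')\<rbrakk> \<Longrightarrow>
    resolution S P W (G1 @ [A] @ G2) \<theta> (subst_goal (G1 @ body C' @ G2) \<theta>)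
      (W \<union> vars_clause C' \<union> vars_subst \<theta>)"
| box_left: "resolution S P W ([] @ G) Var G W"
| box_right: "resolution S P W (G @ []) Var G W"

inductive resolutions ::
  "('p, 'f) signature \<Rightarrow> ('p, 'f, 'v) clause set \<Rightarrow> 'v set \<Rightarrow> ('p, 'f, 'v) goal \<Rightarrow>
   ('v \<Rightarrow> ('f, 'v) trm) \<Rightarrow> ('p, 'f, 'v) goal \<Rightarrow> bool"
  for S P where
  none: "resolutions S P W G Var G"
| step: "\<lbrakk>resolution S P W G \<theta> G1 W1; resolutions S P W1 G1 \<sigma> G'\<rbrakk> \<Longrightarrow>
    resolutions S P W G (\<theta> \<circ>\<^sub>s \<sigma>) G'"

definition sld_step ::
  "('p, 'f) signature \<Rightarrow> ('p, 'f, 'v) clause set \<Rightarrow> ('p, 'f, 'v) goal \<Rightarrow>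
   ('v \<Rightarrow> ('f, 'v) trm) \<Rightarrow> ('p, 'f, 'v) goal \<Rightarrow> bool" where
  "sld_step S P G \<theta> G' \<longleftrightarrow> (\<exists>W'. resolution S P (vars_goal G) G \<theta> G' W')"

definition sld_steps ::
  "('p, 'f) signature \<Rightarrow> ('p, 'f, 'v) clause set \<Rightarrow> ('p, 'f, 'v) goal \<Rightarrow>
   ('v \<Rightarrow> ('f, 'v) trm) \<Rightarrow> ('p, 'f, 'v) goal \<Rightarrow> bool" where
  "sld_steps S P G \<sigma> G' \<longleftrightarrow> resolutions S P (vars_goal G) G \<sigma> G'"


subsection \<open>Arrows as tuples of terms over typed variables\<close>

text \<open>
  An arrow from \<open>o1\<close> to \<open>o0\<close> is a tuple with one component for each position of \<open>o0\<close>, over the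
  variables \<open>0, 1, \<dots>, length o1 - 1\<close>, where variable \<open>i\<close> has sort \<open>o1 ! i\<close>. As \<open>\<and>\<close> is associative
  with unit \<open>\<box>\<close>, a component of sort \<open>p\<close> is a word of atoms and variables of sort \<open>p\<close>.
\<close>

datatype srt = Tm | Pr

datatype ('p, 'f) lit = Lit "('p, 'f, nat) atom" | PVar nat

datatype ('p, 'f) component = TC (tc: "('f, nat) trm") | PC (pc: "('p, 'f) lit list")

datatype ('p, 'f) arrow = Arrow (src: "srt list") (tuple: "('p, 'f) component list")

primrec srt_of :: "('p, 'f) component \<Rightarrow> srt" where
  "srt_of (TC t) = Tm"
| "srt_of (PC w) = Pr"

definition tgt :: "('p, 'f) arrow \<Rightarrow> srt list" where
  "tgt a = map srt_of (tuple a)"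

definition var_comp :: "srt list \<Rightarrow> nat \<Rightarrow> ('p, 'f) component" where
  "var_comp ob i = (case ob ! i of Tm \<Rightarrow> TC (Var i) | Pr \<Rightarrow> PC [PVar i])"

primrec subst_lit :: "('p, 'f) lit \<Rightarrow> (nat \<Rightarrow> ('p, 'f) component) \<Rightarrow> ('p, 'f) lit list" where
  "subst_lit (Lit A) \<kappa> = [Lit (subst_atom A (tc \<circ> \<kappa>))]"
| "subst_lit (PVar i) \<kappa> = pc (\<kappa> i)"

primrec subst_comp1 ::
  "('p, 'f) component \<Rightarrow> (nat \<Rightarrow> ('p, 'f) component) \<Rightarrow> ('p, 'f) component" where
  "subst_comp1 (TC t) \<kappa> = TC (t \<cdot>\<^sub>t (tc \<circ> \<kappa>))"
| "subst_comp1 (PC w) \<kappa> = PC (concat (map (\<lambda>l. subst_lit l \<kappa>) w))"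

primrec shift_lit :: "nat \<Rightarrow> ('p, 'f) lit \<Rightarrow> ('p, 'f) lit" where
  "shift_lit n (Lit A) = Lit (subst_atom A (\<lambda>i. Var (n + i)))"
| "shift_lit n (PVar i) = PVar (n + i)"

primrec shift_comp :: "nat \<Rightarrow> ('p, 'f) component \<Rightarrow> ('p, 'f) component" where
  "shift_comp n (TC t) = TC (t \<cdot>\<^sub>t (\<lambda>i. Var (n + i)))"
| "shift_comp n (PC w) = PC (map (shift_lit n) w)"

definition seq :: "('p, 'f) arrow \<Rightarrow> ('p, 'f) arrow \<Rightarrow> ('p, 'f) arrow"  (infixl ";;" 60) where
  "a ;; b = Arrow (src a) (map (\<lambda>c. subst_comp1 c (\<lambda>i. tuple a ! i)) (tuple b))"

definition par :: "('p, 'f) arrow \<Rightarrow> ('p, 'f) arrow \<Rightarrow> ('p, 'f) arrow"  (infixl "\<otimes>" 70) where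
  "a \<otimes> b = Arrow (src a @ src b) (tuple a @ map (shift_comp (length (src a))) (tuple b))"

definition ident :: "srt list \<Rightarrow> ('p, 'f) arrow" where
  "ident ob = Arrow ob (map (var_comp ob) [0..<length ob])"

definition dup :: "srt list \<Rightarrow> ('p, 'f) arrow" where
  "dup ob = Arrow ob (map (var_comp ob) ([0..<length ob] @ [0..<length ob]))"

definition symm :: "srt list \<Rightarrow> srt list \<Rightarrow> ('p, 'f) arrow" where
  "symm ob ob' = Arrow (ob @ ob')
     (map (var_comp (ob @ ob')) ([length ob..<length ob + length ob'] @ [0..<length ob]))"

abbreviation tms :: "nat \<Rightarrow> srt list" where
  "tms n \<equiv> replicate n Tm"

definition fun_arrow :: "('p, 'f) signature \<Rightarrow> 'f \<Rightarrow> ('p, 'f) arrow" where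
  "fun_arrow S f = Arrow (tms (farity S f)) [TC (Fun f (map Var [0..<farity S f]))]"

definition pred_arrow :: "('p, 'f) signature \<Rightarrow> 'p \<Rightarrow> ('p, 'f) arrow" where
  "pred_arrow S p = Arrow (tms (parity S p)) [PC [Lit (Atom p (map Var [0..<parity S p]))]]"

primrec wf_lit :: "('p, 'f) signature \<Rightarrow> srt list \<Rightarrow> ('p, 'f) lit \<Rightarrow> bool" where
  "wf_lit S ob (Lit A) \<longleftrightarrow> wf_atom S A \<and> (\<forall>i\<in>vars_atom A. i < length ob \<and> ob ! i = Tm)"
| "wf_lit S ob (PVar i) \<longleftrightarrow> i < length ob \<and> ob ! i = Pr"

primrec wf_comp :: "('p, 'f) signature \<Rightarrow> srt list \<Rightarrow> ('p, 'f) component \<Rightarrow> bool" where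
  "wf_comp S ob (TC t) \<longleftrightarrow> wf_trm S t \<and> (\<forall>i\<in>vars_trm t. i < length ob \<and> ob ! i = Tm)"
| "wf_comp S ob (PC w) \<longleftrightarrow> (\<forall>l\<in>set w. wf_lit S ob l)"

primrec pvars_lit :: "('p, 'f) lit \<Rightarrow> nat list" where
  "pvars_lit (Lit A) = []"
| "pvars_lit (PVar i) = [i]"

primrec pvars_comp :: "('p, 'f) component \<Rightarrow> nat list" where
  "pvars_comp (TC t) = []"
| "pvars_comp (PC w) = concat (map pvars_lit w)"

text \<open>
  In configurations the duplicators and dischargers are those of the objects \<open>t\<^sup>n\<close>: every variable
  of sort \<open>p\<close> occurs exactly once in the tuple. Natural duplicators and dischargers at sort \<open>p\<close>
  would break the correspondence with SLD-resolution. With the discharger \<open>p(x); ! = !\<close>, the fact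
  \<open>p(c)\<close> would yield a tile with initial configuration \<open>!\<close> and effect \<open>c\<close>, and so a tile that
  instantiates \<open>x\<close> to \<open>c\<close> in an unrelated goal \<open>q(x)\<close>. With the duplicator, the clause
  \<open>p(x) :- q(x,y)\<close> would rewrite \<open>p(x) \<and> p(x)\<close> to \<open>q(x,y) \<and> q(x,y)\<close> with a shared \<open>y\<close>.
\<close>

definition is_conf :: "('p, 'f) signature \<Rightarrow> ('p, 'f) arrow \<Rightarrow> bool" where
  "is_conf S a \<longleftrightarrow>
     (\<forall>c\<in>set (tuple a). wf_comp S (src a) c) \<and>
     distinct (concat (map pvars_comp (tuple a))) \<and>
     set (concat (map pvars_comp (tuple a))) = {i. i < length (src a) \<and> src a ! i = Pr}"

text \<open>
  Observations are cartesian at both sorts; a component of sort \<open>p\<close> is a variable, since no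
  function symbol has target \<open>p\<close>.
\<close>

definition is_obs :: "('p, 'f) signature \<Rightarrow> ('p, 'f) arrow \<Rightarrow> bool" where
  "is_obs S a \<longleftrightarrow>
     (\<forall>c\<in>set (tuple a). wf_comp S (src a) c \<and> ((\<exists>t. c = TC t) \<or> (\<exists>i. c = PC [PVar i])))"


subsection \<open>Substitutions and goals as arrows\<close>

text \<open>
  Syntax over named variables becomes an arrow once its variables are listed: \<open>pos xs\<close> replaces a
  variable by its position in \<open>xs\<close>. In \<open>terms_arrow xs ts\<close> and \<open>goal_arrow xs G\<close>, the list \<open>xs\<close> is
  meant to be distinct and to contain all variables of \<open>ts\<close> and \<open>G\<close>.
\<close>

definition pos :: "'v list \<Rightarrow> 'v \<Rightarrow> ('f, nat) trm" where
  "pos xs x = Var (length (takeWhile (\<lambda>y. y \<noteq> x) xs))"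

definition terms_arrow :: "'v list \<Rightarrow> ('f, 'v) trm list \<Rightarrow> ('p, 'f) arrow" where
  "terms_arrow xs ts = Arrow (tms (length xs)) (map (\<lambda>t. TC (t \<cdot>\<^sub>t pos xs)) ts)"

definition goal_arrow :: "'v list \<Rightarrow> ('p, 'f, 'v) goal \<Rightarrow> ('p, 'f) arrow" where
  "goal_arrow xs G = Arrow (tms (length xs)) [PC (map Lit (subst_goal G (pos xs)))]"

definition enumerates :: "'v list \<Rightarrow> 'v set \<Rightarrow> bool" where
  "enumerates xs V \<longleftrightarrow> distinct xs \<and> set xs = V"

text \<open>The restriction of \<open>\<sigma>\<close> to \<open>xs\<close>, as an arrow from \<open>t\<^sup>m\<close> to \<open>t\<^sup>n\<close> with \<open>m = length ys\<close>, \<open>n = length xs\<close>.\<close>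

definition subst_arrow :: "'v list \<Rightarrow> 'v list \<Rightarrow> ('v \<Rightarrow> ('f, 'v) trm) \<Rightarrow> ('p, 'f) arrow" where
  "subst_arrow ys xs \<sigma> = terms_arrow ys (map \<sigma> xs)"


subsection \<open>The tile system of a program\<close>

text \<open>The arguments of the tile predicates are, in order: initial configuration, trigger, effect,
  final configuration.\<close>

inductive basic_tile ::
  "('p, 'f) signature \<Rightarrow> ('p, 'f, 'v) clause set \<Rightarrow> ('p, 'f) arrow \<Rightarrow> ('p, 'f) arrow \<Rightarrow>
   ('p, 'f) arrow \<Rightarrow> ('p, 'f) arrow \<Rightarrow> bool"
  for S P where
  clause: "\<lbrakk>C \<in> P; enumerates xs (vars_clause C)\<rbrakk> \<Longrightarrow>
    basic_tile S P (pred_arrow S (pred (head C))) (ident [Pr])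
      (terms_arrow xs (args (head C))) (goal_arrow xs (body C))"
| fun_fun: "n = farity S f \<Longrightarrow>
    basic_tile S P (fun_arrow S f) (fun_arrow S f) (ident (tms n)) (ident (tms n))"
| fun_dup: "n = farity S f \<Longrightarrow>
    basic_tile S P (fun_arrow S f \<otimes> ident (tms 1)) (dup (tms 1))
      (dup (tms n) ;; (ident (tms n) \<otimes> fun_arrow S f)) (fun_arrow S f)"
| dup_fun: "n = farity S f \<Longrightarrow>
    basic_tile S P (dup (tms 1)) (fun_arrow S f \<otimes> ident (tms 1))
      (fun_arrow S f) (dup (tms n) ;; (ident (tms n) \<otimes> fun_arrow S f))"
| dup_dup: "basic_tile S P (dup (tms 1)) (dup (tms 1)) (ident (tms 1)) (ident (tms 1))"
| symm_symm: "basic_tile S P (symm (tms 1) (tms 1)) (symm (tms 1) (tms 1))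
      (ident (tms 2)) (ident (tms 2))"
| dup_dup_shifted: "basic_tile S P (dup (tms 1) \<otimes> ident (tms 1)) (ident (tms 1) \<otimes> dup (tms 1))
      (dup (tms 1)) (dup (tms 1))"

inductive tile ::
  "('p, 'f) signature \<Rightarrow> ('p, 'f, 'v) clause set \<Rightarrow> ('p, 'f) arrow \<Rightarrow> ('p, 'f) arrow \<Rightarrow>
   ('p, 'f) arrow \<Rightarrow> ('p, 'f) arrow \<Rightarrow> bool"
  for S P where
  basic: "basic_tile S P s u v r \<Longrightarrow> tile S P s u v r"
| id_conf: "is_conf S h \<Longrightarrow> tile S P h (ident (tgt h)) (ident (src h)) h"
| id_obs: "is_obs S v \<Longrightarrow> tile S P (ident (tgt v)) v v (ident (src v))"
| horizontal: "\<lbrakk>tile S P s1 u1 v1 r1; tile S P s2 v1 v2 r2\<rbrakk> \<Longrightarrow>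
    tile S P (s2 ;; s1) u1 v2 (r2 ;; r1)"
| vertical: "\<lbrakk>tile S P s1 u1 v1 r1; tile S P r1 u2 v2 r2\<rbrakk> \<Longrightarrow>
    tile S P s1 (u2 ;; u1) (v2 ;; v1) r2"
| parallel: "\<lbrakk>tile S P s1 u1 v1 r1; tile S P s2 u2 v2 r2\<rbrakk> \<Longrightarrow>
    tile S P (s1 \<otimes> s2) (u1 \<otimes> u2) (v1 \<otimes> v2) (r1 \<otimes> r2)"

end

theory Submission
  imports Defs "HOL-Library.Multiset"
begin

text \<open>
  From a resolution step to a tile: the pullback tiles generate, by recursion along a solution of the
  unification problem, a tile that computes the most general unifier of the selected atom and the
  clause head; it is pasted with the tile of the clause.

  From a tile to resolutions: an arrow acts on environments that assign a term or a goal over named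
  variables to each position. For every entailed tile there are proof skeletons such that the tile
  is a weak pullback: the instances of the effect and of the final configuration are exactly the
  pairs that solve the initial configuration against the trigger along these skeletons. This property is
  preserved by the three compositions. For the trigger \<open>id\<close> it says that the effect is a most
  general instance under which \<open>G\<close> derives the final configuration with the given skeleton, and
  the lifting lemma turns such a derivation into an SLD-derivation.
\<close>

text \<open>The unifier computed by tiles is not shown to be universal on its own. One solution is
  given beforehand, and only its factorization through the substitution on the tile is recorded.
  With the most general unifier as the given solution, the two factor through each other and differ
  by a renaming. The given solution also excludes clashes and the occurs check.

  In the converse direction, fixing the skeleton turns derivability into a system with a single
  parametrization: without it a goal has derivations with unrelated choices of clauses, and no
  single effect covers all of them. The serious obstacle is vertical composition. A configuration
  uses each variable of sort \<open>p\<close> once, but an observation may copy or drop it, so the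
  intermediate goal at the common border might be determined twice or not at all. Therefore
  \<open>linear_trigger\<close> belongs to the invariant: wherever a trigger copies or drops a
  variable, the final configuration has a bare variable, which no clause can rewrite.\<close>

section \<open>Terms, atoms and goals under substitution\<close>

lemma wf_trm_Fun [simp]: "wf_trm S (Fun f ts) \<longleftrightarrow> length ts = farity S f \<and> (\<forall>t\<in>set ts. wf_trm S t)"
  by (simp add: list_all_iff)

declare wf_trm.simps(2) [simp del]

lemma finite_vars_trm [simp]: "finite (vars_trm t)"
  by (induction t) auto

lemma subst_trm_cong: "(\<And>x. x \<in> vars_trm t \<Longrightarrow> \<sigma> x = \<tau> x) \<Longrightarrow> t \<cdot>\<^sub>t \<sigma> = t \<cdot>\<^sub>t \<tau>"
  by (induction t) auto

lemma subst_trm_Var [simp]: "t \<cdot>\<^sub>t Var = t"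
  by (induction t) (auto simp: map_idI)

lemma subst_trm_comp: "t \<cdot>\<^sub>t \<sigma> \<cdot>\<^sub>t \<tau> = t \<cdot>\<^sub>t (\<lambda>x. \<sigma> x \<cdot>\<^sub>t \<tau>)"
  by (induction t) auto

lemma vars_subst_trm: "vars_trm (t \<cdot>\<^sub>t \<sigma>) = (\<Union>x\<in>vars_trm t. vars_trm (\<sigma> x))"
  by (induction t) auto

text \<open>The way back from equal instances to equal substitutions; it lets factorizations cancel
  whenever two substitutions are instances of each other.\<close>

lemma subst_trm_eqD: "t \<cdot>\<^sub>t \<sigma> = t \<cdot>\<^sub>t \<tau> \<Longrightarrow> x \<in> vars_trm t \<Longrightarrow> \<sigma> x = \<tau> x"
  by (induction t) auto

lemma wf_subst_trm: "wf_trm S t \<Longrightarrow> (\<And>x. x \<in> vars_trm t \<Longrightarrow> wf_trm S (\<sigma> x)) \<Longrightarrow> wf_trm S (t \<cdot>\<^sub>t \<sigma>)"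
  by (induction t) auto

section \<open>Existence of most general unifiers\<close>

primrec fun_count :: "('f, 'v) trm \<Rightarrow> nat" where
  "fun_count (Var x) = 0"
| "fun_count (Fun f ts) = Suc (sum_list (map fun_count ts))"

text \<open>An occurrence of \<open>x\<close> contributes the symbols of \<open>\<sigma> x\<close>,
  and all symbols of \<open>t\<close> survive. The list of arguments is split at one that contains
  \<open>x\<close>; the other arguments cannot shrink.\<close>

lemma fun_count_subst_ge:
  fixes t :: "('f, 'v) trm" and \<sigma> :: "'v \<Rightarrow> ('f, 'w) trm"
  shows "x \<in> vars_trm t \<Longrightarrow> fun_count (\<sigma> x) + fun_count t \<le> fun_count (t \<cdot>\<^sub>t \<sigma>)"
proof (induction t)
  case (Fun f ts)
  then obtain t where t: "t \<in> set ts" "x \<in> vars_trm t" by auto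
  then obtain us vs where ts: "ts = us @ t # vs" by (meson split_list)
  have ge: "fun_count s \<le> fun_count (s \<cdot>\<^sub>t \<sigma>)" for s :: "('f, 'v) trm"
    by (induction s) (auto intro: sum_list_mono)
  have "fun_count (\<sigma> x) + fun_count t \<le> fun_count (t \<cdot>\<^sub>t \<sigma>)" using Fun.IH t by blast
  moreover have "sum_list (map fun_count us) \<le> sum_list (map (\<lambda>s. fun_count (s \<cdot>\<^sub>t \<sigma>)) us)" for us
    by (intro sum_list_mono ge)
  note this[of us] this[of vs]
  ultimately show ?case by (simp add: ts comp_def)
qed simp

text \<open>A compound \<open>t\<close> containing \<open>x\<close> would have an instance with
  strictly more function symbols than \<open>\<tau> x\<close>, to which that instance is
  equal.\<close>

lemma occurs_check:
  assumes "x \<in> vars_trm t" "\<tau> x = t \<cdot>\<^sub>t \<tau>"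
  shows "t = Var x"
proof (cases t)
  case (Fun f ts)
  then show ?thesis using fun_count_subst_ge[of x t \<tau>] assms by simp
qed (use assms in simp)

lemma subst_atom_Var [simp]: "subst_atom A Var = A"
  by (cases A) (simp add: subst_atom_def)

lemma pred_subst_atom [simp]: "pred (subst_atom A \<sigma>) = pred A"
  and args_subst_atom [simp]: "args (subst_atom A \<sigma>) = map (\<lambda>t. t \<cdot>\<^sub>t \<sigma>) (args A)"
  by (simp_all add: subst_atom_def)

lemma subst_atom_comp: "subst_atom (subst_atom A \<sigma>) \<tau> = subst_atom A (\<lambda>x. \<sigma> x \<cdot>\<^sub>t \<tau>)"
  by (simp add: subst_atom_def subst_trm_comp)

lemma subst_atom_cong: "(\<And>x. x \<in> vars_atom A \<Longrightarrow> \<sigma> x = \<tau> x) \<Longrightarrow> subst_atom A \<sigma> = subst_atom A \<tau>"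
  by (auto simp: subst_atom_def vars_atom_def intro!: subst_trm_cong)

lemma subst_atom_eqD: "subst_atom A \<sigma> = subst_atom A \<tau> \<Longrightarrow> x \<in> vars_atom A \<Longrightarrow> \<sigma> x = \<tau> x"
  by (auto simp: subst_atom_def vars_atom_def dest: subst_trm_eqD)

lemma vars_subst_atom: "vars_atom (subst_atom A \<sigma>) = (\<Union>x\<in>vars_atom A. vars_trm (\<sigma> x))"
  by (auto simp: vars_atom_def vars_subst_trm)

lemma wf_subst_atom: "wf_atom S A \<Longrightarrow> (\<And>x. x \<in> vars_atom A \<Longrightarrow> wf_trm S (\<sigma> x)) \<Longrightarrow> wf_atom S (subst_atom A \<sigma>)"
  by (auto simp: wf_atom_def vars_atom_def intro!: wf_subst_trm)

lemma finite_vars_atom [simp]: "finite (vars_atom A)"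
  by (simp add: vars_atom_def)

lemma finite_vars_goal [simp]: "finite (vars_goal G)"
  by (simp add: vars_goal_def)

lemma finite_vars_clause [simp]: "finite (vars_clause C)"
  by (simp add: vars_clause_def)

lemma vars_goal_append [simp]: "vars_goal (G @ H) = vars_goal G \<union> vars_goal H"
  and vars_goal_Cons [simp]: "vars_goal (A # H) = vars_atom A \<union> vars_goal H"
  and vars_goal_Nil [simp]: "vars_goal [] = {}"
  by (auto simp: vars_goal_def)

lemma subst_goal_append [simp]: "subst_goal (G @ H) \<sigma> = subst_goal G \<sigma> @ subst_goal H \<sigma>"
  and subst_goal_Cons [simp]: "subst_goal (A # H) \<sigma> = subst_atom A \<sigma> # subst_goal H \<sigma>"
  and subst_goal_Nil [simp]: "subst_goal [] \<sigma> = []"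
  by (auto simp: subst_goal_def)

lemma subst_goal_Var [simp]: "subst_goal G Var = G"
  by (simp add: subst_goal_def map_idI)

lemma subst_goal_comp: "subst_goal (subst_goal G \<sigma>) \<tau> = subst_goal G (\<lambda>x. \<sigma> x \<cdot>\<^sub>t \<tau>)"
  by (simp add: subst_goal_def subst_atom_comp)

lemma subst_goal_cong: "(\<And>x. x \<in> vars_goal G \<Longrightarrow> \<sigma> x = \<tau> x) \<Longrightarrow> subst_goal G \<sigma> = subst_goal G \<tau>"
  by (auto simp: subst_goal_def vars_goal_def intro!: subst_atom_cong)

lemma vars_subst_goal: "vars_goal (subst_goal G \<sigma>) = (\<Union>x\<in>vars_goal G. vars_trm (\<sigma> x))"
  by (auto simp: vars_goal_def subst_goal_def vars_subst_atom)

lemma wf_goal_append [simp]: "wf_goal S (G @ H) \<longleftrightarrow> wf_goal S G \<and> wf_goal S H"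
  and wf_goal_Cons [simp]: "wf_goal S (A # H) \<longleftrightarrow> wf_atom S A \<and> wf_goal S H"
  by (auto simp: wf_goal_def)

lemma wf_subst_goal: "wf_goal S G \<Longrightarrow> (\<And>x. x \<in> vars_goal G \<Longrightarrow> wf_trm S (\<sigma> x)) \<Longrightarrow> wf_goal S (subst_goal G \<sigma>)"
  by (auto simp: wf_goal_def subst_goal_def vars_goal_def intro!: wf_subst_atom)

text \<open>The unifier \<open>\<tau>\<^sub>0\<close> takes the place of the failure cases of the
  unification algorithm: in its presence neither a clash nor a failing occurs check can arise. Most
  generality has a strong form, in which a unifier factors through \<open>\<theta>\<close> by
  itself; the mediating substitution then has finite support and well-formed values whenever the
  unifier has.\<close>

lemma unifiable_mgu:
  fixes E :: "(('f, 'v) trm \<times> ('f, 'v) trm) list" and \<tau>\<^sub>0 :: "'v \<Rightarrow> ('f, 'v) trm"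
  assumes "\<forall>(s, t)\<in>set E. wf_trm S s \<and> wf_trm S t" "\<forall>(s, t)\<in>set E. s \<cdot>\<^sub>t \<tau>\<^sub>0 = t \<cdot>\<^sub>t \<tau>\<^sub>0"
  shows "\<exists>\<theta>. is_subst S \<theta> \<and> (\<forall>(s, t)\<in>set E. s \<cdot>\<^sub>t \<theta> = t \<cdot>\<^sub>t \<theta>) \<and>
    (\<forall>\<tau>::'v \<Rightarrow> ('f, 'v) trm. (\<forall>(s, t)\<in>set E. s \<cdot>\<^sub>t \<tau> = t \<cdot>\<^sub>t \<tau>) \<longrightarrow> (\<forall>x. \<tau> x = \<theta> x \<cdot>\<^sub>t \<tau>))"
  using assms
\<comment> \<open>Eliminating a variable lowers the number of variables, decomposing a compound
  equation keeps it and removes two function symbols, and deleting a trivial equation shortens the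
  list.\<close>
proof (induction E rule: wf_induct_rule[OF wf_measures[of "[\<lambda>E. card (\<Union>(s, t)\<in>set E. vars_trm s \<union> vars_trm t),
    \<lambda>E. sum_list (map (\<lambda>(s, t). fun_count s + fun_count t) E), length]"]])
  case (1 E)
  note IH = "1.IH"
  let ?C = "\<lambda>E::(('f, 'v) trm \<times> ('f, 'v) trm) list. \<exists>\<theta>. is_subst S \<theta> \<and> (\<forall>(s, t)\<in>set E. s \<cdot>\<^sub>t \<theta> = t \<cdot>\<^sub>t \<theta>) \<and>
    (\<forall>\<tau>::'v \<Rightarrow> ('f, 'v) trm. (\<forall>(s, t)\<in>set E. s \<cdot>\<^sub>t \<tau> = t \<cdot>\<^sub>t \<tau>) \<longrightarrow> (\<forall>x. \<tau> x = \<theta> x \<cdot>\<^sub>t \<tau>))"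
  let ?V = "\<lambda>E::(('f, 'v) trm \<times> ('f, 'v) trm) list. (\<Union>(s, t)\<in>set E. vars_trm s \<union> vars_trm t)"
  have finV: "finite (?V E)" for E by auto
  \<comment> \<open>Both orientations of an equation with a variable are handled at once, by a
    conclusion that puts the variable on the left.\<close>
  have elim: "?C ((Var x, t) # E1)"
    if E: "E = (Var x, t) # E1 \<or> E = (t, Var x) # E1" and ne: "t \<noteq> Var x" for x t E1
  proof -
    let ?\<delta> = "Var(x := t)"
    let ?E' = "map (\<lambda>(a, b). (a \<cdot>\<^sub>t ?\<delta>, b \<cdot>\<^sub>t ?\<delta>)) E1"
    have \<tau>0: "\<tau>\<^sub>0 x = t \<cdot>\<^sub>t \<tau>\<^sub>0" and E1\<tau>0: "\<forall>(s, t)\<in>set E1. s \<cdot>\<^sub>t \<tau>\<^sub>0 = t \<cdot>\<^sub>t \<tau>\<^sub>0" and wft: "wf_trm S t"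
      and wfE1: "\<forall>(s, t)\<in>set E1. wf_trm S s \<and> wf_trm S t"
      using 1(2,3) E by auto
    have nx: "x \<notin> vars_trm t" using occurs_check[of x t \<tau>\<^sub>0] \<tau>0 ne by blast
    \<comment> \<open>A substitution that satisfies the eliminated equation does not notice
      \<open>?\<delta>\<close>, so it solves \<open>E1\<close> exactly if it solves
      \<open>?E'\<close>.\<close>
    have absorb: "s \<cdot>\<^sub>t ?\<delta> \<cdot>\<^sub>t \<tau> = s \<cdot>\<^sub>t \<tau>" if "\<tau> x = t \<cdot>\<^sub>t \<tau>" for s and \<tau> :: "'v \<Rightarrow> ('f, 'v) trm"
      using that by (auto simp: subst_trm_comp intro!: subst_trm_cong)
    have "?V ?E' \<subseteq> ?V E - {x}"
      using E nx by (fastforce simp: vars_subst_trm split: if_splits)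
    moreover have "x \<in> ?V E" using E by auto
    ultimately have less: "card (?V ?E') < card (?V E)"
      by (metis (no_types, lifting) finV Diff_subset card_Diff1_less card_mono finite_Diff le_less_trans)
    have wfE': "\<forall>(s, t)\<in>set ?E'. wf_trm S s \<and> wf_trm S t"
      using wfE1 wft by (fastforce intro!: wf_subst_trm)
    have "\<forall>(s, t)\<in>set ?E'. s \<cdot>\<^sub>t \<tau>\<^sub>0 = t \<cdot>\<^sub>t \<tau>\<^sub>0"
      using E1\<tau>0 absorb[OF \<tau>0] by auto
    moreover have "(?E', E) \<in> measures [\<lambda>E. card (?V E),
      \<lambda>E. sum_list (map (\<lambda>(s, t). fun_count s + fun_count t) E), length]"
      unfolding in_measures using less by blast
    ultimately have "?C ?E'" using IH[of ?E'] wfE' by blast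
    then obtain \<theta>' where C': "is_subst S \<theta>' \<and> (\<forall>(s, t)\<in>set ?E'. s \<cdot>\<^sub>t \<theta>' = t \<cdot>\<^sub>t \<theta>') \<and>
      (\<forall>\<tau>::'v \<Rightarrow> ('f, 'v) trm. (\<forall>(s, t)\<in>set ?E'. s \<cdot>\<^sub>t \<tau> = t \<cdot>\<^sub>t \<tau>) \<longrightarrow> (\<forall>x. \<tau> x = \<theta>' x \<cdot>\<^sub>t \<tau>))"
      ..
    note \<theta>' = C'[THEN conjunct1] C'[THEN conjunct2, THEN conjunct1]
      C'[THEN conjunct2, THEN conjunct2, THEN spec, THEN mp]
    let ?\<theta> = "\<lambda>y. ?\<delta> y \<cdot>\<^sub>t \<theta>'"
    have "{y. ?\<theta> y \<noteq> Var y} \<subseteq> insert x {y. \<theta>' y \<noteq> Var y}" by auto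
    then have "finite {y. ?\<theta> y \<noteq> Var y}"
      by (rule finite_subset) (use \<theta>'(1) in \<open>simp add: is_subst_def\<close>)
    moreover have "wf_trm S (?\<theta> y)" for y
      using \<theta>'(1) wf_subst_trm[OF wft, of \<theta>'] by (simp add: is_subst_def)
    ultimately have "is_subst S ?\<theta>" unfolding is_subst_def by blast
    moreover have "t \<cdot>\<^sub>t ?\<theta> = t \<cdot>\<^sub>t \<theta>'"
      using nx by (auto intro!: subst_trm_cong)
    then have "\<forall>(s, t)\<in>set ((Var x, t) # E1). s \<cdot>\<^sub>t ?\<theta> = t \<cdot>\<^sub>t ?\<theta>"
      using \<theta>'(2) by (auto simp: subst_trm_comp simp del: fun_upd_apply) simp
    moreover have "\<tau> y = ?\<theta> y \<cdot>\<^sub>t \<tau>" if \<tau>: "\<forall>(s, t)\<in>set ((Var x, t) # E1). s \<cdot>\<^sub>t \<tau> = t \<cdot>\<^sub>t \<tau>" for \<tau> :: "'v \<Rightarrow> ('f, 'v) trm" and y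
    proof -
      have x: "\<tau> x = t \<cdot>\<^sub>t \<tau>" using \<tau> by simp
      have "\<forall>(s, t)\<in>set ?E'. s \<cdot>\<^sub>t \<tau> = t \<cdot>\<^sub>t \<tau>" using \<tau> absorb[OF x] by auto
      from \<theta>'(3)[OF this] have "\<theta>' z \<cdot>\<^sub>t \<tau> = \<tau> z" for z by metis
      then show ?thesis using x by (simp add: subst_trm_comp)
    qed
    ultimately show ?thesis by (intro exI[of _ ?\<theta>] conjI allI impI)
  qed
  show ?case
  proof (cases E)
    case Nil
    then show ?thesis by (intro exI[of _ Var]) (simp add: is_subst_def)
  next
    case (Cons e E1)
    obtain s t where e: "e = (s, t)" by fastforce
    show ?thesis
    proof (cases "s = t")
      case True
      have "card (?V E1) \<le> card (?V E)" using Cons by (intro card_mono finV) auto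
      then have "(E1, E) \<in> measures [\<lambda>E. card (?V E),
          \<lambda>E. sum_list (map (\<lambda>(s, t). fun_count s + fun_count t) E), length]"
        using Cons True e by (simp add: le_less) blast
      then have "?C E1" by (rule IH) (use 1(2,3) Cons in auto)
      then show ?thesis using Cons True e by simp
    next
      case False
      show ?thesis
      proof (cases s)
        case (Var x)
        then show ?thesis using elim[of x t E1] False Cons e by auto
      next
        case s: (Fun f ss)
        show ?thesis
        proof (cases t)
          case (Var x)
          then have "?C ((Var x, s) # E1)" using elim[of x s E1] Cons e False by auto
          then show ?thesis using Cons e Var by (auto simp: eq_commute)
        next
          case t: (Fun g ts)
          have fg: "f = g" "map (\<lambda>t. t \<cdot>\<^sub>t \<tau>\<^sub>0) ss = map (\<lambda>t. t \<cdot>\<^sub>t \<tau>\<^sub>0) ts" using 1(3) Cons e s t by auto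
          then have len: "length ss = length ts" by (metis length_map)
          let ?E' = "zip ss ts @ E1"
          have unif: "(\<forall>(a, b)\<in>set (zip ss ts). a \<cdot>\<^sub>t \<tau> = b \<cdot>\<^sub>t \<tau>) \<longleftrightarrow> s \<cdot>\<^sub>t \<tau> = t \<cdot>\<^sub>t \<tau>" for \<tau> :: "'v \<Rightarrow> ('f, 'v) trm"
            using fg len s t by (auto simp: list_eq_iff_nth_eq set_zip)
          have "?V ?E' = ?V E"
            using len Cons e s t by (fastforce simp: set_zip in_set_conv_nth)
          moreover have "sum_list (map (\<lambda>(s, t). fun_count s + fun_count t) (zip ss ts)) =
            sum_list (map fun_count ss) + sum_list (map fun_count ts)"
            using len by (induction ss ts rule: list_induct2) auto
          moreover have "\<forall>(s, t)\<in>set ?E'. wf_trm S s \<and> wf_trm S t"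
            using 1(2) Cons e s t by (auto dest: set_zip_leftD set_zip_rightD)
          moreover have "\<forall>(s, t)\<in>set ?E'. s \<cdot>\<^sub>t \<tau>\<^sub>0 = t \<cdot>\<^sub>t \<tau>\<^sub>0"
            using 1(3) unif[of \<tau>\<^sub>0] Cons e by auto
          ultimately have "?C ?E'" using IH[of ?E'] Cons e s t by (simp add: in_measures)
          then show ?thesis using Cons e unif by (simp add: ball_Un)
        qed
      qed
    qed
  qed
qed

lemma mgu_exists:
  fixes A B :: "('p, 'f, 'v) atom"
  assumes "wf_atom S A" "wf_atom S B" "subst_atom A \<tau>\<^sub>0 = subst_atom B (\<tau>\<^sub>0 :: 'v \<Rightarrow> ('f, 'v) trm)"
  shows "\<exists>\<theta>. is_mgu S \<theta> A B"
proof -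
  have p: "pred A = pred B" and "map (\<lambda>t. t \<cdot>\<^sub>t \<tau>\<^sub>0) (args A) = map (\<lambda>t. t \<cdot>\<^sub>t \<tau>\<^sub>0) (args B)"
    using assms(3) by (auto simp: subst_atom_def)
  then have len: "length (args A) = length (args B)" by (metis length_map)
  have unif: "subst_atom A \<tau> = subst_atom B \<tau> \<longleftrightarrow> (\<forall>(s, t)\<in>set (zip (args A) (args B)). s \<cdot>\<^sub>t \<tau> = t \<cdot>\<^sub>t \<tau>)"
    for \<tau> :: "'v \<Rightarrow> ('f, 'v) trm"
    using p len by (auto simp: subst_atom_def list_eq_iff_nth_eq set_zip)
  have wf: "\<forall>(s, t)\<in>set (zip (args A) (args B)). wf_trm S s \<and> wf_trm S t"
    using assms(1,2) by (auto simp: wf_atom_def dest: set_zip_leftD set_zip_rightD)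
  have "\<exists>\<theta>. is_subst S \<theta> \<and> (\<forall>(s, t)\<in>set (zip (args A) (args B)). s \<cdot>\<^sub>t \<theta> = t \<cdot>\<^sub>t \<theta>) \<and>
    (\<forall>\<tau>::'v \<Rightarrow> ('f, 'v) trm. (\<forall>(s, t)\<in>set (zip (args A) (args B)). s \<cdot>\<^sub>t \<tau> = t \<cdot>\<^sub>t \<tau>) \<longrightarrow> (\<forall>x. \<tau> x = \<theta> x \<cdot>\<^sub>t \<tau>))"
    by (rule unifiable_mgu[OF wf, of \<tau>\<^sub>0]) (use assms(3) unif[of \<tau>\<^sub>0] in simp)
  then obtain \<theta> where C: "is_subst S \<theta> \<and> (\<forall>(s, t)\<in>set (zip (args A) (args B)). s \<cdot>\<^sub>t \<theta> = t \<cdot>\<^sub>t \<theta>) \<and>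
    (\<forall>\<tau>::'v \<Rightarrow> ('f, 'v) trm. (\<forall>(s, t)\<in>set (zip (args A) (args B)). s \<cdot>\<^sub>t \<tau> = t \<cdot>\<^sub>t \<tau>) \<longrightarrow> (\<forall>x. \<tau> x = \<theta> x \<cdot>\<^sub>t \<tau>))"
    ..
  then have "\<tau> = \<theta> \<circ>\<^sub>s \<tau>" if "subst_atom A \<tau> = subst_atom B \<tau>" for \<tau>
    using that[unfolded unif] by (simp add: fun_eq_iff subst_comp_def)
  then show ?thesis using C unfolding is_mgu_def unif by (intro exI[of _ \<theta>]) metis
qed

subsection \<open>Arrows between term objects over named variables\<close>

lemma pos_obtain:
  assumes "x \<in> set xs"
  obtains i where "i < length xs" "xs ! i = x" "pos xs x = Var i"
proof -
  have "length (takeWhile (\<lambda>y. y \<noteq> x) xs) < length xs \<and> xs ! length (takeWhile (\<lambda>y. y \<noteq> x) xs) = x"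
    using assms by (induction xs) auto
  then show ?thesis using that[of "length (takeWhile (\<lambda>y. y \<noteq> x) xs)"] by (simp add: pos_def)
qed

lemma pos_nth: "distinct xs \<Longrightarrow> i < length xs \<Longrightarrow> pos xs (xs ! i) = Var i"
  by (metis nth_eq_iff_index_eq nth_mem pos_obtain)

definition wf_terms :: "('p, 'f) signature \<Rightarrow> 'v list \<Rightarrow> ('f, 'v) trm list \<Rightarrow> bool" where
  "wf_terms S xs ts \<longleftrightarrow> (\<forall>t\<in>set ts. wf_trm S t \<and> vars_trm t \<subseteq> set xs)"

lemma wf_terms_simps [simp]:
  "wf_terms S xs []"
  "wf_terms S xs (t # ts) \<longleftrightarrow> wf_trm S t \<and> vars_trm t \<subseteq> set xs \<and> wf_terms S xs ts"
  "wf_terms S xs (ts @ us) \<longleftrightarrow> wf_terms S xs ts \<and> wf_terms S xs us"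
  "wf_terms S xs (map Var ys) \<longleftrightarrow> set ys \<subseteq> set xs"
  by (auto simp: wf_terms_def)

lemma wf_terms_mono: "wf_terms S xs ts \<Longrightarrow> set xs \<subseteq> set ys \<Longrightarrow> wf_terms S ys ts"
  by (auto simp: wf_terms_def)

text \<open>The middle tuple has the form \<open>map \<sigma> ys\<close>, so that the names
  \<open>ys\<close> are the domain of a substitution and composing arrows needs no computation with
  positions. By \<open>ex_assignment\<close> every tuple of the right length has this form when
  \<open>ys\<close> is distinct.\<close>

lemma seq_terms_arrow:
  assumes "\<And>t. t \<in> set ts \<Longrightarrow> vars_trm t \<subseteq> set ys"
  shows "terms_arrow xs (map \<sigma> ys) ;; terms_arrow ys ts = terms_arrow xs (map (\<lambda>t. t \<cdot>\<^sub>t \<sigma>) ts)"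
proof -
  have "t \<cdot>\<^sub>t pos ys \<cdot>\<^sub>t (tc \<circ> (\<lambda>i. map (\<lambda>t. TC (t \<cdot>\<^sub>t pos xs)) (map \<sigma> ys) ! i)) = t \<cdot>\<^sub>t \<sigma> \<cdot>\<^sub>t pos xs"
    if "t \<in> set ts" for t
    unfolding subst_trm_comp
  proof (rule subst_trm_cong)
    fix y assume "y \<in> vars_trm t"
    then have "y \<in> set ys" using assms that by blast
    then obtain i where "i < length ys" "ys ! i = y" "pos ys y = (Var i :: ('a, nat) trm)" by (rule pos_obtain)
    then show "pos ys y \<cdot>\<^sub>t (tc \<circ> (!) (map (\<lambda>t. TC (t \<cdot>\<^sub>t pos xs)) (map \<sigma> ys))) = \<sigma> y \<cdot>\<^sub>t pos xs"
      by simp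
  qed
  then show ?thesis unfolding terms_arrow_def seq_def by auto
qed

text \<open>Disjoint name lists hide the index shift in \<open>\<otimes>\<close>: the search for a
  name of \<open>ys\<close> in \<open>xs @ ys\<close> first passes all of \<open>xs\<close>.\<close>

lemma par_terms_arrow:
  assumes "set xs \<inter> set ys = {}" "wf_terms S xs ss" "wf_terms S ys us"
  shows "terms_arrow xs ss \<otimes> terms_arrow ys us = terms_arrow (xs @ ys) (ss @ us)"
proof -
  have "s \<cdot>\<^sub>t pos (xs @ ys) = s \<cdot>\<^sub>t pos xs" if "s \<in> set ss" for s
    using that assms(2) by (intro subst_trm_cong) (auto simp: wf_terms_def pos_def subset_iff intro!: arg_cong[where f = length] takeWhile_append1)
  moreover have "u \<cdot>\<^sub>t pos (xs @ ys) = u \<cdot>\<^sub>t pos ys \<cdot>\<^sub>t (\<lambda>i. Var (length xs + i))" if "u \<in> set us" for u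
    unfolding subst_trm_comp
  proof (rule subst_trm_cong)
    fix y assume "y \<in> vars_trm u"
    then have "y \<notin> set xs" using assms(1,3) that by (auto simp: wf_terms_def)
    then have "takeWhile (\<lambda>z. z \<noteq> y) (xs @ ys) = xs @ takeWhile (\<lambda>z. z \<noteq> y) ys"
      by (intro takeWhile_append2) auto
    then show "pos (xs @ ys) y = pos ys y \<cdot>\<^sub>t (\<lambda>i. Var (length xs + i))" by (simp add: pos_def)
  qed
  ultimately show ?thesis
    by (auto simp: terms_arrow_def par_def replicate_add)
qed

text \<open>Arrows know positions only, so an injective renaming of both the list and the terms is
  absorbed. This gives a clause variant the same tile as the clause, and it later absorbs the
  renaming between two most general solutions.\<close>

lemma terms_arrow_rename:
  assumes "inj_on \<rho> (set xs)" "\<And>t. t \<in> set ts \<Longrightarrow> vars_trm t \<subseteq> set xs"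
  shows "terms_arrow (map \<rho> xs) (map (\<lambda>t. t \<cdot>\<^sub>t (Var \<circ> \<rho>)) ts) = terms_arrow xs ts"
proof -
  have "t \<cdot>\<^sub>t (Var \<circ> \<rho>) \<cdot>\<^sub>t pos (map \<rho> xs) = t \<cdot>\<^sub>t pos xs" if "t \<in> set ts" for t
    unfolding subst_trm_comp
  proof (rule subst_trm_cong)
    fix x assume "x \<in> vars_trm t"
    then have x: "x \<in> set xs" using assms(2) that by blast
    have "takeWhile (\<lambda>y. y \<noteq> \<rho> x) (map \<rho> xs) = map \<rho> (takeWhile (\<lambda>y. y \<noteq> x) xs)"
      unfolding takeWhile_map comp_def
      using assms(1) x by (intro arg_cong[where f = "map \<rho>"] takeWhile_cong) (auto dest: inj_onD)
    then show "(Var \<circ> \<rho>) x \<cdot>\<^sub>t pos (map \<rho> xs) = pos xs x" by (simp add: pos_def)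
  qed
  then show ?thesis by (simp add: terms_arrow_def)
qed

lemma vars_pos: "x \<in> set xs \<Longrightarrow> i \<in> vars_trm (pos xs x) \<Longrightarrow> i < length xs"
  by (metis pos_obtain singletonD trm.set(3))

lemma wf_comp_terms_arrow:
  assumes "wf_terms S xs ts" "c \<in> set (tuple (terms_arrow xs ts))"
  shows "wf_comp S (tms (length xs)) c"
proof -
  obtain t where t: "t \<in> set ts" "c = TC (t \<cdot>\<^sub>t pos xs)" using assms(2) by (auto simp: terms_arrow_def)
  have "wf_trm S (t \<cdot>\<^sub>t pos xs)"
    using assms(1) t(1) by (intro wf_subst_trm) (auto simp: wf_terms_def pos_def)
  moreover have "i < length xs" if "i \<in> vars_trm (t \<cdot>\<^sub>t pos xs)" for i
    using assms(1) t(1) that vars_pos by (fastforce simp: vars_subst_trm wf_terms_def)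
  ultimately show ?thesis using t by simp
qed

lemma concat_map_empty: "(\<And>x. x \<in> set xs \<Longrightarrow> f x = []) \<Longrightarrow> concat (map f xs) = []"
  by (induction xs) auto

lemma is_conf_terms_arrow: "wf_terms S xs ts \<Longrightarrow> is_conf S (terms_arrow xs ts)"
  using wf_comp_terms_arrow[of S xs ts]
  by (simp add: is_conf_def) (simp add: terms_arrow_def comp_def concat_map_empty)

lemma is_obs_terms_arrow: "wf_terms S xs ts \<Longrightarrow> is_obs S (terms_arrow xs ts)"
  using wf_comp_terms_arrow[of S xs ts]
  by (simp add: is_obs_def) (auto simp: terms_arrow_def)

lemma src_terms_arrow [simp]: "src (terms_arrow xs ts) = tms (length xs)"
  and tgt_terms_arrow [simp]: "tgt (terms_arrow xs ts) = tms (length ts)"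
  by (simp_all add: terms_arrow_def tgt_def comp_def map_replicate_const)

lemma map_pos_distinct: "distinct xs \<Longrightarrow> map (pos xs) xs = map Var [0..<length xs]"
  by (rule nth_equalityI) (simp_all add: pos_nth)

lemma ident_terms_arrow:
  assumes "distinct xs"
  shows "terms_arrow xs (map Var xs) = ident (tms (length xs))"
proof -
  have "map (\<lambda>t. TC (t \<cdot>\<^sub>t pos xs)) (map Var xs) = map (var_comp (tms (length xs))) [0..<length xs]"
    using assms by (intro nth_equalityI) (simp_all add: pos_nth var_comp_def)
  then show ?thesis by (simp add: terms_arrow_def ident_def)
qed

lemma fun_arrow_terms_arrow:
  assumes "distinct xs" "length xs = farity S f"
  shows "terms_arrow xs [Fun f (map Var xs)] = fun_arrow S f"
  using assms by (simp add: terms_arrow_def fun_arrow_def comp_def map_pos_distinct)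

lemma dup_terms_arrow:
  assumes "distinct xs"
  shows "terms_arrow xs (map Var (xs @ xs)) = dup (tms (length xs))"
proof -
  have "map (\<lambda>t. TC (t \<cdot>\<^sub>t pos xs)) (map Var xs) = map (var_comp (tms (length xs))) [0..<length xs]"
    using assms by (intro nth_equalityI) (simp_all add: pos_nth var_comp_def)
  then show ?thesis by (simp add: terms_arrow_def dup_def)
qed

lemma symm_terms_arrow:
  assumes "a \<noteq> b"
  shows "terms_arrow [a, b] [Var b, Var a] = symm (tms 1) (tms 1)"
  using assms by (simp add: terms_arrow_def symm_def pos_def var_comp_def upt_rec)

lemma ex_assignment: "distinct ys \<Longrightarrow> length ys = length ts \<Longrightarrow> \<exists>\<sigma>. map \<sigma> ys = ts"
proof (induction ys arbitrary: ts)
  case (Cons y ys)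
  then obtain t ts' where "ts = t # ts'" by (metis length_Suc_conv)
  moreover from this obtain \<sigma> where "map \<sigma> ys = ts'" using Cons by auto
  ultimately show ?case using Cons.prems(1) by (intro exI[of _ "\<sigma>(y := t)"]) auto
qed simp

lemma ex_fresh_list:
  assumes "finite (A :: 'w :: infinite set)"
  shows "\<exists>ns. distinct ns \<and> length ns = k \<and> set ns \<inter> A = {}"
proof -
  have "infinite (UNIV - A)" using assms by (simp add: infinite_UNIV)
  then obtain B where "finite B" "card B = k" "B \<subseteq> UNIV - A"
    by (meson infinite_arbitrarily_large)
  then show ?thesis using finite_distinct_list[of B] distinct_card by fastforce
qed

text \<open>Adjacent transpositions generate all permutations; they are the form in which the
  symmetry tile, which exchanges two wires, can be applied in context.\<close>

lemma adjacent_swaps_induct: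
  assumes "Q xs" "mset ys = mset xs" "\<And>as a b bs. Q (as @ a # b # bs) \<Longrightarrow> Q (as @ b # a # bs)"
  shows "Q ys"
proof -
  \<comment> \<open>Moves \<open>y\<close> leftwards through \<open>us\<close>. With this,
    \<open>ys\<close> is assembled entry by entry behind the growing prefix
    \<open>pre\<close>.\<close>
  have front: "Q (pre @ us @ y # vs) \<Longrightarrow> Q (pre @ y # us @ vs)" for pre us y vs
  proof (induction us arbitrary: vs rule: rev_induct)
    case (snoc u us)
    then have "Q (pre @ us @ y # u # vs)" using assms(3)[of "pre @ us" u y vs] by simp
    from snoc.IH[OF this] show ?case by simp
  qed simp
  have "Q (pre @ xs) \<Longrightarrow> mset ys = mset xs \<Longrightarrow> Q (pre @ ys)" for pre
  proof (induction ys arbitrary: xs pre)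
    case (Cons y ys)
    then have "y \<in> set xs" by (metis list.set_intros(1) set_mset_mset)
    then obtain us vs where xs: "xs = us @ y # vs" by (meson split_list)
    then have "Q (pre @ y # us @ vs)" using front Cons.prems(1) by blast
    moreover have "mset ys = mset (us @ vs)" using Cons.prems(2) xs by simp
    ultimately show ?case using Cons.IH[of "pre @ [y]" "us @ vs"] by simp
  qed simp
  from this[of "[]"] show ?thesis using assms by simp
qed

subsection \<open>Symmetric tiles\<close>

text \<open>Reflection in the diagonal exchanges initial configuration with trigger and effect with
  final configuration. Unification does not distinguish the sides of an equation, and carrying both
  tiles along makes every later construction available in both orientations.\<close>

definition sym_tile where
  "sym_tile S P s u v r \<longleftrightarrow> tile S P s u v r \<and> tile S P u s r v"

lemma sym_tile_sym: "sym_tile S P s u v r \<Longrightarrow> sym_tile S P u s r v"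
  by (simp add: sym_tile_def)

text \<open>Reflection turns horizontal into vertical composition, which is why the two rules are
  needed together, here and in the next lemma.\<close>

lemma sym_tile_horizontal:
  "sym_tile S P s1 u1 v1 r1 \<Longrightarrow> sym_tile S P s2 v1 v2 r2 \<Longrightarrow> sym_tile S P (s2 ;; s1) u1 v2 (r2 ;; r1)"
  by (auto simp: sym_tile_def intro: tile.horizontal tile.vertical)

lemma sym_tile_vertical:
  "sym_tile S P s1 u1 v1 r1 \<Longrightarrow> sym_tile S P r1 u2 v2 r2 \<Longrightarrow> sym_tile S P s1 (u2 ;; u1) (v2 ;; v1) r2"
  by (auto simp: sym_tile_def intro: tile.horizontal tile.vertical)

lemma sym_tile_parallel:
  "sym_tile S P s1 u1 v1 r1 \<Longrightarrow> sym_tile S P s2 u2 v2 r2 \<Longrightarrow>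
   sym_tile S P (s1 \<otimes> s2) (u1 \<otimes> u2) (v1 \<otimes> v2) (r1 \<otimes> r2)"
  by (auto simp: sym_tile_def intro: tile.parallel)

lemma sym_tile_parallel_terms:
  assumes "sym_tile S P (terms_arrow xs ss) (terms_arrow ys us) (terms_arrow ds vs) (terms_arrow ds rs)"
    "sym_tile S P (terms_arrow xs' ss') (terms_arrow ys' us') (terms_arrow ds' vs') (terms_arrow ds' rs')"
    "wf_terms S xs ss" "wf_terms S ys us" "wf_terms S ds vs" "wf_terms S ds rs"
    "wf_terms S xs' ss'" "wf_terms S ys' us'" "wf_terms S ds' vs'" "wf_terms S ds' rs'"
    "set xs \<inter> set xs' = {}" "set ys \<inter> set ys' = {}" "set ds \<inter> set ds' = {}"
  shows "sym_tile S P (terms_arrow (xs @ xs') (ss @ ss')) (terms_arrow (ys @ ys') (us @ us'))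
    (terms_arrow (ds @ ds') (vs @ vs')) (terms_arrow (ds @ ds') (rs @ rs'))"
  using sym_tile_parallel[OF assms(1,2)] assms(3-) by (simp add: par_terms_arrow[where S = S])

text \<open>A tuple of terms is both a configuration and an observation, and its two identity tiles
  are reflections of each other.\<close>

lemma sym_tile_id:
  assumes "wf_terms S xs ts" "distinct xs" "distinct ys" "length ys = length ts"
  shows "sym_tile S P (terms_arrow xs ts) (terms_arrow ys (map Var ys))
    (terms_arrow xs (map Var xs)) (terms_arrow xs ts)"
  using tile.id_conf[OF is_conf_terms_arrow[OF assms(1)], of P]
    tile.id_obs[OF is_obs_terms_arrow[OF assms(1)], of P] assms(2-)
  by (simp add: sym_tile_def ident_terms_arrow)

lemma sym_tile_swap:
  fixes S :: "('p, 'f) signature"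
  assumes "a \<noteq> b"
  shows "sym_tile S P (terms_arrow [a, b] [Var b, Var a]) (terms_arrow [a, b] [Var b, Var a])
    (terms_arrow [a, b] [Var a, Var b]) (terms_arrow [a, b] [Var a, Var b])"
proof -
  have "terms_arrow [a, b] [Var a, Var b] = (ident (tms 2) :: ('p, 'f) arrow)"
    using ident_terms_arrow[of "[a, b]"] assms by (simp add: numeral_2_eq_2)
  then show ?thesis
    using tile.basic[OF basic_tile.symm_symm, of S P]
    by (simp add: sym_tile_def symm_terms_arrow[OF assms, simplified])
qed

lemma sym_tile_dup:
  fixes S :: "('p, 'f) signature"
  shows "sym_tile S P (terms_arrow [a] [Var a, Var a]) (terms_arrow [a] [Var a, Var a])
    (terms_arrow [a] [Var a]) (terms_arrow [a] [Var a])"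
proof -
  have "terms_arrow [a] [Var a, Var a] = (dup (tms 1) :: ('p, 'f) arrow)"
    "terms_arrow [a] [Var a] = (ident (tms 1) :: ('p, 'f) arrow)"
    using dup_terms_arrow[of "[a]"] ident_terms_arrow[of "[a]"] by simp_all
  then show ?thesis using tile.basic[OF basic_tile.dup_dup, of S P] by (simp add: sym_tile_def)
qed

lemma sym_tile_fun:
  assumes "distinct ns" "length ns = farity S f"
  shows "sym_tile S P (terms_arrow ns [Fun f (map Var ns)]) (terms_arrow ns [Fun f (map Var ns)])
    (terms_arrow ns (map Var ns)) (terms_arrow ns (map Var ns))"
  unfolding sym_tile_def fun_arrow_terms_arrow[OF assms] ident_terms_arrow[OF assms(1)] assms(2)
  using tile.basic[OF basic_tile.fun_fun[OF refl], of S P f] by simp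

text \<open>The two basic tiles between the duplicator and \<open>f\<close> are reflections of each
  other. Read as a unification problem, the tile solves \<open>x = f(ns)\<close> together with
  \<open>x = x'\<close>, where \<open>x'\<close> is the last variable of the trigger; the second
  equation keeps the value \<open>f(ns)\<close> of \<open>x\<close> available for further
  use.\<close>

lemma sym_tile_dup_fun:
  fixes S :: "('p, 'f) signature" and ns :: "'w list"
  assumes "distinct ns" "length ns = farity S f" "x \<notin> set ns"
  shows "sym_tile S P (terms_arrow [x] [Var x, Var x]) (terms_arrow (ns @ [x]) [Fun f (map Var ns), Var x])
    (terms_arrow ns [Fun f (map Var ns)]) (terms_arrow ns (map Var ns @ [Fun f (map Var ns)]))"
proof -
  let ?f = "Fun f (map Var ns)"
  have wf: "wf_terms S ns [?f]" using assms by auto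
  have 1: "terms_arrow (ns @ [x]) [?f, Var x] = (fun_arrow S f :: ('p, 'f) arrow) \<otimes> ident (tms 1)"
  proof -
    have "terms_arrow [x] [Var x] = (ident (tms 1) :: ('p, 'f) arrow)"
      using ident_terms_arrow[of "[x]"] by simp
    moreover have "terms_arrow ns [?f] \<otimes> terms_arrow [x] [Var x] = (terms_arrow (ns @ [x]) ([?f] @ [Var x]) :: ('p, 'f) arrow)"
      by (rule par_terms_arrow[OF _ wf]) (use assms in simp_all)
    ultimately show ?thesis by (simp add: fun_arrow_terms_arrow[OF assms(1,2)])
  qed
  \<comment> \<open>Only the length of the name list matters, so the second copy of \<open>ns\<close> may be renamed to naturals.\<close>
  let ?n = "farity S f"
  have f: "fun_arrow S f = terms_arrow [?n..<?n + ?n] [Fun f (map Var [?n..<?n + ?n])]"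
    by (rule fun_arrow_terms_arrow[symmetric]) auto
  have i: "(ident (tms ?n) :: ('p, 'f) arrow) = terms_arrow [0..<?n] (map Var [0..<?n])"
    by (simp add: ident_terms_arrow)
  have upt: "[0..<?n + ?n] = [0..<?n] @ [?n..<?n + ?n]" by (rule upt_add_eq_append) simp
  have if': "ident (tms ?n) \<otimes> fun_arrow S f =
    terms_arrow [0..<?n + ?n] (map Var [0..<?n] @ [Fun f (map Var [?n..<?n + ?n])])"
    unfolding i unfolding f unfolding upt
    by (rule par_terms_arrow[where S = S]) auto
  \<comment> \<open>The duplicator is written over the doubled index range, the list of names that
    \<open>if'\<close> uses, so that the two arrows compose as substitutions.\<close>
  have d: "(dup (tms ?n) :: ('p, 'f) arrow) = terms_arrow ns (map (\<lambda>i. Var ((ns @ ns) ! i)) [0..<?n + ?n])"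
  proof -
    have "map (\<lambda>i. Var ((ns @ ns) ! i)) [0..<?n + ?n] = (map Var (ns @ ns) :: ('f, 'w) trm list)"
      using assms(2) by (intro nth_equalityI) (simp_all add: nth_append)
    then show ?thesis using assms by (simp only: dup_terms_arrow)
  qed
  have "dup (tms ?n) ;; (ident (tms ?n) \<otimes> fun_arrow S f) = terms_arrow ns (map Var ns @ [?f])"
    unfolding d if'
  proof (subst seq_terms_arrow, goal_cases)
    case 2
    have "map ((!) (ns @ ns)) [0..<?n] = ns" "map ((!) (ns @ ns)) [?n..<?n + ?n] = ns"
      using assms(2) by (auto intro!: nth_equalityI simp: nth_append)
    then show ?case by (simp add: comp_def flip: map_map[of Var "(!) (ns @ ns)", unfolded comp_def])
  qed (auto simp: subset_iff)
  moreover have "terms_arrow [x] [Var x, Var x] = (dup (tms 1) :: ('p, 'f) arrow)"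
    using dup_terms_arrow[of "[x]"] by simp
  ultimately show ?thesis
    using tile.basic[OF basic_tile.dup_fun[OF refl], of S P f] tile.basic[OF basic_tile.fun_dup[OF refl], of S P f]
      fun_arrow_terms_arrow[OF assms(1,2)]
    by (simp add: sym_tile_def 1)
qed

lemma seq_terms_arrow_Var:
  assumes "set zs \<subseteq> set ys"
  shows "terms_arrow xs (map \<sigma> ys) ;; terms_arrow ys (map Var zs) = terms_arrow xs (map \<sigma> zs)"
  using assms by (subst seq_terms_arrow) (auto simp: comp_def)

lemma seq_terms_arrow_wf:
  assumes "wf_terms S ys ts"
  shows "terms_arrow xs (map \<sigma> ys) ;; terms_arrow ys ts = terms_arrow xs (map (\<lambda>t. t \<cdot>\<^sub>t \<sigma>) ts)"
  using assms by (intro seq_terms_arrow) (auto simp: wf_terms_def)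

text \<open>The tile says that \<open>ts\<close> has a trivial kernel pair, that is,
  \<open>ts\<close> is a monomorphism: unifying two instances of \<open>ts\<close> amounts to
  unifying their arguments.\<close>

definition mono_tile where
  "mono_tile S P ws ts \<longleftrightarrow> sym_tile S P (terms_arrow ws ts) (terms_arrow ws ts)
     (terms_arrow ws (map Var ws)) (terms_arrow ws (map Var ws))"

lemma mono_tile_id: "distinct ws \<Longrightarrow> mono_tile S P ws (map Var ws)"
  unfolding mono_tile_def by (rule sym_tile_id) simp_all

lemma mono_tile_parallel:
  assumes "mono_tile S P ws ts" "mono_tile S P ws' ts'" "wf_terms S ws ts" "wf_terms S ws' ts'"
    "set ws \<inter> set ws' = {}"
  shows "mono_tile S P (ws @ ws') (ts @ ts')"
  using assms sym_tile_parallel_terms[of S P ws ts ws ts ws "map Var ws" "map Var ws" ws' ts' ws' ts' ws' "map Var ws'" "map Var ws'"]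
  by (simp add: mono_tile_def)

text \<open>Cancels the monomorphism \<open>ts\<close> on both sides of a system: a tile that solves
  \<open>\<kappa>\<close> against \<open>\<nu>\<close> is pasted to the kernel tile of
  \<open>ts\<close>. Decomposing function symbols, dropping repeated equations and reordering
  equations are instances of it.\<close>

lemma sym_tile_mono_comp:
  fixes S :: "('p, 'f) signature"
  assumes "mono_tile S P ws ts" "wf_terms S ws ts" "distinct ws" "distinct xs" "wf_terms S xs (map \<kappa> ws)"
    "sym_tile S P (terms_arrow xs (map \<kappa> ws)) (terms_arrow zs (map \<nu> ws)) (terms_arrow ds (map \<sigma> xs)) r"
  shows "sym_tile S P (terms_arrow xs (map (\<lambda>t. t \<cdot>\<^sub>t \<kappa>) ts)) (terms_arrow zs (map (\<lambda>t. t \<cdot>\<^sub>t \<nu>) ts))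
    (terms_arrow ds (map \<sigma> xs)) r"
proof -
  have "sym_tile S P (terms_arrow xs (map \<kappa> ws)) (terms_arrow ws (map Var ws))
    (terms_arrow xs (map Var xs)) (terms_arrow xs (map \<kappa> ws))"
    using assms by (intro sym_tile_id) simp_all
  from sym_tile_horizontal[OF assms(1)[unfolded mono_tile_def] this]
  have "sym_tile S P (terms_arrow xs (map (\<lambda>t. t \<cdot>\<^sub>t \<kappa>) ts)) (terms_arrow ws ts)
    (terms_arrow xs (map Var xs)) (terms_arrow xs (map \<kappa> ws))"
    by (simp add: seq_terms_arrow_wf[OF assms(2)] seq_terms_arrow_Var)
  from sym_tile_vertical[OF this assms(6)] show ?thesis
    by (simp add: seq_terms_arrow_wf[OF assms(2)] seq_terms_arrow_Var)
qed

lemma mono_tile_swap: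
  assumes "distinct (as @ a # b # bs)"
  shows "mono_tile S P (as @ a # b # bs) (map Var (as @ b # a # bs))"
proof -
  have "mono_tile S P [a, b] [Var b, Var a]"
    using assms sym_tile_swap[of a b S P] by (simp add: mono_tile_def)
  from mono_tile_parallel[OF this mono_tile_id[of bs]]
  have "mono_tile S P ([a, b] @ bs) ([Var b, Var a] @ map Var bs)" using assms by simp
  from mono_tile_parallel[OF mono_tile_id[of as] this]
  show ?thesis using assms by auto
qed

text \<open>Adjacent swaps are monomorphisms, and \<open>sym_tile_mono_comp\<close> composes
  them.\<close>

lemma mono_tile_perm:
  assumes "distinct xs" "mset ys = mset xs"
  shows "mono_tile S P xs (map Var ys)"
proof -
  have "mono_tile S P xs (map Var ys) \<and> mset ys = mset xs"
    using _ assms(2)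
  proof (rule adjacent_swaps_induct)
    show "mono_tile S P xs (map Var xs) \<and> mset xs = mset xs" using assms mono_tile_id by auto
    fix as a b bs assume as: "mono_tile S P xs (map Var (as @ a # b # bs)) \<and> mset (as @ a # b # bs) = mset xs"
    then have d: "distinct (as @ a # b # bs)" and s: "set (as @ a # b # bs) = set xs"
      using assms(1) by (metis mset_eq_imp_distinct_iff, metis mset_eq_setD)
    have "sym_tile S P (terms_arrow xs (map (\<lambda>t. t \<cdot>\<^sub>t Var) (map Var (as @ b # a # bs))))
      (terms_arrow xs (map (\<lambda>t. t \<cdot>\<^sub>t Var) (map Var (as @ b # a # bs))))
      (terms_arrow xs (map Var xs)) (terms_arrow xs (map Var xs))"
      by (rule sym_tile_mono_comp[OF mono_tile_swap[OF d] _ d assms(1)])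
        (use as s in \<open>auto simp: mono_tile_def\<close>)
    then show "mono_tile S P xs (map Var (as @ b # a # bs)) \<and> mset (as @ b # a # bs) = mset xs"
      using as by (auto simp: mono_tile_def add_mset_commute)
  qed
  then show ?thesis ..
qed

text \<open>The kernel tile of the permutation, continued by the identity tile of the effect, moves
  the permutation from the configuration into the effect.\<close>

lemma sym_tile_perm_src:
  assumes t: "sym_tile S P (terms_arrow xs ss) u (terms_arrow ds (map \<sigma> xs)) (terms_arrow ds rs)"
    and "distinct xs" "distinct ds" "mset xs' = mset xs" "wf_terms S xs ss" "wf_terms S ds (map \<sigma> xs)" "wf_terms S ds rs"
  shows "sym_tile S P (terms_arrow xs' ss) u (terms_arrow ds (map \<sigma> xs')) (terms_arrow ds rs)"
proof -
  have d: "distinct xs'" and s: "set xs' = set xs"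
    using assms(2,4) by (metis mset_eq_imp_distinct_iff, metis mset_eq_setD)
  have w: "wf_terms S ds (map \<sigma> xs')" using assms(6) s by (simp add: wf_terms_def)
  have 1: "sym_tile S P (terms_arrow xs' (map Var xs)) (terms_arrow xs' (map Var xs))
    (terms_arrow xs' (map Var xs')) (terms_arrow xs' (map Var xs'))"
    using mono_tile_perm[OF d, of xs S P] assms(4) by (simp add: mono_tile_def)
  have "sym_tile S P (terms_arrow xs' (map Var xs')) (terms_arrow ds (map \<sigma> xs'))
    (terms_arrow ds (map \<sigma> xs')) (terms_arrow ds (map Var ds))"
    by (rule sym_tile_sym, rule sym_tile_id) (use w d assms(3) in simp_all)
  from sym_tile_vertical[OF 1 this]
  have "sym_tile S P (terms_arrow xs' (map Var xs)) (terms_arrow ds (map \<sigma> xs))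
    (terms_arrow ds (map \<sigma> xs')) (terms_arrow ds (map Var ds))"
    using s by (simp add: seq_terms_arrow_Var)
  from sym_tile_horizontal[OF t this] show ?thesis
    by (simp add: seq_terms_arrow_wf[OF assms(5)] seq_terms_arrow_wf[OF assms(7)])
qed

text \<open>Starts from the kernel tile of the inverse permutation and pastes the permutation to
  both of its sides, so that each side composes to the identity. It serves to reorder the common
  source of effect and final configuration.\<close>

lemma tile_rename_perm:
  assumes "distinct ds" "mset ds' = mset ds"
  shows "sym_tile S P (terms_arrow ds (map Var ds)) (terms_arrow ds (map Var ds))
    (terms_arrow ds' (map Var ds)) (terms_arrow ds' (map Var ds))"
proof -
  have d: "distinct ds'" and s: "set ds' = set ds" and l: "length ds' = length ds"
    using assms by (metis mset_eq_imp_distinct_iff, metis mset_eq_setD, metis mset_eq_length)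
  have 1: "sym_tile S P (terms_arrow ds (map Var ds')) (terms_arrow ds (map Var ds'))
    (terms_arrow ds (map Var ds)) (terms_arrow ds (map Var ds))"
    using mono_tile_perm[OF assms(1), of ds' S P] assms(2) by (simp add: mono_tile_def)
  have 2: "sym_tile S P (terms_arrow ds' (map Var ds)) (terms_arrow ds (map Var ds))
    (terms_arrow ds' (map Var ds')) (terms_arrow ds' (map Var ds))"
    by (rule sym_tile_id) (use s d assms(1) in simp_all)
  from sym_tile_vertical[OF 1 sym_tile_sym[OF 2]]
  have "sym_tile S P (terms_arrow ds (map Var ds')) (terms_arrow ds' (map Var ds'))
    (terms_arrow ds' (map Var ds)) (terms_arrow ds' (map Var ds'))"
    using s by (simp add: seq_terms_arrow_Var)
  from sym_tile_horizontal[OF 2 this] show ?thesis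
    using s by (simp add: seq_terms_arrow_Var)
qed

lemma sym_tile_perm_apex:
  assumes t: "sym_tile S P (terms_arrow xs ss) u (terms_arrow ds (map \<sigma> xs)) (terms_arrow ds rs)"
    and "distinct xs" "distinct ds" "mset ds' = mset ds" "wf_terms S xs ss" "wf_terms S ds (map \<sigma> xs)" "wf_terms S ds rs"
  shows "sym_tile S P (terms_arrow xs ss) u (terms_arrow ds' (map \<sigma> xs)) (terms_arrow ds' rs)"
proof -
  have "sym_tile S P (terms_arrow xs (map Var xs)) (terms_arrow ds (map \<sigma> xs))
    (terms_arrow ds (map \<sigma> xs)) (terms_arrow ds (map Var ds))"
    by (rule sym_tile_sym, rule sym_tile_id) (use assms in simp_all)
  from sym_tile_vertical[OF this tile_rename_perm[OF assms(3,4)]]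
  have "sym_tile S P (terms_arrow xs (map Var xs)) (terms_arrow ds (map \<sigma> xs))
    (terms_arrow ds' (map \<sigma> xs)) (terms_arrow ds' (map Var ds))"
    by (simp add: seq_terms_arrow_wf[OF assms(6)] comp_def)
  from sym_tile_horizontal[OF t this] show ?thesis
    by (simp add: seq_terms_arrow_wf[OF assms(5)] seq_terms_arrow_wf[OF assms(7)])
qed

lemma mset_eq_map_nth:
  assumes "mset ys = mset xs"
  shows "\<exists>p. mset p = mset [0..<length xs] \<and> ys = map ((!) xs) p"
  using _ assms
proof (rule adjacent_swaps_induct)
  show "\<exists>p. mset p = mset [0..<length xs] \<and> xs = map ((!) xs) p"
    by (intro exI[of _ "[0..<length xs]"]) (simp add: map_nth)
  fix as a b bs assume "\<exists>p. mset p = mset [0..<length xs] \<and> as @ a # b # bs = map ((!) xs) p"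
  then obtain p where p: "mset p = mset [0..<length xs]" "as @ a # b # bs = map ((!) xs) p" by blast
  then obtain ps i j qs where "p = ps @ i # j # qs" "as = map ((!) xs) ps" "a = xs ! i" "b = xs ! j" "bs = map ((!) xs) qs"
    by (auto simp: append_eq_map_conv Cons_eq_map_conv)
  then show "\<exists>p. mset p = mset [0..<length xs] \<and> as @ b # a # bs = map ((!) xs) p"
    using p(1) by (intro exI[of _ "ps @ j # i # qs"]) (simp add: add_mset_commute)
qed

text \<open>Reordering the equations applies one permutation, a monomorphism, to both sides at once;
  the positions in \<open>E\<close> serve as its names.\<close>

lemma sym_tile_perm_pairs:
  assumes t: "sym_tile S P (terms_arrow xs (map fst E)) (terms_arrow zs (map snd E)) (terms_arrow ds (map \<sigma> xs)) r"
    and "distinct xs" "mset E' = mset E" "wf_terms S xs (map fst E)"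
  shows "sym_tile S P (terms_arrow xs (map fst E')) (terms_arrow zs (map snd E')) (terms_arrow ds (map \<sigma> xs)) r"
proof -
  let ?ws = "[0..<length E]"
  obtain p where p: "mset p = mset ?ws" "E' = map ((!) E) p" using mset_eq_map_nth[OF assms(3)] by blast
  have s: "set p = set ?ws" using mset_eq_setD[OF p(1)] .
  have E: "map (\<lambda>i. fst (E ! i)) ?ws = map fst E" "map (\<lambda>i. snd (E ! i)) ?ws = map snd E"
    by (auto intro: nth_equalityI)
  have E': "map (\<lambda>t. t \<cdot>\<^sub>t (\<lambda>i. fst (E ! i))) (map Var p) = map fst E'"
    "map (\<lambda>t. t \<cdot>\<^sub>t (\<lambda>i. snd (E ! i))) (map Var p) = map snd E'"
    using p(2) by simp_all
  show ?thesis
    unfolding E'[symmetric]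
    by (rule sym_tile_mono_comp[OF mono_tile_perm[OF _ p(1)]]) (use assms E s in simp_all)
qed

subsection \<open>Unification by tiles\<close>

text \<open>A tile for the equations \<open>E\<close> whose left sides live over \<open>xs\<close>
  and whose right sides live over \<open>zs\<close>. Its effect and final configuration list the
  values of the two groups of variables under the solution \<open>\<sigma>\<close>. The given
  solution is \<open>\<mu>\<close>, and \<open>h\<close> is its factorization through
  \<open>\<sigma>\<close>. The names \<open>ds\<close> are exactly the variables of
  \<open>\<sigma>\<close>, so that they can be matched with the variables of a most general unifier
  in the end.\<close>

definition unif_data ::
  "('p, 'f) signature \<Rightarrow> ('p, 'f, 'v) clause set \<Rightarrow> ('w \<Rightarrow> ('f, 'u) trm) \<Rightarrow> 'w list \<Rightarrow> 'w list \<Rightarrow>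
   (('f, 'w) trm \<times> ('f, 'w) trm) list \<Rightarrow> 'w list \<Rightarrow> ('w \<Rightarrow> ('f, 'w) trm) \<Rightarrow> ('w \<Rightarrow> ('f, 'u) trm) \<Rightarrow> bool" where
  "unif_data S P \<mu> xs zs E ds \<sigma> h \<longleftrightarrow>
     sym_tile S P (terms_arrow xs (map fst E)) (terms_arrow zs (map snd E))
       (terms_arrow ds (map \<sigma> xs)) (terms_arrow ds (map \<sigma> zs)) \<and>
     distinct ds \<and> (\<forall>x\<in>set xs \<union> set zs. wf_trm S (\<sigma> x)) \<and>
     (\<Union>x\<in>set xs \<union> set zs. vars_trm (\<sigma> x)) = set ds \<and>
     (\<forall>(s, t)\<in>set E. s \<cdot>\<^sub>t \<sigma> = t \<cdot>\<^sub>t \<sigma>) \<and>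
     (\<forall>x\<in>set xs \<union> set zs. \<mu> x = \<sigma> x \<cdot>\<^sub>t h)"

definition unif_tile where
  "unif_tile S P \<mu> xs zs E \<longleftrightarrow> (\<exists>ds \<sigma> h. unif_data S P \<mu> xs zs E ds \<sigma> h)"

lemma unif_dataD:
  assumes "unif_data S P \<mu> xs zs E ds \<sigma> h"
  shows "sym_tile S P (terms_arrow xs (map fst E)) (terms_arrow zs (map snd E))
       (terms_arrow ds (map \<sigma> xs)) (terms_arrow ds (map \<sigma> zs))"
    "distinct ds" "wf_terms S ds (map \<sigma> xs)" "wf_terms S ds (map \<sigma> zs)"
    "(\<Union>x\<in>set xs \<union> set zs. vars_trm (\<sigma> x)) = set ds"
    "\<And>s t. (s, t) \<in> set E \<Longrightarrow> s \<cdot>\<^sub>t \<sigma> = t \<cdot>\<^sub>t \<sigma>"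
    "\<And>x. x \<in> set xs \<union> set zs \<Longrightarrow> \<mu> x = \<sigma> x \<cdot>\<^sub>t h"
    "\<And>x. x \<in> set xs \<union> set zs \<Longrightarrow> wf_trm S (\<sigma> x)"
  using assms by (auto simp: unif_data_def wf_terms_def)

text \<open>This is where reflected tiles pay off: exchanging the sides of all equations is the
  reflection of the tile.\<close>

lemma unif_tile_flip:
  assumes "unif_tile S P \<mu> zs xs (map prod.swap E)"
  shows "unif_tile S P \<mu> xs zs E"
proof -
  from assms obtain ds \<sigma> h where *: "unif_data S P \<mu> zs xs (map prod.swap E) ds \<sigma> h"
    unfolding unif_tile_def by blast
  have "unif_data S P \<mu> xs zs E ds \<sigma> h"
    unfolding unif_data_def
  proof (intro conjI)
    show "sym_tile S P (terms_arrow xs (map fst E)) (terms_arrow zs (map snd E))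
       (terms_arrow ds (map \<sigma> xs)) (terms_arrow ds (map \<sigma> zs))"
      using sym_tile_sym[OF unif_dataD(1)[OF *]] by (simp add: comp_def)
    show "\<forall>(s, t)\<in>set E. s \<cdot>\<^sub>t \<sigma> = t \<cdot>\<^sub>t \<sigma>"
      using unif_dataD(6)[OF *] by (force simp: eq_commute)
  qed (use unif_dataD[OF *] in auto)
  then show ?thesis unfolding unif_tile_def by blast
qed

lemma unif_tile_perm_pairs:
  assumes "unif_tile S P \<mu> xs zs E" "distinct xs" "mset E' = mset E" "wf_terms S xs (map fst E)"
  shows "unif_tile S P \<mu> xs zs E'"
proof -
  from assms obtain ds \<sigma> h where *: "unif_data S P \<mu> xs zs E ds \<sigma> h" unfolding unif_tile_def by blast
  have "unif_data S P \<mu> xs zs E' ds \<sigma> h"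
    using * sym_tile_perm_pairs[OF unif_dataD(1)[OF *] assms(2-4)] mset_eq_setD[OF assms(3)]
    unfolding unif_data_def by simp
  then show ?thesis unfolding unif_tile_def by blast
qed

lemma unif_tile_perm_vars:
  assumes "unif_tile S P \<mu> xs zs E" "distinct xs" "mset xs' = mset xs" "wf_terms S xs (map fst E)"
  shows "unif_tile S P \<mu> xs' zs E"
proof -
  from assms obtain ds \<sigma> h where *: "unif_data S P \<mu> xs zs E ds \<sigma> h" unfolding unif_tile_def by blast
  note D = unif_dataD[OF *]
  have "unif_data S P \<mu> xs' zs E ds \<sigma> h"
    using * sym_tile_perm_src[OF D(1) assms(2) D(2) assms(3,4) D(3,4)] mset_eq_setD[OF assms(3)]
    unfolding unif_data_def by simp
  then show ?thesis unfolding unif_tile_def by blast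
qed

text \<open>Since \<open>f\<close> is a monomorphism, an equation between two \<open>f\<close>-terms
  may be replaced by the equations between the arguments; the other equations ride along on identity
  wires.\<close>

lemma unif_tile_fun_fun:
  fixes xs zs :: "'w list"
  assumes "unif_tile S P \<mu> xs zs (zip ss us @ E)" "distinct xs"
    "length ss = farity S f" "length us = farity S f"
    "wf_terms S xs (Fun f ss # map fst E)"
  shows "unif_tile S P \<mu> xs zs ((Fun f ss, Fun f us) # E)"
proof -
  from assms obtain ds \<sigma> h where *: "unif_data S P \<mu> xs zs (zip ss us @ E) ds \<sigma> h" unfolding unif_tile_def by blast
  let ?n = "farity S f" and ?m = "farity S f + length E"
  let ?as = "[0..<?n]" and ?bs = "[?n..<?m]"
  have m: "mono_tile S P (?as @ ?bs) ([Fun f (map Var ?as)] @ map Var ?bs)"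
    by (rule mono_tile_parallel)
      (auto intro: mono_tile_id sym_tile_fun simp: mono_tile_def[of S P ?as])
  let ?s = "(!) (ss @ map fst E)" and ?u = "(!) (us @ map snd E)"
  have e: "map ?s ?as = ss" "map ?s ?bs = map fst E" "map ?u ?as = us" "map ?u ?bs = map snd E"
    using assms(3,4) by (auto intro!: nth_equalityI simp: nth_append)
  have "sym_tile S P
    (terms_arrow xs (map (\<lambda>t. t \<cdot>\<^sub>t ?s) ([Fun f (map Var ?as)] @ map Var ?bs)))
    (terms_arrow zs (map (\<lambda>t. t \<cdot>\<^sub>t ?u) ([Fun f (map Var ?as)] @ map Var ?bs)))
    (terms_arrow ds (map \<sigma> xs)) (terms_arrow ds (map \<sigma> zs))"
    by (rule sym_tile_mono_comp[OF m])
      (use assms(2-5) unif_dataD(1)[OF *] in \<open>auto simp: e wf_terms_def simp del: upt_Suc\<close>)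
  moreover have "map (\<lambda>t. t \<cdot>\<^sub>t ?s) ([Fun f (map Var ?as)] @ map Var ?bs) = Fun f ss # map fst E"
    "map (\<lambda>t. t \<cdot>\<^sub>t ?u) ([Fun f (map Var ?as)] @ map Var ?bs) = Fun f us # map snd E"
    using e by (simp_all add: comp_def)
  moreover have "Fun f ss \<cdot>\<^sub>t \<sigma> = Fun f us \<cdot>\<^sub>t \<sigma>"
  proof -
    have "ss ! i \<cdot>\<^sub>t \<sigma> = us ! i \<cdot>\<^sub>t \<sigma>" if "i < farity S f" for i
      by (rule unif_dataD(6)[OF *]) (use that assms(3,4) in \<open>auto simp: set_zip\<close>)
    then show ?thesis using assms(3,4) by (auto intro!: nth_equalityI)
  qed
  ultimately have "unif_data S P \<mu> xs zs ((Fun f ss, Fun f us) # E) ds \<sigma> h"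
    using * unfolding unif_data_def by simp
  then show ?thesis unfolding unif_tile_def by blast
qed

text \<open>To solve \<open>x = f(us)\<close>, the variable \<open>x\<close> becomes
  \<open>f(ns)\<close> with fresh \<open>ns\<close>, also in the equations that remain, and
  \<open>ns\<close> is equated with \<open>us\<close>. On tiles, \<open>x\<close> is duplicated: one
  copy meets \<open>f\<close>, the other one supplies the remaining equations with the value
  \<open>f(ns)\<close>. The solution \<open>\<mu>'\<close> extends \<open>\<mu>\<close> to
  \<open>ns\<close>.\<close>

lemma unif_tile_var_fun:
  fixes S :: "('p, 'f) signature" and P :: "('p, 'f, 'v) clause set" and ns xs zs :: "'w :: infinite list"
    and \<mu> \<mu>' :: "'w \<Rightarrow> ('f, 'u) trm" and x :: 'w and f :: 'f
  defines "w \<equiv> Var(x := Fun f (map Var ns))"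
  assumes u: "unif_tile S P \<mu>' (ns @ xs) zs (zip (map Var ns) us @ map (\<lambda>(s, t). (s \<cdot>\<^sub>t w, t)) E)"
    and d: "distinct (x # xs)" "distinct ns" "set ns \<inter> (set (x # xs) \<union> set zs) = {}" "set (x # xs) \<inter> set zs = {}"
    and l: "length ns = farity S f" "length us = farity S f"
    and wf: "wf_terms S (x # xs) (map fst E)" "wf_terms S zs (us @ map snd E)"
    and \<mu>: "\<And>y. y \<in> set xs \<union> set zs \<Longrightarrow> \<mu>' y = \<mu> y" "\<mu> x = Fun f (map \<mu>' ns)"
  shows "unif_tile S P \<mu> (x # xs) zs ((Var x, Fun f us) # E)"
proof -
  let ?E' = "zip (map Var ns) us @ map (\<lambda>(s, t). (s \<cdot>\<^sub>t w, t)) E"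
  from u obtain ds \<sigma> h where *: "unif_data S P \<mu>' (ns @ xs) zs ?E' ds \<sigma> h"
    unfolding unif_tile_def by blast
  note D = unif_dataD[OF *]
  let ?F = "Fun f (map Var ns)"
  let ?N = "terms_arrow :: 'w list \<Rightarrow> ('f, 'w) trm list \<Rightarrow> ('p, 'f) arrow"
  have F: "wf_trm S ?F" "vars_trm ?F = set ns" using l by auto
  \<comment> \<open>The name \<open>c\<close> stands for the copy of \<open>x\<close> that is
    consumed by the function symbol.\<close>
  obtain c where c: "c \<notin> set (x # xs)" using ex_new_if_finite[OF infinite_UNIV, of "set (x # xs)"] by blast
  obtain bs where bs: "distinct bs" "length bs = length E" "set bs \<inter> set ns = {}"
    using ex_fresh_list[of "set ns" "length E"] by auto
  have id1: "sym_tile S P (?N [c] [Var c]) (?N ns [?F]) (?N ns [?F]) (?N ns (map Var ns))"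
    using sym_tile_sym[OF sym_tile_id[of S ns "[?F]" "[c]" P]] F d by simp
  have id2: "sym_tile S P (?N (x # xs) (map fst E)) (?N bs (map Var bs)) (?N (x # xs) (map Var (x # xs))) (?N (x # xs) (map fst E))"
    by (rule sym_tile_id) (use wf d bs in simp_all)
  \<comment> \<open>Solves \<open>c = f(ns)\<close> and passes the left sides of \<open>E\<close> to
    the placeholders \<open>bs\<close>; here \<open>c\<close> and \<open>x\<close> are still
    independent.\<close>
  have B: "sym_tile S P (?N ([c] @ x # xs) ([Var c] @ map fst E)) (?N (ns @ bs) ([?F] @ map Var bs))
    (?N (ns @ x # xs) ([?F] @ map Var (x # xs))) (?N (ns @ x # xs) (map Var ns @ map fst E))"
    by (rule sym_tile_parallel_terms[OF id1 id2]) (use wf d bs F c in auto)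
  have id3: "sym_tile S P (?N xs (map Var xs)) (?N xs (map Var xs)) (?N xs (map Var xs)) (?N xs (map Var xs))"
    by (rule sym_tile_id) (use d in simp_all)
  \<comment> \<open>Identifies \<open>c\<close> with \<open>x\<close> by duplicating both from one
    variable, so that \<open>x\<close> becomes \<open>f(ns)\<close> as well.\<close>
  have C: "sym_tile S P (?N ([x] @ xs) ([Var x, Var x] @ map Var xs)) (?N ((ns @ [x]) @ xs) ([?F, Var x] @ map Var xs))
    (?N (ns @ xs) ([?F] @ map Var xs)) (?N (ns @ xs) ((map Var ns @ [?F]) @ map Var xs))"
    by (rule sym_tile_parallel_terms[OF sym_tile_dup_fun id3]) (use d l F in auto)
  have wmap: "map w (ns @ xs) = map Var (ns @ xs)" using d unfolding w_def by auto
  have wns: "map w ns = map Var ns" and wxs: "map w xs = map Var xs" using wmap by auto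
  have wzs: "w z = Var z" if "z \<in> set zs" for z using d that unfolding w_def by auto
  have wx: "w x = ?F" unfolding w_def by simp
  have s1: "?N (x # xs) (map (Var(c := Var x)) (c # x # xs)) ;; ?N (c # x # xs) (Var c # map fst E) =
    ?N (x # xs) (map (\<lambda>t. t \<cdot>\<^sub>t Var(c := Var x)) (Var c # map fst E))"
    by (rule seq_terms_arrow_wf[of S]) (use wf(1) in \<open>auto intro: wf_terms_mono\<close>)
  have m1: "map (Var(c := Var x)) (c # x # xs) = Var x # Var x # map Var xs" using c by auto
  have "t \<cdot>\<^sub>t Var(c := Var x) = t" if "t \<in> set (map fst E)" for t
  proof -
    have "t \<cdot>\<^sub>t Var(c := Var x) = t \<cdot>\<^sub>t Var"
      by (rule subst_trm_cong) (use that wf(1) c in \<open>auto simp: wf_terms_def\<close>)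
    then show ?thesis by simp
  qed
  then have m2: "map (\<lambda>t. t \<cdot>\<^sub>t Var(c := Var x)) (map fst E) = map fst E" by (rule map_idI)
  have s: "?N (x # xs) (Var x # Var x # map Var xs) ;; ?N (c # x # xs) (Var c # map fst E) =
    ?N (x # xs) (Var x # map fst E)"
    using s1[unfolded m1] unfolding list.map m2 by simp
  have "?N (ns @ xs) (map w (ns @ x # xs)) ;; ?N (ns @ x # xs) (map Var ns @ map fst E) =
    ?N (ns @ xs) (map (\<lambda>t. t \<cdot>\<^sub>t w) (map Var ns @ map fst E))"
    by (rule seq_terms_arrow_wf[of S]) (use wf(1) in \<open>auto intro: wf_terms_mono\<close>)
  then have r: "?N (ns @ xs) (map Var ns @ ?F # map Var xs) ;; ?N (ns @ x # xs) (map Var ns @ map fst E) =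
    ?N (ns @ xs) (map Var ns @ map (\<lambda>t. t \<cdot>\<^sub>t w) (map fst E))"
    by (simp add: comp_def wns wxs wx)
  have BC: "sym_tile S P (?N (x # xs) (Var x # map fst E)) (?N (ns @ bs) (?F # map Var bs))
    (?N (ns @ xs) (map w (x # xs))) (?N (ns @ xs) (map Var ns @ map (\<lambda>t. t \<cdot>\<^sub>t w) (map fst E)))"
    using sym_tile_horizontal[OF B[simplified] C[simplified]] by (simp add: s r wxs wx)
  have e1: "map fst ?E' = map Var ns @ map (\<lambda>t. t \<cdot>\<^sub>t w) (map fst E)" and e2: "map snd ?E' = us @ map snd E"
    using l by (simp_all add: comp_def case_prod_beta)
  \<comment> \<open>Puts the actual right sides in place of \<open>ns\<close> and \<open>bs\<close>;
    these are the right sides of the smaller problem.\<close>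
  obtain \<nu> where "map \<nu> (ns @ bs) = us @ map snd E"
    using ex_assignment[of "ns @ bs" "us @ map snd E"] d bs l by auto
  then have \<nu>: "map \<nu> ns = us" "map \<nu> bs = map snd E" "us @ map snd E = map \<nu> (ns @ bs)" using l by auto
  have "?N zs (us @ map snd E) ;; ?N (ns @ bs) (?F # map Var bs) = ?N zs (map (\<lambda>t. t \<cdot>\<^sub>t \<nu>) (?F # map Var bs))"
    unfolding \<nu>(3) by (rule seq_terms_arrow_wf[of S]) (use F in auto)
  then have u': "?N zs (us @ map snd E) ;; ?N (ns @ bs) (?F # map Var bs) = ?N zs (Fun f us # map snd E)"
    using \<nu>(1,2) by (simp add: comp_def)
  have "?N ds (map \<sigma> (ns @ xs)) ;; ?N (ns @ xs) (map w (x # xs)) = ?N ds (map (\<lambda>t. t \<cdot>\<^sub>t \<sigma>) (map w (x # xs)))"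
    by (rule seq_terms_arrow_wf[of S]) (use F wx wmap in \<open>auto simp: wf_terms_def\<close>)
  then have v': "?N ds (map \<sigma> (ns @ xs)) ;; ?N (ns @ xs) (map w (x # xs)) = ?N ds (map (\<lambda>y. w y \<cdot>\<^sub>t \<sigma>) (x # xs))"
    by (simp add: comp_def)
  \<comment> \<open>The solution first replaces \<open>x\<close> by \<open>f(ns)\<close> and then
    solves the smaller problem.\<close>
  let ?\<sigma> = "\<lambda>y. w y \<cdot>\<^sub>t \<sigma>"
  have zs: "map \<sigma> zs = map ?\<sigma> zs" using wzs by auto
  have T: "sym_tile S P (?N (x # xs) (Var x # map fst E)) (?N zs (Fun f us # map snd E))
    (?N ds (map ?\<sigma> (x # xs))) (?N ds (map ?\<sigma> zs))"
    using sym_tile_vertical[OF BC D(1)[unfolded e1 e2]] unfolding u' v' zs .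
  have \<sigma>x: "?\<sigma> x = Fun f (map \<sigma> ns)" and \<sigma>y: "\<And>y. y \<in> set xs \<union> set zs \<Longrightarrow> ?\<sigma> y = \<sigma> y"
    using wx wmap wzs by auto
  have tz: "t \<cdot>\<^sub>t ?\<sigma> = t \<cdot>\<^sub>t \<sigma>" if "vars_trm t \<subseteq> set zs" for t
    by (rule subst_trm_cong) (use that \<sigma>y in auto)
  have "\<sigma> (ns ! i) = us ! i \<cdot>\<^sub>t \<sigma>" if "i < farity S f" for i
  proof -
    have "Var (ns ! i) \<cdot>\<^sub>t \<sigma> = us ! i \<cdot>\<^sub>t \<sigma>" by (rule D(6)) (use that l in \<open>force simp: set_zip\<close>)
    then show ?thesis by simp
  qed
  then have "map \<sigma> ns = map (\<lambda>t. t \<cdot>\<^sub>t \<sigma>) us" using l by (auto intro!: nth_equalityI)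
  also have "\<dots> = map (\<lambda>t. t \<cdot>\<^sub>t ?\<sigma>) us" using wf(2) tz by (auto simp: wf_terms_def)
  finally have U1: "?\<sigma> x = Fun f us \<cdot>\<^sub>t ?\<sigma>" using \<sigma>x by simp
  have U2: "s \<cdot>\<^sub>t ?\<sigma> = t \<cdot>\<^sub>t ?\<sigma>" if "(s, t) \<in> set E" for s t
  proof -
    have "s \<cdot>\<^sub>t w \<cdot>\<^sub>t \<sigma> = t \<cdot>\<^sub>t \<sigma>" by (rule D(6)) (use that in force)
    moreover have "t \<in> set (map snd E)" using that by force
    then have "t \<cdot>\<^sub>t ?\<sigma> = t \<cdot>\<^sub>t \<sigma>" using wf(2) by (intro tz) (simp add: wf_terms_def)
    ultimately show ?thesis by (simp add: subst_trm_comp)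
  qed
  have "unif_data S P \<mu> (x # xs) zs ((Var x, Fun f us) # E) ds ?\<sigma> h"
    unfolding unif_data_def
  proof (intro conjI ballI)
    show "sym_tile S P (?N (x # xs) (map fst ((Var x, Fun f us) # E))) (?N zs (map snd ((Var x, Fun f us) # E)))
      (?N ds (map ?\<sigma> (x # xs))) (?N ds (map ?\<sigma> zs))" using T by simp
    show "distinct ds" by (rule D)
    fix y assume y: "y \<in> set (x # xs) \<union> set zs"
    show "wf_trm S (?\<sigma> y)" using y \<sigma>x \<sigma>y[of y] D(8) l by (cases "y = x") auto
    show "\<mu> y = ?\<sigma> y \<cdot>\<^sub>t h"
    proof (cases "y = x")
      case True
      then show ?thesis using \<sigma>x \<mu>(2) D(7) by simp
    next
      case False
      then show ?thesis using y \<sigma>y[of y] \<mu>(1)[of y] D(7)[of y] by auto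
    qed
  next
    have "(\<Union>y\<in>set (x # xs) \<union> set zs. vars_trm (?\<sigma> y)) = vars_trm (?\<sigma> x) \<union> (\<Union>y\<in>set xs \<union> set zs. vars_trm (?\<sigma> y))" by auto
    also have "\<dots> = vars_trm (Fun f (map \<sigma> ns)) \<union> (\<Union>y\<in>set xs \<union> set zs. vars_trm (\<sigma> y))"
      using \<sigma>x \<sigma>y by simp
    also have "\<dots> = (\<Union>y\<in>set (ns @ xs) \<union> set zs. vars_trm (\<sigma> y))" by auto
    finally show "(\<Union>y\<in>set (x # xs) \<union> set zs. vars_trm (?\<sigma> y)) = set ds" using D(5) by simp
  next
    fix e assume "e \<in> set ((Var x, Fun f us) # E)"
    then show "case e of (s, t) \<Rightarrow> s \<cdot>\<^sub>t ?\<sigma> = t \<cdot>\<^sub>t ?\<sigma>" using U1 U2 by auto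
  qed
  then show ?thesis unfolding unif_tile_def by blast
qed

lemma unif_tile_merge_same:
  fixes xs zs :: "'w list"
  assumes "unif_tile S P \<mu> xs zs ((Var x, Var z) # E)" "distinct xs" "wf_terms S xs (Var x # map fst E)"
  shows "unif_tile S P \<mu> xs zs ((Var x, Var z) # (Var x, Var z) # E)"
proof -
  from assms obtain ds \<sigma> h where *: "unif_data S P \<mu> xs zs ((Var x, Var z) # E) ds \<sigma> h" unfolding unif_tile_def by blast
  let ?bs = "[Suc 0..<Suc (length E)]"
  have m: "mono_tile S P ([0] @ ?bs) ([Var 0, Var 0] @ map Var ?bs)"
    by (rule mono_tile_parallel) (auto intro: mono_tile_id sym_tile_dup simp: mono_tile_def[of S P "[0]"] simp del: upt_Suc)
  let ?s = "(!) (Var x # map fst E)" and ?u = "(!) (Var z # map snd E)"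
  have e: "map ?s ?bs = map fst E" "map ?u ?bs = map snd E"
    by (auto intro!: nth_equalityI simp del: upt_Suc)
  have "sym_tile S P
    (terms_arrow xs (map (\<lambda>t. t \<cdot>\<^sub>t ?s) ([Var 0, Var 0] @ map Var ?bs)))
    (terms_arrow zs (map (\<lambda>t. t \<cdot>\<^sub>t ?u) ([Var 0, Var 0] @ map Var ?bs)))
    (terms_arrow ds (map \<sigma> xs)) (terms_arrow ds (map \<sigma> zs))"
    by (rule sym_tile_mono_comp[OF m])
      (use assms(2-3) unif_dataD(1)[OF *] in \<open>auto simp: e wf_terms_def simp del: upt_Suc\<close>)
  moreover have "map (\<lambda>t. t \<cdot>\<^sub>t ?s) ([Var 0, Var 0] @ map Var ?bs) = Var x # Var x # map fst E"
    "map (\<lambda>t. t \<cdot>\<^sub>t ?u) ([Var 0, Var 0] @ map Var ?bs) = Var z # Var z # map snd E"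
    using e by (simp_all add: comp_def del: upt_Suc)
  ultimately have "unif_data S P \<mu> xs zs ((Var x, Var z) # (Var x, Var z) # E) ds \<sigma> h"
    using * unfolding unif_data_def by simp
  then show ?thesis unfolding unif_tile_def by blast
qed

text \<open>Among the pullback tiles this is the one whose reflection is not again a basic tile. The
  reflection is obtained by conjugation: reversing the three wires of the target and then exchanging
  the two source wires on either side turns one placement of the duplicator into the other.\<close>

lemma sym_tile_dup_shifted:
  fixes S :: "('p, 'f) signature"
  shows "sym_tile S P (terms_arrow [0, 1 :: nat] [Var 0, Var 0, Var 1]) (terms_arrow [0, 1 :: nat] [Var 0, Var 1, Var 1])
    (terms_arrow [0 :: nat] [Var 0, Var 0]) (terms_arrow [0 :: nat] [Var 0, Var 0])"
proof -
  let ?N = "terms_arrow :: nat list \<Rightarrow> ('f, nat) trm list \<Rightarrow> ('p, 'f) arrow"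
  have 0: "tile S P (?N [0, 1] [Var 0, Var 0, Var 1]) (?N [0, 1] [Var 0, Var 1, Var 1]) (?N [0] [Var 0, Var 0]) (?N [0] [Var 0, Var 0])"
  proof -
    have "?N [0, 1] [Var 0, Var 0, Var 1] = dup (tms 1) \<otimes> ident (tms 1)"
      "?N [0, 1] [Var 0, Var 1, Var 1] = ident (tms 1) \<otimes> dup (tms 1)" "?N [0] [Var 0, Var 0] = dup (tms 1)"
      by (simp_all add: terms_arrow_def dup_def ident_def par_def pos_def var_comp_def)
    then show ?thesis using tile.basic[OF basic_tile.dup_dup_shifted, of S P] by simp
  qed
  have sw: "tile S P (?N [0, 1] [Var 1, Var 0]) (?N [0, 1] [Var 1, Var 0]) (?N [0, 1] [Var 0, Var 1]) (?N [0, 1] [Var 0, Var 1])"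
    using sym_tile_swap[of "0 :: nat" 1 S P] by (simp add: sym_tile_def)
  have rv: "tile S P (?N [0, 1, 2] [Var 2, Var 1, Var 0]) (?N [0, 1, 2] [Var 2, Var 1, Var 0])
    (?N [0, 1, 2] [Var 0, Var 1, Var 2]) (?N [0, 1, 2] [Var 0, Var 1, Var 2])"
    using mono_tile_perm[of "[0, 1, 2 :: nat]" "[2, 1, 0]" S P] by (simp add: mono_tile_def sym_tile_def add_mset_commute)
  have idc: "tile S P (?N xs ts) (?N ys (map Var ys)) (?N xs (map Var xs)) (?N xs ts)"
    and ido: "tile S P (?N ys (map Var ys)) (?N xs ts) (?N xs ts) (?N xs (map Var xs))"
    if "wf_terms S xs ts" "distinct xs" "distinct ys" "length ys = length ts" for xs ys ts
    using sym_tile_id[OF that, of P] by (simp_all add: sym_tile_def)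
  note ev = seq_def terms_arrow_def pos_def
  have "tile S P (?N [0, 1] [Var 0, Var 0, Var 1]) (?N [0, 1, 2] [Var 0, Var 1, Var 2]) (?N [0, 1] [Var 0, Var 1]) (?N [0, 1] [Var 0, Var 0, Var 1])"
    using idc[of "[0, 1]" "[Var 0, Var 0, Var 1]" "[0, 1, 2]"] by simp
  from tile.vertical[OF tile.horizontal[OF rv this, simplified] _, of "?N [0, 1] [Var 0, Var 1, Var 1]" "?N [0] [Var 0, Var 0]" "?N [0] [Var 0, Var 0]"] 0
  have 1: "tile S P (?N [0, 1] [Var 1, Var 0, Var 0]) (?N [0, 1] [Var 1, Var 1, Var 0]) (?N [0] [Var 0, Var 0]) (?N [0] [Var 0, Var 0])"
    by (simp add: ev)
  have "tile S P (?N [0, 1] [Var 0, Var 1]) (?N [0] [Var 0, Var 0]) (?N [0] [Var 0, Var 0]) (?N [0] [Var 0])"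
    using ido[of "[0]" "[Var 0, Var 0]" "[0, 1]"] by simp
  from tile.horizontal[OF 1 _, of "?N [0, 1] [Var 1, Var 0]" "?N [0] [Var 0, Var 0]" "?N [0] [Var 0]"] tile.vertical[OF sw this]
  have 2: "tile S P (?N [0, 1] [Var 0, Var 1, Var 1]) (?N [0, 1] [Var 1, Var 1, Var 0]) (?N [0] [Var 0, Var 0]) (?N [0] [Var 0, Var 0])"
    by (simp add: ev)
  have "tile S P (?N [0] [Var 0, Var 0]) (?N [0, 1] [Var 0, Var 1]) (?N [0] [Var 0]) (?N [0] [Var 0, Var 0])"
    using idc[of "[0]" "[Var 0, Var 0]" "[0, 1]"] by simp
  from tile.vertical[OF 2 _, of "?N [0, 1] [Var 1, Var 0]" "?N [0] [Var 0]" "?N [0] [Var 0, Var 0]"] tile.horizontal[OF sw this]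
  have "tile S P (?N [0, 1] [Var 0, Var 1, Var 1]) (?N [0, 1] [Var 0, Var 0, Var 1]) (?N [0] [Var 0, Var 0]) (?N [0] [Var 0, Var 0])"
    by (simp add: ev)
  with 0 show ?thesis by (simp add: sym_tile_def)
qed

text \<open>The problem is \<open>x = c\<close>, \<open>y = c\<close>, \<open>x = x'\<close>,
  \<open>y = y'\<close>, which makes all variables equal. Up to order and names it is the zigzag
  \<open>0 = 0'\<close>, \<open>0 = 1'\<close>, \<open>1 = 1'\<close>, \<open>1 = 2'\<close> with
  \<open>1'\<close> in the role of \<open>c\<close>, and this zigzag is a shifted duplicator tile
  pasted to the reflection of another one.\<close>

lemma sym_tile_merge:
  fixes S :: "('p, 'f) signature"
  assumes "x \<noteq> y" "c \<noteq> x" "c \<noteq> y"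
  shows "sym_tile S P (terms_arrow [x, y] [Var x, Var y, Var x, Var y]) (terms_arrow [c, x, y] [Var c, Var c, Var x, Var y])
    (terms_arrow [x] [Var x, Var x]) (terms_arrow [x] [Var x, Var x, Var x])"
proof -
  let ?N = "terms_arrow :: nat list \<Rightarrow> ('f, nat) trm list \<Rightarrow> ('p, 'f) arrow"
  note ev = seq_def terms_arrow_def pos_def
  have "sym_tile S P (?N [2] [Var 2]) (?N [2] [Var 2]) (?N [2] [Var 2]) (?N [2] [Var 2])"
    using sym_tile_id[of S "[2]" "[Var 2]" "[2]" P] by simp
  from sym_tile_parallel_terms[OF this sym_tile_sym[OF sym_tile_dup_shifted[of S P]]]
  have "sym_tile S P (?N [2, 0, 1] [Var 2, Var 0, Var 1, Var 1]) (?N [2, 0, 1] [Var 2, Var 0, Var 0, Var 1])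
    (?N [2, 0] [Var 2, Var 0, Var 0]) (?N [2, 0] [Var 2, Var 0, Var 0])"
    by simp
  then have 1: "sym_tile S P (?N [0, 1, 2] [Var 0, Var 1, Var 2, Var 2]) (?N [0, 1, 2] [Var 0, Var 1, Var 1, Var 2])
    (?N [0, 1] [Var 0, Var 1, Var 1]) (?N [0, 1] [Var 0, Var 1, Var 1])"
    by (simp add: ev)
  let ?E = "[(Var 0, Var 0), (Var 0, Var 1), (Var 1, Var 1), (Var 1, Var 2)] :: (('f, nat) trm \<times> ('f, nat) trm) list"
  let ?E' = "[(Var 0, Var 1), (Var 1, Var 1), (Var 0, Var 0), (Var 1, Var 2)] :: (('f, nat) trm \<times> ('f, nat) trm) list"
  let ?\<sigma> = "\<lambda>_ :: nat. Var 0 :: ('f, nat) trm"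
  from sym_tile_horizontal[OF 1 sym_tile_dup_shifted[of S P]]
  have "sym_tile S P (?N [0, 1] (map fst ?E)) (?N [0, 1, 2] (map snd ?E)) (?N [0] (map ?\<sigma> [0, 1])) (?N [0] [Var 0, Var 0, Var 0])"
    by (simp add: ev)
  from sym_tile_sym[OF sym_tile_perm_pairs[OF this, of ?E']]
  have "sym_tile S P (?N [0, 1, 2] (map snd ?E')) (?N [0, 1] (map fst ?E')) (?N [0] (map ?\<sigma> [0, 1, 2])) (?N [0] (map ?\<sigma> [0, 1]))"
    by (simp add: add_mset_commute)
  from sym_tile_sym[OF sym_tile_perm_src[OF this, of "[1, 0, 2]"]]
  have "sym_tile S P (?N [0, 1] (map fst ?E')) (?N [1, 0, 2] (map snd ?E')) (?N [0] (map ?\<sigma> [0, 1])) (?N [0] (map ?\<sigma> [1, 0, 2]))"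
    by (simp add: add_mset_commute)
  then show ?thesis using assms by (simp add: ev)
qed


text \<open>Two variables equated with the same \<open>z\<close> are merged by replacing
  \<open>y\<close> with \<open>x\<close> in the other equations. Both are duplicated, because one
  copy of each meets \<open>z\<close> while the other may occur in \<open>E\<close>; the copies that
  meet \<open>z\<close> are named \<open>c\<close> and \<open>d'\<close>, and \<open>c\<close> also
  stands for \<open>z\<close> on the right until \<open>\<nu>\<close> is applied.\<close>

lemma unif_tile_merge:
  fixes S :: "('p, 'f) signature" and P :: "('p, 'f, 'v) clause set" and xs zs :: "'w :: infinite list"
    and \<mu> :: "'w \<Rightarrow> ('f, 'u) trm" and x y :: 'w
  defines "w \<equiv> Var(y := Var x)"
  assumes u: "unif_tile S P \<mu> (x # xs) zs ((Var x, Var z) # map (\<lambda>(s, t). (s \<cdot>\<^sub>t w, t)) E)"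
    and d: "distinct (x # y # xs)" "set (x # y # xs) \<inter> set zs = {}"
    and wf: "wf_terms S (x # y # xs) (map fst E)" "wf_terms S zs (Var z # map snd E)"
    and \<mu>: "\<mu> x = \<mu> y"
  shows "unif_tile S P \<mu> (x # y # xs) zs ((Var x, Var z) # (Var y, Var z) # E)"
proof -
  let ?E' = "(Var x, Var z) # map (\<lambda>(s, t). (s \<cdot>\<^sub>t w, t)) E"
  from u obtain ds \<sigma> h where *: "unif_data S P \<mu> (x # xs) zs ?E' ds \<sigma> h"
    unfolding unif_tile_def by blast
  note D = unif_dataD[OF *]
  let ?N = "terms_arrow :: 'w list \<Rightarrow> ('f, 'w) trm list \<Rightarrow> ('p, 'f) arrow"
  let ?xs = "x # y # xs"
  obtain c where c: "c \<notin> set ?xs" using ex_new_if_finite[OF infinite_UNIV, of "set ?xs"] by blast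
  obtain d' where d': "d' \<notin> set (c # ?xs)" using ex_new_if_finite[OF infinite_UNIV, of "set (c # ?xs)"] by blast
  obtain bs where bs: "distinct bs" "length bs = length E" "set bs \<inter> {c} = {}"
    using ex_fresh_list[of "{c}" "length E"] by auto
  have id1: "sym_tile S P (?N [c, d'] [Var c, Var d']) (?N [c] [Var c, Var c]) (?N [c] [Var c, Var c]) (?N [c] [Var c])"
    using sym_tile_sym[OF sym_tile_id[of S "[c]" "[Var c, Var c]" "[c, d']" P]] d' by auto
  have id2: "sym_tile S P (?N ?xs (map fst E)) (?N bs (map Var bs)) (?N ?xs (map Var ?xs)) (?N ?xs (map fst E))"
    by (rule sym_tile_id) (use wf d bs in simp_all)
  have B: "sym_tile S P (?N ([c, d'] @ ?xs) ([Var c, Var d'] @ map fst E)) (?N ([c] @ bs) ([Var c, Var c] @ map Var bs))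
    (?N ([c] @ ?xs) ([Var c, Var c] @ map Var ?xs)) (?N ([c] @ ?xs) ([Var c] @ map fst E))"
    by (rule sym_tile_parallel_terms[OF id1 id2]) (use wf d bs c d' in auto)
  have id3: "sym_tile S P (?N xs (map Var xs)) (?N xs (map Var xs)) (?N xs (map Var xs)) (?N xs (map Var xs))"
    by (rule sym_tile_id) (use d in simp_all)
  have C: "sym_tile S P (?N ([x, y] @ xs) ([Var x, Var y, Var x, Var y] @ map Var xs)) (?N ([c, x, y] @ xs) ([Var c, Var c, Var x, Var y] @ map Var xs))
    (?N ([x] @ xs) ([Var x, Var x] @ map Var xs)) (?N ([x] @ xs) ([Var x, Var x, Var x] @ map Var xs))"
    by (rule sym_tile_parallel_terms[OF sym_tile_merge id3]) (use d c in auto)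
  have wxs: "map w xs = map Var xs" and wx: "w x = Var x" and wy: "w y = Var x" using d unfolding w_def by auto
  have wzs: "w z = Var z" if "z \<in> set zs" for z using d that unfolding w_def by auto
  let ?k = "Var(c := Var x, d' := Var y)"
  have s1: "?N ?xs (map ?k (c # d' # ?xs)) ;; ?N (c # d' # ?xs) (Var c # Var d' # map fst E) =
    ?N ?xs (map (\<lambda>t. t \<cdot>\<^sub>t ?k) (Var c # Var d' # map fst E))"
    by (rule seq_terms_arrow_wf[of S]) (use wf(1) in \<open>auto intro: wf_terms_mono\<close>)
  have m1: "map ?k (c # d' # ?xs) = Var x # Var y # Var x # Var y # map Var xs" using c d' by auto
  have "t \<cdot>\<^sub>t ?k = t" if "t \<in> set (map fst E)" for t
  proof -
    have "t \<cdot>\<^sub>t ?k = t \<cdot>\<^sub>t Var"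
      by (rule subst_trm_cong) (use that wf(1) c d' in \<open>auto simp: wf_terms_def\<close>)
    then show ?thesis by simp
  qed
  then have m2: "map (\<lambda>t. t \<cdot>\<^sub>t ?k) (map fst E) = map fst E" by (rule map_idI)
  have s: "?N ?xs (Var x # Var y # Var x # Var y # map Var xs) ;; ?N (c # d' # ?xs) (Var c # Var d' # map fst E) =
    ?N ?xs (Var x # Var y # map fst E)"
    using s1[unfolded m1] d' unfolding list.map m2 by auto
  let ?wc = "w(c := Var x)"
  have r1: "?N (x # xs) (map ?wc (c # ?xs)) ;; ?N (c # ?xs) (Var c # map fst E) =
    ?N (x # xs) (map (\<lambda>t. t \<cdot>\<^sub>t ?wc) (Var c # map fst E))"
    by (rule seq_terms_arrow_wf[of S]) (use wf(1) in \<open>auto intro: wf_terms_mono\<close>)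
  have m3: "map ?wc (c # ?xs) = Var x # Var x # Var x # map Var xs" using c wxs wx wy by auto
  have "t \<cdot>\<^sub>t ?wc = t \<cdot>\<^sub>t w" if "t \<in> set (map fst E)" for t
    by (rule subst_trm_cong) (use that wf(1) c d' in \<open>auto simp: wf_terms_def\<close>)
  then have m4: "map (\<lambda>t. t \<cdot>\<^sub>t ?wc) (map fst E) = map (\<lambda>t. t \<cdot>\<^sub>t w) (map fst E)" by (rule map_cong[OF refl])
  have r: "?N (x # xs) (Var x # Var x # Var x # map Var xs) ;; ?N (c # ?xs) (Var c # map fst E) =
    ?N (x # xs) (Var x # map (\<lambda>t. t \<cdot>\<^sub>t w) (map fst E))"
    using r1[unfolded m3] unfolding list.map m4 by simp
  have BC: "sym_tile S P (?N ?xs (Var x # Var y # map fst E)) (?N (c # bs) (Var c # Var c # map Var bs))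
    (?N (x # xs) (map w ?xs)) (?N (x # xs) (Var x # map (\<lambda>t. t \<cdot>\<^sub>t w) (map fst E)))"
    using sym_tile_horizontal[OF B[simplified] C[simplified]] by (simp add: s r wxs wx wy)
  have e1: "map fst ?E' = Var x # map (\<lambda>t. t \<cdot>\<^sub>t w) (map fst E)" and e2: "map snd ?E' = Var z # map snd E"
    by (simp_all add: comp_def case_prod_beta)
  obtain \<nu> where "map \<nu> (c # bs) = Var z # map snd E"
    using ex_assignment[of "c # bs" "Var z # map snd E"] bs by auto
  then have \<nu>: "\<nu> c = Var z" "map \<nu> bs = map snd E" "Var z # map snd E = map \<nu> (c # bs)" by auto
  have "?N zs (Var z # map snd E) ;; ?N (c # bs) (Var c # Var c # map Var bs) =
    ?N zs (map (\<lambda>t. t \<cdot>\<^sub>t \<nu>) (Var c # Var c # map Var bs))"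
    unfolding \<nu>(3) by (rule seq_terms_arrow_wf[of S]) auto
  then have u': "?N zs (Var z # map snd E) ;; ?N (c # bs) (Var c # Var c # map Var bs) = ?N zs (Var z # Var z # map snd E)"
    using \<nu>(1,2) by (simp add: comp_def)
  have "?N ds (map \<sigma> (x # xs)) ;; ?N (x # xs) (map w ?xs) = ?N ds (map (\<lambda>t. t \<cdot>\<^sub>t \<sigma>) (map w ?xs))"
    by (rule seq_terms_arrow_wf[of S]) (use wx wy wxs in \<open>auto simp: wf_terms_def\<close>)
  then have v': "?N ds (map \<sigma> (x # xs)) ;; ?N (x # xs) (map w ?xs) = ?N ds (map (\<lambda>y. w y \<cdot>\<^sub>t \<sigma>) ?xs)"
    by (simp add: comp_def)
  let ?\<sigma> = "\<lambda>y. w y \<cdot>\<^sub>t \<sigma>"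
  have zs: "map \<sigma> zs = map ?\<sigma> zs" using wzs by auto
  have T: "sym_tile S P (?N ?xs (Var x # Var y # map fst E)) (?N zs (Var z # Var z # map snd E))
    (?N ds (map ?\<sigma> ?xs)) (?N ds (map ?\<sigma> zs))"
    using sym_tile_vertical[OF BC D(1)[unfolded e1 e2]] unfolding u' v' zs .
  have \<sigma>y: "?\<sigma> y = \<sigma> x" and \<sigma>v: "\<And>v. v \<in> set (x # xs) \<union> set zs \<Longrightarrow> ?\<sigma> v = \<sigma> v"
    using wx wy wxs wzs by auto
  have tz: "t \<cdot>\<^sub>t ?\<sigma> = t \<cdot>\<^sub>t \<sigma>" if "vars_trm t \<subseteq> set zs" for t
    by (rule subst_trm_cong) (use that \<sigma>v in auto)
  have U1: "?\<sigma> x = ?\<sigma> z"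
  proof -
    have "Var x \<cdot>\<^sub>t \<sigma> = Var z \<cdot>\<^sub>t \<sigma>" by (rule D(6)) simp
    then show ?thesis using \<sigma>v[of x] \<sigma>v[of z] wf(2) by simp
  qed
  have U2: "s \<cdot>\<^sub>t ?\<sigma> = t \<cdot>\<^sub>t ?\<sigma>" if "(s, t) \<in> set E" for s t
  proof -
    have "s \<cdot>\<^sub>t w \<cdot>\<^sub>t \<sigma> = t \<cdot>\<^sub>t \<sigma>" by (rule D(6)) (use that in force)
    moreover have "t \<in> set (map snd E)" using that by force
    then have "t \<cdot>\<^sub>t ?\<sigma> = t \<cdot>\<^sub>t \<sigma>" using wf(2) by (intro tz) (auto simp: wf_terms_def)
    ultimately show ?thesis by (simp add: subst_trm_comp)
  qed
  have "unif_data S P \<mu> ?xs zs ((Var x, Var z) # (Var y, Var z) # E) ds ?\<sigma> h"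
    unfolding unif_data_def
  proof (intro conjI ballI)
    show "sym_tile S P (?N ?xs (map fst ((Var x, Var z) # (Var y, Var z) # E))) (?N zs (map snd ((Var x, Var z) # (Var y, Var z) # E)))
      (?N ds (map ?\<sigma> ?xs)) (?N ds (map ?\<sigma> zs))" using T by simp
    show "distinct ds" by (rule D)
    fix v assume v: "v \<in> set ?xs \<union> set zs"
    show "wf_trm S (?\<sigma> v)" using v \<sigma>y \<sigma>v[of v] D(8)[of x] D(8)[of v] by (cases "v = y") auto
    show "\<mu> v = ?\<sigma> v \<cdot>\<^sub>t h"
      using v \<sigma>y \<sigma>v[of v] \<mu> D(7)[of x] D(7)[of v] by (cases "v = y") auto
  next
    have "(\<Union>v\<in>set ?xs \<union> set zs. vars_trm (?\<sigma> v)) = vars_trm (?\<sigma> y) \<union> (\<Union>v\<in>set (x # xs) \<union> set zs. vars_trm (?\<sigma> v))" by auto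
    also have "\<dots> = vars_trm (\<sigma> x) \<union> (\<Union>v\<in>set (x # xs) \<union> set zs. vars_trm (\<sigma> v))"
      using \<sigma>y \<sigma>v by simp
    also have "\<dots> = (\<Union>y\<in>set (x # xs) \<union> set zs. vars_trm (\<sigma> y))" by auto
    finally show "(\<Union>v\<in>set ?xs \<union> set zs. vars_trm (?\<sigma> v)) = set ds" using D(5) by simp
  next
    fix e assume "e \<in> set ((Var x, Var z) # (Var y, Var z) # E)"
    then show "case e of (s, t) \<Rightarrow> s \<cdot>\<^sub>t ?\<sigma> = t \<cdot>\<^sub>t ?\<sigma>" using U1 U2 wx wy by auto
  qed
  then show ?thesis unfolding unif_tile_def by blast
qed

text \<open>When the right sides are distinct variables, the left sides are already the solution and
  an identity tile computes it. The other variables \<open>zs\<close> of the right are discharged by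
  the trigger and stay free, hence they reappear among the variables of the solution. The given
  solution factors by itself.\<close>

lemma unif_tile_distinct:
  fixes S :: "('p, 'f) signature" and P :: "('p, 'f, 'v) clause set" and xs ws zs :: "'w list"
    and \<mu> :: "'w \<Rightarrow> ('f, 'u) trm"
  assumes d: "distinct xs" "distinct (ws @ zs)" "set xs \<inter> set (ws @ zs) = {}" and l: "length ss = length ws"
    and wf: "wf_terms S xs ss" and \<mu>: "map (\<lambda>t. t \<cdot>\<^sub>t \<mu>) ss = map \<mu> ws"
  shows "unif_tile S P \<mu> xs (ws @ zs) (zip ss (map Var ws))"
proof -
  let ?N = "terms_arrow :: 'w list \<Rightarrow> ('f, 'w) trm list \<Rightarrow> ('p, 'f) arrow"
  obtain \<kappa> where \<kappa>: "map \<kappa> ws = ss" using ex_assignment[of ws ss] d l by auto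
  let ?\<sigma> = "\<lambda>v. if v \<in> set ws then \<kappa> v else Var v"
  have 1: "sym_tile S P (?N xs ss) (?N ws (map Var ws)) (?N xs (map Var xs)) (?N xs ss)"
    by (rule sym_tile_id) (use d l wf in auto)
  have 2: "sym_tile S P (?N [] []) (?N zs []) (?N zs []) (?N zs (map Var zs))"
    using sym_tile_sym[OF sym_tile_id[of S zs "[]" "[]" P]] d by simp
  have "sym_tile S P (?N (xs @ []) (ss @ [])) (?N (ws @ zs) (map Var ws @ [])) (?N (xs @ zs) (map Var xs @ [])) (?N (xs @ zs) (ss @ map Var zs))"
    by (rule sym_tile_parallel_terms[OF 1 2]) (use d wf in auto)
  moreover have m: "map ?\<sigma> xs = map Var xs" "map ?\<sigma> ws = ss" "map ?\<sigma> zs = map Var zs" using d \<kappa> by auto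
  ultimately have T: "sym_tile S P (?N xs ss) (?N (ws @ zs) (map Var ws)) (?N (xs @ zs) (map ?\<sigma> xs)) (?N (xs @ zs) (map ?\<sigma> (ws @ zs)))"
    by (simp only: map_append append_Nil2)
  have \<kappa>mem: "\<kappa> v \<in> set ss" if "v \<in> set ws" for v using that \<kappa> by auto
  have \<kappa>s: "s = \<kappa> v" if "(s, Var v) \<in> set (zip ss (map Var ws))" for s v
    using that unfolding \<kappa>[symmetric] by (auto simp: set_zip)
  have ss: "s \<cdot>\<^sub>t ?\<sigma> = s" if "s \<in> set ss" for s
  proof -
    have "s \<cdot>\<^sub>t ?\<sigma> = s \<cdot>\<^sub>t Var" by (rule subst_trm_cong) (use that wf d in \<open>auto simp: wf_terms_def\<close>)
    then show ?thesis by simp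
  qed
  have "unif_data S P \<mu> xs (ws @ zs) (zip ss (map Var ws)) (xs @ zs) ?\<sigma> \<mu>"
    unfolding unif_data_def
  proof (intro conjI ballI)
    show "sym_tile S P (?N xs (map fst (zip ss (map Var ws)))) (?N (ws @ zs) (map snd (zip ss (map Var ws))))
      (?N (xs @ zs) (map ?\<sigma> xs)) (?N (xs @ zs) (map ?\<sigma> (ws @ zs)))" using T l by simp
    show "distinct (xs @ zs)" using d by auto
    fix v assume v: "v \<in> set xs \<union> set (ws @ zs)"
    show "wf_trm S (?\<sigma> v)" using wf \<kappa>mem[of v] by (simp add: wf_terms_def)
    have "\<kappa> v \<cdot>\<^sub>t \<mu> = \<mu> v" if "v \<in> set ws" using that \<mu> unfolding \<kappa>[symmetric] by simp
    then show "\<mu> v = ?\<sigma> v \<cdot>\<^sub>t \<mu>" by simp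
  next
    show "(\<Union>x\<in>set xs \<union> set (ws @ zs). vars_trm (?\<sigma> x)) = set (xs @ zs)" (is "?L = _")
    proof
      show "?L \<subseteq> set (xs @ zs)"
      proof
        fix a assume "a \<in> ?L"
        then obtain v where v: "v \<in> set xs \<union> set (ws @ zs)" "a \<in> vars_trm (?\<sigma> v)" by blast
        show "a \<in> set (xs @ zs)"
        proof (cases "v \<in> set ws")
          case True
          then show ?thesis using v(2) \<kappa>mem[of v] wf by (auto simp: wf_terms_def)
        qed (use v in auto)
      qed
      show "set (xs @ zs) \<subseteq> ?L"
      proof
        fix a assume a: "a \<in> set (xs @ zs)"
        then have "a \<in> vars_trm (?\<sigma> a)" using d by auto
        then show "a \<in> ?L" using a by (intro UN_I[of a]) auto
      qed
    qed
  next
    fix e :: "('f, 'w) trm \<times> ('f, 'w) trm" assume e: "e \<in> set (zip ss (map Var ws))"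
    then obtain i where "i < length ss" "e = (ss ! i, Var (ws ! i))" using l by (auto simp: set_zip)
    then obtain s v where sv: "e = (s, Var v)" "s \<in> set ss" "v \<in> set ws" using l by auto
    then have "s = \<kappa> v" using \<kappa>s e by blast
    then show "case e of (s, t) \<Rightarrow> s \<cdot>\<^sub>t ?\<sigma> = t \<cdot>\<^sub>t ?\<sigma>" using sv ss[of s] by simp
  qed
  then show ?thesis unfolding unif_tile_def by blast
qed

definition unif_problem where
  "unif_problem S \<mu> xs zs E \<longleftrightarrow> distinct xs \<and> distinct zs \<and> set xs \<inter> set zs = {} \<and>
     wf_terms S xs (map fst E) \<and> wf_terms S zs (map snd E) \<and> (\<forall>(s, t)\<in>set E. s \<cdot>\<^sub>t \<mu> = t \<cdot>\<^sub>t \<mu>)"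

text \<open>The termination measure: replacing \<open>x\<close> by \<open>f(ns)\<close> removes the
  outermost symbol of \<open>\<mu> x\<close> from the solution, even though the equations may
  grow.\<close>

definition solution_size :: "('w \<Rightarrow> ('f, 'u) trm) \<Rightarrow> 'w list \<Rightarrow> nat" where
  "solution_size \<mu> xs = sum_list (map (\<lambda>x. fun_count (\<mu> x)) xs)"

lemma solution_size_simps [simp]:
  "solution_size \<mu> [] = 0"
  "solution_size \<mu> (x # xs) = fun_count (\<mu> x) + solution_size \<mu> xs"
  "solution_size \<mu> (xs @ ys) = solution_size \<mu> xs + solution_size \<mu> ys"
  by (simp_all add: solution_size_def)

lemma sum_list_mset_cong: "mset xs = mset ys \<Longrightarrow> sum_list (map g xs) = (sum_list (map g ys) :: nat)"
  by (metis mset_map sum_mset_sum_list)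

lemma solution_size_mset: "mset xs = mset ys \<Longrightarrow> solution_size \<mu> xs = solution_size \<mu> ys"
  unfolding solution_size_def by (rule sum_list_mset_cong)

lemma solution_size_cong: "(\<And>x. x \<in> set xs \<Longrightarrow> \<mu> x = \<nu> x) \<Longrightarrow> solution_size \<mu> xs = solution_size \<nu> xs"
  unfolding solution_size_def by (metis (no_types, lifting) map_cong)

lemma unif_problem_flip: "unif_problem S \<mu> zs xs (map prod.swap E) \<longleftrightarrow> unif_problem S \<mu> xs zs E"
  unfolding unif_problem_def by (auto simp: comp_def eq_commute)

lemma wf_terms_mset: "mset ts = mset us \<Longrightarrow> wf_terms S xs ts \<longleftrightarrow> wf_terms S xs us"
  unfolding wf_terms_def by (metis mset_eq_setD)

lemma wf_terms_mapI:
  "(\<And>t. t \<in> set ts \<Longrightarrow> wf_trm S (g t) \<and> vars_trm (g t) \<subseteq> set xs) \<Longrightarrow> wf_terms S xs (map g ts)"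
  by (auto simp: wf_terms_def)

lemma wf_terms_perm: "mset xs = mset ys \<Longrightarrow> wf_terms S xs ts \<longleftrightarrow> wf_terms S ys ts"
  unfolding wf_terms_def by (metis mset_eq_setD)

lemma unif_problem_perm_pairs:
  assumes "mset E' = mset E"
  shows "unif_problem S \<mu> xs zs E' \<longleftrightarrow> unif_problem S \<mu> xs zs E"
proof -
  have "mset (map fst E') = mset (map fst E)" "mset (map snd E') = mset (map snd E)" using assms by simp_all
  then show ?thesis
    using mset_eq_setD[OF assms] wf_terms_mset[of "map fst E'" "map fst E"] wf_terms_mset[of "map snd E'" "map snd E"]
    unfolding unif_problem_def by metis
qed

text \<open>Chooses the fresh \<open>ns\<close> and extends the solution by the values of
  \<open>us\<close>, which are the arguments of \<open>\<mu> x\<close>. The induction hypothesis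
  enters as an assumption, so that the step serves both orientations of the equation.\<close>

lemma unif_tile_var_fun_step:
  fixes S :: "('p, 'f) signature" and xs zs :: "'w :: infinite list" and \<mu> :: "'w \<Rightarrow> ('f, 'u) trm"
  assumes IH: "\<And>(\<mu>' :: 'w \<Rightarrow> ('f, 'u) trm) xs' zs' E'. unif_problem S \<mu>' xs' zs' E' \<Longrightarrow>
      solution_size \<mu>' (xs' @ zs') < solution_size \<mu> (xs @ zs) \<Longrightarrow> unif_tile S P \<mu>' xs' zs' E'"
    and p: "unif_problem S \<mu> xs zs ((Var x, Fun f us) # E)"
  shows "unif_tile S P \<mu> xs zs ((Var x, Fun f us) # E)"
proof -
  define ys where "ys = remove1 x xs"
  have x: "x \<in> set xs" using p by (simp add: unif_problem_def)
  then have m: "mset (x # ys) = mset xs" by (simp add: ys_def)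
  then have d: "distinct (x # ys)" and s: "set (x # ys) = set xs"
    using p by (metis mset_eq_imp_distinct_iff unif_problem_def, metis mset_eq_setD)
  obtain ns where ns: "distinct ns" "length ns = farity S f" "set ns \<inter> (set xs \<union> set zs) = {}"
    using ex_fresh_list[of "set xs \<union> set zs" "farity S f"] by auto
  have us: "length us = farity S f" using p by (simp add: unif_problem_def)
  obtain \<mu>0 where \<mu>0: "map \<mu>0 ns = map (\<lambda>t. t \<cdot>\<^sub>t \<mu>) us" using ex_assignment[of ns "map (\<lambda>t. t \<cdot>\<^sub>t \<mu>) us"] ns us by auto
  define \<mu>' where "\<mu>' v = (if v \<in> set ns then \<mu>0 v else \<mu> v)" for v
  have \<mu>'ns: "map \<mu>' ns = map (\<lambda>t. t \<cdot>\<^sub>t \<mu>) us" unfolding \<mu>0[symmetric] \<mu>'_def by simp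
  have \<mu>'v: "\<mu>' v = \<mu> v" if "v \<in> set xs \<union> set zs" for v using that ns by (auto simp: \<mu>'_def)
  have \<mu>x: "\<mu> x = Fun f (map \<mu>' ns)" using p \<mu>'ns by (simp add: unif_problem_def)
  let ?w = "Var(x := Fun f (map Var ns))"
  let ?E' = "zip (map Var ns) us @ map (\<lambda>(s, t). (s \<cdot>\<^sub>t ?w, t)) E"
  have e: "map fst ?E' = map Var ns @ map (\<lambda>t. t \<cdot>\<^sub>t ?w) (map fst E)" "map snd ?E' = us @ map snd E"
    using ns us by (simp_all add: comp_def case_prod_beta)
  have wfE: "wf_terms S (x # ys) (map fst E)" "wf_terms S zs (us @ map snd E)"
    using p s wf_terms_perm[OF m] by (auto simp: unif_problem_def wf_terms_def)
  have absorb: "?w v \<cdot>\<^sub>t \<mu>' = \<mu> v" if "v \<in> set (x # ys) \<union> set zs" for v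
    using that \<mu>x \<mu>'v s by (auto simp: fun_upd_def)
  have zs\<mu>: "t \<cdot>\<^sub>t \<mu>' = t \<cdot>\<^sub>t \<mu>" if "vars_trm t \<subseteq> set zs" for t
    by (rule subst_trm_cong) (use that \<mu>'v in auto)
  have "unif_problem S \<mu>' (ns @ ys) zs ?E'"
    unfolding unif_problem_def e
  proof (intro conjI ballI)
    show "distinct (ns @ ys)" "distinct zs" "set (ns @ ys) \<inter> set zs = {}"
      using p d ns s by (auto simp: unif_problem_def)
    have "wf_trm S (t \<cdot>\<^sub>t ?w) \<and> vars_trm (t \<cdot>\<^sub>t ?w) \<subseteq> set (ns @ ys)" if "t \<in> set (map fst E)" for t
    proof
      have t: "wf_trm S t" "vars_trm t \<subseteq> set (x # ys)" using wfE(1) that by (auto simp: wf_terms_def)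
      show "wf_trm S (t \<cdot>\<^sub>t ?w)" by (rule wf_subst_trm) (use t ns in auto)
      show "vars_trm (t \<cdot>\<^sub>t ?w) \<subseteq> set (ns @ ys)" using t(2) by (auto simp: vars_subst_trm split: if_splits)
    qed
    then show "wf_terms S (ns @ ys) (map Var ns @ map (\<lambda>t. t \<cdot>\<^sub>t ?w) (map fst E))"
      by (auto simp: wf_terms_def)
    show "wf_terms S zs (us @ map snd E)" by (rule wfE)
    fix e assume "e \<in> set ?E'"
    then consider i where "i < farity S f" "e = (Var (ns ! i), us ! i)" | a b where "(a, b) \<in> set E" "e = (a \<cdot>\<^sub>t ?w, b)"
      using ns us by (auto simp: set_zip)
    then show "case e of (s, t) \<Rightarrow> s \<cdot>\<^sub>t \<mu>' = t \<cdot>\<^sub>t \<mu>'"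
    proof cases
      case 1
      have "\<mu>' (ns ! i) = us ! i \<cdot>\<^sub>t \<mu>" using arg_cong[OF \<mu>'ns, of "\<lambda>l. l ! i"] 1 ns us by simp
      moreover have "us ! i \<cdot>\<^sub>t \<mu>' = us ! i \<cdot>\<^sub>t \<mu>" using wfE(2) 1 us by (intro zs\<mu>) (simp add: wf_terms_def)
      ultimately show ?thesis using 1 by simp
    next
      case 2
      have "a \<in> set (map fst E)" "b \<in> set (map snd E)" using 2 by force+
      then have a: "vars_trm a \<subseteq> set (x # ys)" and b: "vars_trm b \<subseteq> set zs" using wfE by (auto simp: wf_terms_def)
      have "a \<cdot>\<^sub>t ?w \<cdot>\<^sub>t \<mu>' = a \<cdot>\<^sub>t \<mu>"
        unfolding subst_trm_comp by (rule subst_trm_cong, rule absorb) (use a in auto)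
      then show ?thesis using 2 zs\<mu>[OF b] p by (auto simp: unif_problem_def)
    qed
  qed
  moreover have "solution_size \<mu>' ((ns @ ys) @ zs) < solution_size \<mu> (xs @ zs)"
  proof -
    have "solution_size \<mu> xs = solution_size \<mu> (x # ys)" by (rule solution_size_mset[OF m[symmetric]])
    moreover have "solution_size \<mu>' ys = solution_size \<mu> ys" "solution_size \<mu>' zs = solution_size \<mu> zs"
      by (rule solution_size_cong, use \<mu>'v s in auto)+
    moreover have "fun_count (\<mu> x) = Suc (solution_size \<mu>' ns)" using \<mu>x by (simp add: solution_size_def comp_def)
    ultimately show ?thesis by simp
  qed
  ultimately have u: "unif_tile S P \<mu>' (ns @ ys) zs ?E'" by (rule IH)
  have "unif_tile S P \<mu> (x # ys) zs ((Var x, Fun f us) # E)"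
    by (rule unif_tile_var_fun[OF u]) (use d ns s us wfE p \<mu>'v \<mu>x in \<open>auto simp: unif_problem_def\<close>)
  from unif_tile_perm_vars[OF this d m[symmetric]] show ?thesis
    using wfE(1) by simp
qed

text \<open>Equations that contain a function symbol are treated first. Once all equations are
  between variables, either the right sides are distinct, which is the base case, or two equations
  share their right side and can be merged. The measure compares solution size, then symbols in the
  equations, then the number of equations.\<close>

theorem unif_tile_exists:
  fixes S :: "('p, 'f) signature" and P :: "('p, 'f, 'v) clause set"
    and xs zs :: "'w :: infinite list" and \<mu> :: "'w \<Rightarrow> ('f, 'u) trm"
  assumes "unif_problem S \<mu> xs zs E"
  shows "unif_tile S P \<mu> xs zs E"
proof -
  let ?R = "measures [\<lambda>(\<mu> :: 'w \<Rightarrow> ('f, 'u) trm, xs, zs, E). solution_size \<mu> (xs @ zs),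
    \<lambda>(\<mu>, xs, zs, E). sum_list (map (\<lambda>(s :: ('f, 'w) trm, t :: ('f, 'w) trm). fun_count s + fun_count t) E),
    \<lambda>(\<mu>, xs, zs, E). length E]"
  let ?Q = "\<lambda>(\<mu> :: 'w \<Rightarrow> ('f, 'u) trm, xs, zs, E). unif_problem S \<mu> xs zs E \<longrightarrow> unif_tile S P \<mu> xs zs E"
  have "?Q (\<mu>, xs, zs, E)"
  proof (induction "(\<mu>, xs, zs, E)" arbitrary: \<mu> xs zs E rule: wf_induct_rule[OF wf_measures[of "[\<lambda>(\<mu> :: 'w \<Rightarrow> ('f, 'u) trm, xs, zs, E). solution_size \<mu> (xs @ zs),
    \<lambda>(\<mu>, xs, zs, E). sum_list (map (\<lambda>(s :: ('f, 'w) trm, t :: ('f, 'w) trm). fun_count s + fun_count t) E),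
    \<lambda>(\<mu>, xs, zs, E). length E]"]])
    case (1 \<mu> xs zs E)
    have IH: "unif_tile S P \<mu>' xs' zs' E'" if "((\<mu>', xs', zs', E'), (\<mu>, xs, zs, E)) \<in> ?R" "unif_problem S \<mu>' xs' zs' E'" for \<mu>' :: "'w \<Rightarrow> ('f, 'u) trm" and xs' zs' E'
      using 1[OF that(1)] that(2) by simp
    have R3: "((\<mu>', xs', zs', E'), (\<mu>, xs, zs, E)) \<in> ?R"
      if "solution_size \<mu>' (xs' @ zs') \<le> solution_size \<mu> (xs @ zs)"
        "sum_list (map (\<lambda>(s, t). fun_count s + fun_count t) E') = sum_list (map (\<lambda>(s, t). fun_count s + fun_count t) E)"
        "length E' < length E" for \<mu>' :: "'w \<Rightarrow> ('f, 'u) trm" and xs' zs' E'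
      using that by (auto simp: le_less)
    show ?case unfolding prod.case
    proof
      assume p: "unif_problem S \<mu> xs zs E"
      then have dx: "distinct xs" and dz: "distinct zs" and dxz: "set xs \<inter> set zs = {}"
        and wx: "wf_terms S xs (map fst E)" and wz: "wf_terms S zs (map snd E)"
        and sol: "\<And>s t. (s, t) \<in> set E \<Longrightarrow> s \<cdot>\<^sub>t \<mu> = t \<cdot>\<^sub>t \<mu>"
        by (auto simp: unif_problem_def)
      have reorder: "unif_tile S P \<mu> xs zs E" if "mset E' = mset E" "unif_tile S P \<mu> xs zs E'" for E'
        by (rule unif_tile_perm_pairs[OF that(2) dx that(1)[symmetric]])
          (use wx that(1) wf_terms_mset[of "map fst E'" "map fst E" S xs] in simp)
      show "unif_tile S P \<mu> xs zs E"
      proof (cases "\<exists>s t. (s, t) \<in> set E \<and> \<not> (\<exists>x z. s = Var x \<and> t = Var z)")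
        case True
        then obtain s t where st: "(s, t) \<in> set E" "\<not> (\<exists>x z. s = Var x \<and> t = Var z)" by blast
        then obtain E0 where m: "mset ((s, t) # E0) = mset E" by (metis insert_DiffM mset.simps(2) ex_mset set_mset_mset)
        have p': "unif_problem S \<mu> xs zs ((s, t) # E0)" using p unif_problem_perm_pairs[OF m] by blast
        have small: "unif_tile S P \<mu>' xs' zs' E'" if "unif_problem S \<mu>' xs' zs' E'" "solution_size \<mu>' (xs' @ zs') < solution_size \<mu> (xs @ zs)"
          for \<mu>' :: "'w \<Rightarrow> ('f, 'u) trm" and xs' zs' E'
          by (rule IH) (use that in auto)
        have "unif_tile S P \<mu> xs zs ((s, t) # E0)"
        proof (cases s)
          case s: (Var x)
          then obtain f us where t: "t = Fun f us" using st(2) by (cases t) auto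
          show ?thesis unfolding s t
            by (rule unif_tile_var_fun_step) (use small p' s t in auto)
        next
          case s: (Fun f ss)
          show ?thesis
          proof (cases t)
            case t: (Var z)
            have "unif_tile S P \<mu> zs xs ((Var z, Fun f ss) # map prod.swap E0)"
            proof (rule unif_tile_var_fun_step)
              show "unif_problem S \<mu> zs xs ((Var z, Fun f ss) # map prod.swap E0)"
                using p' unif_problem_flip[of S \<mu> zs xs "(s, t) # E0"] s t by simp
              show "unif_tile S P \<mu>' xs' zs' E'" if "unif_problem S \<mu>' xs' zs' E'"
                "solution_size \<mu>' (xs' @ zs') < solution_size \<mu> (zs @ xs)" for \<mu>' :: "'w \<Rightarrow> ('f, 'u) trm" and xs' zs' E'
                by (rule small[OF that(1)]) (use that(2) in simp)
            qed
            then show ?thesis unfolding s t by (intro unif_tile_flip[of S P \<mu> zs xs]) simp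
          next
            case t: (Fun g us)
            have "Fun f ss \<cdot>\<^sub>t \<mu> = Fun g us \<cdot>\<^sub>t \<mu>" using p' s t by (simp add: unif_problem_def)
            then have fg: "g = f" and eq: "map (\<lambda>t. t \<cdot>\<^sub>t \<mu>) ss = map (\<lambda>t. t \<cdot>\<^sub>t \<mu>) us" by simp_all
            have len: "length ss = farity S f" "length us = farity S f" using p' s t fg by (simp_all add: unif_problem_def)
            let ?E' = "zip ss us @ E0"
            have "unif_problem S \<mu> xs zs ?E'"
              unfolding unif_problem_def
            proof (intro conjI)
              show "wf_terms S xs (map fst ?E')" "wf_terms S zs (map snd ?E')"
                using p' s t len by (auto simp: unif_problem_def wf_terms_def)
              have "\<forall>i<farity S f. ss ! i \<cdot>\<^sub>t \<mu> = us ! i \<cdot>\<^sub>t \<mu>" using eq len by (metis length_map nth_map)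
              then show "\<forall>(s, t)\<in>set ?E'. s \<cdot>\<^sub>t \<mu> = t \<cdot>\<^sub>t \<mu>"
                using p' len by (auto simp: unif_problem_def set_zip)
            qed (use dx dz dxz in auto)
            moreover have "sum_list (map (\<lambda>(s, t). fun_count s + fun_count t) ?E') < sum_list (map (\<lambda>(s, t). fun_count s + fun_count t) E)"
            proof -
              have "sum_list (map (\<lambda>(s, t). fun_count s + fun_count t) E) = sum_list (map (\<lambda>(s, t). fun_count s + fun_count t) ((s, t) # E0))"
                by (rule sum_list_mset_cong) (rule m[symmetric])
              moreover have "length ss = length us" using len by simp
              then have "sum_list (map (\<lambda>(s, t). fun_count s + fun_count t) (zip ss us)) = sum_list (map fun_count ss) + sum_list (map fun_count us)"
                by (induction ss us rule: list_induct2) auto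
              ultimately show ?thesis using s t by simp
            qed
            ultimately have "unif_tile S P \<mu> xs zs ?E'" by (intro IH) auto
            then show ?thesis unfolding s t fg
              by (rule unif_tile_fun_fun) (use dx len p' s in \<open>auto simp: unif_problem_def\<close>)
          qed
        qed
        then show ?thesis by (rule reorder[OF m])
      next
        case False
        then have vv: "\<exists>x z. e = (Var x, Var z)" if "e \<in> set E" for e using that by (cases e) auto
        \<comment> \<open>The variable on the right of an equation; it is meaningful on
          \<open>E\<close>, where only equations between variables are left.\<close>
        define zf where "zf e = (SOME z. snd e = (Var z :: ('f, 'w) trm))" for e :: "('f, 'w) trm \<times> ('f, 'w) trm"
        have zf: "snd e = Var (zf e)" if "e \<in> set E" for e
          using vv[OF that] unfolding zf_def by auto
        let ?ws = "map zf E"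
        have sndE: "map snd E = map Var ?ws" using zf by simp
        show ?thesis
        proof (cases "distinct ?ws")
          case True
          have sub: "set ?ws \<subseteq> set zs" using wz unfolding sndE by (simp del: map_map)
          let ?rs = "filter (\<lambda>z. z \<notin> set ?ws) zs"
          have m: "mset (?ws @ ?rs) = mset zs"
            using True dz sub by (subst set_eq_iff_mset_eq_distinct[symmetric]) auto
          have E: "E = zip (map fst E) (map Var ?ws)" unfolding sndE[symmetric] by (simp add: zip_map_fst_snd)
          have "unif_tile S P \<mu> xs (?ws @ ?rs) (zip (map fst E) (map Var ?ws))"
          proof (rule unif_tile_distinct)
            show "map (\<lambda>t. t \<cdot>\<^sub>t \<mu>) (map fst E) = map \<mu> ?ws"
            proof (simp, intro ballI)
              fix e assume e: "e \<in> set E"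
              show "fst e \<cdot>\<^sub>t \<mu> = \<mu> (zf e)" using sol[of "fst e" "Var (zf e)"] e zf[OF e] by (metis prod.collapse subst_trm.simps(1))
            qed
          qed (use True dx dz dxz sub wx in auto)
          \<comment> \<open>Reordering of variables is available for the left list only, hence the
            detour through the flipped problem.\<close>
          then have "unif_tile S P \<mu> xs (?ws @ ?rs) (map prod.swap (map prod.swap E))"
            using E by (simp add: comp_def del: map_map) (simp add: comp_def)
          then have "unif_tile S P \<mu> (?ws @ ?rs) xs (map prod.swap E)"
            by (rule unif_tile_flip)
          from unif_tile_perm_vars[OF this _ m[symmetric]]
          have "unif_tile S P \<mu> zs xs (map prod.swap E)"
            using True dz wz sub by (auto simp: comp_def wf_terms_def)
          then show ?thesis by (rule unif_tile_flip)
        next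
          case False
          then obtain as b bs cs where "?ws = as @ [b] @ bs @ [b] @ cs" using not_distinct_decomp by blast
          then obtain E1 e1 E2 e2 E3 where Ed: "E = E1 @ [e1] @ E2 @ [e2] @ E3" and b: "zf e1 = b" "zf e2 = b"
          proof -
            assume ws: "?ws = as @ [b] @ bs @ [b] @ cs"
              and that: "\<And>E1 e1 E2 e2 E3. E = E1 @ [e1] @ E2 @ [e2] @ E3 \<Longrightarrow> zf e1 = b \<Longrightarrow> zf e2 = b \<Longrightarrow> thesis"
            from ws obtain E1 F where F: "E = E1 @ F" "map zf F = b # bs @ b # cs" by (auto simp: map_eq_append_conv)
            then obtain e1 F' where F': "F = e1 # F'" "zf e1 = b" "map zf F' = bs @ b # cs" by (auto simp: map_eq_Cons_conv)
            then obtain E2 H where H: "F' = E2 @ H" "map zf H = b # cs" by (auto simp: map_eq_append_conv)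
            then obtain e2 E3 where "H = e2 # E3" "zf e2 = b" by (auto simp: map_eq_Cons_conv)
            then show thesis using F F' H that[of E1 e1 E2 e2 E3] by simp
          qed
          then obtain x y where e: "e1 = (Var x, Var b)" "e2 = (Var y, Var b)"
            using vv[of e1] vv[of e2] zf[of e1] zf[of e2] by fastforce
          let ?E0 = "E1 @ E2 @ E3"
          have m: "mset (e1 # e2 # ?E0) = mset E" using Ed by simp
          have p': "unif_problem S \<mu> xs zs (e1 # e2 # ?E0)" using p unif_problem_perm_pairs[OF m] by blast
          have fc: "sum_list (map (\<lambda>(s, t). fun_count s + fun_count t) F) = 0"
            if "\<And>e. e \<in> set F \<Longrightarrow> \<exists>x z. e = (Var x, Var z)" for F :: "(('f, 'w) trm \<times> ('f, 'w) trm) list"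
            using that by (induction F) fastforce+
          have fcE: "sum_list (map (\<lambda>(s, t). fun_count s + fun_count t) E) = 0" using vv by (rule fc)
          have xy: "\<mu> x = \<mu> y" using p' e by (simp add: unif_problem_def)
          have "unif_tile S P \<mu> xs zs (e1 # e2 # ?E0)"
          proof (cases "x = y")
            case True
            have pr: "unif_problem S \<mu> xs zs (e1 # ?E0)" using p' by (auto simp: unif_problem_def)
            have "sum_list (map (\<lambda>(s, t). fun_count s + fun_count t) (e1 # ?E0)) = 0"
              by (rule fc) (use vv Ed in auto)
            then have "unif_tile S P \<mu> xs zs (e1 # ?E0)" by (intro IH[OF _ pr]) (use fcE Ed in auto)
            then show ?thesis unfolding e True
              by (rule unif_tile_merge_same) (use dx p' e True in \<open>auto simp: unif_problem_def\<close>)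
          next
            case xy': False
            have xin: "x \<in> set xs" "y \<in> set xs" using p' e by (auto simp: unif_problem_def)
            define ys where "ys = remove1 y (remove1 x xs)"
            \<comment> \<open>Since \<open>x\<close> and \<open>y\<close> differ, removing
              \<open>x\<close> leaves \<open>y\<close> in the list, and both can be brought to its
              front.\<close>
            have "y \<in> set (remove1 x xs)" using xin xy' by (simp add: in_set_remove1)
            then have "mset (y # ys) = mset (remove1 x xs)" 
              unfolding ys_def mset.simps mset_remove1[of y] by (intro insert_DiffM) (simp only: set_mset_mset)
            then have mx: "mset (x # y # ys) = mset xs" using xin by simp
            then have d: "distinct (x # y # ys)" and sx: "set (x # y # ys) = set xs"
              using dx by (metis mset_eq_imp_distinct_iff, metis mset_eq_setD)
            have wfE: "wf_terms S (x # y # ys) (map fst ?E0)" "wf_terms S zs (Var b # map snd ?E0)"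
              using p' e sx by (auto simp: unif_problem_def wf_terms_def)
            let ?w = "Var(y := Var x)"
            let ?F = "map (\<lambda>(s, t). (s \<cdot>\<^sub>t ?w, t)) ?E0"
            have Fvv: "\<exists>x z. e = (Var x, Var z)" if "e \<in> set ((Var x, Var b) # ?F)" for e
            proof -
              have "\<exists>x z. (case e of (s, t) \<Rightarrow> (s \<cdot>\<^sub>t ?w, t)) = (Var x, Var z)" if "e \<in> set ?E0" for e
                using vv[of e] that Ed by auto
              then show ?thesis using that by fastforce
            qed
            have pr: "unif_problem S \<mu> (x # ys) zs ((Var x, Var b) # ?F)"
              unfolding unif_problem_def
            proof (intro conjI)
              have "wf_trm S (t \<cdot>\<^sub>t ?w) \<and> vars_trm (t \<cdot>\<^sub>t ?w) \<subseteq> set (x # ys)" if "t \<in> set (map fst ?E0)" for t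
              proof
                have t: "wf_trm S t" "vars_trm t \<subseteq> set (x # y # ys)" using wfE(1) that by (simp_all add: wf_terms_def)
                show "wf_trm S (t \<cdot>\<^sub>t ?w)" by (rule wf_subst_trm) (use t in auto)
                show "vars_trm (t \<cdot>\<^sub>t ?w) \<subseteq> set (x # ys)" using t(2) by (auto simp: vars_subst_trm split: if_splits)
              qed
              then have "wf_terms S (x # ys) (map (\<lambda>t. t \<cdot>\<^sub>t ?w) (map fst ?E0))" by (rule wf_terms_mapI)
              moreover have "map (\<lambda>t. t \<cdot>\<^sub>t ?w) (map fst ?E0) = map fst ?F" by (simp add: comp_def case_prod_beta)
              ultimately have "wf_terms S (x # ys) (map fst ?F)" by (rule subst[rotated])
              then show "wf_terms S (x # ys) (map fst ((Var x, Var b) # ?F))"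
                unfolding list.map wf_terms_simps by (intro conjI) simp_all
              have "map snd ((Var x, Var b) # ?F) = Var b # map snd ?E0" by (simp add: comp_def case_prod_beta)
              then show "wf_terms S zs (map snd ((Var x, Var b) # ?F))"
                using wfE(2) by (simp only:)
              have "s \<cdot>\<^sub>t ?w \<cdot>\<^sub>t \<mu> = s \<cdot>\<^sub>t \<mu>" for s
                unfolding subst_trm_comp by (rule subst_trm_cong) (use xy in auto)
              moreover have "s \<cdot>\<^sub>t \<mu> = t \<cdot>\<^sub>t \<mu>" if "(s, t) \<in> set E1 \<union> (set E2 \<union> set E3)" for s t
                using sol[of s t] that Ed by auto
              moreover have "\<mu> x = \<mu> b" using p' e by (simp add: unif_problem_def)
              ultimately show "\<forall>(s, t)\<in>set ((Var x, Var b) # ?F). s \<cdot>\<^sub>t \<mu> = t \<cdot>\<^sub>t \<mu>"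
                by auto
            qed (use d dz dxz sx in auto)
            have "solution_size \<mu> xs = solution_size \<mu> (x # y # ys)" by (rule solution_size_mset[OF mx[symmetric]])
            \<comment> \<open>Dropping \<open>y\<close> does not enlarge the solution, neither
              system contains a function symbol, and one equation has disappeared.\<close>
            then have "((\<mu>, x # ys, zs, (Var x, Var b) # ?F), (\<mu>, xs, zs, E)) \<in> ?R"
              by (intro R3) (use Ed in simp, simp only: fcE fc[of "(Var x, Var b) # ?F", OF Fvv], use Ed in simp)
            then have "unif_tile S P \<mu> (x # ys) zs ((Var x, Var b) # ?F)" using pr by (rule IH)
            then have "unif_tile S P \<mu> (x # y # ys) zs ((Var x, Var b) # (Var y, Var b) # ?E0)"
              by (rule unif_tile_merge) (use d wfE dxz sx xy in auto)
            from unif_tile_perm_vars[OF this d mx[symmetric]] show ?thesis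
              unfolding e using wfE(1) by simp
          qed
          then show ?thesis by (rule reorder[OF m])
        qed
      qed
    qed
  qed
  then show ?thesis using assms by simp
qed

subsection \<open>Resolution steps as tiles\<close>

lemma pos_map_rename:
  assumes "inj_on \<rho> (set xs)" "x \<in> set xs"
  shows "pos (map \<rho> xs) (\<rho> x) = pos xs x"
proof -
  have "takeWhile (\<lambda>y. y \<noteq> \<rho> x) (map \<rho> xs) = map \<rho> (takeWhile (\<lambda>y. y \<noteq> x) xs)"
    unfolding takeWhile_map comp_def
    using assms by (intro arg_cong[where f = "map \<rho>"] takeWhile_cong) (auto dest: inj_onD)
  then show ?thesis by (simp add: pos_def)
qed

lemma goal_arrow_rename:
  assumes "inj_on \<rho> (set xs)" "vars_goal G \<subseteq> set xs"
  shows "goal_arrow (map \<rho> xs) (subst_goal G (Var \<circ> \<rho>)) = goal_arrow xs G"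
proof -
  have "subst_goal (subst_goal G (Var \<circ> \<rho>)) (pos (map \<rho> xs)) = subst_goal G (pos xs)"
    unfolding subst_goal_comp by (rule subst_goal_cong) (use assms in \<open>auto simp: pos_map_rename\<close>)
  then show ?thesis by (simp add: goal_arrow_def)
qed

lemma vars_subst_clause: "vars_clause (subst_clause C \<sigma>) = (\<Union>x\<in>vars_clause C. vars_trm (\<sigma> x))"
  by (auto simp: vars_clause_def subst_clause_def vars_subst_atom vars_subst_goal)

lemma seq_terms_arrow_goal:
  fixes H :: "('p, 'f, nat) goal"
  shows "terms_arrow ys ts ;; Arrow o1 [PC (map Lit H)] =
   Arrow (tms (length ys)) [PC (map Lit (subst_goal H (\<lambda>i. tc ((map (\<lambda>t. TC (t \<cdot>\<^sub>t pos ys)) ts :: ('p, 'f) component list) ! i))))]"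
  by (simp add: seq_def terms_arrow_def subst_goal_def comp_def)

lemma vars_goal_pos: "vars_goal G \<subseteq> set xs \<Longrightarrow> i \<in> vars_goal (subst_goal G (pos xs)) \<Longrightarrow> i < length xs"
  by (fastforce simp: vars_subst_goal dest: vars_pos)

text \<open>Fills the hole of a goal context. The context finds its own variables at the first
  \<open>n\<close> positions and the goal for the hole at position \<open>n\<close>; the variables
  of that goal are therefore shifted by \<open>n\<close>.\<close>

lemma seq_context:
  fixes H :: "('p, 'f, nat) goal"
  assumes "vars_goal H1 \<subseteq> {..<n}" "vars_goal H2 \<subseteq> {..<n}"
  shows "(ident (tms n) \<otimes> Arrow (tms m) [PC (map Lit H)]) ;; Arrow (tms n @ [Pr]) [PC (map Lit H1 @ [PVar n] @ map Lit H2)] =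
    Arrow (tms (n + m)) [PC (map Lit (H1 @ subst_goal H (\<lambda>i. Var (n + i)) @ H2))]"
proof -
  let ?t = "map (\<lambda>i. TC (Var i)) [0..<n] @ [PC (map Lit (subst_goal H (\<lambda>i. Var (n + i))))] :: ('p, 'f) component list"
  have id: "ident (tms n) = (Arrow (tms n) (map (\<lambda>i. TC (Var i)) [0..<n]) :: ('p, 'f) arrow)"
    by (auto simp: ident_def var_comp_def)
  have par: "ident (tms n) \<otimes> Arrow (tms m) [PC (map Lit H)] = Arrow (tms (n + m)) ?t"
    unfolding id by (simp add: par_def replicate_add subst_goal_def comp_def)
  have H: "concat (map (\<lambda>l. subst_lit l ((!) ?t)) (map Lit K)) = map Lit K" if "vars_goal K \<subseteq> {..<n}" for K :: "('p, 'f, nat) goal"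
  proof -
    have "subst_atom A (tc \<circ> (!) ?t) = A" if "A \<in> set K" for A
    proof -
      have "subst_atom A (tc \<circ> (!) ?t) = subst_atom A Var"
        by (rule subst_atom_cong) (use \<open>vars_goal K \<subseteq> {..<n}\<close> that in \<open>force simp: vars_goal_def nth_append\<close>)
      then show ?thesis by simp
    qed
    then have "map (\<lambda>l. subst_lit l ((!) ?t)) (map Lit K) = map (\<lambda>A. [Lit A]) K" by (simp add: comp_def)
    then show ?thesis by (simp add: comp_def)
  qed
  show ?thesis unfolding par seq_def
    using H[OF assms(1)] H[OF assms(2)] by (simp add: nth_append del: map_map concat_map_singleton)
qed

text \<open>The atoms that are not selected form a configuration with a variable of sort
  \<open>p\<close> in place of the selected one; its identity tile carries them through the step
  unchanged.\<close>

lemma goal_hole_tile: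
  fixes G1 G2 :: "('p, 'f, 'w) goal" and S :: "('p, 'f) signature"
  assumes "wf_goal S G1" "wf_goal S G2" "vars_goal G1 \<subseteq> set xs" "vars_goal G2 \<subseteq> set xs"
  defines "K \<equiv> Arrow (tms (length xs) @ [Pr]) [PC (map Lit (subst_goal G1 (pos xs)) @ [PVar (length xs)] @ map Lit (subst_goal G2 (pos xs)))]"
  shows "tile S P K (ident [Pr]) (ident (tms (length xs) @ [Pr])) K"
proof -
  let ?n = "length xs"
  have lit: "wf_lit S (tms ?n @ [Pr]) l" if l: "l \<in> set (map Lit (subst_goal G (pos xs)))" and "wf_goal S G" "vars_goal G \<subseteq> set xs"
    for G :: "('p, 'f, 'w) goal" and l
  proof -
    obtain A where A: "A \<in> set (subst_goal G (pos xs))" "l = Lit A" using l by auto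
    have "wf_goal S (subst_goal G (pos xs))" using that(2) by (rule wf_subst_goal) (simp add: pos_def)
    moreover have "i < ?n" if "i \<in> vars_atom A" for i
      using that A vars_goal_pos[of G xs i] \<open>vars_goal G \<subseteq> set xs\<close> by (auto simp: vars_goal_def)
    ultimately show ?thesis using A by (auto simp: wf_goal_def nth_append less_SucI)
  qed
  have "is_conf S K"
    unfolding is_conf_def K_def
    using lit[OF _ assms(1,3)] lit[OF _ assms(2,4)]
    by (auto simp: comp_def nth_append less_Suc_eq concat_map_empty)
  from tile.id_conf[OF this] show ?thesis by (simp add: K_def tgt_def)
qed

lemma ident_par_Pr: "ident (tms n) \<otimes> ident [Pr] = ident (tms n @ [Pr])"
  by (auto simp: ident_def par_def var_comp_def nth_append intro!: nth_equalityI)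

text \<open>Three tiles are pasted horizontally: the context of the selected atom, the clause beside
  identity wires for the goal variables, and the unification tile. The trigger of the last one must
  return the goal variables beside the arguments of the head, so copies \<open>xs'\<close> are added
  on the right with the equations \<open>xs = xs'\<close>. Its given solution is the unifier of the
  step; mutual factorization makes the computed solution a renaming of it.\<close>

lemma resolve_tile:
  fixes S :: "('p, 'f) signature" and P :: "('p, 'f, 'v :: infinite) clause set" and xs :: "'v list"
  assumes wfP: "wf_program S P" and wfG: "wf_goal S (G1 @ [A] @ G2)" and xs: "enumerates xs (vars_goal (G1 @ [A] @ G2))"
    and C: "C \<in> P" "variant_of C' C" "vars_clause C' \<inter> vars_goal (G1 @ [A] @ G2) = {}"
    and mgu: "is_mgu S \<theta> A (head C')"
    and ys: "enumerates ys ((\<Union>x\<in>vars_goal (G1 @ [A] @ G2). vars_trm (\<theta> x)) \<union> vars_goal (subst_goal (G1 @ body C' @ G2) \<theta>))"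
  shows "tile S P (goal_arrow xs (G1 @ [A] @ G2)) (ident [Pr]) (subst_arrow ys xs \<theta>) (goal_arrow ys (subst_goal (G1 @ body C' @ G2) \<theta>))"
proof -
  let ?G = "G1 @ [A] @ G2"
  have dxs: "distinct xs" and sxs: "set xs = vars_goal ?G" using xs by (auto simp: enumerates_def)
  obtain \<rho> where \<rho>: "inj_on \<rho> (vars_clause C)" and C': "C' = subst_clause C (Var \<circ> \<rho>)" using C(2) by (auto simp: variant_of_def)
  obtain cs where cs: "distinct cs" "set cs = vars_clause C" using finite_distinct_list[OF finite_vars_clause] by metis
  let ?zs = "map \<rho> cs"
  have dzs: "distinct ?zs" using cs \<rho> by (simp add: distinct_map)
  have szs: "set ?zs = vars_clause C'" using cs by (auto simp: C' vars_subst_clause)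
  have disj: "set xs \<inter> set ?zs = {}" using C(3) sxs szs by auto
  have inj: "inj_on \<rho> (set cs)" using \<rho> cs by simp
  have wfC: "wf_atom S (head C)" "wf_goal S (body C)" using wfP C(1) by (auto simp: wf_program_def)
  have wfH: "wf_atom S (head C')" unfolding C' subst_clause_def by (simp, rule wf_subst_atom) (use wfC in simp_all)
  have wfB: "wf_goal S (body C')" unfolding C' subst_clause_def by (simp, rule wf_subst_goal) (use wfC in simp_all)
  have hd: "head C' = subst_atom (head C) (Var \<circ> \<rho>)" "body C' = subst_goal (body C) (Var \<circ> \<rho>)"
    by (simp_all add: C' subst_clause_def)
  have \<theta>: "is_subst S \<theta>" "subst_atom A \<theta> = subst_atom (head C') \<theta>" using mgu by (auto simp: is_mgu_def)
  then have predA: "pred A = pred (head C')" by (metis pred_subst_atom)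
  have wfA: "wf_atom S A" using wfG by simp
  have lenA: "length (args A) = length (args (head C'))" using wfA wfH predA by (simp add: wf_atom_def)
  have argsA: "wf_terms S xs (args A)" using wfA sxs by (auto simp: wf_terms_def wf_atom_def vars_atom_def)
  have argsH: "wf_terms S ?zs (args (head C'))"
    unfolding wf_terms_def szs using wfH by (auto simp: wf_atom_def vars_atom_def vars_clause_def)
  have clause: "tile S P (pred_arrow S (pred (head C'))) (ident [Pr]) (terms_arrow ?zs (args (head C'))) (goal_arrow ?zs (body C'))"
  proof -
    have "terms_arrow ?zs (args (head C')) = (terms_arrow cs (args (head C)) :: ('p, 'f) arrow)"
      unfolding hd args_subst_atom using cs(2)
      by (intro terms_arrow_rename[OF inj]) (auto simp: vars_clause_def vars_atom_def)
    moreover have "goal_arrow ?zs (body C') = goal_arrow cs (body C)"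
      unfolding hd using cs(2) by (intro goal_arrow_rename[OF inj]) (auto simp: vars_clause_def)
    ultimately show ?thesis
      using tile.basic[OF basic_tile.clause[OF C(1)], of cs S] cs hd by (simp add: enumerates_def)
  qed
  obtain xs' where xs': "distinct xs'" "length xs' = length xs" "set xs' \<inter> (set xs \<union> set ?zs) = {}"
    using ex_fresh_list[of "set xs \<union> set ?zs" "length xs"] by auto
  obtain \<mu>0 where \<mu>0: "map \<mu>0 xs' = map \<theta> xs" using ex_assignment[of xs' "map \<theta> xs"] xs' by auto
  \<comment> \<open>The given solution is the most general unifier, with the copies
    \<open>xs'\<close> valued like \<open>xs\<close>.\<close>
  define \<mu> where "\<mu> v = (if v \<in> set xs' then \<mu>0 v else \<theta> v)" for v
  have \<mu>': "map \<mu> xs' = map \<theta> xs" unfolding \<mu>0[symmetric] by (simp add: \<mu>_def)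
  have \<mu>v: "\<mu> v = \<theta> v" if "v \<in> set xs \<union> set ?zs" for v using that xs'(3) by (auto simp: \<mu>_def)
  let ?E = "zip (map Var xs) (map Var xs') @ zip (args A) (args (head C'))"
  have fstE: "map fst ?E = map Var xs @ args A" and sndE: "map snd ?E = map Var xs' @ args (head C')"
    using xs'(2) lenA by simp_all
  have "unif_problem S \<mu> xs (xs' @ ?zs) ?E"
    unfolding unif_problem_def fstE sndE
  proof (intro conjI ballI)
    show "distinct xs" "distinct (xs' @ ?zs)" "set xs \<inter> set (xs' @ ?zs) = {}"
      using dxs dzs xs' disj by auto
    show "wf_terms S xs (map Var xs @ args A)" "wf_terms S (xs' @ ?zs) (map Var xs' @ args (head C'))"
      using argsA argsH by (auto intro: wf_terms_mono)
    fix e assume "e \<in> set ?E"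
    then consider i where "i < length xs" "e = (Var (xs ! i), Var (xs' ! i))"
      | i where "i < length (args A)" "e = (args A ! i, args (head C') ! i)"
      using xs'(2) lenA by (auto simp: set_zip)
    then show "case e of (s, t) \<Rightarrow> s \<cdot>\<^sub>t \<mu> = t \<cdot>\<^sub>t \<mu>"
    proof cases
      case 1
      have "\<mu> (xs' ! i) = \<theta> (xs ! i)" using arg_cong[OF \<mu>', of "\<lambda>l. l ! i"] 1 xs'(2) by simp
      then show ?thesis using 1 \<mu>v[of "xs ! i"] by simp
    next
      case 2
      have "args A ! i \<cdot>\<^sub>t \<theta> = args (head C') ! i \<cdot>\<^sub>t \<theta>"
        using arg_cong[OF \<theta>(2), of "\<lambda>B. args B ! i"] 2 lenA by simp
      moreover have "args A ! i \<cdot>\<^sub>t \<mu> = args A ! i \<cdot>\<^sub>t \<theta>"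
        by (rule subst_trm_cong, rule \<mu>v) (use argsA 2 in \<open>auto simp: wf_terms_def\<close>)
      moreover have "args (head C') ! i \<cdot>\<^sub>t \<mu> = args (head C') ! i \<cdot>\<^sub>t \<theta>"
        by (rule subst_trm_cong, rule \<mu>v) (use argsH 2 lenA in \<open>fastforce simp: wf_terms_def\<close>)
      ultimately show ?thesis using 2 by simp
    qed
  qed
  from unif_tile_exists[OF this, of P] obtain ds \<sigma> h where "unif_data S P \<mu> xs (xs' @ ?zs) ?E ds \<sigma> h"
    unfolding unif_tile_def by blast
  note D = unif_dataD[OF this]
  have \<sigma>': "map \<sigma> xs' = map \<sigma> xs"
  proof (rule nth_equalityI)
    fix i assume "i < length (map \<sigma> xs')"
    then have i: "i < length xs" using xs'(2) by simp
    have "Var (xs ! i) \<cdot>\<^sub>t \<sigma> = Var (xs' ! i) \<cdot>\<^sub>t \<sigma>"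
      by (rule D(6)) (use i xs'(2) in \<open>force simp: set_zip\<close>)
    then show "map \<sigma> xs' ! i = map \<sigma> xs ! i" using i xs'(2) by simp
  qed (use xs'(2) in simp)
  let ?V = "set xs \<union> set ?zs"
  \<comment> \<open>Nothing is known about \<open>\<sigma>\<close> off the variables of the problem.
    Setting it to the identity there yields a substitution of finite support, to which most
    generality of \<open>\<theta>\<close> applies.\<close>
  define \<tau> where "\<tau> v = (if v \<in> ?V then \<sigma> v else Var v)" for v
  have "finite {v. \<tau> v \<noteq> Var v}" by (rule finite_subset[of _ ?V]) (auto simp: \<tau>_def)
  then have \<tau>1: "is_subst S \<tau>" using D(8) by (auto simp: is_subst_def \<tau>_def)
  have \<tau>A: "subst_atom A \<tau> = subst_atom (head C') \<tau>"
  proof -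
    have "args A ! i \<cdot>\<^sub>t \<sigma> = args (head C') ! i \<cdot>\<^sub>t \<sigma>" if "i < length (args A)" for i
      by (rule D(6)) (use that lenA in \<open>auto simp: set_zip\<close>)
    then have "subst_atom A \<sigma> = subst_atom (head C') \<sigma>"
      using predA lenA by (auto simp: subst_atom_def intro!: nth_equalityI)
    moreover have "subst_atom A \<tau> = subst_atom A \<sigma>"
      by (rule subst_atom_cong) (use sxs in \<open>auto simp: \<tau>_def\<close>)
    moreover have "subst_atom (head C') \<tau> = subst_atom (head C') \<sigma>"
      by (rule subst_atom_cong) (use szs in \<open>auto simp: \<tau>_def vars_clause_def\<close>)
    ultimately show ?thesis by simp
  qed
  from mgu \<tau>1 \<tau>A obtain \<gamma> where "\<tau> = \<theta> \<circ>\<^sub>s \<gamma>" unfolding is_mgu_def by blast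
  then have \<tau>\<gamma>: "\<tau> v = \<theta> v \<cdot>\<^sub>t \<gamma>" for v by (simp add: subst_comp_def)
  have \<gamma>: "\<sigma> v = \<theta> v \<cdot>\<^sub>t \<gamma>" if "v \<in> ?V" for v
    using that \<tau>\<gamma>[of v] unfolding \<tau>_def by (simp only: if_True)
  have \<theta>h: "\<theta> v = \<sigma> v \<cdot>\<^sub>t h" if "v \<in> ?V" for v using D(7)[of v] \<mu>v[OF that] that by auto
  have dsV: "(\<Union>v\<in>?V. vars_trm (\<sigma> v)) = set ds"
  proof -
    have "(\<Union>v\<in>set xs'. vars_trm (\<sigma> v)) = (\<Union>t\<in>set (map \<sigma> xs'). vars_trm t)" by simp
    also have "\<dots> = (\<Union>v\<in>set xs. vars_trm (\<sigma> v))" unfolding \<sigma>' by simp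
    finally show ?thesis using D(5) by auto
  qed
  \<comment> \<open>On the variables of the solution, \<open>h\<close> followed by
    \<open>\<gamma>\<close> is the identity, and a term with a variable as an instance is itself a
    variable.\<close>
  have "\<exists>y. h d = Var y \<and> \<gamma> y = Var d" if d: "d \<in> set ds" for d
  proof -
    obtain v where v: "v \<in> ?V" "d \<in> vars_trm (\<sigma> v)" using d dsV by blast
    have "\<sigma> v \<cdot>\<^sub>t (\<lambda>d. h d \<cdot>\<^sub>t \<gamma>) = \<sigma> v \<cdot>\<^sub>t Var"
      using \<gamma>[OF v(1)] \<theta>h[OF v(1)] by (simp flip: subst_trm_comp)
    from subst_trm_eqD[OF this v(2)] show ?thesis by (cases "h d") auto
  qed
  then obtain \<eta> where \<eta>: "\<And>d. d \<in> set ds \<Longrightarrow> h d = Var (\<eta> d) \<and> \<gamma> (\<eta> d) = Var d" by metis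
  have inj\<eta>: "inj_on \<eta> (set ds)" by (rule inj_onI) (metis \<eta> trm.inject(1))
  have \<theta>\<eta>: "\<theta> v = \<sigma> v \<cdot>\<^sub>t (Var \<circ> \<eta>)" if "v \<in> ?V" for v
    unfolding \<theta>h[OF that] by (rule subst_trm_cong) (use \<eta> dsV that in auto)
  \<comment> \<open>The variables of the head get their values through the selected atom and those
    of the body occur in the new goal, so \<open>ys\<close> misses nothing that the solution
    contains.\<close>
  have sys: "set ys = (\<Union>v\<in>?V. vars_trm (\<theta> v))"
  proof -
    have "(\<Union>v\<in>vars_atom (head C'). vars_trm (\<theta> v)) = (\<Union>v\<in>vars_atom A. vars_trm (\<theta> v))"
      using arg_cong[OF \<theta>(2), of vars_atom] by (simp add: vars_subst_atom)
    then show ?thesis using ys szs sxs by (auto simp: enumerates_def vars_subst_goal vars_clause_def simp del: set_map)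
  qed
  have "(\<Union>v\<in>?V. vars_trm (\<theta> v)) = \<eta> ` set ds" using \<theta>\<eta> unfolding dsV[symmetric] by (auto simp: vars_subst_trm)
  \<comment> \<open>Hence \<open>ys\<close> is a reordering of the renamed \<open>ds\<close>, and
    reordering the source of the effect is possible on tiles.\<close>
  then have mys: "mset ys = mset (map \<eta> ds)"
    using sys ys inj\<eta> D(2) by (subst set_eq_iff_mset_eq_distinct[symmetric]) (auto simp: enumerates_def distinct_map)
  have ren: "terms_arrow ds (map \<sigma> vs) = (terms_arrow (map \<eta> ds) (map \<theta> vs) :: ('p, 'f) arrow)" if "set vs \<subseteq> ?V" for vs
  proof -
    have \<theta>vs: "map \<theta> vs = map (\<lambda>t. t \<cdot>\<^sub>t (Var \<circ> \<eta>)) (map \<sigma> vs)" using that \<theta>\<eta> by auto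
    have "vars_trm t \<subseteq> set ds" if "t \<in> set (map \<sigma> vs)" for t
      using that \<open>set vs \<subseteq> ?V\<close> unfolding dsV[symmetric] by auto
    then show ?thesis unfolding \<theta>vs by (intro terms_arrow_rename[OF inj\<eta>, symmetric])
  qed
  have wf\<theta>: "wf_terms S (map \<eta> ds) (map \<theta> vs)" if "set vs \<subseteq> ?V" for vs
  proof (rule wf_terms_mapI)
    fix v assume "v \<in> set vs"
    then have v: "v \<in> ?V" using that by blast
    then have "vars_trm (\<theta> v) \<subseteq> (\<Union>v\<in>?V. vars_trm (\<theta> v))" by blast
    then show "wf_trm S (\<theta> v) \<and> vars_trm (\<theta> v) \<subseteq> set (map \<eta> ds)"
      using \<theta>(1) \<open>(\<Union>v\<in>?V. vars_trm (\<theta> v)) = \<eta> ` set ds\<close> by (simp add: is_subst_def)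
  qed
  have "sym_tile S P (terms_arrow xs (map Var xs @ args A)) (terms_arrow (xs' @ ?zs) (map Var xs' @ args (head C')))
    (terms_arrow ds (map \<sigma> xs)) (terms_arrow ds (map \<sigma> (xs @ ?zs)))"
    using D(1)[unfolded fstE sndE] unfolding map_append \<sigma>' .
  then have "sym_tile S P (terms_arrow xs (map Var xs @ args A)) (terms_arrow (xs' @ ?zs) (map Var xs' @ args (head C')))
    (terms_arrow (map \<eta> ds) (map \<theta> xs)) (terms_arrow (map \<eta> ds) (map \<theta> (xs @ ?zs)))"
    by (subst (asm) ren, simp, subst (asm) ren) simp_all
  then have T3: "tile S P (terms_arrow xs (map Var xs @ args A)) (terms_arrow (xs' @ ?zs) (map Var xs' @ args (head C')))
    (terms_arrow ys (map \<theta> xs)) (terms_arrow ys (map \<theta> (xs @ ?zs)))"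
  proof -
    assume t: "sym_tile S P (terms_arrow xs (map Var xs @ args A)) (terms_arrow (xs' @ ?zs) (map Var xs' @ args (head C')))
      (terms_arrow (map \<eta> ds) (map \<theta> xs)) (terms_arrow (map \<eta> ds) (map \<theta> (xs @ ?zs)))"
    have "distinct (map \<eta> ds)" using inj\<eta> D(2) by (simp add: distinct_map)
    from sym_tile_perm_apex[OF t dxs this mys _ wf\<theta> wf\<theta>] argsA show ?thesis by (simp add: sym_tile_def)
  qed
  let ?n = "length xs"
  have idn: "terms_arrow xs' (map Var xs') = (ident (tms ?n) :: ('p, 'f) arrow)"
    using ident_terms_arrow[OF xs'(1)] xs'(2) by simp
  have "tile S P (ident (tms ?n)) (ident (tms ?n)) (ident (tms ?n)) (ident (tms ?n))"
    using sym_tile_id[of S xs' "map Var xs'" xs' P] xs'(1) by (simp add: sym_tile_def idn)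
  note par = tile.parallel[OF this clause]
  have idpar: "ident (tms ?n) \<otimes> terms_arrow ?zs (args (head C')) =
    (terms_arrow (xs' @ ?zs) (map Var xs' @ args (head C')) :: ('p, 'f) arrow)"
    unfolding idn[symmetric] by (rule par_terms_arrow[OF _ _ argsH]) (use xs'(3) in auto)
  have T2: "tile S P (ident (tms ?n) \<otimes> pred_arrow S (pred A)) (ident (tms ?n @ [Pr]))
    (terms_arrow (xs' @ ?zs) (map Var xs' @ args (head C'))) (ident (tms ?n) \<otimes> goal_arrow ?zs (body C'))"
    using par unfolding ident_par_Pr idpar predA .
  let ?K = "Arrow (tms ?n @ [Pr]) [PC (map Lit (subst_goal G1 (pos xs)) @ [PVar ?n] @ map Lit (subst_goal G2 (pos xs)))] :: ('p, 'f) arrow"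
  have T1: "tile S P ?K (ident [Pr]) (ident (tms ?n @ [Pr])) ?K"
    by (rule goal_hole_tile) (use wfG sxs in auto)
  have T: "tile S P (terms_arrow xs (map Var xs @ args A) ;; (ident (tms ?n) \<otimes> pred_arrow S (pred A) ;; ?K)) (ident [Pr])
    (terms_arrow ys (map \<theta> xs)) (terms_arrow ys (map \<theta> (xs @ ?zs)) ;; (ident (tms ?n) \<otimes> goal_arrow ?zs (body C') ;; ?K))"
    by (rule tile.horizontal[OF tile.horizontal[OF T1 T2] T3])
  have sub1: "vars_goal G1 \<subseteq> set xs" and sub2: "vars_goal G2 \<subseteq> set xs" using sxs by auto
  have v1: "vars_goal (subst_goal G1 (pos xs)) \<subseteq> {..<?n}" "vars_goal (subst_goal G2 (pos xs)) \<subseteq> {..<?n}"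
    using vars_goal_pos[of G1 xs] vars_goal_pos[of G2 xs] sxs by auto
  let ?k = "parity S (pred A)"
  have pa: "pred_arrow S (pred A) = Arrow (tms ?k) [PC (map Lit [Atom (pred A) (map Var [0..<?k])])]"
    by (simp add: pred_arrow_def)
  have s: "terms_arrow xs (map Var xs @ args A) ;; (ident (tms ?n) \<otimes> pred_arrow S (pred A) ;; ?K) = goal_arrow xs ?G"
  proof -
    let ?\<phi> = "\<lambda>i. tc ((map (\<lambda>t. TC (t \<cdot>\<^sub>t pos xs)) (map Var xs @ args A) :: ('p, 'f) component list) ! i)"
    have x: "pos xs x \<cdot>\<^sub>t ?\<phi> = pos xs x" if x: "x \<in> set xs" for x
    proof -
      obtain i where "i < length xs" "xs ! i = x" "pos xs x = (Var i :: ('f, nat) trm)" using x by (rule pos_obtain)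
      then show ?thesis by (auto simp: nth_append simp del: map_map)
    qed
    have HH: "subst_goal (subst_goal H (pos xs)) ?\<phi> = subst_goal H (pos xs)" if "vars_goal H \<subseteq> set xs" for H :: "('p, 'f, 'v) goal"
      unfolding subst_goal_comp by (rule subst_goal_cong) (use that x in auto)
    have "subst_atom (subst_atom (Atom (pred A) (map Var [0..<?k])) (\<lambda>i. Var (?n + i))) ?\<phi> = subst_atom A (pos xs)"
      using wfA by (auto simp: subst_atom_def wf_atom_def nth_append intro!: nth_equalityI)
    then show ?thesis
      unfolding pa seq_context[OF v1] seq_terms_arrow_goal using HH[OF sub1] HH[OF sub2] by (simp add: goal_arrow_def)
  qed
  have r: "terms_arrow ys (map \<theta> (xs @ ?zs)) ;; (ident (tms ?n) \<otimes> goal_arrow ?zs (body C') ;; ?K) =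
    goal_arrow ys (subst_goal (G1 @ body C' @ G2) \<theta>)"
  proof -
    let ?\<phi> = "\<lambda>i. tc ((map (\<lambda>t. TC (t \<cdot>\<^sub>t pos ys)) (map \<theta> (xs @ ?zs)) :: ('p, 'f) component list) ! i)"
    have x: "pos xs x \<cdot>\<^sub>t ?\<phi> = \<theta> x \<cdot>\<^sub>t pos ys" if x: "x \<in> set xs" for x
    proof -
      obtain i where "i < length xs" "xs ! i = x" "pos xs x = (Var i :: ('f, nat) trm)" using x by (rule pos_obtain)
      then show ?thesis by (auto simp: nth_append simp del: map_map)
    qed
    have z: "pos ?zs z \<cdot>\<^sub>t (\<lambda>i. Var (?n + i)) \<cdot>\<^sub>t ?\<phi> = \<theta> z \<cdot>\<^sub>t pos ys" if z: "z \<in> set ?zs" for z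
    proof -
      obtain i where "i < length ?zs" "?zs ! i = z" "pos ?zs z = (Var i :: ('f, nat) trm)" using z by (rule pos_obtain)
      then show ?thesis by (auto simp: nth_append simp del: map_map)
    qed
    have HH: "subst_goal (subst_goal H (pos xs)) ?\<phi> = subst_goal (subst_goal H \<theta>) (pos ys)" if "vars_goal H \<subseteq> set xs" for H :: "('p, 'f, 'v) goal"
      unfolding subst_goal_comp by (rule subst_goal_cong) (use that x in auto)
    have "subst_goal (subst_goal (subst_goal (body C') (pos ?zs)) (\<lambda>i. Var (?n + i))) ?\<phi> = subst_goal (subst_goal (body C') \<theta>) (pos ys)"
      unfolding subst_goal_comp
    proof (rule subst_goal_cong)
      fix w assume "w \<in> vars_goal (body C')"
      then have "w \<in> set ?zs" unfolding szs by (simp add: vars_clause_def)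
      then show "pos ?zs w \<cdot>\<^sub>t (\<lambda>i. Var (?n + i)) \<cdot>\<^sub>t ?\<phi> = \<theta> w \<cdot>\<^sub>t pos ys" by (rule z)
    qed
    then show ?thesis
      unfolding goal_arrow_def[of ?zs] seq_context[OF v1] seq_terms_arrow_goal using HH[OF sub1] HH[OF sub2]
      by (simp add: goal_arrow_def)
  qed
  show ?thesis using T unfolding s r subst_arrow_def .
qed

subsection \<open>Derivation skeletons\<close>

text \<open>A forest that records which items are left alone and which are resolved, and by which
  clauses. The instances of the clauses are not recorded; they are the unknowns of the system that a
  tile solves.\<close>

datatype ('p, 'f, 'v) skeleton = Leaf | Node "('p, 'f, 'v) clause" "('p, 'f, 'v) skeleton list"

text \<open>The entries of a component of sort \<open>p\<close>: atoms, and opaque labels for its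
  variables. Labels are indices in the description of a tile and goals in its solutions, hence the
  type parameter.\<close>

datatype ('p, 'f, 'v, 'x) item = At "('p, 'f, 'v) atom" | Ot 'x

text \<open>Clauses are applied in arbitrary well-formed instances, without unification. The last
  list collects what stands at the leaves from left to right. A label can only be met by
  \<open>Leaf\<close>, since \<open>Node\<close> asks for an atom.\<close>

inductive der :: "('p, 'f) signature \<Rightarrow> ('p, 'f, 'v) clause set \<Rightarrow> ('p, 'f, 'v) skeleton list \<Rightarrow>
    ('p, 'f, 'v, 'x) item list \<Rightarrow> ('p, 'f, 'v, 'x) item list \<Rightarrow> bool" for S P where
  Nil: "der S P [] [] []"
| Leaf: "der S P ds gs ms \<Longrightarrow> der S P (Leaf # ds) (g # gs) (g # ms)"
| Node: "\<lbrakk>C \<in> P; \<forall>x\<in>vars_clause C. wf_trm S (\<tau> x); der S P cs (map (\<lambda>B. At (subst_atom B \<tau>)) (body C)) ms1;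
    der S P ds gs ms2\<rbrakk> \<Longrightarrow> der S P (Node C cs # ds) (At (subst_atom (head C) \<tau>) # gs) (ms1 @ ms2)"

inductive_simps der_Nil_iff [simp]: "der S P [] gs ms"
inductive_simps der_Leaf_iff: "der S P (Leaf # ds) gs ms"
inductive_simps der_Node_iff: "der S P (Node C cs # ds) gs ms"

primrec flat :: "('p, 'f, 'v, ('p, 'f, 'v) goal) item \<Rightarrow> ('p, 'f, 'v) goal" where
  "flat (At A) = [A]"
| "flat (Ot g) = g"

fun leaf_count :: "('p, 'f, 'v) skeleton list \<Rightarrow> nat" where
  "leaf_count [] = 0"
| "leaf_count (Leaf # ds) = Suc (leaf_count ds)"
| "leaf_count (Node C cs # ds) = leaf_count cs + leaf_count ds"

fun plug :: "('p, 'f, 'v) skeleton list \<Rightarrow> ('p, 'f, 'v) skeleton list \<Rightarrow> ('p, 'f, 'v) skeleton list" where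
  "plug [] es = []"
| "plug (Leaf # ds) es = hd es # plug ds (tl es)"
| "plug (Node C cs # ds) es = Node C (plug cs (take (leaf_count cs) es)) # plug ds (drop (leaf_count cs) es)"

lemma der_length: "der S P ds gs ms \<Longrightarrow> length gs = length ds"
  by (induction rule: der.induct) auto

lemma der_leaf_count: "der S P ds gs ms \<Longrightarrow> length ms = leaf_count ds"
  by (induction rule: der.induct) auto

primrec relabel :: "('x \<Rightarrow> 'y) \<Rightarrow> ('p, 'f, 'v, 'x) item \<Rightarrow> ('p, 'f, 'v, 'y) item" where
  "relabel f (At A) = At A"
| "relabel f (Ot x) = Ot (f x)"

lemma der_relabel:
  assumes "der S P ds gs ms"
  shows "der S P ds (map (relabel f) gs) (map (relabel f) ms)"
  using assms
proof (induction rule: der.induct)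
  case (Node C \<tau> cs ms1 ds gs ms2)
  then have "der S P cs (map (\<lambda>B. At (subst_atom B \<tau>)) (body C)) (map (relabel f) ms1)" by (simp add: comp_def)
  then show ?case using Node by (auto intro: der.Node)
qed (auto intro: der.intros)

lemma der_appendI:
  assumes "der S P ds gs ms" "der S P ds' gs' ms'"
  shows "der S P (ds @ ds') (gs @ gs') (ms @ ms')"
  using assms by (induction rule: der.induct) (auto intro: der.intros)

lemma der_appendD:
  assumes "der S P (ds @ ds') (gs @ gs') ms" "length gs = length ds"
  shows "\<exists>ms1 ms2. ms = ms1 @ ms2 \<and> der S P ds gs ms1 \<and> der S P ds' gs' ms2"
  using assms
proof (induction ds arbitrary: gs ms)
  case (Cons d ds)
  then obtain g gs1 where gs: "gs = g # gs1" by (cases gs) auto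
  show ?case
  proof (cases d)
    case Leaf
    then obtain ms' where "ms = g # ms'" "der S P (ds @ ds') (gs1 @ gs') ms'" using Cons.prems gs by (auto simp: der_Leaf_iff)
    moreover from this obtain ms1 ms2 where "ms' = ms1 @ ms2" "der S P ds gs1 ms1" "der S P ds' gs' ms2"
      using Cons.IH[of gs1 ms'] Cons.prems(2) gs by auto
    ultimately show ?thesis using Leaf gs by (intro exI[of _ "g # ms1"] exI[of _ ms2]) (auto simp: der_Leaf_iff)
  next
    case (Node C cs)
    from Cons.prems(1) obtain \<tau> n1 n2 where 1: "C \<in> P" "\<forall>x\<in>vars_clause C. wf_trm S (\<tau> x)"
      "der S P cs (map (\<lambda>B. At (subst_atom B \<tau>)) (body C)) n1" "der S P (ds @ ds') (gs1 @ gs') n2" "ms = n1 @ n2"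
      "g = At (subst_atom (head C) \<tau>)"
      unfolding Node gs append_Cons der_Node_iff by blast
    moreover from 1 obtain ms1 ms2 where "n2 = ms1 @ ms2" "der S P ds gs1 ms1" "der S P ds' gs' ms2"
      using Cons.IH[of gs1 n2] Cons.prems(2) gs by auto
    ultimately show ?thesis unfolding Node gs
      by (intro exI[of _ "n1 @ ms1"] exI[of _ ms2]) (auto intro: der.Node)
  qed
qed simp

lemma der_concatI:
  assumes "length gss = length dss" "length mss = length dss" "\<And>q. q < length dss \<Longrightarrow> der S P (dss ! q) (gss ! q) (mss ! q)"
  shows "der S P (concat dss) (concat gss) (concat mss)"
  using assms
proof (induction dss arbitrary: gss mss)
  case (Cons ds dss)
  then obtain gs gss' ms mss' where *: "gss = gs # gss'" "mss = ms # mss'" by (metis length_Suc_conv)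
  have "der S P (concat dss) (concat gss') (concat mss')"
    by (rule Cons.IH) (use Cons.prems(1,2) Cons.prems(3)[of "Suc _"] * in auto)
  then show ?case using Cons.prems(3)[of 0] * by (auto intro: der_appendI)
qed simp

lemma der_concatD:
  assumes "der S P (concat dss) (concat gss) ms" "length gss = length dss" "\<And>q. q < length dss \<Longrightarrow> length (gss ! q) = length (dss ! q)"
  shows "\<exists>mss. length mss = length dss \<and> ms = concat mss \<and> (\<forall>q<length dss. der S P (dss ! q) (gss ! q) (mss ! q))"
  using assms
proof (induction dss arbitrary: gss ms)
  case (Cons ds dss)
  then obtain gs gss' where *: "gss = gs # gss'" by (metis length_Suc_conv)
  have "length gs = length ds" using Cons.prems(3)[of 0] * by simp
  then obtain ms1 ms2 where 1: "ms = ms1 @ ms2" "der S P ds gs ms1" "der S P (concat dss) (concat gss') ms2"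
    using der_appendD[of S P ds "concat dss" gs "concat gss'" ms] Cons.prems(1) * by auto
  then obtain mss where "length mss = length dss" "ms2 = concat mss" "\<forall>q<length dss. der S P (dss ! q) (gss' ! q) (mss ! q)"
    using Cons.IH[OF 1(3)] Cons.prems(2) Cons.prems(3)[of "Suc _"] * by auto
  then show ?case using 1 * by (intro exI[of _ "ms1 # mss"]) (auto simp: nth_Cons')
qed simp

lemma der_singlesI:
  assumes "length gs = length ds" "length mss = length ds" "\<And>q. q < length ds \<Longrightarrow> der S P [ds ! q] [gs ! q] (mss ! q)"
  shows "der S P ds gs (concat mss)"
  using der_concatI[of "map (\<lambda>g. [g]) gs" "map (\<lambda>d. [d]) ds" mss S P] assms by simp

lemma der_Ot_Leaf:
  assumes "der S P ds gs ms" "q < length gs" "gs ! q = Ot x"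
  shows "ds ! q = Leaf"
  using assms by (induction arbitrary: q rule: der.induct) (auto simp: nth_Cons split: nat.splits)

lemma der_all_Ot:
  assumes "der S P ds gs ms" "set gs \<subseteq> range Ot"
  shows "ms = gs"
  using assms by (induction rule: der.induct) auto

lemma der_all_At:
  assumes "der S P ds gs ms" "set gs \<subseteq> range At"
  shows "set ms \<subseteq> range At"
  using assms by (induction rule: der.induct) auto

primrec labels1 :: "('p, 'f, 'v, 'x) item \<Rightarrow> 'x list" where
  "labels1 (At A) = []"
| "labels1 (Ot x) = [x]"

lemma labels_At: "set ms \<subseteq> range At \<Longrightarrow> concat (map labels1 ms) = []"
  by (induction ms) auto

text \<open>No clause produces or consumes a label, so labels pass through a derivation in their
  order.\<close>

lemma der_labels:
  assumes "der S P ds gs ms"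
  shows "concat (map labels1 ms) = concat (map labels1 gs)"
  using assms
proof (induction rule: der.induct)
  case (Node C \<tau> cs ms1 ds gs ms2)
  have "set ms1 \<subseteq> range At" by (rule der_all_At[OF Node.hyps(3)]) auto
  then show ?case using Node by (simp add: labels_At)
qed auto

text \<open>Substituting derivations for the labels; the trees \<open>Ts ! q\<close> refine the leaves at labels.\<close>

lemma der_refine:
  assumes "der S P ds gs ms" "length Ts = length ds" "length Xs = length ds"
    "\<And>q. q < length ds \<Longrightarrow> (case gs ! q of At A \<Rightarrow> Ts ! q = [ds ! q] \<and> Xs ! q = [At A] | Ot k \<Rightarrow> der S P (Ts ! q) (Xs ! q) (\<phi> k))"
  shows "der S P (concat Ts) (concat Xs) (concat (map (\<lambda>g. case g of At A \<Rightarrow> [At A] | Ot k \<Rightarrow> \<phi> k) ms))"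
  using assms
proof (induction arbitrary: Ts Xs rule: der.induct)
  case (Leaf ds gs ms g)
  then obtain T Ts' X Xs' where *: "Ts = T # Ts'" "Xs = X # Xs'" by (metis length_Suc_conv)
  have "der S P (concat Ts') (concat Xs') (concat (map (\<lambda>g. case g of At A \<Rightarrow> [At A] | Ot k \<Rightarrow> \<phi> k) ms))"
  proof (rule Leaf.IH)
    show "case gs ! q of At A \<Rightarrow> Ts' ! q = [ds ! q] \<and> Xs' ! q = [At A] | Ot k \<Rightarrow> der S P (Ts' ! q) (Xs' ! q) (\<phi> k)"
      if "q < length ds" for q using Leaf.prems(3)[of "Suc q"] that unfolding * by (simp split: item.splits)
  qed (use Leaf.prems(1,2) * in simp_all)
  moreover have "der S P T X (case g of At A \<Rightarrow> [At A] | Ot k \<Rightarrow> \<phi> k)"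
    using Leaf.prems(3)[of 0] * by (cases g) (auto simp: der_Leaf_iff)
  ultimately show ?case using * by (auto intro: der_appendI)
next
  case (Node C \<tau> cs ms1 ds gs ms2)
  then obtain T Ts' X Xs' where *: "Ts = T # Ts'" "Xs = X # Xs'" by (metis length_Suc_conv)
  have 1: "der S P (concat Ts') (concat Xs') (concat (map (\<lambda>g. case g of At A \<Rightarrow> [At A] | Ot k \<Rightarrow> \<phi> k) ms2))"
  proof (rule Node.IH(2))
    show "case gs ! q of At A \<Rightarrow> Ts' ! q = [ds ! q] \<and> Xs' ! q = [At A] | Ot k \<Rightarrow> der S P (Ts' ! q) (Xs' ! q) (\<phi> k)"
      if "q < length ds" for q using Node.prems(3)[of "Suc q"] that unfolding * by (simp split: item.splits)
  qed (use Node.prems(1,2) * in simp_all)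
  have l: "length (body C) = length cs" using der_length[OF Node.hyps(3)] by simp
  have "der S P (concat (map (\<lambda>d. [d]) cs)) (concat (map (\<lambda>B. [At (subst_atom B \<tau>)]) (body C)))
    (concat (map (\<lambda>g. case g of At A \<Rightarrow> [At A] | Ot k \<Rightarrow> \<phi> k) ms1))"
    by (rule Node.IH(1)) (use l in auto)
  then have "der S P cs (map (\<lambda>B. At (subst_atom B \<tau>)) (body C)) (concat (map (\<lambda>g. case g of At A \<Rightarrow> [At A] | Ot k \<Rightarrow> \<phi> k) ms1))"
    by simp
  from der.Node[OF Node.hyps(1,2) this 1] show ?case
    using Node.prems(3)[of 0] * by simp
qed simp

text \<open>Two derivations in sequence are one derivation along the grafted forest: vertical
  composition at the level of skeletons. The leaf counts tell which part of \<open>es\<close>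
  belongs to which tree.\<close>

lemma der_plug:
  assumes "length es = leaf_count ds"
  shows "der S P (plug ds es) gs ms \<longleftrightarrow> (\<exists>ns. der S P ds gs ns \<and> der S P es ns ms)"
  using assms
proof (induction ds es arbitrary: gs ms rule: plug.induct)
  case (2 ds es)
  then obtain e es' where es: "es = e # es'" by (cases es) auto
  show ?case
  proof
    assume L: "der S P (plug (Leaf # ds) es) gs ms"
    then have "length gs = Suc (length (plug ds es'))" using der_length[OF L] es by simp
    then obtain g gs' where gs: "gs = g # gs'" by (cases gs) auto
    from L obtain m1 m2 where m: "ms = m1 @ m2" "der S P [e] [g] m1" "der S P (plug ds es') gs' m2"
      using der_appendD[of S P "[e]" "plug ds es'" "[g]" gs' ms] es gs by auto
    then obtain ns where "der S P ds gs' ns" "der S P es' ns m2" using "2.IH"[of gs' m2] "2.prems" es by auto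
    then show "\<exists>ns. der S P (Leaf # ds) gs ns \<and> der S P es ns ms"
      using m gs es der_appendI[of S P "[e]" "[g]" m1 es' ns m2] by (intro exI[of _ "g # ns"]) (auto intro: der.Leaf)
  next
    assume "\<exists>ns. der S P (Leaf # ds) gs ns \<and> der S P es ns ms"
    then obtain g gs' ns where gs: "gs = g # gs'" "der S P ds gs' ns" "der S P es (g # ns) ms" by (auto simp: der_Leaf_iff)
    then obtain m1 m2 where m: "ms = m1 @ m2" "der S P [e] [g] m1" "der S P es' ns m2"
      using der_appendD[of S P "[e]" es' "[g]" ns ms] es by auto
    then have "der S P (plug ds es') gs' m2" using "2.IH"[of gs' m2] "2.prems" es gs by auto
    then show "der S P (plug (Leaf # ds) es) gs ms"
      using m gs es der_appendI[of S P "[e]" "[g]" m1 "plug ds es'" gs' m2] by simp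
  qed
next
  case (3 C cs ds es)
  let ?e1 = "take (leaf_count cs) es" and ?e2 = "drop (leaf_count cs) es"
  have l: "length ?e1 = leaf_count cs" "length ?e2 = leaf_count ds" using "3.prems" by auto
  show ?case
  proof
    assume "der S P (plug (Node C cs # ds) es) gs ms"
    then obtain \<tau> gs' m1 m2 where 1: "C \<in> P" "\<forall>x\<in>vars_clause C. wf_trm S (\<tau> x)" "gs = At (subst_atom (head C) \<tau>) # gs'" "ms = m1 @ m2"
      "der S P (plug cs ?e1) (map (\<lambda>B. At (subst_atom B \<tau>)) (body C)) m1" "der S P (plug ds ?e2) gs' m2"
      by (auto simp: der_Node_iff)
    obtain n1 where n1: "der S P cs (map (\<lambda>B. At (subst_atom B \<tau>)) (body C)) n1" "der S P ?e1 n1 m1"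
      using "3.IH"(1)[OF l(1)] 1(5) by blast
    obtain n2 where n2: "der S P ds gs' n2" "der S P ?e2 n2 m2" using "3.IH"(2)[OF l(2)] 1(6) by blast
    have "der S P es (n1 @ n2) ms" using der_appendI[OF n1(2) n2(2)] 1(4) by simp
    then show "\<exists>ns. der S P (Node C cs # ds) gs ns \<and> der S P es ns ms"
      using der.Node[OF 1(1,2) n1(1) n2(1)] 1(3) by blast
  next
    assume "\<exists>ns. der S P (Node C cs # ds) gs ns \<and> der S P es ns ms"
    then obtain \<tau> gs' n1 n2 where 1: "C \<in> P" "\<forall>x\<in>vars_clause C. wf_trm S (\<tau> x)" "gs = At (subst_atom (head C) \<tau>) # gs'"
      "der S P cs (map (\<lambda>B. At (subst_atom B \<tau>)) (body C)) n1" "der S P ds gs' n2" "der S P es (n1 @ n2) ms"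
      by (auto simp: der_Node_iff)
    have "length n1 = length ?e1" using der_leaf_count[OF 1(4)] l by simp
    then obtain m1 m2 where m: "ms = m1 @ m2" "der S P ?e1 n1 m1" "der S P ?e2 n2 m2"
      using der_appendD[of S P ?e1 ?e2 n1 n2 ms] 1(6) by auto
    have "der S P (plug cs ?e1) (map (\<lambda>B. At (subst_atom B \<tau>)) (body C)) m1" using "3.IH"(1)[OF l(1)] 1(4) m(2) by blast
    moreover have "der S P (plug ds ?e2) gs' m2" using "3.IH"(2)[OF l(2)] 1(5) m(3) by blast
    ultimately show "der S P (plug (Node C cs # ds) es) gs ms"
      using der.Node[OF 1(1,2)] 1(3) m(1) by auto
  qed
qed simp

definition same_kind :: "('p, 'f, 'v, 'x) item \<Rightarrow> ('p, 'f, 'v, 'x) item \<Rightarrow> bool" where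
  "same_kind g g' \<longleftrightarrow> (case g of At A \<Rightarrow> (\<exists>B. g' = At B) | Ot x \<Rightarrow> g' = Ot x)"

lemma der_same_kind:
  assumes "der S P ds gs ms" "der S P ds gs' ms'" "list_all2 same_kind gs gs'"
  shows "list_all2 same_kind ms ms'"
  using assms
proof (induction arbitrary: gs' ms' rule: der.induct)
  case (Leaf ds gs ms g)
  then show ?case by (auto simp: der_Leaf_iff list_all2_Cons1)
next
  case (Node C \<tau> cs ms1 ds gs ms2)
  from Node.prems(1) obtain \<tau>' gs'' m1 m2 where 1: "gs' = At (subst_atom (head C) \<tau>') # gs''" "ms' = m1 @ m2"
      "der S P cs (map (\<lambda>B. At (subst_atom B \<tau>')) (body C)) m1" "der S P ds gs'' m2"
    unfolding der_Node_iff by blast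
  have "list_all2 same_kind ms1 m1"
    by (rule Node.IH(1)[OF 1(3)]) (auto simp: list_all2_map1 list_all2_map2 same_kind_def intro!: list.rel_refl)
  moreover have "list_all2 same_kind ms2 m2" using Node.IH(2)[OF 1(4)] Node.prems(2) 1(1) by simp
  ultimately show ?case using 1(2) by (simp add: list_all2_appendI)
qed simp

lemma same_kind_flat:
  assumes "list_all2 same_kind ms ms'" "concat (map flat ms) = concat (map flat ms')"
  shows "ms = ms'"
  using assms
  by (induction rule: list_all2_induct) (auto simp: same_kind_def split: item.splits)

text \<open>Skeleton and start do not determine the result, because a clause body may have variables
  that are not in the head. They do determine which entries of the result are atoms and which are
  labels, and the labels themselves, so the flattened goal can be parsed in one way only.\<close>

lemma der_flat_unique:
  assumes "der S P ds gs ms" "der S P ds gs ms'" "concat (map flat ms) = concat (map flat ms')"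
  shows "ms = ms'"
proof (rule same_kind_flat[OF der_same_kind[OF assms(1,2)] assms(3)])
  show "list_all2 same_kind gs gs" by (rule list.rel_refl) (simp add: same_kind_def split: item.splits)
qed

subsection \<open>Evaluating arrows on environments\<close>

datatype ('p, 'f, 'v) val = VT (vt: "('f, 'v) trm") | VG (vg: "('p, 'f, 'v) goal")

primrec evl :: "('p, 'f) lit \<Rightarrow> ('p, 'f, 'v) val list \<Rightarrow> ('p, 'f, 'v) goal" where
  "evl (Lit A) h = [subst_atom A (\<lambda>i. vt (h ! i))]"
| "evl (PVar i) h = vg (h ! i)"

primrec evc :: "('p, 'f) component \<Rightarrow> ('p, 'f, 'v) val list \<Rightarrow> ('p, 'f, 'v) val" where
  "evc (TC t) h = VT (t \<cdot>\<^sub>t (\<lambda>i. vt (h ! i)))"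
| "evc (PC w) h = VG (concat (map (\<lambda>l. evl l h) w))"

definition ev :: "('p, 'f) arrow \<Rightarrow> ('p, 'f, 'v) val list \<Rightarrow> ('p, 'f, 'v) val list" where
  "ev a h = map (\<lambda>c. evc c h) (tuple a)"

primrec val_ok :: "('p, 'f) signature \<Rightarrow> srt \<Rightarrow> ('p, 'f, 'v) val \<Rightarrow> bool" where
  "val_ok S Tm v \<longleftrightarrow> (\<exists>t. v = VT t \<and> wf_trm S t)"
| "val_ok S Pr v \<longleftrightarrow> (\<exists>g. v = VG g)"

definition env :: "('p, 'f) signature \<Rightarrow> srt list \<Rightarrow> ('p, 'f, 'v) val list \<Rightarrow> bool" where
  "env S ob h \<longleftrightarrow> length h = length ob \<and> (\<forall>i<length ob. val_ok S (ob ! i) (h ! i))"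

text \<open>In contrast to \<open>evl\<close>, a variable of sort \<open>p\<close> stays a single
  labelled entry, so that a skeleton cannot look inside the goal that is to be substituted.\<close>

primrec itm :: "(nat \<Rightarrow> 'x) \<Rightarrow> ('p, 'f, 'v) val list \<Rightarrow> ('p, 'f) lit \<Rightarrow> ('p, 'f, 'v, 'x) item" where
  "itm g h (Lit A) = At (subst_atom A (\<lambda>i. vt (h ! i)))"
| "itm g h (PVar m) = Ot (g m)"

definition wf_arrow :: "('p, 'f) signature \<Rightarrow> ('p, 'f) arrow \<Rightarrow> bool" where
  "wf_arrow S a \<longleftrightarrow> (\<forall>c\<in>set (tuple a). wf_comp S (src a) c)"

definition pvar_at :: "('p, 'f) arrow \<Rightarrow> nat \<Rightarrow> nat \<Rightarrow> bool" where
  "pvar_at a j i \<longleftrightarrow> j < length (tuple a) \<and> tuple a ! j = PC [PVar i]"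

text \<open>Meant for observations, where a component of sort \<open>p\<close> is a bare variable;
  the value 0 in other cases is arbitrary.\<close>

definition pidx :: "('p, 'f) arrow \<Rightarrow> nat \<Rightarrow> nat" where
  "pidx a j = (case pc (tuple a ! j) of PVar k # _ \<Rightarrow> k | _ \<Rightarrow> 0)"

lemma pvar_at_pidx: "pvar_at a j i \<Longrightarrow> pidx a j = i"
  by (simp add: pvar_at_def pidx_def)

lemma length_tuple: "length (tuple a) = length (tgt a)"
  by (simp add: tgt_def)

lemma tgt_nth_Tm: "j < length (tuple a) \<Longrightarrow> tgt a ! j = Tm \<longleftrightarrow> (\<exists>t. tuple a ! j = TC t)"
  and tgt_nth_Pr: "j < length (tuple a) \<Longrightarrow> tgt a ! j = Pr \<longleftrightarrow> (\<exists>w. tuple a ! j = PC w)"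
  by (cases "tuple a ! j"; simp add: tgt_def)+

lemma src_seq [simp]: "src (a ;; b) = src a"
  and length_tuple_seq [simp]: "length (tuple (a ;; b)) = length (tuple b)"
  and nth_tuple_seq: "j < length (tuple b) \<Longrightarrow> tuple (a ;; b) ! j = subst_comp1 (tuple b ! j) (\<lambda>i. tuple a ! i)"
  by (simp_all add: seq_def)

lemma srt_of_subst_comp1 [simp]: "srt_of (subst_comp1 c \<kappa>) = srt_of c"
  by (cases c) auto

lemma srt_of_shift_comp [simp]: "srt_of (shift_comp n c) = srt_of c"
  by (cases c) auto

lemma tgt_seq [simp]: "tgt (a ;; b) = tgt b"
  by (simp add: tgt_def seq_def)

lemma src_par [simp]: "src (a \<otimes> b) = src a @ src b"
  and tgt_par [simp]: "tgt (a \<otimes> b) = tgt a @ tgt b"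
  by (simp_all add: par_def tgt_def)

lemma env_nth: "env S ob h \<Longrightarrow> i < length ob \<Longrightarrow> val_ok S (ob ! i) (h ! i)"
  and env_length: "env S ob h \<Longrightarrow> length h = length ob"
  by (simp_all add: env_def)

lemma evc_TC_cong:
  assumes "wf_comp S ob (TC t)" "\<And>i. i < length ob \<Longrightarrow> ob ! i = Tm \<Longrightarrow> h ! i = h' ! i"
  shows "evc (TC t) h = evc (TC t) h'"
  using assms by (auto intro!: subst_trm_cong)

lemma itm_Lit_cong:
  assumes "wf_lit S ob (Lit A)" "\<And>i. i < length ob \<Longrightarrow> ob ! i = Tm \<Longrightarrow> h ! i = h' ! i"
  shows "subst_atom A (\<lambda>i. vt (h ! i)) = subst_atom A (\<lambda>i. vt (h' ! i))"
  using assms by (auto intro!: subst_atom_cong)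

lemma wf_nth: "wf_arrow S a \<Longrightarrow> j < length (tuple a) \<Longrightarrow> wf_comp S (src a) (tuple a ! j)"
  by (simp add: wf_arrow_def)

lemma tc_evc:
  assumes "i < length ts" "map srt_of ts ! i = Tm"
  shows "tc (ts ! i) \<cdot>\<^sub>t (\<lambda>i. vt (h ! i)) = vt (map (\<lambda>c. evc c h) ts ! i)"
  using assms by (cases "ts ! i") auto

lemma subst_atom_evc:
  assumes "wf_lit S (map srt_of ts) (Lit A)"
  shows "subst_atom (subst_atom A (tc \<circ> (!) ts)) (\<lambda>i. vt (h ! i)) = subst_atom A (\<lambda>i. vt (map (\<lambda>c. evc c h) ts ! i))"
  unfolding subst_atom_comp using assms by (intro subst_atom_cong) (simp add: tc_evc del: nth_map)

lemma evl_subst: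
  assumes "wf_lit S (map srt_of ts) l"
  shows "concat (map (\<lambda>l. evl l h) (subst_lit l ((!) ts))) = evl l (map (\<lambda>c. evc c h) ts)"
proof (cases l)
  case (Lit A)
  then show ?thesis using subst_atom_evc[of S ts A h] assms by (simp del: nth_map)
next
  case (PVar i)
  then show ?thesis using assms by (cases "ts ! i") auto
qed

lemma evc_subst:
  assumes "wf_comp S (map srt_of ts) c"
  shows "evc (subst_comp1 c ((!) ts)) h = evc c (map (\<lambda>c. evc c h) ts)"
proof (cases c)
  case (TC t)
  then show ?thesis using assms tc_evc[of _ ts h]
    by (auto simp: subst_trm_comp simp del: nth_map intro!: subst_trm_cong)
next
  case (PC w)
  have "concat (map (\<lambda>l. evl l h) (concat (map (\<lambda>l. subst_lit l ((!) ts)) w))) = concat (map (\<lambda>l. evl l (map (\<lambda>c. evc c h) ts)) w)"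
    if "\<forall>l\<in>set w. wf_lit S (map srt_of ts) l"
    using that by (induction w) (auto simp: evl_subst)
  then show ?thesis using assms PC by simp
qed

text \<open>Functoriality of evaluation. The typing conditions guarantee that the selectors
  \<open>tc\<close> and \<open>pc\<close> inside the substitution meet components of the right
  sort.\<close>

lemma ev_seq:
  assumes "wf_arrow S b" "tgt a = src b"
  shows "ev (a ;; b) h = ev b (ev a h)"
  using assms evc_subst[of S "tuple a" _ h] by (auto simp: ev_def seq_def wf_arrow_def tgt_def)

lemma evc_seq:
  assumes "wf_arrow S b" "tgt a = src b" "j < length (tuple b)"
  shows "evc (tuple (a ;; b) ! j) h = evc (tuple b ! j) (ev a h)"
  using assms evc_subst[of S "tuple a" "tuple b ! j" h] wf_nth[OF assms(1,3)]
  by (simp add: nth_tuple_seq ev_def tgt_def)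

lemma env_ev:
  assumes "wf_arrow S a" "env S (src a) h"
  shows "env S (tgt a) (ev a h)"
proof -
  have "val_ok S (srt_of c) (evc c h)" if c: "c \<in> set (tuple a)" for c
  proof (cases c)
    case (TC t)
    have "wf_trm S (t \<cdot>\<^sub>t (\<lambda>i. vt (h ! i)))"
    proof (rule wf_subst_trm)
      show "wf_trm S t" using assms(1) c TC by (auto simp: wf_arrow_def)
      fix i assume "i \<in> vars_trm t"
      then have "i < length (src a) \<and> src a ! i = Tm" using assms(1) c TC by (auto simp: wf_arrow_def)
      then show "wf_trm S (vt (h ! i))" using env_nth[OF assms(2), of i] by auto
    qed
    then show ?thesis using TC by simp
  qed simp
  then show ?thesis by (auto simp: env_def ev_def tgt_def)
qed

lemma ev_ident: "env S ob h \<Longrightarrow> ev (ident ob) h = h"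
proof (rule nth_equalityI)
  assume e: "env S ob h"
  then show "length (ev (ident ob) h) = length h" by (simp add: ev_def ident_def env_def)
  fix i assume "i < length (ev (ident ob) h)"
  then have "i < length ob" by (simp add: ev_def ident_def)
  then show "ev (ident ob) h ! i = h ! i"
    using env_nth[OF e, of i] by (cases "ob ! i") (auto simp: ev_def ident_def var_comp_def)
qed

lemma env_append:
  "length h1 = length ob1 \<Longrightarrow> env S (ob1 @ ob2) (h1 @ h2) \<longleftrightarrow> env S ob1 h1 \<and> env S ob2 h2"
  by (auto simp: env_def nth_append all_conj_distrib)

lemma env_split: "env S (ob1 @ ob2) h \<Longrightarrow> \<exists>h1 h2. h = h1 @ h2 \<and> env S ob1 h1 \<and> env S ob2 h2"
proof -
  assume e: "env S (ob1 @ ob2) h"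
  let ?h1 = "take (length ob1) h" and ?h2 = "drop (length ob1) h"
  have "length ?h1 = length ob1" using env_length[OF e] by simp
  then show ?thesis using e env_append[of ?h1 ob1 S ob2 ?h2] by (intro exI[of _ ?h1] exI[of _ ?h2]) simp
qed

lemma evl_left:
  assumes "wf_lit S ob l" "length h1 = length ob"
  shows "evl l (h1 @ h2) = evl l h1"
  using assms by (cases l) (auto simp: nth_append intro!: subst_atom_cong)

lemma evc_left:
  assumes "wf_comp S ob c" "length h1 = length ob"
  shows "evc c (h1 @ h2) = evc c h1"
proof (cases c)
  case (PC w)
  then have "map (\<lambda>l. evl l (h1 @ h2)) w = map (\<lambda>l. evl l h1) w"
    using assms evl_left[of S ob _ h1 h2] by (intro map_cong) auto
  then show ?thesis using PC by (simp only: evc.simps)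
qed (use assms in \<open>auto simp: nth_append intro!: subst_trm_cong\<close>)

lemma itm_left:
  assumes "wf_lit S ob l" "length h1 = length ob"
  shows "itm g (h1 @ h2) l = itm g h1 l"
  using assms by (cases l) (auto simp: nth_append intro!: subst_atom_cong)

lemma evl_shift: "length h1 = n \<Longrightarrow> evl (shift_lit n l) (h1 @ h2) = evl l h2"
  by (cases l) (auto simp: subst_atom_comp)

lemma evc_shift: "length h1 = n \<Longrightarrow> evc (shift_comp n c) (h1 @ h2) = evc c h2"
  by (cases c) (auto simp: subst_trm_comp evl_shift comp_def)

lemma itm_shift: "length h1 = n \<Longrightarrow> itm g (h1 @ h2) (shift_lit n l) = itm (\<lambda>m. g (n + m)) h2 l"
  by (cases l) (auto simp: subst_atom_comp)

lemma ev_par: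
  assumes "wf_arrow S a" "length h1 = length (src a)"
  shows "ev (a \<otimes> b) (h1 @ h2) = ev a h1 @ ev b h2"
  using assms by (auto simp: ev_def par_def wf_arrow_def evc_shift intro: evc_left)

lemma flat_itm: "flat (itm (\<lambda>m. vg (h ! m)) h l) = evl l h"
  by (cases l) auto

lemma concat_flat_itm: "concat (map flat (map (itm (\<lambda>m. vg (h ! m)) h) w)) = concat (map (\<lambda>l. evl l h) w)"
  by (simp add: comp_def flat_itm)

subsection \<open>Closure of configurations and observations\<close>

lemma tc_wf:
  assumes "i < length ts" "map srt_of ts ! i = Tm" "\<And>c. c \<in> set ts \<Longrightarrow> wf_comp S ob c"
  shows "wf_trm S (tc (ts ! i)) \<and> (\<forall>k\<in>vars_trm (tc (ts ! i)). k < length ob \<and> ob ! k = Tm)"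
  using assms(1,2) assms(3)[OF nth_mem[OF assms(1)]] by (cases "ts ! i") auto

lemma wf_lit_subst:
  assumes "wf_lit S (map srt_of ts) l" "\<And>c. c \<in> set ts \<Longrightarrow> wf_comp S ob c" "l' \<in> set (subst_lit l ((!) ts))"
  shows "wf_lit S ob l'"
proof (cases l)
  case (Lit A)
  have i: "wf_trm S (tc (ts ! i)) \<and> (\<forall>k\<in>vars_trm (tc (ts ! i)). k < length ob \<and> ob ! k = Tm)" if "i \<in> vars_atom A" for i
    using assms(1) Lit that by (intro tc_wf assms(2)) auto
  then have "wf_atom S (subst_atom A (tc \<circ> (!) ts))" using assms(1) Lit by (intro wf_subst_atom) auto
  then show ?thesis using i assms(3) Lit by (auto simp: vars_subst_atom)
next
  case (PVar i)
  then have "i < length ts" "map srt_of ts ! i = Pr" using assms(1) by auto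
  then show ?thesis using PVar assms(3) assms(2)[OF nth_mem[of i ts]] by (cases "ts ! i") auto
qed

lemma wf_comp_subst:
  assumes "wf_comp S (map srt_of ts) c" "\<And>c. c \<in> set ts \<Longrightarrow> wf_comp S ob c"
  shows "wf_comp S ob (subst_comp1 c ((!) ts))"
proof (cases c)
  case (TC t)
  have i: "wf_trm S (tc (ts ! i)) \<and> (\<forall>k\<in>vars_trm (tc (ts ! i)). k < length ob \<and> ob ! k = Tm)" if "i \<in> vars_trm t" for i
    using assms(1) TC that by (intro tc_wf assms(2)) auto
  then have "wf_trm S (t \<cdot>\<^sub>t (tc \<circ> (!) ts))" using assms(1) TC by (intro wf_subst_trm) auto
  then show ?thesis using i TC by (auto simp: vars_subst_trm)
next
  case (PC w)
  then show ?thesis using assms wf_lit_subst[OF _ assms(2), of ts] by auto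
qed

lemma wf_arrow_seq: "wf_arrow S a \<Longrightarrow> wf_arrow S b \<Longrightarrow> tgt a = src b \<Longrightarrow> wf_arrow S (a ;; b)"
  using wf_comp_subst[of S "tuple a" _ "src a"] by (auto simp: wf_arrow_def seq_def tgt_def)

lemma wf_lit_append1: "wf_lit S ob l \<Longrightarrow> wf_lit S (ob @ ob') l"
  by (cases l) (auto simp: nth_append)

lemma wf_comp_append1: "wf_comp S ob c \<Longrightarrow> wf_comp S (ob @ ob') c"
  by (cases c) (auto simp: nth_append wf_lit_append1)

lemma wf_lit_shift: "wf_lit S ob' l \<Longrightarrow> wf_lit S (ob @ ob') (shift_lit (length ob) l)"
  by (cases l) (auto simp: vars_subst_atom intro!: wf_subst_atom)

lemma wf_comp_shift: "wf_comp S ob' c \<Longrightarrow> wf_comp S (ob @ ob') (shift_comp (length ob) c)"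
  by (cases c) (auto simp: vars_subst_trm wf_lit_shift intro!: wf_subst_trm)

lemma wf_arrow_par: "wf_arrow S a \<Longrightarrow> wf_arrow S b \<Longrightarrow> wf_arrow S (a \<otimes> b)"
  by (auto simp: wf_arrow_def par_def wf_comp_append1 wf_comp_shift)

lemma is_conf_wf: "is_conf S a \<Longrightarrow> wf_arrow S a"
  by (simp add: is_conf_def wf_arrow_def)

lemma is_obs_wf: "is_obs S a \<Longrightarrow> wf_arrow S a"
  by (simp add: is_obs_def wf_arrow_def)

lemma is_obs_seq:
  assumes "is_obs S a" "is_obs S b" "tgt a = src b"
  shows "is_obs S (a ;; b)"
proof -
  have "(\<exists>t. c = TC t) \<or> (\<exists>i. c = PC [PVar i])" if c: "c \<in> set (tuple (a ;; b))" for c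
  proof -
    obtain c' where c': "c' \<in> set (tuple b)" "c = subst_comp1 c' ((!) (tuple a))" using c by (auto simp: seq_def)
    consider t where "c' = TC t" | i where "c' = PC [PVar i]" using assms(2) c' by (auto simp: is_obs_def)
    then show ?thesis
    proof cases
      case 2
      then have i: "i < length (tuple a)" "tgt a ! i = Pr" using assms(2,3) c'(1) by (auto simp: is_obs_def length_tuple)
      then obtain w where w: "tuple a ! i = PC w" by (auto simp: tgt_nth_Pr)
      then have "\<exists>k. w = [PVar k]" using assms(1) i(1) by (metis component.distinct(1) component.inject(2) is_obs_def nth_mem)
      then show ?thesis using 2 c' w by auto
    qed (use c' in simp)
  qed
  then show ?thesis using wf_arrow_seq[OF is_obs_wf[OF assms(1)] is_obs_wf[OF assms(2)] assms(3)]
    by (auto simp: is_obs_def wf_arrow_def)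
qed

lemma is_obs_par: "is_obs S a \<Longrightarrow> is_obs S b \<Longrightarrow> is_obs S (a \<otimes> b)"
  using wf_arrow_par[of S a b]
  by (fastforce simp: is_obs_def wf_arrow_def par_def)

lemma pvars_comp_shift: "pvars_comp (shift_comp n c) = map ((+) n) (pvars_comp c)"
proof (cases c)
  case (PC w)
  have "pvars_lit (shift_lit n l) = map ((+) n) (pvars_lit l)" for l :: "('a, 'b) lit" by (cases l) auto
  then show ?thesis using PC by (simp add: comp_def map_concat)
qed simp

lemma pvars_lit_subst:
  assumes "wf_lit S (map srt_of ts) l"
  shows "concat (map pvars_lit (subst_lit l ((!) ts))) = concat (map (\<lambda>m. pvars_comp (ts ! m)) (pvars_lit l))"
proof (cases l)
  case (PVar i)
  then show ?thesis using assms by (cases "ts ! i") auto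
qed simp

lemma pvars_comp_subst:
  assumes "wf_comp S (map srt_of ts) c"
  shows "pvars_comp (subst_comp1 c ((!) ts)) = concat (map (\<lambda>m. pvars_comp (ts ! m)) (pvars_comp c))"
proof (cases c)
  case (PC w)
  have "concat (map pvars_lit (concat (map (\<lambda>l. subst_lit l ((!) ts)) w))) = concat (map (\<lambda>m. pvars_comp (ts ! m)) (concat (map pvars_lit w)))"
    if "\<forall>l\<in>set w. wf_lit S (map srt_of ts) l"
    using that by (induction w) (auto simp: pvars_lit_subst)
  then show ?thesis using assms PC by simp
qed simp

definition pvars :: "('p, 'f) arrow \<Rightarrow> nat list" where
  "pvars a = concat (map pvars_comp (tuple a))"

lemma is_conf_alt: "is_conf S a \<longleftrightarrow> wf_arrow S a \<and> distinct (pvars a) \<and> set (pvars a) = {i. i < length (src a) \<and> src a ! i = Pr}"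
  by (simp add: is_conf_def wf_arrow_def pvars_def)

lemma pvars_seq:
  assumes "wf_arrow S b" "tgt a = src b"
  shows "pvars (a ;; b) = concat (map (\<lambda>m. pvars_comp (tuple a ! m)) (pvars b))"
proof -
  have "concat (map pvars_comp (map (\<lambda>c. subst_comp1 c ((!) (tuple a))) cs)) = concat (map (\<lambda>m. pvars_comp (tuple a ! m)) (concat (map pvars_comp cs)))"
    if "\<forall>c\<in>set cs. wf_comp S (map srt_of (tuple a)) c" for cs
    using that by (induction cs) (auto simp: pvars_comp_subst)
  then show ?thesis using assms by (simp add: pvars_def seq_def wf_arrow_def tgt_def)
qed

lemma mset_concat_map_cong:
  assumes "mset ys = mset xs"
  shows "mset (concat (map f ys)) = mset (concat (map f xs))"
  by (rule adjacent_swaps_induct[where Q = "\<lambda>ys. mset (concat (map f ys)) = mset (concat (map f xs))", OF refl assms])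
    (simp add: ac_simps)

text \<open>Each component of sort \<open>p\<close> of \<open>a\<close> is used once by
  \<open>b\<close>, and components of sort \<open>t\<close> contain no variable of sort
  \<open>p\<close>. Hence the composite has the same such variables as \<open>a\<close>, in another
  order.\<close>

lemma is_conf_seq:
  assumes a: "is_conf S a" and b: "is_conf S b" and ab: "tgt a = src b"
  shows "is_conf S (a ;; b)"
proof -
  let ?f = "\<lambda>m. pvars_comp (tuple a ! m)"
  let ?n = "length (tuple a)"
  let ?F = "filter (\<lambda>i. tgt a ! i = Pr) [0..<?n]"
  have "mset (pvars b) = mset ?F"
    using b ab by (subst set_eq_iff_mset_eq_distinct[symmetric]) (auto simp: is_conf_alt length_tuple)
  then have F: "mset (concat (map ?f (pvars b))) = mset (concat (map ?f ?F))"
    by (rule mset_concat_map_cong)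
  have filt: "concat (map ?f (filter (\<lambda>i. tgt a ! i = Pr) is)) = concat (map ?f is)" if "set is \<subseteq> {..<?n}" for "is"
    using that
  proof (induction "is")
    case (Cons i "is")
    have "?f i = []" if "tgt a ! i \<noteq> Pr" using that Cons.prems by (cases "tuple a ! i") (auto simp: tgt_def)
    then show ?case using Cons by auto
  qed simp
  have "concat (map ?f ?F) = concat (map ?f [0..<?n])" by (rule filt) auto
  moreover have "map ?f [0..<?n] = map pvars_comp (tuple a)" by (auto intro: nth_equalityI)
  ultimately have m: "mset (pvars (a ;; b)) = mset (pvars a)" using F pvars_seq[OF is_conf_wf[OF b] ab]
    by (simp only: pvars_def)
  show ?thesis unfolding is_conf_alt
    using a wf_arrow_seq[OF is_conf_wf[OF a] is_conf_wf[OF b] ab] mset_eq_imp_distinct_iff[OF m] mset_eq_setD[OF m]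
    by (simp add: is_conf_alt)
qed

lemma is_conf_par:
  assumes "is_conf S a" "is_conf S b"
  shows "is_conf S (a \<otimes> b)"
proof -
  have p: "pvars (a \<otimes> b) = pvars a @ map ((+) (length (src a))) (pvars b)"
    by (simp add: pvars_def par_def comp_def pvars_comp_shift map_concat)
  have pa: "i \<in> set (pvars a) \<longleftrightarrow> i < length (src a) \<and> src a ! i = Pr"
    and pb: "i \<in> set (pvars b) \<longleftrightarrow> i < length (src b) \<and> src b ! i = Pr" for i
    using assms unfolding is_conf_alt by simp_all
  have "set (pvars (a \<otimes> b)) = {i. i < length (src (a \<otimes> b)) \<and> src (a \<otimes> b) ! i = Pr}"
  proof -
    have "i \<in> set (pvars (a \<otimes> b)) \<longleftrightarrow> i < length (src (a \<otimes> b)) \<and> src (a \<otimes> b) ! i = Pr" for i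
    proof (cases "i < length (src a)")
      case True
      then show ?thesis using pa[of i] by (auto simp: p nth_append)
    next
      case False
      then obtain k where k: "i = length (src a) + k" by (metis le_Suc_ex not_less)
      have "i \<in> set (pvars (a \<otimes> b)) \<longleftrightarrow> k \<in> set (pvars b)" using pa[of i] by (auto simp: p k)
      then show ?thesis using pb[of k] by (simp add: k nth_append)
    qed
    then show ?thesis by (intro set_eqI) (simp only: mem_Collect_eq)
  qed
  moreover have d: "distinct (pvars a)" "distinct (pvars b)" and lt: "\<And>i. i \<in> set (pvars a) \<Longrightarrow> i < length (src a)"
    using assms unfolding is_conf_alt by simp_all
  have "distinct (pvars (a \<otimes> b))"
    unfolding p distinct_append
  proof (intro conjI)
    show "distinct (map ((+) (length (src a))) (pvars b))" using d by (simp add: distinct_map)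
    show "set (pvars a) \<inter> set (map ((+) (length (src a))) (pvars b)) = {}" using lt by force
  qed (rule d)
  moreover have "wf_arrow S (a \<otimes> b)" using assms by (intro wf_arrow_par is_conf_wf)
  ultimately show ?thesis unfolding is_conf_alt by blast
qed

subsection \<open>The invariant of entailed tiles\<close>

definition typed :: "('p, 'f) signature \<Rightarrow> ('p, 'f) arrow \<Rightarrow> ('p, 'f) arrow \<Rightarrow> ('p, 'f) arrow \<Rightarrow> ('p, 'f) arrow \<Rightarrow> bool" where
  "typed S s u v r \<longleftrightarrow> is_conf S s \<and> is_conf S r \<and> is_obs S u \<and> is_obs S v \<and>
     tgt s = tgt u \<and> src s = tgt v \<and> src u = tgt r \<and> src v = src r"

text \<open>An observation may copy or drop a variable of sort \<open>p\<close>. Where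
  \<open>u\<close> does this, the final configuration has to be a bare variable; a tile attached to
  it vertically can then only leave that component alone, which keeps the intermediate value
  determined.\<close>

definition linear_trigger :: "('p, 'f) arrow \<Rightarrow> ('p, 'f) arrow \<Rightarrow> bool" where
  "linear_trigger u r \<longleftrightarrow> (\<forall>i<length (src u). src u ! i = Pr \<longrightarrow> (\<exists>!j. pvar_at u j i) \<or> (\<exists>k. tuple r ! i = PC [PVar k]))"

text \<open>One half of the weak pullback: every environment for the common source of effect and
  final configuration yields a solution. At sort \<open>p\<close> the claim is made for labels, a
  variable being labelled by its index in the source of the effect; the derivation thus cannot
  depend on the goals that the variables will receive.\<close>

definition sound where
  "sound S P D s u v r \<longleftrightarrow> (\<forall>h. env S (src v) h \<longrightarrow>
     (\<forall>j<length (tuple s). tgt s ! j = Tm \<longrightarrow> evc (tuple s ! j) (ev v h) = evc (tuple u ! j) (ev r h)) \<and>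
     (\<forall>j i. pvar_at u j i \<longrightarrow> der S P (D j) (map (itm (pidx v) (ev v h)) (pc (tuple s ! j))) (map (itm id h) (pc (tuple r ! i)))))"

text \<open>Here the labels are the goals assigned by \<open>\<alpha>\<close>, and the result of a
  derivation is compared with the trigger after flattening only.\<close>

definition solves where
  "solves S P D s u \<alpha> \<beta> \<longleftrightarrow> (\<forall>j<length (tuple s).
     (tgt s ! j = Tm \<longrightarrow> evc (tuple s ! j) \<alpha> = evc (tuple u ! j) \<beta>) \<and>
     (tgt s ! j = Pr \<longrightarrow> (\<exists>ms. der S P (D j) (map (itm (\<lambda>m. vg (\<alpha> ! m)) \<alpha>) (pc (tuple s ! j))) ms \<and>
        evc (tuple u ! j) \<beta> = VG (concat (map flat ms)))))"

text \<open>The other half of the weak pullback: a mediating environment exists, and its uniqueness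
  is not claimed.\<close>

definition complete_tile where
  "complete_tile S P D s u v r \<longleftrightarrow> (\<forall>\<alpha> \<beta>. env S (src s) \<alpha> \<longrightarrow> env S (src u) \<beta> \<longrightarrow> solves S P D s u \<alpha> \<beta> \<longrightarrow>
     (\<exists>h. env S (src v) h \<and> \<alpha> = ev v h \<and> \<beta> = ev r h))"

lemma typedD:
  assumes "typed S s u v r"
  shows "is_conf S s" "is_conf S r" "is_obs S u" "is_obs S v" "wf_arrow S s" "wf_arrow S r" "wf_arrow S u" "wf_arrow S v"
    "tgt s = tgt u" "src s = tgt v" "src u = tgt r" "src v = src r" "length (tuple s) = length (tuple u)"
  using assms by (auto simp: typed_def length_tuple intro: is_conf_wf is_obs_wf)

lemma obs_Pr:
  assumes "is_obs S u" "j < length (tuple u)" "tgt u ! j = Pr"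
  shows "\<exists>i. pvar_at u j i \<and> i < length (src u) \<and> src u ! i = Pr"
proof -
  obtain w where w: "tuple u ! j = PC w" using assms(2,3) by (auto simp: tgt_nth_Pr)
  have c: "wf_comp S (src u) (tuple u ! j) \<and> ((\<exists>t. tuple u ! j = TC t) \<or> (\<exists>i. tuple u ! j = PC [PVar i]))"
    using assms(1,2) by (simp add: is_obs_def)
  then obtain i where "w = [PVar i]" using w by auto
  then show ?thesis using c w assms(2) by (auto simp: pvar_at_def)
qed

lemma pvar_atD:
  assumes "is_obs S u" "pvar_at u j i"
  shows "j < length (tuple u)" "tgt u ! j = Pr" "i < length (src u)" "src u ! i = Pr" "tuple u ! j = PC [PVar i]"
proof -
  show j: "j < length (tuple u)" and t: "tuple u ! j = PC [PVar i]" using assms(2) by (simp_all add: pvar_at_def)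
  then show "tgt u ! j = Pr" by (simp add: tgt_nth_Pr)
  have "wf_comp S (src u) (tuple u ! j)" using assms(1) j by (simp add: is_obs_def)
  then show "i < length (src u)" "src u ! i = Pr" using t by simp_all
qed

lemma env_exists: "\<exists>h :: ('p, 'f, 'v) val list. env S ob h"
  by (intro exI[of _ "map (\<lambda>b. case b of Tm \<Rightarrow> VT (Var undefined) | Pr \<Rightarrow> VG []) ob"])
    (auto simp: env_def split: srt.split intro: srt.exhaust)

lemma labels_itm: "concat (map labels1 (map (itm g h) w)) = map g (concat (map pvars_lit w))"
proof -
  have "labels1 (itm g h l) = map g (pvars_lit l)" for l by (cases l) auto
  then show ?thesis by (simp add: comp_def map_concat)
qed

lemma itm_eq_Ot: "itm g h l = Ot x \<Longrightarrow> \<exists>m. l = PVar m \<and> x = g m"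
  by (cases l) auto

text \<open>The shape of a skeleton can be read off from soundness at any single environment, and
  some environment exists for every object.\<close>

lemma sound_facts:
  fixes P :: "('p, 'f, 'v) clause set"
  assumes t: "typed S s u v r" and sd: "sound S P D s u v r" and j: "pvar_at u j i"
  shows "length (D j) = length (pc (tuple s ! j))"
    and "q < length (pc (tuple s ! j)) \<Longrightarrow> pc (tuple s ! j) ! q = PVar m \<Longrightarrow> D j ! q = Leaf"
    and "map (pidx v) (pvars_comp (tuple s ! j)) = pvars_comp (tuple r ! i)"
    and "length (pc (tuple r ! i)) = leaf_count (D j)"
    and "tuple s ! j = PC [PVar m] \<Longrightarrow> tuple r ! i = PC [PVar (pidx v m)]"
proof -
  note T = typedD[OF t]
  obtain h :: "('p, 'f, 'v) val list" where h: "env S (src v) h" using env_exists by blast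
  have d: "der S P (D j) (map (itm (pidx v) (ev v h)) (pc (tuple s ! j))) (map (itm id h) (pc (tuple r ! i)))"
    using sd h j unfolding sound_def by blast
  obtain w where w: "tuple s ! j = PC w"
    using pvar_atD[OF T(3) j] T(9,13) by (metis tgt_nth_Pr)
  obtain w' where w': "tuple r ! i = PC w'"
    using pvar_atD[OF T(3) j] T(11) by (metis tgt_nth_Pr length_tuple)
  show "length (D j) = length (pc (tuple s ! j))" using der_length[OF d] by simp
  show "D j ! q = Leaf" if "q < length (pc (tuple s ! j))" "pc (tuple s ! j) ! q = PVar m" for q m
    by (rule der_Ot_Leaf[OF d, of q "pidx v m"]) (use that in auto)
  show "map (pidx v) (pvars_comp (tuple s ! j)) = pvars_comp (tuple r ! i)"
    using der_labels[OF d] unfolding labels_itm w w' by simp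
  show "length (pc (tuple r ! i)) = leaf_count (D j)" using der_leaf_count[OF d] by simp
  assume s: "tuple s ! j = PC [PVar m]"
  have "map (itm id h) w' = [Ot (pidx v m)]"
    using der_all_Ot[OF d] s w' by simp
  then obtain l where "w' = [l]" "itm id h l = Ot (pidx v m)" by (auto simp: map_eq_Cons_conv)
  then show "tuple r ! i = PC [PVar (pidx v m)]" using w' itm_eq_Ot[of id h l "pidx v m"] by auto
qed

lemma distinct_concat_nth:
  assumes "distinct (concat xss)" "j < length xss" "j' < length xss" "x \<in> set (xss ! j)" "x \<in> set (xss ! j')"
  shows "j = j'"
  using assms
proof (induction xss arbitrary: j j')
  case (Cons xs xss)
  show ?case
  proof (cases j; cases j')
    fix a b assume "j = Suc a" "j' = Suc b"
    then show ?thesis using Cons.IH[of a b] Cons.prems by simp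
  qed (use Cons.prems in \<open>force simp: in_set_conv_nth\<close>)+
qed simp

lemma pvars_comp_PC: "m \<in> set (pvars_comp (PC w)) \<longleftrightarrow> (\<exists>q<length w. w ! q = PVar m)"
proof -
  have "m \<in> set (pvars_lit l) \<longleftrightarrow> l = PVar m" for l :: "('a, 'b) lit" by (cases l) auto
  then show ?thesis by (auto simp: in_set_conv_nth)
qed

lemma conf_unique_comp:
  assumes "is_conf S s" "j < length (tuple s)" "j' < length (tuple s)" "m \<in> set (pvars_comp (tuple s ! j))" "m \<in> set (pvars_comp (tuple s ! j'))"
  shows "j = j'"
  by (rule distinct_concat_nth[of "map pvars_comp (tuple s)" j j' m]) (use assms in \<open>auto simp: is_conf_def\<close>)

lemma conf_unique:
  assumes c: "is_conf S s" and j: "j < length (tuple s)" "tuple s ! j = PC w" "q < length w" "w ! q = PVar m"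
    and j': "j' < length (tuple s)" "tuple s ! j' = PC w'" "q' < length w'" "w' ! q' = PVar m"
  shows "j = j' \<and> q = q'"
proof -
  have "m \<in> set (pvars_comp (tuple s ! j))" "m \<in> set (pvars_comp (tuple s ! j'))"
    using j j' by (auto simp: pvars_comp_PC simp del: pvars_comp.simps)
  then have jj: "j = j'" by (rule conf_unique_comp[OF c j(1) j'(1)])
  have "distinct (concat (map pvars_comp (tuple s)))" using c by (simp add: is_conf_def)
  then have "distinct (pvars_comp (tuple s ! j))" using j(1) by (simp add: distinct_concat_iff)
  then have "distinct (concat (map pvars_lit w))" using j(2) by simp
  moreover have "w' = w" using j(2) j'(2) jj by simp
  ultimately have "q = q'" using j(3,4) j'(3,4) by (intro distinct_concat_nth[of "map pvars_lit w" q q' m]) auto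
  then show ?thesis using jj by simp
qed

lemma conf_exists:
  assumes c: "is_conf S s" and m: "m < length (src s)" "src s ! m = Pr"
  shows "\<exists>j w q. j < length (tuple s) \<and> tuple s ! j = PC w \<and> q < length w \<and> w ! q = PVar m"
proof -
  have "m \<in> set (concat (map pvars_comp (tuple s)))" using c m by (simp add: is_conf_def)
  then obtain c where "c \<in> set (tuple s)" "m \<in> set (pvars_comp c)" by auto
  then obtain j where j: "j < length (tuple s)" "m \<in> set (pvars_comp (tuple s ! j))" by (metis in_set_conv_nth)
  then obtain w where w: "tuple s ! j = PC w" by (cases "tuple s ! j") auto
  then show ?thesis using j pvars_comp_PC[of m w] by auto
qed

lemma conf_pvar_src:
  assumes "wf_arrow S s" "j < length (tuple s)" "m \<in> set (pvars_comp (tuple s ! j))"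
  shows "m < length (src s) \<and> src s ! m = Pr"
proof -
  obtain w where w: "tuple s ! j = PC w" using assms(3) by (cases "tuple s ! j") auto
  then obtain q where "q < length w" "w ! q = PVar m" using assms(3) pvars_comp_PC[of m w] by auto
  then show ?thesis using wf_nth[OF assms(1,2)] w by (metis nth_mem wf_comp.simps(2) wf_lit.simps(2))
qed

section \<open>Closure of the invariant under horizontal and vertical composition\<close>

lemma typed_horizontal:
  assumes "typed S s1 u1 v1 r1" "typed S s2 v1 v2 r2"
  shows "typed S (s2 ;; s1) u1 v2 (r2 ;; r1)"
  using assms by (auto simp: typed_def intro: is_conf_seq)

lemma typed_vertical:
  assumes "typed S s1 u1 v1 r1" "typed S r1 u2 v2 r2"
  shows "typed S s1 (u2 ;; u1) (v2 ;; v1) r2"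
  using assms by (auto simp: typed_def intro: is_obs_seq)

lemma typed_parallel:
  assumes "typed S s1 u1 v1 r1" "typed S s2 u2 v2 r2"
  shows "typed S (s1 \<otimes> s2) (u1 \<otimes> u2) (v1 \<otimes> v2) (r1 \<otimes> r2)"
  using assms by (auto simp: typed_def intro: is_conf_par is_obs_par)

lemma pvar_at_seq:
  assumes "is_obs S u2" "is_obs S u1" "tgt u2 = src u1"
  shows "pvar_at (u2 ;; u1) j i \<longleftrightarrow> (\<exists>k. pvar_at u1 j k \<and> pvar_at u2 k i)"
proof
  assume *: "pvar_at (u2 ;; u1) j i"
  then have j: "j < length (tuple u1)" "subst_comp1 (tuple u1 ! j) ((!) (tuple u2)) = PC [PVar i]"
    by (auto simp: pvar_at_def nth_tuple_seq)
  then have "tgt u1 ! j = Pr" by (cases "tuple u1 ! j") (auto simp: tgt_def)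
  then obtain k where k: "pvar_at u1 j k" "k < length (src u1)" "src u1 ! k = Pr" using obs_Pr[OF assms(2) j(1)] by blast
  then have "pc (tuple u2 ! k) = [PVar i]" using j by (simp add: pvar_at_def)
  moreover have k2: "k < length (tuple u2)" using k(2) assms(3) by (simp add: length_tuple)
  ultimately show "\<exists>k. pvar_at u1 j k \<and> pvar_at u2 k i"
    using k assms(3) tgt_nth_Pr[OF k2] by (auto simp: pvar_at_def)
next
  assume "\<exists>k. pvar_at u1 j k \<and> pvar_at u2 k i"
  then show "pvar_at (u2 ;; u1) j i" by (auto simp: pvar_at_def nth_tuple_seq)
qed

lemma pidx_seq:
  assumes "is_obs S v2" "is_obs S v1" "tgt v2 = src v1" "m < length (tuple v1)" "tgt v1 ! m = Pr"
  shows "pidx (v2 ;; v1) m = pidx v2 (pidx v1 m)"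
proof -
  obtain k where k: "pvar_at v1 m k" "k < length (src v1)" "src v1 ! k = Pr" using obs_Pr[OF assms(2,4,5)] by blast
  obtain l where l: "pvar_at v2 k l" using obs_Pr[OF assms(1), of k] k assms(3) by (auto simp: length_tuple)
  have "pvar_at (v2 ;; v1) m l" using pvar_at_seq[OF assms(1-3)] k l by blast
  then show ?thesis using k l by (simp add: pvar_at_pidx)
qed

text \<open>Suppose the condition fails at \<open>i\<close>. Then \<open>r1\<close> has a bare
  variable \<open>k\<close> there, and by the condition for the second tile \<open>k\<close> occurs
  in \<open>v1\<close> exactly once, at some \<open>m\<close>. Every component of \<open>s1\<close>
  that belongs to \<open>i\<close> must contain \<open>m\<close>, and linearity of configurations
  leaves exactly one such component, a contradiction.\<close>

lemma linear_horizontal: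
  fixes P :: "('p, 'f, 'v) clause set"
  assumes t1: "typed S s1 u1 v1 r1" and t2: "typed S s2 v1 v2 r2" and sd: "sound S P D1 s1 u1 v1 r1"
    and l1: "linear_trigger u1 r1" and l2: "linear_trigger v1 r2"
  shows "linear_trigger u1 (r2 ;; r1)"
  unfolding linear_trigger_def
proof (intro allI impI)
  note T1 = typedD[OF t1] and T2 = typedD[OF t2]
  fix i assume i: "i < length (src u1)" "src u1 ! i = Pr"
  show "(\<exists>!j. pvar_at u1 j i) \<or> (\<exists>k. tuple (r2 ;; r1) ! i = PC [PVar k])"
  proof (rule disjCI)
    assume nk: "\<nexists>k. tuple (r2 ;; r1) ! i = PC [PVar k]"
    show "\<exists>!j. pvar_at u1 j i"
    proof (rule ccontr)
      assume nj: "\<not> (\<exists>!j. pvar_at u1 j i)"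
      then obtain k where k: "tuple r1 ! i = PC [PVar k]" using l1 i unfolding linear_trigger_def by blast
      have ir: "i < length (tuple r1)" using i T1(11) by (simp add: length_tuple)
      have ksrc: "k < length (src r1)" "src r1 ! k = Pr" using conf_pvar_src[OF T1(6) ir, of k] k by auto
      have "\<exists>!m. pvar_at v1 m k"
      proof (rule ccontr)
        assume "\<not> (\<exists>!m. pvar_at v1 m k)"
        then obtain l where "tuple r2 ! k = PC [PVar l]" using l2 ksrc T1(12) unfolding linear_trigger_def by auto
        then have "tuple (r2 ;; r1) ! i = PC [PVar l]" using k ir by (simp add: nth_tuple_seq)
        then show False using nk by blast
      qed
      then obtain m where m: "pvar_at v1 m k" "\<And>m'. pvar_at v1 m' k \<Longrightarrow> m' = m" by blast
      have mt: "m < length (src s1)" "src s1 ! m = Pr" using pvar_atD[OF T1(4) m(1)] T1(10) by (auto simp: length_tuple)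
      \<comment> \<open>Soundness matches the variables of \<open>s1\<close> at \<open>j\<close>
        with those of \<open>r1\<close> at \<open>i\<close>: there is a single one, and
        \<open>v1\<close> sends it to \<open>k\<close>.\<close>
      have mem: "m \<in> set (pvars_comp (tuple s1 ! j))" if "pvar_at u1 j i" for j
      proof -
        have "map (pidx v1) (pvars_comp (tuple s1 ! j)) = [k]" using sound_facts(3)[OF t1 sd that] k by simp
        then obtain m' where m': "pvars_comp (tuple s1 ! j) = [m']" "pidx v1 m' = k" by (auto simp: map_eq_Cons_conv)
        have "j < length (tuple s1)" using that T1(13) by (simp add: pvar_at_def)
        then have "m' < length (src s1)" "src s1 ! m' = Pr" using conf_pvar_src[OF T1(5), of j m'] m' by auto
        then obtain k' where "pvar_at v1 m' k'" using obs_Pr[OF T1(4), of m'] T1(10) by (auto simp: length_tuple)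
        then have "pvar_at v1 m' k" using m'(2) pvar_at_pidx by blast
        then show ?thesis using m(2) m'(1) by auto
      qed
      \<comment> \<open>For existence, the component of \<open>s1\<close> with \<open>m\<close>
        belongs to some \<open>i'\<close>, and \<open>i' = i\<close> because \<open>k\<close> occurs
        in \<open>r1\<close> only once.\<close>
      obtain j where j: "j < length (tuple s1)" "m \<in> set (pvars_comp (tuple s1 ! j))"
        using conf_exists[OF T1(1) mt] pvars_comp_PC by metis
      then have "tgt u1 ! j = Pr" using T1(9) tgt_nth_Pr[OF j(1)] by (cases "tuple s1 ! j") auto
      then obtain i' where i': "pvar_at u1 j i'" "i' < length (src u1)" using obs_Pr[OF T1(3), of j] j(1) T1(13) by auto
      have "pidx v1 m \<in> set (pvars_comp (tuple r1 ! i'))"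
        using sound_facts(3)[OF t1 sd i'(1)] j(2) by (metis image_eqI set_map)
      then have "k \<in> set (pvars_comp (tuple r1 ! i'))" using m(1) pvar_at_pidx by metis
      then have "i' = i" using conf_unique_comp[OF T1(2), of i' i k] k ir i'(2) T1(11) by (simp add: length_tuple)
      then have "pvar_at u1 j i" using i' by simp
      moreover have "j' = j" if "pvar_at u1 j' i" for j'
        using conf_unique_comp[OF T1(1), of j' j m] mem[OF that] j that T1(13) by (simp add: pvar_at_def)
      ultimately show False using nj by blast
    qed
  qed
qed

text \<open>If \<open>u2\<close> uses \<open>i\<close> exactly once, through \<open>k\<close>, then
  either \<open>u1\<close> uses \<open>k\<close> exactly once or \<open>r1\<close> has a bare
  variable at \<open>k\<close>. In the latter case soundness carries the bare variable on to
  \<open>r2\<close>.\<close>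

lemma linear_vertical:
  fixes P :: "('p, 'f, 'v) clause set"
  assumes t1: "typed S s1 u1 v1 r1" and t2: "typed S r1 u2 v2 r2" and sd: "sound S P D2 r1 u2 v2 r2"
    and l1: "linear_trigger u1 r1" and l2: "linear_trigger u2 r2"
  shows "linear_trigger (u2 ;; u1) r2"
  unfolding linear_trigger_def
proof (intro allI impI)
  note T1 = typedD[OF t1] and T2 = typedD[OF t2]
  have seq: "pvar_at (u2 ;; u1) j i \<longleftrightarrow> (\<exists>k. pvar_at u1 j k \<and> pvar_at u2 k i)" for j i
    by (rule pvar_at_seq[OF T2(3) T1(3)]) (use T1(11) T2(9) in simp)
  fix i assume i: "i < length (src (u2 ;; u1))" "src (u2 ;; u1) ! i = Pr"
  then have "(\<exists>!k. pvar_at u2 k i) \<or> (\<exists>l. tuple r2 ! i = PC [PVar l])"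
    using l2 unfolding linear_trigger_def by simp
  then consider (lin) "\<exists>!k. pvar_at u2 k i" | (var) l where "tuple r2 ! i = PC [PVar l]" by blast
  then show "(\<exists>!j. pvar_at (u2 ;; u1) j i) \<or> (\<exists>k. tuple r2 ! i = PC [PVar k])"
  proof cases
    case lin
    then obtain k where k: "pvar_at u2 k i" "\<And>k'. pvar_at u2 k' i \<Longrightarrow> k' = k" by blast
    have ks: "k < length (src u1)" "src u1 ! k = Pr" using pvar_atD[OF T2(3) k(1)] T1(11) T2(9) by (auto simp: length_tuple)
    show ?thesis
    proof (cases "\<exists>!j. pvar_at u1 j k")
      case True
      then have "\<exists>!j. pvar_at (u2 ;; u1) j i" unfolding seq using k by metis
      then show ?thesis ..
    next
      case False
      then obtain l where "tuple r1 ! k = PC [PVar l]" using l1 ks unfolding linear_trigger_def by blast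
      then show ?thesis using sound_facts(5)[OF t2 sd k(1)] by blast
    qed
  qed blast
qed

lemma itm_subst_Lit:
  assumes "wf_lit S (map srt_of ts) (Lit A)"
  shows "map (itm g h) (subst_lit (Lit A) ((!) ts)) = [At (subst_atom A (\<lambda>i. vt (map (\<lambda>c. evc c h) ts ! i)))]"
  using subst_atom_evc[OF assms, of h] by simp

lemma itm_seq_Lit:
  assumes "wf_lit S (src b) (Lit A)" "tgt a = src b"
  shows "map (itm g h) (subst_lit (Lit A) ((!) (tuple a))) = [At (subst_atom A (\<lambda>i. vt (ev a h ! i)))]"
  using itm_subst_Lit[of S "tuple a" A g h] assms unfolding ev_def tgt_def by simp

lemma relabel_itm: "map (relabel f) (map (itm g h) w) = map (itm (\<lambda>m. f (g m)) h) w"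
proof -
  have "relabel f (itm g h l) = itm (\<lambda>m. f (g m)) h l" for l by (cases l) auto
  then show ?thesis by simp
qed

lemma itm_cong:
  assumes "\<And>m. PVar m \<in> set w \<Longrightarrow> g m = g' m"
  shows "map (itm g h) w = map (itm g' h) w"
proof (rule map_cong[OF refl])
  fix l assume l: "l \<in> set w"
  show "itm g h l = itm g' h l"
  proof (cases l)
    case (PVar m)
    then show ?thesis using assms[of m] l by simp
  qed simp
qed

lemma concat_flat_concat: "concat (map flat (concat xss)) = concat (map (\<lambda>xs. concat (map flat xs)) xss)"
  by (induction xss) auto

lemma wf_PC:
  assumes "wf_arrow S a" "j < length (tuple a)" "tuple a ! j = PC w" "l \<in> set w"
  shows "wf_lit S (src a) l"
  using wf_nth[OF assms(1,2)] assms(3,4) by simp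

lemma pc_nth_seq:
  assumes "j < length (tuple b)" "tuple b ! j = PC w"
  shows "pc (tuple (a ;; b) ! j) = concat (map (\<lambda>l. subst_lit l ((!) (tuple a))) w)"
  using assms by (simp add: nth_tuple_seq)

text \<open>The tree of an atom of \<open>s1\<close> is kept, and the leaf at a variable
  \<open>m\<close> is replaced by the forest for the component of \<open>s2\<close> that is
  substituted for \<open>m\<close>.\<close>

definition hskel where
  "hskel s1 D1 D2 j = map2 (\<lambda>l t. case l of Lit A \<Rightarrow> [t] | PVar m \<Rightarrow> D2 m) (pc (tuple s1 ! j)) (D1 j)"

text \<open>Composing with \<open>s2\<close> replaces labels by lists of items, and
  \<open>der_refine\<close> inserts the derivations of the second tile at the same places.\<close>

lemma sound_horizontal:
  fixes P :: "('p, 'f, 'v) clause set"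
  assumes t1: "typed S s1 u1 v1 r1" and t2: "typed S s2 v1 v2 r2"
    and sd1: "sound S P D1 s1 u1 v1 r1" and sd2: "sound S P D2 s2 v1 v2 r2"
  shows "sound S P (\<lambda>j. concat (hskel s1 D1 D2 j)) (s2 ;; s1) u1 v2 (r2 ;; r1)"
  unfolding sound_def
proof (intro allI impI conjI)
  note T1 = typedD[OF t1] and T2 = typedD[OF t2]
  have st: "tgt s2 = src s1" using T1(10) T2(9) by simp
  have rt: "tgt r2 = src r1" using T1(12) T2(11) by simp
  fix h :: "('p, 'f, 'v) val list" assume h: "env S (src v2) h"
  let ?h1 = "ev r2 h"
  have h1: "env S (src v1) ?h1" using env_ev[OF T2(6), of h] h T2(11,12) by simp
  have tm: "ev s2 (ev v2 h) ! m = ev v1 ?h1 ! m" if "m < length (src s1)" "src s1 ! m = Tm" for m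
  proof -
    have m: "m < length (tuple s2)" "tgt s2 ! m = Tm" "m < length (tuple v1)" using that st T2(13) by (auto simp: length_tuple)
    then have "evc (tuple s2 ! m) (ev v2 h) = evc (tuple v1 ! m) ?h1" using sd2 h unfolding sound_def by blast
    then show ?thesis using m by (simp add: ev_def)
  qed
  have er1: "ev (r2 ;; r1) h = ev r1 ?h1" by (rule ev_seq[OF T1(6) rt])
  { fix j assume j: "j < length (tuple (s2 ;; s1))" "tgt (s2 ;; s1) ! j = Tm"
    then obtain t where t: "tuple s1 ! j = TC t" by (auto simp: tgt_nth_Tm)
    have "evc (tuple (s2 ;; s1) ! j) (ev v2 h) = evc (tuple s1 ! j) (ev s2 (ev v2 h))"
      by (rule evc_seq[OF T1(5) st]) (use j in simp)
    also have "\<dots> = evc (tuple s1 ! j) (ev v1 ?h1)" unfolding t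
      by (rule evc_TC_cong[of S "src s1"]) (use wf_nth[OF T1(5), of j] t j tm in auto)
    also have "\<dots> = evc (tuple u1 ! j) (ev r1 ?h1)" using sd1 h1 j unfolding sound_def by simp
    finally show "evc (tuple (s2 ;; s1) ! j) (ev v2 h) = evc (tuple u1 ! j) (ev (r2 ;; r1) h)" unfolding er1 . }
  fix j i assume ji: "pvar_at u1 j i"
  have j: "j < length (tuple s1)" using ji T1(13) by (simp add: pvar_at_def)
  obtain w where w: "tuple s1 ! j = PC w" using pvar_atD[OF T1(3) ji] T1(9) tgt_nth_Pr[OF j] by auto
  have i: "i < length (tuple r1)" "tgt r1 ! i = Pr" using pvar_atD[OF T1(3) ji] T1(11) by (auto simp: length_tuple)
  then obtain w' where w': "tuple r1 ! i = PC w'" by (auto simp: tgt_nth_Pr)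
  have d1: "der S P (D1 j) (map (itm (pidx v1) (ev v1 ?h1)) w) (map (itm id ?h1) w')"
    using sd1 h1 ji w w' unfolding sound_def by fastforce
  have len: "length (D1 j) = length w" using sound_facts(1)[OF t1 sd1 ji] w by simp
  let ?X = "map (\<lambda>l. map (itm (pidx v2) (ev v2 h)) (subst_lit l ((!) (tuple s2)))) w"
  let ?\<phi> = "\<lambda>k. map (itm id h) (pc (tuple r2 ! k))"
  have "der S P (concat (hskel s1 D1 D2 j)) (concat ?X) (concat (map (\<lambda>g. case g of At A \<Rightarrow> [At A] | Ot k \<Rightarrow> ?\<phi> k) (map (itm id ?h1) w')))"
  proof (rule der_refine[OF d1])
    show "length (hskel s1 D1 D2 j) = length (D1 j)" "length ?X = length (D1 j)" using len w by (simp_all add: hskel_def)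
    fix q assume "q < length (D1 j)"
    then have q: "q < length w" using len by simp
    then have hq: "hskel s1 D1 D2 j ! q = (case w ! q of Lit A \<Rightarrow> [D1 j ! q] | PVar m \<Rightarrow> D2 m)" using w len by (simp add: hskel_def)
    have wfl: "wf_lit S (src s1) (w ! q)" by (rule wf_PC[OF T1(5) j w]) (use q in simp)
    show "case map (itm (pidx v1) (ev v1 ?h1)) w ! q of At A \<Rightarrow> hskel s1 D1 D2 j ! q = [D1 j ! q] \<and> ?X ! q = [At A]
      | Ot k \<Rightarrow> der S P (hskel s1 D1 D2 j ! q) (?X ! q) (?\<phi> k)"
    proof (cases "w ! q")
      case (Lit A)
      have "?X ! q = [At (subst_atom A (\<lambda>i. vt (ev s2 (ev v2 h) ! i)))]"
        using itm_seq_Lit[OF wfl[unfolded Lit] st, of "pidx v2" "ev v2 h"] Lit q by (simp del: subst_lit.simps)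
      moreover have "subst_atom A (\<lambda>i. vt (ev s2 (ev v2 h) ! i)) = subst_atom A (\<lambda>i. vt (ev v1 ?h1 ! i))"
        by (rule itm_Lit_cong[of S "src s1"]) (use wfl Lit tm in auto)
      ultimately show ?thesis using Lit hq q by simp
    next
      case (PVar m)
      then have "m < length (tuple v1)" "tgt v1 ! m = Pr" using wfl T1(10) by (auto simp: length_tuple)
      then obtain k where k: "pvar_at v1 m k" using obs_Pr[OF T1(4)] by blast
      then have "der S P (D2 m) (map (itm (pidx v2) (ev v2 h)) (pc (tuple s2 ! m))) (?\<phi> k)"
        using sd2 h unfolding sound_def by blast
      then show ?thesis using PVar hq q pvar_at_pidx[OF k] by simp
    qed
  qed
  moreover have "concat ?X = map (itm (pidx v2) (ev v2 h)) (pc (tuple (s2 ;; s1) ! j))"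
    unfolding pc_nth_seq[OF j w] by (simp add: map_concat comp_def)
  moreover have "concat (map (\<lambda>g. case g of At A \<Rightarrow> [At A] | Ot k \<Rightarrow> ?\<phi> k) (map (itm id ?h1) w')) = map (itm id h) (pc (tuple (r2 ;; r1) ! i))"
  proof -
    have "(case itm id ?h1 l of At A \<Rightarrow> [At A] | Ot k \<Rightarrow> ?\<phi> k) = map (itm id h) (subst_lit l ((!) (tuple r2)))" if l: "l \<in> set w'" for l
    proof (cases l)
      case (Lit A)
      have "wf_lit S (src r1) l" using wf_PC[OF T1(6) i(1) w' l] .
      then show ?thesis using itm_seq_Lit[of S r1 A r2 id h] Lit rt by (simp del: subst_lit.simps)
    qed simp
    then show ?thesis unfolding pc_nth_seq[OF i(1) w'] by (simp add: map_concat comp_def cong: map_cong)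
  qed
  ultimately show "der S P (concat (hskel s1 D1 D2 j)) (map (itm (pidx v2) (ev v2 h)) (pc (tuple (s2 ;; s1) ! j)))
    (map (itm id h) (pc (tuple (r2 ;; r1) ! i)))" by simp
qed

text \<open>A solution of the composite splits along the entries of \<open>s1\<close>. In the
  environment for the first tile, a variable of sort \<open>p\<close> receives the goal reached by
  the piece at its occurrence; by linearity of \<open>s1\<close> there is exactly one occurrence.
  Completeness of the first tile yields values for the source of \<open>v1\<close>, against which
  the pieces at variables solve the second tile.\<close>

lemma complete_horizontal:
  fixes P :: "('p, 'f, 'v) clause set"
  assumes t1: "typed S s1 u1 v1 r1" and t2: "typed S s2 v1 v2 r2"
    and sd1: "sound S P D1 s1 u1 v1 r1" and sd2: "sound S P D2 s2 v1 v2 r2"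
    and c1: "complete_tile S P D1 s1 u1 v1 r1" and c2: "complete_tile S P D2 s2 v1 v2 r2"
  shows "complete_tile S P (\<lambda>j. concat (hskel s1 D1 D2 j)) (s2 ;; s1) u1 v2 (r2 ;; r1)"
  unfolding complete_tile_def
proof (intro allI impI)
  note T1 = typedD[OF t1] and T2 = typedD[OF t2]
  have st: "tgt s2 = src s1" using T1(10) T2(9) by simp
  have rt: "tgt r2 = src r1" using T1(12) T2(11) by simp
  fix \<alpha> \<beta> :: "('p, 'f, 'v) val list"
  assume \<alpha>: "env S (src (s2 ;; s1)) \<alpha>" and \<beta>: "env S (src u1) \<beta>"
    and sol: "solves S P (\<lambda>j. concat (hskel s1 D1 D2 j)) (s2 ;; s1) u1 \<alpha> \<beta>"
  let ?g = "\<lambda>m. vg (\<alpha> ! m)"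
  let ?X = "\<lambda>j. map (\<lambda>l. map (itm ?g \<alpha>) (subst_lit l ((!) (tuple s2)))) (pc (tuple s1 ! j))"
  \<comment> \<open>\<open>M j\<close> holds the results of the pieces, one list for each entry of
    \<open>s1\<close> at \<open>j\<close>.\<close>
  have "\<exists>M. \<forall>j<length (tuple s1). tgt s1 ! j = Pr \<longrightarrow> length (M j) = length (pc (tuple s1 ! j)) \<and>
    (\<forall>q<length (pc (tuple s1 ! j)). der S P (hskel s1 D1 D2 j ! q) (?X j ! q) (M j ! q)) \<and>
    evc (tuple u1 ! j) \<beta> = VG (concat (map flat (concat (M j))))"
  proof (rule choice, rule allI)
    fix j
    show "\<exists>M. j < length (tuple s1) \<longrightarrow> tgt s1 ! j = Pr \<longrightarrow> length M = length (pc (tuple s1 ! j)) \<and>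
      (\<forall>q<length (pc (tuple s1 ! j)). der S P (hskel s1 D1 D2 j ! q) (?X j ! q) (M ! q)) \<and>
      evc (tuple u1 ! j) \<beta> = VG (concat (map flat (concat M)))"
    proof (cases "j < length (tuple s1) \<and> tgt s1 ! j = Pr")
      case True
      then have j: "j < length (tuple s1)" "tgt s1 ! j = Pr" by auto
      then obtain w where w: "tuple s1 ! j = PC w" by (auto simp: tgt_nth_Pr)
      obtain i where ji: "pvar_at u1 j i" using obs_Pr[OF T1(3), of j] j T1(9,13) by auto
      have len: "length (D1 j) = length w" using sound_facts(1)[OF t1 sd1 ji] w by simp
      have X: "map (itm ?g \<alpha>) (pc (tuple (s2 ;; s1) ! j)) = concat (?X j)"
        unfolding pc_nth_seq[OF j(1) w] w by (simp add: map_concat comp_def)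
      obtain ms where ms: "der S P (concat (hskel s1 D1 D2 j)) (concat (?X j)) ms" "evc (tuple u1 ! j) \<beta> = VG (concat (map flat ms))"
        using sol j X unfolding solves_def by auto
      have lh: "length (hskel s1 D1 D2 j) = length w" using len w by (simp add: hskel_def)
      have "\<exists>mss. length mss = length (hskel s1 D1 D2 j) \<and> ms = concat mss \<and>
        (\<forall>q<length (hskel s1 D1 D2 j). der S P (hskel s1 D1 D2 j ! q) (?X j ! q) (mss ! q))"
      proof (rule der_concatD[OF ms(1)])
        show "length (?X j) = length (hskel s1 D1 D2 j)" using lh w by simp
        fix q assume "q < length (hskel s1 D1 D2 j)"
        then have q: "q < length w" using lh by simp
        have wfl: "wf_lit S (src s1) (w ! q)" by (rule wf_PC[OF T1(5) j(1) w]) (use q in simp)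
        show "length (?X j ! q) = length (hskel s1 D1 D2 j ! q)"
        proof (cases "w ! q")
          case (PVar m)
          then have "m < length (tuple v1)" "tgt v1 ! m = Pr" using wfl T1(10) by (auto simp: length_tuple)
          then obtain k where "pvar_at v1 m k" using obs_Pr[OF T1(4)] by blast
          from sound_facts(1)[OF t2 sd2 this] show ?thesis using PVar q w len by (simp add: hskel_def)
        qed (use q w len in \<open>simp add: hskel_def\<close>)
      qed
      then show ?thesis using ms(2) lh w by auto
    qed auto
  qed
  then obtain M where M: "\<And>j. j < length (tuple s1) \<Longrightarrow> tgt s1 ! j = Pr \<Longrightarrow> length (M j) = length (pc (tuple s1 ! j))"
    "\<And>j q. j < length (tuple s1) \<Longrightarrow> tgt s1 ! j = Pr \<Longrightarrow> q < length (pc (tuple s1 ! j)) \<Longrightarrow> der S P (hskel s1 D1 D2 j ! q) (?X j ! q) (M j ! q)"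
    "\<And>j. j < length (tuple s1) \<Longrightarrow> tgt s1 ! j = Pr \<Longrightarrow> evc (tuple u1 ! j) \<beta> = VG (concat (map flat (concat (M j))))"
    by blast
  \<comment> \<open>Specifies the intermediate environment: terms are computed by \<open>s2\<close>,
    and goals are taken from the piece at an occurrence.\<close>
  let ?Q = "\<lambda>m x. (tgt s2 ! m = Tm \<longrightarrow> x = evc (tuple s2 ! m) \<alpha>) \<and>
    (tgt s2 ! m = Pr \<longrightarrow> (\<exists>j w q. j < length (tuple s1) \<and> tuple s1 ! j = PC w \<and> q < length w \<and> w ! q = PVar m \<and> x = VG (concat (map flat (M j ! q)))))"
  have "\<forall>m<length (tuple s2). \<exists>x. ?Q m x"
  proof (intro allI impI)
    fix m assume m: "m < length (tuple s2)"
    show "\<exists>x. ?Q m x"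
    proof (cases "tgt s2 ! m")
      case Pr
      then have "m < length (src s1)" "src s1 ! m = Pr" using m st by (auto simp: length_tuple)
      then obtain j w q where "j < length (tuple s1) \<and> tuple s1 ! j = PC w \<and> q < length w \<and> w ! q = PVar m" using conf_exists[OF T1(1)] by blast
      then show ?thesis using Pr by (intro exI[of _ "VG (concat (map flat (M j ! q)))"]) auto
    qed auto
  qed
  then obtain \<alpha>1 where len1: "length \<alpha>1 = length (tuple s2)" and \<alpha>1: "\<And>m. m < length (tuple s2) \<Longrightarrow> ?Q m (\<alpha>1 ! m)"
    unfolding Skolem_list_nth by blast
  have \<alpha>1Tm: "\<alpha>1 ! m = ev s2 \<alpha> ! m" if "m < length (src s1)" "src s1 ! m = Tm" for m
  proof -
    have m: "m < length (tuple s2)" "tgt s2 ! m = Tm" using that st by (simp_all add: length_tuple)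
    then have "\<alpha>1 ! m = evc (tuple s2 ! m) \<alpha>" using \<alpha>1[of m] by blast
    then show ?thesis using m(1) by (simp add: ev_def)
  qed
  have \<alpha>1Pr: "\<alpha>1 ! m = VG (concat (map flat (M j ! q)))"
    if "j < length (tuple s1)" "tuple s1 ! j = PC w" "q < length w" "w ! q = PVar m" for m j w q
  proof -
    have "wf_lit S (src s1) (PVar m)" using wf_PC[OF T1(5) that(1,2), of "PVar m"] that(3,4) by (metis nth_mem)
    then have "m < length (tuple s2)" "tgt s2 ! m = Pr" using st by (auto simp: length_tuple)
    then obtain j' w' q' where "j' < length (tuple s1)" "tuple s1 ! j' = PC w'" "q' < length w'" "w' ! q' = PVar m" "\<alpha>1 ! m = VG (concat (map flat (M j' ! q')))"
      using \<alpha>1[of m] by blast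
    then show ?thesis using conf_unique[OF T1(1) that, of j' w' q'] by auto
  qed
  have es2: "env S (src s1) (ev s2 \<alpha>)" using env_ev[OF T2(5), of \<alpha>] \<alpha> st by simp
  have env1: "env S (src s1) \<alpha>1"
    unfolding env_def
  proof (intro conjI allI impI)
    show "length \<alpha>1 = length (src s1)" using len1 st by (simp add: length_tuple)
    fix m assume m: "m < length (src s1)"
    show "val_ok S (src s1 ! m) (\<alpha>1 ! m)"
    proof (cases "src s1 ! m")
      case Tm
      then show ?thesis using env_nth[OF es2 m] \<alpha>1Tm[OF m] by simp
    next
      case Pr
      moreover have "m < length (tuple s2)" "tgt s2 ! m = Pr" using m st Pr by (simp_all add: length_tuple)
      then obtain x where "\<alpha>1 ! m = VG x" using \<alpha>1[of m] by blast
      ultimately show ?thesis by simp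
    qed
  qed
  have "solves S P D1 s1 u1 \<alpha>1 \<beta>"
    unfolding solves_def
  proof (intro allI impI conjI)
    fix j assume j: "j < length (tuple s1)"
    { assume Tm: "tgt s1 ! j = Tm"
      then obtain t where t: "tuple s1 ! j = TC t" using j by (auto simp: tgt_nth_Tm)
      have "evc (tuple s1 ! j) \<alpha>1 = evc (tuple s1 ! j) (ev s2 \<alpha>)" unfolding t
        by (rule evc_TC_cong[of S "src s1"]) (use wf_nth[OF T1(5), of j] t j \<alpha>1Tm in auto)
      also have "\<dots> = evc (tuple (s2 ;; s1) ! j) \<alpha>" by (rule evc_seq[OF T1(5) st j, symmetric])
      also have "\<dots> = evc (tuple u1 ! j) \<beta>" using sol j Tm unfolding solves_def by simp
      finally show "evc (tuple s1 ! j) \<alpha>1 = evc (tuple u1 ! j) \<beta>" . }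
    assume Pr: "tgt s1 ! j = Pr"
    then obtain w where w: "tuple s1 ! j = PC w" using j by (auto simp: tgt_nth_Pr)
    obtain i where ji: "pvar_at u1 j i" using obs_Pr[OF T1(3), of j] j Pr T1(9,13) by auto
    have len: "length (D1 j) = length w" using sound_facts(1)[OF t1 sd1 ji] w by simp
    let ?g1 = "\<lambda>m. vg (\<alpha>1 ! m)"
    \<comment> \<open>In the first tile a variable is a single labelled entry, so the piece at a
      variable shrinks to one label; flattening does not see the difference.\<close>
    let ?ms = "map (\<lambda>q. case w ! q of Lit A \<Rightarrow> M j ! q | PVar m \<Rightarrow> [Ot (?g1 m)]) [0..<length w]"
    have "der S P (D1 j) (map (itm ?g1 \<alpha>1) w) (concat ?ms)"
    proof (rule der_singlesI)
      show "length (map (itm ?g1 \<alpha>1) w) = length (D1 j)" "length ?ms = length (D1 j)" using len by simp_all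
      fix q assume "q < length (D1 j)"
      then have q: "q < length w" using len by simp
      have wfl: "wf_lit S (src s1) (w ! q)" by (rule wf_PC[OF T1(5) j w]) (use q in simp)
      show "der S P [D1 j ! q] [map (itm ?g1 \<alpha>1) w ! q] (?ms ! q)"
      proof (cases "w ! q")
        case (Lit A)
        have "?X j ! q = [At (subst_atom A (\<lambda>i. vt (ev s2 \<alpha> ! i)))]"
          using itm_seq_Lit[OF wfl[unfolded Lit] st, of ?g \<alpha>] Lit q w by (simp del: subst_lit.simps)
        moreover have "subst_atom A (\<lambda>i. vt (ev s2 \<alpha> ! i)) = subst_atom A (\<lambda>i. vt (\<alpha>1 ! i))"
          by (rule itm_Lit_cong[of S "src s1"]) (use wfl Lit \<alpha>1Tm in auto)
        moreover have "hskel s1 D1 D2 j ! q = [D1 j ! q]" using Lit w q len by (simp add: hskel_def)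
        ultimately show ?thesis using M(2)[OF j Pr, of q] Lit q w by simp
      next
        case (PVar m)
        have "D1 j ! q = Leaf" using sound_facts(2)[OF t1 sd1 ji, of q m] PVar q w by simp
        then show ?thesis using PVar q by (simp add: der_Leaf_iff)
      qed
    qed
    moreover have "concat (map flat (concat ?ms)) = concat (map flat (concat (M j)))"
    proof -
      have "map (\<lambda>xs. concat (map flat xs)) ?ms = map (\<lambda>xs. concat (map flat xs)) (M j)"
      proof (rule nth_equalityI)
        show "length (map (\<lambda>xs. concat (map flat xs)) ?ms) = length (map (\<lambda>xs. concat (map flat xs)) (M j))" using M(1)[OF j Pr] w by simp
        fix q assume "q < length (map (\<lambda>xs. concat (map flat xs)) ?ms)"
        then have q: "q < length w" by simp
        then show "map (\<lambda>xs. concat (map flat xs)) ?ms ! q = map (\<lambda>xs. concat (map flat xs)) (M j) ! q"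
          using M(1)[OF j Pr] w \<alpha>1Pr[OF j w q] by (cases "w ! q") auto
      qed
      then show ?thesis unfolding concat_flat_concat by simp
    qed
    ultimately show "\<exists>ms. der S P (D1 j) (map (itm ?g1 \<alpha>1) (pc (tuple s1 ! j))) ms \<and> evc (tuple u1 ! j) \<beta> = VG (concat (map flat ms))"
      using M(3)[OF j Pr] w by (intro exI[of _ "concat ?ms"]) simp
  qed
  then obtain h1 where h1: "env S (src v1) h1" "\<alpha>1 = ev v1 h1" "\<beta> = ev r1 h1"
    using c1 env1 \<beta> unfolding complete_tile_def by blast
  have "solves S P D2 s2 v1 \<alpha> h1"
    unfolding solves_def
  proof (intro allI impI conjI)
    fix m assume m: "m < length (tuple s2)"
    have e: "\<alpha>1 ! m = evc (tuple v1 ! m) h1" using h1(2) m T2(13) by (simp add: ev_def)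
    { assume "tgt s2 ! m = Tm"
      then show "evc (tuple s2 ! m) \<alpha> = evc (tuple v1 ! m) h1" using \<alpha>1[OF m] e by simp }
    assume "tgt s2 ! m = Pr"
    then obtain j w q where q: "j < length (tuple s1)" "tuple s1 ! j = PC w" "q < length w" "w ! q = PVar m" "\<alpha>1 ! m = VG (concat (map flat (M j ! q)))"
      using \<alpha>1[OF m] by blast
    have Pr: "tgt s1 ! j = Pr" using q by (auto simp: tgt_nth_Pr)
    obtain i where ji: "pvar_at u1 j i" using obs_Pr[OF T1(3), of j] q(1) Pr T1(9,13) by auto
    have len: "length (D1 j) = length w" using sound_facts(1)[OF t1 sd1 ji] q by simp
    have "der S P (D2 m) (map (itm ?g \<alpha>) (pc (tuple s2 ! m))) (M j ! q)"
      using M(2)[OF q(1) Pr, of q] q len by (simp add: hskel_def)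
    then show "\<exists>ms. der S P (D2 m) (map (itm ?g \<alpha>) (pc (tuple s2 ! m))) ms \<and> evc (tuple v1 ! m) h1 = VG (concat (map flat ms))"
      using e q(5) by auto
  qed
  then obtain h2 where "env S (src v2) h2" "\<alpha> = ev v2 h2" "h1 = ev r2 h2"
    using c2 \<alpha> h1(1) unfolding complete_tile_def by (metis src_seq)
  then show "\<exists>h. env S (src v2) h \<and> \<alpha> = ev v2 h \<and> \<beta> = ev (r2 ;; r1) h"
    using h1(3) ev_seq[OF T1(6) rt, of h2] by auto
qed

definition vskel where
  "vskel u1 D1 D2 j = plug (D1 j) (D2 (pidx u1 j))"

text \<open>The final items of the first tile become the initial items of the second one once their
  labels are sent along \<open>pidx v2\<close>; then the two derivations are grafted.\<close>

lemma sound_vertical: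
  fixes P :: "('p, 'f, 'v) clause set"
  assumes t1: "typed S s1 u1 v1 r1" and t2: "typed S r1 u2 v2 r2"
    and sd1: "sound S P D1 s1 u1 v1 r1" and sd2: "sound S P D2 r1 u2 v2 r2"
  shows "sound S P (vskel u1 D1 D2) s1 (u2 ;; u1) (v2 ;; v1) r2"
  unfolding sound_def
proof (intro allI impI conjI)
  note T1 = typedD[OF t1] and T2 = typedD[OF t2]
  have ut: "tgt u2 = src u1" using T1(11) T2(9) by simp
  have vt': "tgt v2 = src v1" using T1(12) T2(10) by simp
  fix h :: "('p, 'f, 'v) val list" assume "env S (src (v2 ;; v1)) h"
  then have h: "env S (src v2) h" by simp
  let ?h1 = "ev v2 h"
  have h1: "env S (src v1) ?h1" using env_ev[OF T2(8) h] vt' by simp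
  have ev1: "ev (v2 ;; v1) h = ev v1 ?h1" by (rule ev_seq[OF T1(8) vt'])
  { fix j assume j: "j < length (tuple s1)" "tgt s1 ! j = Tm"
    then have ju: "j < length (tuple u1)" "tgt u1 ! j = Tm" using T1(9,13) by auto
    then obtain t where t: "tuple u1 ! j = TC t" by (auto simp: tgt_nth_Tm)
    have tm: "ev r1 ?h1 ! i = ev u2 (ev r2 h) ! i" if "i < length (src u1)" "src u1 ! i = Tm" for i
    proof -
      have "i < length (tuple r1)" "tgt r1 ! i = Tm" "i < length (tuple u2)" using that T1(11) T2(13) by (auto simp: length_tuple)
      then have "evc (tuple r1 ! i) ?h1 = evc (tuple u2 ! i) (ev r2 h)" using sd2 h unfolding sound_def by blast
      then show ?thesis using \<open>i < length (tuple r1)\<close> \<open>i < length (tuple u2)\<close> by (simp add: ev_def)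
    qed
    have "evc (tuple s1 ! j) (ev v1 ?h1) = evc (tuple u1 ! j) (ev r1 ?h1)" using sd1 h1 j unfolding sound_def by blast
    also have "\<dots> = evc (tuple u1 ! j) (ev u2 (ev r2 h))" unfolding t
      by (rule evc_TC_cong[of S "src u1"]) (use wf_nth[OF T1(7) ju(1)] t tm in auto)
    also have "\<dots> = evc (tuple (u2 ;; u1) ! j) (ev r2 h)" by (rule evc_seq[OF T1(7) ut ju(1), symmetric])
    finally show "evc (tuple s1 ! j) (ev (v2 ;; v1) h) = evc (tuple (u2 ;; u1) ! j) (ev r2 h)" unfolding ev1 . }
  fix j l assume "pvar_at (u2 ;; u1) j l"
  then obtain i where ji: "pvar_at u1 j i" and il: "pvar_at u2 i l" using pvar_at_seq[OF T2(3) T1(3) ut] by blast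
  have j: "j < length (tuple s1)" using ji T1(13) by (simp add: pvar_at_def)
  obtain w where w: "tuple s1 ! j = PC w" using pvar_atD[OF T1(3) ji] T1(9) tgt_nth_Pr[OF j] by auto
  have "der S P (D1 j) (map (itm (pidx v1) (ev v1 ?h1)) w) (map (itm id ?h1) (pc (tuple r1 ! i)))"
    using sd1 h1 ji w unfolding sound_def by fastforce
  from der_relabel[OF this, of "pidx v2"]
  have d1: "der S P (D1 j) (map (itm (\<lambda>m. pidx v2 (pidx v1 m)) (ev v1 ?h1)) w) (map (itm (pidx v2) ?h1) (pc (tuple r1 ! i)))"
    unfolding relabel_itm by simp
  have "map (itm (\<lambda>m. pidx v2 (pidx v1 m)) (ev v1 ?h1)) w = map (itm (pidx (v2 ;; v1)) (ev v1 ?h1)) w"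
  proof (rule itm_cong)
    fix m assume "PVar m \<in> set w"
    then have "wf_lit S (src s1) (PVar m)" by (rule wf_PC[OF T1(5) j w])
    then have "m < length (tuple v1)" "tgt v1 ! m = Pr" using T1(10) by (auto simp: length_tuple)
    then show "pidx v2 (pidx v1 m) = pidx (v2 ;; v1) m" by (rule pidx_seq[OF T2(4) T1(4) vt', symmetric])
  qed
  with d1 have d1': "der S P (D1 j) (map (itm (pidx (v2 ;; v1)) (ev v1 ?h1)) w) (map (itm (pidx v2) ?h1) (pc (tuple r1 ! i)))" by simp
  have d2: "der S P (D2 i) (map (itm (pidx v2) ?h1) (pc (tuple r1 ! i))) (map (itm id h) (pc (tuple r2 ! l)))"
    using sd2 h il unfolding sound_def by blast
  have len: "length (D2 i) = leaf_count (D1 j)" using sound_facts(1)[OF t2 sd2 il] sound_facts(4)[OF t1 sd1 ji] by simp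
  show "der S P (vskel u1 D1 D2 j) (map (itm (pidx (v2 ;; v1)) (ev (v2 ;; v1) h)) (pc (tuple s1 ! j))) (map (itm id h) (pc (tuple r2 ! l)))"
    unfolding vskel_def pvar_at_pidx[OF ji] ev1 w component.sel by (rule der_plug[OF len, THEN iffD2]) (use d1' d2 in blast)
qed

text \<open>A composite derivation is cut at the graft, with \<open>N j\<close> in between, and the
  intermediate environment \<open>\<gamma>\<close> must hold the flattened \<open>N j\<close> at the
  variable that \<open>u1\<close> has at \<open>j\<close>. Several positions, or none, may lead to
  the same variable. There \<open>linear_trigger\<close> provides a bare variable of
  \<open>r1\<close>, the second skeleton is a single leaf, and the value is forced to be that of
  \<open>u2\<close> under \<open>\<beta>\<close>.\<close>

lemma complete_vertical:
  fixes P :: "('p, 'f, 'v) clause set"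
  assumes t1: "typed S s1 u1 v1 r1" and t2: "typed S r1 u2 v2 r2"
    and sd1: "sound S P D1 s1 u1 v1 r1" and sd2: "sound S P D2 r1 u2 v2 r2"
    and c1: "complete_tile S P D1 s1 u1 v1 r1" and c2: "complete_tile S P D2 r1 u2 v2 r2"
    and l1: "linear_trigger u1 r1"
  shows "complete_tile S P (vskel u1 D1 D2) s1 (u2 ;; u1) (v2 ;; v1) r2"
  unfolding complete_tile_def
proof (intro allI impI)
  note T1 = typedD[OF t1] and T2 = typedD[OF t2]
  have ut: "tgt u2 = src u1" using T1(11) T2(9) by simp
  have vt': "tgt v2 = src v1" using T1(12) T2(10) by simp
  fix \<alpha> \<beta> :: "('p, 'f, 'v) val list"
  assume \<alpha>: "env S (src s1) \<alpha>" and "env S (src (u2 ;; u1)) \<beta>" and sol: "solves S P (vskel u1 D1 D2) s1 (u2 ;; u1) \<alpha> \<beta>"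
  then have \<beta>: "env S (src u2) \<beta>" by simp
  let ?g = "\<lambda>m. vg (\<alpha> ! m)"
  have pidx_at: "pvar_at u1 j (pidx u1 j)" if "j < length (tuple s1)" "tgt s1 ! j = Pr" for j
    using obs_Pr[OF T1(3), of j] that T1(9,13) pvar_at_pidx by force
  have u2at: "\<exists>l. pvar_at u2 i l" if "i < length (src u1)" "src u1 ! i = Pr" for i
    using obs_Pr[OF T2(3), of i] that ut by (auto simp: length_tuple)
  have ev2: "evc (tuple (u2 ;; u1) ! j) \<beta> = VG (vg (evc (tuple u2 ! i) \<beta>))" if "pvar_at u1 j i" for j i
  proof -
    have i: "i < length (tuple u2)" using pvar_atD(3)[OF T1(3) that] ut by (simp add: length_tuple)
    have "evc (tuple (u2 ;; u1) ! j) \<beta> = evc (tuple u1 ! j) (ev u2 \<beta>)"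
      by (rule evc_seq[OF T1(7) ut]) (use that in \<open>simp add: pvar_at_def\<close>)
    then show ?thesis using that i by (simp add: pvar_at_def ev_def)
  qed
  have "\<exists>N. \<forall>j<length (tuple s1). tgt s1 ! j = Pr \<longrightarrow> (\<exists>ms. der S P (D1 j) (map (itm ?g \<alpha>) (pc (tuple s1 ! j))) (N j) \<and>
    der S P (D2 (pidx u1 j)) (N j) ms \<and> vg (evc (tuple u2 ! pidx u1 j) \<beta>) = concat (map flat ms))"
  proof (rule choice, rule allI)
    fix j
    show "\<exists>ns. j < length (tuple s1) \<longrightarrow> tgt s1 ! j = Pr \<longrightarrow> (\<exists>ms. der S P (D1 j) (map (itm ?g \<alpha>) (pc (tuple s1 ! j))) ns \<and>
      der S P (D2 (pidx u1 j)) ns ms \<and> vg (evc (tuple u2 ! pidx u1 j) \<beta>) = concat (map flat ms))"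
    proof (cases "j < length (tuple s1) \<and> tgt s1 ! j = Pr")
      case True
      then have ji: "pvar_at u1 j (pidx u1 j)" using pidx_at by blast
      then obtain l where "pvar_at u2 (pidx u1 j) l" using u2at pvar_atD(3,4)[OF T1(3) ji] by blast
      then have len: "length (D2 (pidx u1 j)) = leaf_count (D1 j)" using sound_facts(1)[OF t2 sd2] sound_facts(4)[OF t1 sd1 ji] by simp
      obtain ms where ms: "der S P (vskel u1 D1 D2 j) (map (itm ?g \<alpha>) (pc (tuple s1 ! j))) ms" "evc (tuple (u2 ;; u1) ! j) \<beta> = VG (concat (map flat ms))"
        using sol True unfolding solves_def by blast
      obtain ns where "der S P (D1 j) (map (itm ?g \<alpha>) (pc (tuple s1 ! j))) ns" "der S P (D2 (pidx u1 j)) ns ms"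
        using der_plug[OF len, THEN iffD1, OF ms(1)[unfolded vskel_def]] by blast
      then show ?thesis using ms(2) ev2[OF ji] by auto
    qed auto
  qed
  then obtain N where N: "\<And>j. j < length (tuple s1) \<Longrightarrow> tgt s1 ! j = Pr \<Longrightarrow> \<exists>ms. der S P (D1 j) (map (itm ?g \<alpha>) (pc (tuple s1 ! j))) (N j) \<and>
    der S P (D2 (pidx u1 j)) (N j) ms \<and> vg (evc (tuple u2 ! pidx u1 j) \<beta>) = concat (map flat ms)" by blast
  have Nat: "\<exists>ms. der S P (D1 j) (map (itm ?g \<alpha>) (pc (tuple s1 ! j))) (N j) \<and>
    der S P (D2 i) (N j) ms \<and> vg (evc (tuple u2 ! i) \<beta>) = concat (map flat ms)" if "pvar_at u1 j i" for j i
    using N[of j] pvar_atD(1,2)[OF T1(3) that] T1(9,13) pvar_at_pidx[OF that] by simp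
  have D2var: "D2 i = [Leaf]" if i: "i < length (src u1)" "src u1 ! i = Pr" and k: "tuple r1 ! i = PC [PVar k]" for i k
  proof -
    obtain l where il: "pvar_at u2 i l" using u2at i by blast
    have "length (D2 i) = 1" using sound_facts(1)[OF t2 sd2 il] k by simp
    moreover have "D2 i ! 0 = Leaf" using sound_facts(2)[OF t2 sd2 il, of 0 k] k by simp
    ultimately show ?thesis by (cases "D2 i") auto
  qed
  \<comment> \<open>The last condition also fixes \<open>\<gamma>\<close> at variables dropped by
    \<open>u1\<close>, where no derivation prescribes a value.\<close>
  let ?Q = "\<lambda>i x. (src u1 ! i = Tm \<longrightarrow> x = evc (tuple u2 ! i) \<beta>) \<and>
    (src u1 ! i = Pr \<longrightarrow> (\<exists>g. x = VG g \<and> (\<forall>j. pvar_at u1 j i \<longrightarrow> g = concat (map flat (N j))) \<and>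
       ((\<exists>k. tuple r1 ! i = PC [PVar k]) \<longrightarrow> x = evc (tuple u2 ! i) \<beta>)))"
  have "\<forall>i<length (src u1). \<exists>x. ?Q i x"
  proof (intro allI impI)
    fix i assume i: "i < length (src u1)"
    show "\<exists>x. ?Q i x"
    proof (cases "src u1 ! i")
      case Pr
      show ?thesis
      proof (cases "\<exists>k. tuple r1 ! i = PC [PVar k]")
        case True
        then have D2: "D2 i = [Leaf]" using D2var i Pr by blast
        obtain l where "pvar_at u2 i l" using u2at i Pr by blast
        then have g: "evc (tuple u2 ! i) \<beta> = VG (vg (evc (tuple u2 ! i) \<beta>))" by (simp add: pvar_at_def)
        have "vg (evc (tuple u2 ! i) \<beta>) = concat (map flat (N j))" if "pvar_at u1 j i" for j
          using Nat[OF that] unfolding D2 by (auto simp: der_Leaf_iff)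
        then have "?Q i (evc (tuple u2 ! i) \<beta>)" using g Pr by (metis srt.distinct(1))
        then show ?thesis by (rule exI)
      next
        case False
        then obtain j where "pvar_at u1 j i" "\<And>j'. pvar_at u1 j' i \<Longrightarrow> j' = j" using l1 i Pr unfolding linear_trigger_def by blast
        then have "\<forall>j'. pvar_at u1 j' i \<longrightarrow> concat (map flat (N j)) = concat (map flat (N j'))" by blast
        then have "?Q i (VG (concat (map flat (N j))))" using False Pr by simp
        then show ?thesis by (rule exI)
      qed
    qed auto
  qed
  then obtain \<gamma> where len\<gamma>: "length \<gamma> = length (src u1)" and \<gamma>: "\<And>i. i < length (src u1) \<Longrightarrow> ?Q i (\<gamma> ! i)"
    unfolding Skolem_list_nth by blast
  have eu2: "env S (src u1) (ev u2 \<beta>)" using env_ev[OF T2(7) \<beta>] ut by simp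
  have \<gamma>Tm: "\<gamma> ! i = ev u2 \<beta> ! i" if "i < length (src u1)" "src u1 ! i = Tm" for i
  proof -
    have i: "i < length (tuple u2)" using that(1) ut by (simp add: length_tuple)
    have "\<gamma> ! i = evc (tuple u2 ! i) \<beta>" using \<gamma>[OF that(1)] that(2) by blast
    then show ?thesis using i by (simp add: ev_def)
  qed
  have env\<gamma>: "env S (src u1) \<gamma>"
    unfolding env_def
  proof (intro conjI allI impI)
    fix i assume i: "i < length (src u1)"
    show "val_ok S (src u1 ! i) (\<gamma> ! i)"
    proof (cases "src u1 ! i")
      case Tm
      then show ?thesis using env_nth[OF eu2 i] \<gamma>Tm[OF i] by simp
    next
      case Pr
      then obtain g where "\<gamma> ! i = VG g" using \<gamma>[OF i] by blast
      then show ?thesis using Pr by simp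
    qed
  qed (rule len\<gamma>)
  have \<gamma>at: "\<gamma> ! i = VG (concat (map flat (N j)))" if "pvar_at u1 j i" for j i
    using \<gamma>[OF pvar_atD(3)[OF T1(3) that]] pvar_atD(4)[OF T1(3) that] that by blast
  have "solves S P D1 s1 u1 \<alpha> \<gamma>"
    unfolding solves_def
  proof (intro allI impI conjI)
    fix j assume j: "j < length (tuple s1)"
    { assume Tm: "tgt s1 ! j = Tm"
      then have ju: "j < length (tuple u1)" "tgt u1 ! j = Tm" using j T1(9,13) by auto
      then obtain t where t: "tuple u1 ! j = TC t" by (auto simp: tgt_nth_Tm)
      have "evc (tuple s1 ! j) \<alpha> = evc (tuple (u2 ;; u1) ! j) \<beta>" using sol j Tm unfolding solves_def by blast
      also have "\<dots> = evc (tuple u1 ! j) (ev u2 \<beta>)" by (rule evc_seq[OF T1(7) ut ju(1)])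
      also have "\<dots> = evc (tuple u1 ! j) \<gamma>" unfolding t
        by (rule evc_TC_cong[of S "src u1"]) (use wf_nth[OF T1(7) ju(1)] t \<gamma>Tm in auto)
      finally show "evc (tuple s1 ! j) \<alpha> = evc (tuple u1 ! j) \<gamma>" . }
    assume "tgt s1 ! j = Pr"
    then have ji: "pvar_at u1 j (pidx u1 j)" using pidx_at j by blast
    then have "evc (tuple u1 ! j) \<gamma> = VG (concat (map flat (N j)))" using \<gamma>at[OF ji] by (simp add: pvar_at_def)
    then show "\<exists>ms. der S P (D1 j) (map (itm ?g \<alpha>) (pc (tuple s1 ! j))) ms \<and> evc (tuple u1 ! j) \<gamma> = VG (concat (map flat ms))"
      using Nat[OF ji] by blast
  qed
  then obtain h1 where h1: "env S (src v1) h1" "\<alpha> = ev v1 h1" "\<gamma> = ev r1 h1"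
    using c1 \<alpha> env\<gamma> unfolding complete_tile_def by blast
  have eh1: "env S (src r1) h1" using h1(1) T1(12) by simp
  have "solves S P D2 r1 u2 h1 \<beta>"
    unfolding solves_def
  proof (intro allI impI conjI)
    fix i assume i: "i < length (tuple r1)"
    then have iu: "i < length (src u1)" "src u1 ! i = tgt r1 ! i" using T1(11) by (auto simp: length_tuple)
    have e: "\<gamma> ! i = evc (tuple r1 ! i) h1" using h1(3) i by (simp add: ev_def)
    { assume "tgt r1 ! i = Tm"
      then show "evc (tuple r1 ! i) h1 = evc (tuple u2 ! i) \<beta>" using \<gamma>[OF iu(1)] iu(2) e by metis }
    assume Pr: "tgt r1 ! i = Pr"
    then obtain w1 where w1: "tuple r1 ! i = PC w1" using i by (auto simp: tgt_nth_Pr)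
    obtain l where "pvar_at u2 i l" using u2at iu Pr by auto
    then have g: "evc (tuple u2 ! i) \<beta> = VG (vg (evc (tuple u2 ! i) \<beta>))" by (simp add: pvar_at_def)
    let ?g1 = "\<lambda>m. vg (h1 ! m)"
    show "\<exists>ms. der S P (D2 i) (map (itm ?g1 h1) (pc (tuple r1 ! i))) ms \<and> evc (tuple u2 ! i) \<beta> = VG (concat (map flat ms))"
    proof (cases "\<exists>j. pvar_at u1 j i")
      case True
      then obtain j where ji: "pvar_at u1 j i" by blast
      have j: "j < length (tuple s1)" using ji T1(13) by (simp add: pvar_at_def)
      obtain w where w: "tuple s1 ! j = PC w" using pvar_atD[OF T1(3) ji] T1(9) tgt_nth_Pr[OF j] by auto
      obtain ms where ms: "der S P (D1 j) (map (itm ?g \<alpha>) w) (N j)" "der S P (D2 i) (N j) ms" "vg (evc (tuple u2 ! i) \<beta>) = concat (map flat ms)"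
        using Nat[OF ji] w by auto
      have "der S P (D1 j) (map (itm (pidx v1) (ev v1 h1)) w) (map (itm id h1) w1)"
        using sd1 h1(1) ji w w1 unfolding sound_def by fastforce
      from der_relabel[OF this, of ?g1]
      have "der S P (D1 j) (map (itm (\<lambda>m. ?g1 (pidx v1 m)) \<alpha>) w) (map (itm ?g1 h1) w1)"
        unfolding relabel_itm h1(2)[symmetric] by simp
      moreover have "map (itm (\<lambda>m. ?g1 (pidx v1 m)) \<alpha>) w = map (itm ?g \<alpha>) w"
      proof (rule itm_cong)
        fix m assume "PVar m \<in> set w"
        then have "wf_lit S (src s1) (PVar m)" by (rule wf_PC[OF T1(5) j w])
        then have m: "m < length (tuple v1)" "tgt v1 ! m = Pr" using T1(10) by (auto simp: length_tuple)
        then obtain k where "pvar_at v1 m k" using obs_Pr[OF T1(4)] by blast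
        then show "?g1 (pidx v1 m) = ?g m" using h1(2) m(1) pvar_at_pidx[of v1 m k] by (simp add: ev_def pvar_at_def)
      qed
      ultimately have d: "der S P (D1 j) (map (itm ?g \<alpha>) w) (map (itm ?g1 h1) w1)" by simp
      \<comment> \<open>Completeness of the first tile gives back the goal in flattened form only.
        By \<open>der_flat_unique\<close> its items are those of \<open>N j\<close>, so the rest of
        the derivation indeed starts from \<open>r1\<close>.\<close>
      have "concat (map flat (N j)) = concat (map flat (map (itm ?g1 h1) w1))"
        unfolding concat_flat_itm using \<gamma>at[OF ji] e w1 by simp
      from der_flat_unique[OF ms(1) d this] show ?thesis using ms(2,3) w1 g by auto
    next
      case False
      then obtain k where k: "tuple r1 ! i = PC [PVar k]" using l1 iu Pr unfolding linear_trigger_def by auto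
      then have "D2 i = [Leaf]" using D2var iu Pr by auto
      moreover have "evc (tuple u2 ! i) \<beta> = evc (tuple r1 ! i) h1" using \<gamma>[OF iu(1)] iu(2) Pr k e by metis
      ultimately show ?thesis using k by (intro exI[of _ "[Ot (?g1 k)]"]) (simp add: der_Leaf_iff)
    qed
  qed
  then obtain h where "env S (src v2) h" "h1 = ev v2 h" "\<beta> = ev r2 h"
    using c2 eh1 \<beta> unfolding complete_tile_def by blast
  then show "\<exists>h. env S (src (v2 ;; v1)) h \<and> \<alpha> = ev (v2 ;; v1) h \<and> \<beta> = ev r2 h"
    using h1(2) ev_seq[OF T1(8) vt', of h] by auto
qed

definition good where
  "good S P s u v r \<longleftrightarrow> typed S s u v r \<and> linear_trigger u r \<and> (\<exists>D. sound S P D s u v r \<and> complete_tile S P D s u v r)"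

lemma good_horizontal:
  fixes P :: "('p, 'f, 'v) clause set"
  assumes "good S P s1 u1 v1 r1" "good S P s2 v1 v2 r2"
  shows "good S P (s2 ;; s1) u1 v2 (r2 ;; r1)"
proof -
  obtain D1 D2 where "typed S s1 u1 v1 r1" "typed S s2 v1 v2 r2" "sound S P D1 s1 u1 v1 r1" "sound S P D2 s2 v1 v2 r2"
    "complete_tile S P D1 s1 u1 v1 r1" "complete_tile S P D2 s2 v1 v2 r2" "linear_trigger u1 r1" "linear_trigger v1 r2"
    using assms unfolding good_def by blast
  then show ?thesis unfolding good_def
    by (intro conjI exI[of _ "\<lambda>j. concat (hskel s1 D1 D2 j)"] typed_horizontal linear_horizontal sound_horizontal complete_horizontal)
qed

lemma good_vertical:
  fixes P :: "('p, 'f, 'v) clause set"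
  assumes "good S P s1 u1 v1 r1" "good S P r1 u2 v2 r2"
  shows "good S P s1 (u2 ;; u1) (v2 ;; v1) r2"
proof -
  obtain D1 D2 where "typed S s1 u1 v1 r1" "typed S r1 u2 v2 r2" "sound S P D1 s1 u1 v1 r1" "sound S P D2 r1 u2 v2 r2"
    "complete_tile S P D1 s1 u1 v1 r1" "complete_tile S P D2 r1 u2 v2 r2" "linear_trigger u1 r1" "linear_trigger u2 r2"
    using assms unfolding good_def by blast
  then show ?thesis unfolding good_def
    by (intro conjI exI[of _ "vskel u1 D1 D2"] typed_vertical linear_vertical sound_vertical complete_vertical)
qed

section \<open>Closure of the invariant under parallel composition\<close>

lemma nth_par_left: "j < length (tuple a) \<Longrightarrow> tuple (a \<otimes> b) ! j = tuple a ! j"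
  and nth_par_right: "j < length (tuple b) \<Longrightarrow> tuple (a \<otimes> b) ! (length (tuple a) + j) = shift_comp (length (src a)) (tuple b ! j)"
  and length_tuple_par [simp]: "length (tuple (a \<otimes> b)) = length (tuple a) + length (tuple b)"
  by (simp_all add: par_def nth_append)

lemma shift_comp_PVar: "shift_comp n c = PC [PVar i] \<longleftrightarrow> (\<exists>i'. c = PC [PVar i'] \<and> i = n + i')"
proof (cases c)
  case (PC w)
  have "shift_lit n l = PVar i \<longleftrightarrow> (\<exists>i'. l = PVar i' \<and> i = n + i')" for l :: "('a, 'b) lit" by (cases l) auto
  then show ?thesis using PC by (auto simp: map_eq_Cons_conv)
qed simp

lemma pvar_at_par_left:
  assumes "j < length (tuple a)"
  shows "pvar_at (a \<otimes> b) j i \<longleftrightarrow> pvar_at a j i"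
  using assms by (simp add: pvar_at_def nth_par_left)

lemma pvar_at_par_right: "pvar_at (a \<otimes> b) (length (tuple a) + j) i \<longleftrightarrow> (\<exists>i'. i = length (src a) + i' \<and> pvar_at b j i')"
  by (auto simp: pvar_at_def nth_par_right shift_comp_PVar)

lemma pidx_par_left: "j < length (tuple a) \<Longrightarrow> pidx (a \<otimes> b) j = pidx a j"
  by (simp add: pidx_def nth_par_left)

lemma pidx_par_right:
  assumes "pvar_at b j k"
  shows "pidx (a \<otimes> b) (length (tuple a) + j) = length (src a) + pidx b j"
  using pvar_at_pidx[of "a \<otimes> b" "length (tuple a) + j" "length (src a) + k"] pvar_at_pidx[OF assms] assms
  by (simp add: pvar_at_par_right)

lemma par_index_cases:
  assumes "j < length (tuple (a \<otimes> b))"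
  obtains "j < length (tuple a)" | j' where "j = length (tuple a) + j'" "j' < length (tuple b)"
  using assms by (metis add_less_cancel_left le_Suc_ex length_tuple_par not_less)

lemma linear_parallel:
  assumes t1: "typed S s1 u1 v1 r1" and t2: "typed S s2 u2 v2 r2" and l1: "linear_trigger u1 r1" and l2: "linear_trigger u2 r2"
  shows "linear_trigger (u1 \<otimes> u2) (r1 \<otimes> r2)"
  unfolding linear_trigger_def
proof (intro allI impI)
  note T1 = typedD[OF t1] and T2 = typedD[OF t2]
  let ?n = "length (src u1)" and ?m = "length (tuple u1)"
  fix i assume i: "i < length (src (u1 \<otimes> u2))" "src (u1 \<otimes> u2) ! i = Pr"
  have split: "pvar_at (u1 \<otimes> u2) j i \<longleftrightarrow> pvar_at u1 j i \<or> (\<exists>j' i'. j = ?m + j' \<and> i = ?n + i' \<and> pvar_at u2 j' i')" for j i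
  proof
    assume *: "pvar_at (u1 \<otimes> u2) j i"
    then have "j < length (tuple (u1 \<otimes> u2))" by (simp add: pvar_at_def)
    then show "pvar_at u1 j i \<or> (\<exists>j' i'. j = ?m + j' \<and> i = ?n + i' \<and> pvar_at u2 j' i')"
      by (rule par_index_cases) (use * in \<open>auto simp: pvar_at_par_left pvar_at_par_right\<close>)
  next
    assume "pvar_at u1 j i \<or> (\<exists>j' i'. j = ?m + j' \<and> i = ?n + i' \<and> pvar_at u2 j' i')"
    then show "pvar_at (u1 \<otimes> u2) j i"
    proof
      assume "pvar_at u1 j i"
      then show ?thesis using pvar_at_par_left[of j u1 u2 i] by (simp add: pvar_at_def[of u1])
    qed (auto simp: pvar_at_par_right)
  qed
  show "(\<exists>!j. pvar_at (u1 \<otimes> u2) j i) \<or> (\<exists>k. tuple (r1 \<otimes> r2) ! i = PC [PVar k])"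
  proof (cases "i < ?n")
    case True
    then have "src u1 ! i = Pr" using i by (simp add: nth_append)
    then have "(\<exists>!j. pvar_at u1 j i) \<or> (\<exists>k. tuple r1 ! i = PC [PVar k])" using l1 True unfolding linear_trigger_def by blast
    moreover have "pvar_at (u1 \<otimes> u2) j i \<longleftrightarrow> pvar_at u1 j i" for j using split[of j i] True by auto
    moreover have "tuple (r1 \<otimes> r2) ! i = tuple r1 ! i" by (rule nth_par_left) (use True T1(11) in \<open>simp add: length_tuple\<close>)
    ultimately show ?thesis by simp
  next
    case False
    then obtain i' where i': "i = ?n + i'" by (metis le_Suc_ex not_less)
    then have s: "i' < length (src u2)" "src u2 ! i' = Pr" using i by (simp_all add: nth_append)
    have at: "pvar_at (u1 \<otimes> u2) j i \<longleftrightarrow> (\<exists>j'. j = ?m + j' \<and> pvar_at u2 j' i')" for j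
    proof -
      have "\<not> pvar_at u1 j i" using pvar_atD(3)[OF T1(3)] False by blast
      then show ?thesis unfolding split using i' by simp
    qed
    have "?n = length (tuple r1)" "i' < length (tuple r2)" using T1(11) T2(11) s by (simp_all add: length_tuple)
    then have r: "tuple (r1 \<otimes> r2) ! i = shift_comp (length (src r1)) (tuple r2 ! i')" using i' nth_par_right[of i' r2 r1] by simp
    have "(\<exists>!j. pvar_at u2 j i') \<or> (\<exists>k. tuple r2 ! i' = PC [PVar k])" using l2 s unfolding linear_trigger_def by blast
    then show ?thesis
    proof
      assume "\<exists>!j. pvar_at u2 j i'"
      then obtain j where j: "pvar_at u2 j i'" "\<And>j'. pvar_at u2 j' i' \<Longrightarrow> j' = j" by blast
      have "\<exists>!j. pvar_at (u1 \<otimes> u2) j i"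
      proof (rule ex1I)
        show "pvar_at (u1 \<otimes> u2) (?m + j) i" using at j(1) by blast
        fix j2 assume "pvar_at (u1 \<otimes> u2) j2 i"
        then obtain j' where "j2 = ?m + j'" "pvar_at u2 j' i'" using at by blast
        then show "j2 = ?m + j" using j(2) by blast
      qed
      then show ?thesis ..
    next
      assume "\<exists>k. tuple r2 ! i' = PC [PVar k]"
      then show ?thesis unfolding r by auto
    qed
  qed
qed

definition pskel where
  "pskel s1 D1 D2 j = (if j < length (tuple s1) then D1 j else D2 (j - length (tuple s1)))"

lemma itms_left:
  assumes "wf_arrow S a" "j < length (tuple a)" "length x = length (src a)" "tgt a ! j = Pr"
  shows "map (itm g (x @ y)) (pc (tuple a ! j)) = map (itm g x) (pc (tuple a ! j))"
proof -
  obtain w where w: "tuple a ! j = PC w" using assms(2,4) by (auto simp: tgt_nth_Pr)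
  show ?thesis unfolding w component.sel
    by (intro map_cong refl itm_left[OF wf_PC[OF assms(1,2) w]] assms(3))
qed

lemma itms_right:
  assumes "j < length (tuple b)" "tgt b ! j = Pr" "length x = n"
  shows "map (itm g (x @ y)) (pc (shift_comp n (tuple b ! j))) = map (itm (\<lambda>m. g (n + m)) y) (pc (tuple b ! j))"
proof -
  obtain w where w: "tuple b ! j = PC w" using assms(1,2) by (auto simp: tgt_nth_Pr)
  show ?thesis using assms(3) by (simp add: w itm_shift)
qed

lemma sound_parallel:
  fixes P :: "('p, 'f, 'v) clause set"
  assumes t1: "typed S s1 u1 v1 r1" and t2: "typed S s2 u2 v2 r2"
    and sd1: "sound S P D1 s1 u1 v1 r1" and sd2: "sound S P D2 s2 u2 v2 r2"
  shows "sound S P (pskel s1 D1 D2) (s1 \<otimes> s2) (u1 \<otimes> u2) (v1 \<otimes> v2) (r1 \<otimes> r2)"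
  unfolding sound_def
proof (intro allI impI conjI)
  note T1 = typedD[OF t1] and T2 = typedD[OF t2]
  fix h :: "('p, 'f, 'v) val list" assume "env S (src (v1 \<otimes> v2)) h"
  then obtain a b where h: "h = a @ b" and a: "env S (src v1) a" and b: "env S (src v2) b" using env_split[of S "src v1" "src v2" h] by auto
  have la: "length a = length (src v1)" "length a = length (src r1)" using env_length[OF a] T1(12) by simp_all
  have ev: "ev (v1 \<otimes> v2) h = ev v1 a @ ev v2 b" unfolding h by (rule ev_par[OF T1(8) la(1)])
  have er: "ev (r1 \<otimes> r2) h = ev r1 a @ ev r2 b" unfolding h by (rule ev_par[OF T1(6) la(2)])
  have lv: "length (ev v1 a) = length (src s1)" using T1(10) by (simp add: ev_def length_tuple)
  have lr: "length (ev r1 a) = length (src u1)" using T1(11) by (simp add: ev_def length_tuple)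
  have su: "length (tuple u1) = length (tuple s1)" using T1(13) by simp
  { fix j assume j: "j < length (tuple (s1 \<otimes> s2))" "tgt (s1 \<otimes> s2) ! j = Tm"
    show "evc (tuple (s1 \<otimes> s2) ! j) (ev (v1 \<otimes> v2) h) = evc (tuple (u1 \<otimes> u2) ! j) (ev (r1 \<otimes> r2) h)"
      using j(1)
    proof (rule par_index_cases)
      assume j1: "j < length (tuple s1)"
      then have "tgt s1 ! j = Tm" using j(2) by (simp add: nth_append length_tuple)
      then have "evc (tuple s1 ! j) (ev v1 a) = evc (tuple u1 ! j) (ev r1 a)" using sd1 a j1 unfolding sound_def by blast
      then show ?thesis unfolding ev er
        using j1 su evc_left[OF wf_nth[OF T1(5) j1] lv] evc_left[OF wf_nth[OF T1(7), of j] lr] by (simp add: nth_par_left)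
    next
      fix j' assume j': "j = length (tuple s1) + j'" "j' < length (tuple s2)"
      then have "tgt s2 ! j' = Tm" using j(2) by (simp add: nth_append length_tuple)
      then have e: "evc (tuple s2 ! j') (ev v2 b) = evc (tuple u2 ! j') (ev r2 b)" using sd2 b j' unfolding sound_def by blast
      have "tuple (s1 \<otimes> s2) ! j = shift_comp (length (src s1)) (tuple s2 ! j')" using j' by (simp add: nth_par_right)
      moreover have "tuple (u1 \<otimes> u2) ! j = shift_comp (length (src u1)) (tuple u2 ! j')"
        using j' su T2(13) nth_par_right[of j' u2 u1] by simp
      ultimately show ?thesis unfolding ev er using e lv lr by (simp add: evc_shift)
    qed }
  fix j i assume ji: "pvar_at (u1 \<otimes> u2) j i"
  then have "j < length (tuple (u1 \<otimes> u2))" by (simp add: pvar_at_def)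
  then show "der S P (pskel s1 D1 D2 j) (map (itm (pidx (v1 \<otimes> v2)) (ev (v1 \<otimes> v2) h)) (pc (tuple (s1 \<otimes> s2) ! j))) (map (itm id h) (pc (tuple (r1 \<otimes> r2) ! i)))"
  proof (rule par_index_cases)
    assume j1: "j < length (tuple u1)"
    then have ji1: "pvar_at u1 j i" using ji pvar_at_par_left by blast
    note p = pvar_atD[OF T1(3) ji1]
    have js: "j < length (tuple s1)" "tgt s1 ! j = Pr" using p T1(9) su by auto
    have ir: "i < length (tuple r1)" "tgt r1 ! i = Pr" using p T1(11) by (auto simp: length_tuple)
    obtain w where w: "tuple s1 ! j = PC w" using js by (auto simp: tgt_nth_Pr)
    have d: "der S P (D1 j) (map (itm (pidx v1) (ev v1 a)) (pc (tuple s1 ! j))) (map (itm id a) (pc (tuple r1 ! i)))"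
      using sd1 a ji1 unfolding sound_def by blast
    have c: "map (itm (pidx (v1 \<otimes> v2)) (ev v1 a)) w = map (itm (pidx v1) (ev v1 a)) w"
    proof (rule itm_cong)
      fix m assume "PVar m \<in> set w"
      then have "wf_lit S (src s1) (PVar m)" by (rule wf_PC[OF T1(5) js(1) w])
      then have "m < length (tuple v1)" using T1(10) by (simp add: length_tuple)
      then show "pidx (v1 \<otimes> v2) m = pidx v1 m" by (rule pidx_par_left)
    qed
    have e1: "map (itm (pidx (v1 \<otimes> v2)) (ev (v1 \<otimes> v2) h)) (pc (tuple (s1 \<otimes> s2) ! j)) = map (itm (pidx v1) (ev v1 a)) (pc (tuple s1 ! j))"
      unfolding ev nth_par_left[OF js(1)] itms_left[OF T1(5) js(1) lv js(2)] unfolding w component.sel by (rule c)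
    have e2: "map (itm id h) (pc (tuple (r1 \<otimes> r2) ! i)) = map (itm id a) (pc (tuple r1 ! i))"
      unfolding h nth_par_left[OF ir(1)] by (rule itms_left[OF T1(6) ir(1) la(2) ir(2)])
    have e3: "pskel s1 D1 D2 j = D1 j" using js(1) by (simp add: pskel_def)
    show ?thesis unfolding e1 e2 e3 by (rule d)
  next
    fix j' assume j': "j = length (tuple u1) + j'" "j' < length (tuple u2)"
    then obtain i' where i': "i = length (src u1) + i'" "pvar_at u2 j' i'" using ji pvar_at_par_right by blast
    note p = pvar_atD[OF T2(3) i'(2)]
    have js: "j' < length (tuple s2)" "tgt s2 ! j' = Pr" using p T2(9,13) by auto
    have ir: "i' < length (tuple r2)" "tgt r2 ! i' = Pr" using p T2(11) by (auto simp: length_tuple)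
    obtain w where w: "tuple s2 ! j' = PC w" using js by (auto simp: tgt_nth_Pr)
    let ?n = "length (src v1)"
    have "der S P (D2 j') (map (itm (pidx v2) (ev v2 b)) (pc (tuple s2 ! j'))) (map (itm id b) (pc (tuple r2 ! i')))"
      using sd2 b i'(2) unfolding sound_def by blast
    \<comment> \<open>The labels of the second tile are indices into its own source, which now comes
      after that of the first.\<close>
    from der_relabel[OF this, of "\<lambda>k. ?n + k"]
    have d: "der S P (D2 j') (map (itm (\<lambda>m. ?n + pidx v2 m) (ev v2 b)) w) (map (itm (\<lambda>m. ?n + m) b) (pc (tuple r2 ! i')))"
      unfolding relabel_itm w by simp
    have c: "map (itm (\<lambda>m. pidx (v1 \<otimes> v2) (length (src s1) + m)) (ev v2 b)) w = map (itm (\<lambda>m. ?n + pidx v2 m) (ev v2 b)) w"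
    proof (rule itm_cong)
      fix m assume "PVar m \<in> set w"
      then have "wf_lit S (src s2) (PVar m)" by (rule wf_PC[OF T2(5) js(1) w])
      then have "m < length (tuple v2)" "tgt v2 ! m = Pr" using T2(10) by (auto simp: length_tuple)
      then obtain k where "pvar_at v2 m k" using obs_Pr[OF T2(4)] by blast
      moreover have "length (src s1) = length (tuple v1)" using T1(10) by (simp add: length_tuple)
      ultimately show "pidx (v1 \<otimes> v2) (length (src s1) + m) = ?n + pidx v2 m" using pidx_par_right[of v2 m k v1] by simp
    qed
    have t1: "tuple (s1 \<otimes> s2) ! j = shift_comp (length (src s1)) (tuple s2 ! j')" using j' su js(1) nth_par_right[of j' s2 s1] by simp
    have t2: "tuple (r1 \<otimes> r2) ! i = shift_comp (length (src r1)) (tuple r2 ! i')"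
      using i'(1) ir(1) T1(11) nth_par_right[of i' r2 r1] by (simp add: length_tuple)
    have e3: "pskel s1 D1 D2 j = D2 j'" using j'(1) su by (simp add: pskel_def)
    have e2: "map (itm id (a @ b)) (pc (shift_comp (length (src r1)) (tuple r2 ! i'))) = map (itm (\<lambda>m. ?n + m) b) (pc (tuple r2 ! i'))"
      using itms_right[OF ir la(2), of id b] T1(12) by simp
    have e1: "map (itm (pidx (v1 \<otimes> v2)) (ev (v1 \<otimes> v2) h)) (pc (tuple (s1 \<otimes> s2) ! j)) = map (itm (\<lambda>m. ?n + pidx v2 m) (ev v2 b)) w"
      unfolding ev t1 itms_right[OF js lv] unfolding w component.sel by (rule c)
    show ?thesis unfolding e1 e3 unfolding h t2 e2 by (rule d)
  qed
qed

lemma complete_parallel: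
  fixes P :: "('p, 'f, 'v) clause set"
  assumes t1: "typed S s1 u1 v1 r1" and t2: "typed S s2 u2 v2 r2"
    and c1: "complete_tile S P D1 s1 u1 v1 r1" and c2: "complete_tile S P D2 s2 u2 v2 r2"
  shows "complete_tile S P (pskel s1 D1 D2) (s1 \<otimes> s2) (u1 \<otimes> u2) (v1 \<otimes> v2) (r1 \<otimes> r2)"
  unfolding complete_tile_def
proof (intro allI impI)
  note T1 = typedD[OF t1] and T2 = typedD[OF t2]
  fix \<alpha> \<beta> :: "('p, 'f, 'v) val list"
  assume "env S (src (s1 \<otimes> s2)) \<alpha>" "env S (src (u1 \<otimes> u2)) \<beta>" and sol: "solves S P (pskel s1 D1 D2) (s1 \<otimes> s2) (u1 \<otimes> u2) \<alpha> \<beta>"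
  then obtain a b c d where \<alpha>: "\<alpha> = a @ b" "env S (src s1) a" "env S (src s2) b" and \<beta>: "\<beta> = c @ d" "env S (src u1) c" "env S (src u2) d"
    using env_split[of S "src s1" "src s2" \<alpha>] env_split[of S "src u1" "src u2" \<beta>] by auto
  have la: "length a = length (src s1)" and lc: "length c = length (src u1)" using env_length[OF \<alpha>(2)] env_length[OF \<beta>(2)] by auto
  have su: "length (tuple u1) = length (tuple s1)" using T1(13) by simp
  have "solves S P D1 s1 u1 a c"
    unfolding solves_def
  proof (intro allI impI)
    fix j assume j: "j < length (tuple s1)"
    have e: "evc (tuple s1 ! j) (a @ b) = evc (tuple s1 ! j) a" "evc (tuple u1 ! j) (c @ d) = evc (tuple u1 ! j) c"
      using evc_left[OF wf_nth[OF T1(5) j] la] evc_left[OF wf_nth[OF T1(7), of j] lc] j su by auto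
    have s: "(tgt s1 ! j = Tm \<longrightarrow> evc (tuple s1 ! j) a = evc (tuple u1 ! j) c) \<and>
      (tgt s1 ! j = Pr \<longrightarrow> (\<exists>ms. der S P (D1 j) (map (itm (\<lambda>m. vg ((a @ b) ! m)) (a @ b)) (pc (tuple s1 ! j))) ms \<and> evc (tuple u1 ! j) c = VG (concat (map flat ms))))"
      using sol[unfolded solves_def, rule_format, of j] j su e unfolding \<alpha>(1) \<beta>(1)
      by (simp add: pskel_def nth_par_left nth_append[of "tgt s1"] length_tuple[symmetric])
    have "map (itm (\<lambda>m. vg ((a @ b) ! m)) (a @ b)) (pc (tuple s1 ! j)) = map (itm (\<lambda>m. vg (a ! m)) a) (pc (tuple s1 ! j))" if Pr: "tgt s1 ! j = Pr"
    proof -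
      obtain w where w: "tuple s1 ! j = PC w" using j Pr by (auto simp: tgt_nth_Pr)
      have "map (itm (\<lambda>m. vg ((a @ b) ! m)) a) w = map (itm (\<lambda>m. vg (a ! m)) a) w"
      proof (rule itm_cong)
        fix m assume "PVar m \<in> set w"
        then have "wf_lit S (src s1) (PVar m)" by (rule wf_PC[OF T1(5) j w])
        then show "vg ((a @ b) ! m) = vg (a ! m)" using la by (simp add: nth_append)
      qed
      then show ?thesis using itms_left[OF T1(5) j la Pr, of "\<lambda>m. vg ((a @ b) ! m)" b] w by simp
    qed
    with s show "(tgt s1 ! j = Tm \<longrightarrow> evc (tuple s1 ! j) a = evc (tuple u1 ! j) c) \<and>
      (tgt s1 ! j = Pr \<longrightarrow> (\<exists>ms. der S P (D1 j) (map (itm (\<lambda>m. vg (a ! m)) a) (pc (tuple s1 ! j))) ms \<and> evc (tuple u1 ! j) c = VG (concat (map flat ms))))"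
      by simp
  qed
  then obtain h1 where h1: "env S (src v1) h1" "a = ev v1 h1" "c = ev r1 h1" using c1 \<alpha>(2) \<beta>(2) unfolding complete_tile_def by blast
  have "solves S P D2 s2 u2 b d"
    unfolding solves_def
  proof (intro allI impI)
    fix j assume j: "j < length (tuple s2)"
    let ?j = "length (tuple s1) + j"
    have j1: "?j < length (tuple (s1 \<otimes> s2))" using j by simp
    have t: "tuple (s1 \<otimes> s2) ! ?j = shift_comp (length (src s1)) (tuple s2 ! j)" using j by (simp add: nth_par_right)
    have u: "tuple (u1 \<otimes> u2) ! ?j = shift_comp (length (src u1)) (tuple u2 ! j)" using j su T2(13) nth_par_right[of j u2 u1] by simp
    have g: "tgt (s1 \<otimes> s2) ! ?j = tgt s2 ! j" by (simp add: nth_append length_tuple)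
    have D: "pskel s1 D1 D2 ?j = D2 j" by (simp add: pskel_def)
    have "map (itm (\<lambda>m. vg ((a @ b) ! m)) (a @ b)) (pc (shift_comp (length (src s1)) (tuple s2 ! j))) = map (itm (\<lambda>m. vg (b ! m)) b) (pc (tuple s2 ! j))" if "tgt s2 ! j = Pr"
    proof -
      have gg: "(\<lambda>m. vg ((a @ b) ! (length (src s1) + m))) = (\<lambda>m. vg (b ! m))" using la[symmetric] by simp
      show ?thesis using itms_right[OF j that la, of "\<lambda>m. vg ((a @ b) ! m)" b] unfolding gg .
    qed
    then show "(tgt s2 ! j = Tm \<longrightarrow> evc (tuple s2 ! j) b = evc (tuple u2 ! j) d) \<and>
      (tgt s2 ! j = Pr \<longrightarrow> (\<exists>ms. der S P (D2 j) (map (itm (\<lambda>m. vg (b ! m)) b) (pc (tuple s2 ! j))) ms \<and> evc (tuple u2 ! j) d = VG (concat (map flat ms))))"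
      using sol[unfolded solves_def, rule_format, OF j1] unfolding t u g D \<alpha>(1) \<beta>(1) evc_shift[OF la] evc_shift[OF lc] by auto
  qed
  then obtain h2 where h2: "env S (src v2) h2" "b = ev v2 h2" "d = ev r2 h2" using c2 \<alpha>(3) \<beta>(3) unfolding complete_tile_def by blast
  have lh: "length h1 = length (src v1)" "length h1 = length (src r1)" using env_length[OF h1(1)] T1(12) by auto
  have "env S (src (v1 \<otimes> v2)) (h1 @ h2)" using env_append[OF lh(1), of S "src v2" h2] h1(1) h2(1) by simp
  then show "\<exists>h. env S (src (v1 \<otimes> v2)) h \<and> \<alpha> = ev (v1 \<otimes> v2) h \<and> \<beta> = ev (r1 \<otimes> r2) h"
    using \<alpha>(1) \<beta>(1) h1(2,3) h2(2,3) ev_par[OF T1(8) lh(1), of v2 h2] ev_par[OF T1(6) lh(2), of r2 h2] by auto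
qed

lemma good_parallel:
  fixes P :: "('p, 'f, 'v) clause set"
  assumes "good S P s1 u1 v1 r1" "good S P s2 u2 v2 r2"
  shows "good S P (s1 \<otimes> s2) (u1 \<otimes> u2) (v1 \<otimes> v2) (r1 \<otimes> r2)"
proof -
  obtain D1 D2 where "typed S s1 u1 v1 r1" "typed S s2 u2 v2 r2" "sound S P D1 s1 u1 v1 r1" "sound S P D2 s2 u2 v2 r2"
    "complete_tile S P D1 s1 u1 v1 r1" "complete_tile S P D2 s2 u2 v2 r2" "linear_trigger u1 r1" "linear_trigger u2 r2"
    using assms unfolding good_def by blast
  then show ?thesis unfolding good_def
    by (intro conjI exI[of _ "pskel s1 D1 D2"] typed_parallel linear_parallel sound_parallel complete_parallel)
qed

subsection \<open>Lifting to SLD-resolution\<close>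

fun node_count :: "('p, 'f, 'v) skeleton list \<Rightarrow> nat" where
  "node_count [] = 0"
| "node_count (Leaf # ds) = node_count ds"
| "node_count (Node C cs # ds) = Suc (node_count cs + node_count ds)"

lemma node_count_append [simp]: "node_count (ds @ es) = node_count ds + node_count es"
  by (induction ds rule: node_count.induct) auto

lemma der_all_Leaf: "set ds \<subseteq> {Leaf} \<Longrightarrow> der S P ds gs ms \<longleftrightarrow> length gs = length ds \<and> ms = gs"
proof (induction ds arbitrary: gs ms)
  case (Cons d ds)
  then have "d = Leaf" by simp
  then show ?case using Cons by (cases gs) (auto simp: der_Leaf_iff)
qed auto

lemma der_NodeE:
  assumes "der S P (Node C cs # ds) (g # gs) ms"
  obtains \<tau> n1 n2 where "C \<in> P" "\<forall>x\<in>vars_clause C. wf_trm S (\<tau> x)" "g = At (subst_atom (head C) \<tau>)"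
    "der S P cs (map (\<lambda>B. At (subst_atom B \<tau>)) (body C)) n1" "der S P ds gs n2" "ms = n1 @ n2"
  using assms unfolding der_Node_iff by blast

lemma ex_fresh_renaming:
  assumes "finite V" "finite (W :: 'v :: infinite set)"
  shows "\<exists>\<rho>. inj_on \<rho> V \<and> \<rho> ` V \<inter> W = {}"
proof -
  obtain ns where ns: "distinct ns" "length ns = card V" "set ns \<inter> W = {}" using ex_fresh_list[OF assms(2)] by blast
  then have "card V = card (set ns)" by (simp add: distinct_card)
  then obtain \<rho> where "bij_betw \<rho> V (set ns)" using finite_same_card_bij[OF assms(1), of "set ns"] by auto
  then show ?thesis using ns(3) by (auto simp: bij_betw_def)
qed

text \<open>A derivation by instances is covered by an SLD-derivation that resolves the same nodes;
  the induction is on their number. The derivation in the conclusion repeats the skeleton for the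
  computed \<open>\<sigma>\<close> and \<open>G'\<close>, and it is what completeness of a tile is
  later applied to. The set \<open>W\<close> collects the variables seen so far: clause variants
  avoid them, and the factorization through \<open>k\<close> is asserted on them.\<close>

lemma resolution_lifting:
  fixes P :: "('p, 'f, 'v :: infinite) clause set"
  assumes wfP: "wf_program S P" and "finite W" "vars_goal G \<subseteq> W" "wf_goal S G" "\<And>x. x \<in> W \<Longrightarrow> wf_trm S (\<theta>\<^sub>0 x)"
    and "der S P ds (map (\<lambda>A. At (subst_atom A \<theta>\<^sub>0)) G) (ms :: ('p, 'f, 'v, 'x) item list)"
  shows "\<exists>\<sigma> G' k. resolutions S P W G \<sigma> G' \<and> (\<forall>x\<in>W. \<theta>\<^sub>0 x = \<sigma> x \<cdot>\<^sub>t k) \<and> ms = map (\<lambda>A. At (subst_atom A k)) G' \<and>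
    der S P ds (map (\<lambda>A. At (subst_atom A \<sigma>)) G) (map At G' :: ('p, 'f, 'v, 'x) item list) \<and> (\<forall>x\<in>W. wf_trm S (\<sigma> x))"
  using assms(2-)
proof (induction "node_count ds" arbitrary: ds W G \<theta>\<^sub>0 ms rule: less_induct)
  case less
  note finW = less.prems(1) and GW = less.prems(2) and wfG = less.prems(3) and wf\<theta>0 = less.prems(4) and d = less.prems(5)
  show ?case
  proof (cases "set ds \<subseteq> {Leaf}")
    case True
    have "length ds = length G" using der_length[OF d] by simp
    then have "der S P ds (map (\<lambda>A. At (subst_atom A Var)) G) (map At G :: ('p, 'f, 'v, 'x) item list)"
      by (simp add: der_all_Leaf[OF True])
    moreover have "ms = map (\<lambda>A. At (subst_atom A \<theta>\<^sub>0)) G" using d by (simp add: der_all_Leaf[OF True])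
    ultimately show ?thesis
      by (intro exI[of _ Var] exI[of _ G] exI[of _ \<theta>\<^sub>0]) (simp add: resolutions.none)
  next
    case False
    \<comment> \<open>Any node at the top level may be resolved first; its children take its place
      in the forest.\<close>
    then obtain C cs where "Node C cs \<in> set ds" by (metis insertI1 skeleton.exhaust subsetI)
    then obtain ds1 ds2 where ds: "ds = ds1 @ Node C cs # ds2" by (meson split_list)
    have lenG: "length G = length ds" using der_length[OF d] by simp
    define G1 A G2 where "G1 = take (length ds1) G" and "A = G ! length ds1" and "G2 = drop (Suc (length ds1)) G"
    have G: "G = G1 @ [A] @ G2" using lenG ds by (simp add: G1_def A_def G2_def id_take_nth_drop)
    have lenG1: "length G1 = length ds1" using lenG ds by (simp add: G1_def)
    let ?i = "\<lambda>\<sigma>. map (\<lambda>A. At (subst_atom A \<sigma>))"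
    have "der S P (ds1 @ Node C cs # ds2) (?i \<theta>\<^sub>0 G1 @ (At (subst_atom A \<theta>\<^sub>0) # ?i \<theta>\<^sub>0 G2)) ms" using d G ds by simp
    then obtain m1 m' where m1: "ms = m1 @ m'" "der S P ds1 (?i \<theta>\<^sub>0 G1) m1" "der S P (Node C cs # ds2) (At (subst_atom A \<theta>\<^sub>0) # ?i \<theta>\<^sub>0 G2) m'"
      using der_appendD[of S P ds1 "Node C cs # ds2" "?i \<theta>\<^sub>0 G1" "At (subst_atom A \<theta>\<^sub>0) # ?i \<theta>\<^sub>0 G2" ms] lenG1 by auto
    from m1(3) obtain \<tau> n1 m2 where \<tau>: "C \<in> P" "\<forall>x\<in>vars_clause C. wf_trm S (\<tau> x)" "(At (subst_atom A \<theta>\<^sub>0) :: ('p, 'f, 'v, 'x) item) = At (subst_atom (head C) \<tau>)"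
      "der S P cs (?i \<tau> (body C)) n1" "der S P ds2 (?i \<theta>\<^sub>0 G2) m2" "m' = n1 @ m2"
      by (rule der_NodeE)
    obtain \<rho> where \<rho>: "inj_on \<rho> (vars_clause C)" "\<rho> ` vars_clause C \<inter> W = {}" using ex_fresh_renaming[OF finite_vars_clause[of C] finW] by blast
    define C' where "C' = subst_clause C (Var \<circ> \<rho>)"
    have hd: "head C' = subst_atom (head C) (Var \<circ> \<rho>)" "body C' = subst_goal (body C) (Var \<circ> \<rho>)" by (simp_all add: C'_def subst_clause_def)
    have vC': "vars_clause C' = \<rho> ` vars_clause C" by (auto simp: C'_def vars_subst_clause)
    have var: "variant_of C' C" using \<rho>(1) by (auto simp: variant_of_def C'_def)
    \<comment> \<open>Unifies the selected atom with the renamed head: the goal instance on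
      \<open>W\<close>, the clause instance on the fresh variables, and the identity elsewhere for
      the sake of finite support.\<close>
    define \<mu> where "\<mu> y = (if y \<in> W then \<theta>\<^sub>0 y else if y \<in> \<rho> ` vars_clause C then \<tau> (inv_into (vars_clause C) \<rho> y) else Var y)" for y
    have \<mu>W: "\<mu> x = \<theta>\<^sub>0 x" if "x \<in> W" for x using that by (simp add: \<mu>_def)
    have \<mu>C: "\<mu> (\<rho> x) = \<tau> x" if "x \<in> vars_clause C" for x using that \<rho> by (auto simp: \<mu>_def)
    have "finite {y. \<mu> y \<noteq> Var y}" by (rule finite_subset[of _ "W \<union> \<rho> ` vars_clause C"]) (auto simp: \<mu>_def finW)
    moreover have "wf_trm S (\<mu> y)" for y
      using wf\<theta>0[of y] \<tau>(2) \<rho>(1) by (auto simp: \<mu>_def)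
    ultimately have \<mu>s: "is_subst S \<mu>" by (simp add: is_subst_def)
    have A\<mu>: "subst_atom B \<mu> = subst_atom B \<theta>\<^sub>0" if "vars_atom B \<subseteq> W" for B :: "('p, 'f, 'v) atom"
      by (rule subst_atom_cong) (use that \<mu>W in auto)
    have C\<mu>: "subst_atom (subst_atom B (Var \<circ> \<rho>)) \<mu> = subst_atom B \<tau>" if "vars_atom B \<subseteq> vars_clause C" for B :: "('p, 'f, 'v) atom"
      unfolding subst_atom_comp by (rule subst_atom_cong) (use that \<mu>C in auto)
    have vars: "vars_goal G1 \<subseteq> W" "vars_atom A \<subseteq> W" "vars_goal G2 \<subseteq> W" using GW G by auto
    have unif: "subst_atom A \<mu> = subst_atom (head C') \<mu>"
      using A\<mu>[OF vars(2)] C\<mu>[of "head C"] \<tau>(3) hd by (simp add: vars_clause_def)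
    have wfC: "wf_atom S (head C)" "wf_goal S (body C)" using wfP \<tau>(1) by (auto simp: wf_program_def)
    have wfH: "wf_atom S (head C')" unfolding hd by (rule wf_subst_atom) (use wfC in simp_all)
    have wfB: "wf_goal S (body C')" unfolding hd by (rule wf_subst_goal) (use wfC in simp_all)
    obtain \<theta> where mgu: "is_mgu S \<theta> A (head C')" using mgu_exists[OF _ wfH unif] wfG G by auto
    then have \<theta>: "is_subst S \<theta>" "subst_atom A \<theta> = subst_atom (head C') \<theta>" by (auto simp: is_mgu_def)
    from mgu \<mu>s unif obtain \<gamma> where \<gamma>: "is_subst S \<gamma>" "\<mu> = \<theta> \<circ>\<^sub>s \<gamma>" unfolding is_mgu_def by blast
    have \<mu>\<gamma>: "\<theta> y \<cdot>\<^sub>t \<gamma> = \<mu> y" for y using \<gamma>(2) by (simp add: subst_comp_def)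
    let ?B = "G1 @ body C' @ G2"
    let ?H = "subst_goal ?B \<theta>"
    let ?W = "W \<union> vars_clause C' \<union> vars_subst \<theta>"
    have \<theta>W: "vars_trm (\<theta> x) \<subseteq> ?W" if "x \<in> W \<union> vars_clause C'" for x
      using that by (cases "\<theta> x = Var x") (auto simp: vars_subst_def)
    have fin: "finite ?W" using finW \<theta>(1) by (auto simp: vars_subst_def is_subst_def)
    have "vars_goal ?B \<subseteq> W \<union> vars_clause C'" using vars by (auto simp: vars_clause_def)
    then have HW: "vars_goal ?H \<subseteq> ?W" unfolding vars_subst_goal using \<theta>W by blast
    have wfH': "wf_goal S ?H" by (rule wf_subst_goal) (use wfG G wfB \<theta>(1) in \<open>auto simp: is_subst_def\<close>)
    \<comment> \<open>Since \<open>\<mu>\<close> factors through the unifier, the new goal under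
      \<open>\<gamma>\<close> is the old derivation with the resolved node removed.\<close>
    have iH: "?i \<gamma> (subst_goal K \<theta>) = ?i \<mu> K" for K :: "('p, 'f, 'v) goal"
      by (simp add: subst_goal_def subst_atom_comp \<mu>\<gamma>)
    have i1: "?i \<mu> K = ?i \<theta>\<^sub>0 K" if "vars_goal K \<subseteq> W" for K :: "('p, 'f, 'v) goal"
      using that by (auto simp: vars_goal_def intro!: A\<mu>)
    have i2: "?i \<mu> (body C') = ?i \<tau> (body C)"
      unfolding hd by (auto simp: subst_goal_def vars_clause_def vars_goal_def intro!: C\<mu>)
    have "der S P (ds1 @ cs @ ds2) (?i \<theta>\<^sub>0 G1 @ ?i \<tau> (body C) @ ?i \<theta>\<^sub>0 G2) (m1 @ n1 @ m2)"
      by (intro der_appendI m1(2) \<tau>(4,5))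
    then have dH: "der S P (ds1 @ cs @ ds2) (?i \<gamma> ?H) (m1 @ n1 @ m2)"
      unfolding iH by (simp add: i1[OF vars(1)] i1[OF vars(3)] i2)
    have "node_count (ds1 @ cs @ ds2) < node_count ds" using ds by simp
    from less.hyps[OF this fin HW wfH' _ dH] \<gamma>(1)
    obtain \<sigma>' G' k where IH: "resolutions S P ?W ?H \<sigma>' G'" "\<forall>x\<in>?W. \<gamma> x = \<sigma>' x \<cdot>\<^sub>t k" "m1 @ n1 @ m2 = map (\<lambda>A. At (subst_atom A k)) G'"
      "der S P (ds1 @ cs @ ds2) (?i \<sigma>' ?H) (map At G' :: ('p, 'f, 'v, 'x) item list)" "\<forall>x\<in>?W. wf_trm S (\<sigma>' x)"
      unfolding is_subst_def by blast
    let ?\<sigma> = "\<theta> \<circ>\<^sub>s \<sigma>'"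
    have \<sigma>: "?\<sigma> x = \<theta> x \<cdot>\<^sub>t \<sigma>'" for x by (simp add: subst_comp_def)
    have \<sigma>': "(\<lambda>x. \<theta> x \<cdot>\<^sub>t \<sigma>') = ?\<sigma>" by (rule ext) (simp add: \<sigma>)
    have "resolution S P W (G1 @ [A] @ G2) \<theta> ?H ?W"
      by (rule resolution.resolve[OF \<tau>(1) var _ mgu]) (use vC' \<rho>(2) in simp)
    then have res: "resolutions S P W G ?\<sigma> G'" unfolding G using IH(1) by (rule resolutions.step)
    have fact: "\<theta>\<^sub>0 x = ?\<sigma> x \<cdot>\<^sub>t k" if x: "x \<in> W" for x
    proof -
      have "\<theta>\<^sub>0 x = \<theta> x \<cdot>\<^sub>t \<gamma>" using \<mu>W[OF x] \<mu>\<gamma> by simp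
      also have "\<dots> = \<theta> x \<cdot>\<^sub>t (\<lambda>y. \<sigma>' y \<cdot>\<^sub>t k)" by (rule subst_trm_cong) (use \<theta>W[of x] x IH(2) in blast)
      finally show ?thesis by (simp add: \<sigma> subst_trm_comp)
    qed
    have wf\<sigma>: "wf_trm S (?\<sigma> x)" if "x \<in> W \<union> vars_clause C'" for x
      unfolding \<sigma> by (rule wf_subst_trm) (use \<theta>(1) \<theta>W[OF that] IH(5) in \<open>auto simp: is_subst_def\<close>)
    have i\<sigma>: "?i \<sigma>' (subst_goal K \<theta>) = ?i ?\<sigma> K" for K :: "('p, 'f, 'v) goal"
      by (simp add: subst_goal_def subst_atom_comp \<sigma>')
    have lenB: "length (body C') = length cs" using der_length[OF \<tau>(4)] hd by (simp add: subst_goal_def)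
    \<comment> \<open>The derivation lifted for the new goal is cut out at \<open>cs\<close> again,
      to be put back under its node.\<close>
    have "der S P (ds1 @ cs @ ds2) (?i ?\<sigma> G1 @ ?i ?\<sigma> (body C') @ ?i ?\<sigma> G2) (map At G' :: ('p, 'f, 'v, 'x) item list)"
      using IH(4) unfolding i\<sigma> by simp
    then obtain a1 a' where a1: "map At G' = a1 @ a'" "der S P ds1 (?i ?\<sigma> G1) a1" "der S P (cs @ ds2) (?i ?\<sigma> (body C') @ ?i ?\<sigma> G2) (a' :: ('p, 'f, 'v, 'x) item list)"
      using der_appendD[of S P ds1 "cs @ ds2" "?i ?\<sigma> G1" "?i ?\<sigma> (body C') @ ?i ?\<sigma> G2" "map At G'"] lenG1 by auto
    obtain a2 a3 where a2: "a' = a2 @ a3" "der S P cs (?i ?\<sigma> (body C')) a2" "der S P ds2 (?i ?\<sigma> G2) a3"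
      using der_appendD[OF a1(3)] lenB by auto
    \<comment> \<open>The instance of the original clause at this node in the lifted
      derivation.\<close>
    let ?\<tau> = "\<lambda>x. ?\<sigma> (\<rho> x)"
    have "?i ?\<sigma> (body C') = (?i ?\<tau> (body C) :: ('p, 'f, 'v, 'x) item list)" unfolding hd by (simp add: subst_goal_def subst_atom_comp)
    then have b: "der S P cs (?i ?\<tau> (body C)) a2" using a2(2) by simp
    have w: "\<forall>x\<in>vars_clause C. wf_trm S (?\<tau> x)" using wf\<sigma> vC' by blast
    have "subst_atom A ?\<sigma> = subst_atom (subst_atom A \<theta>) \<sigma>'" by (simp add: subst_atom_comp \<sigma>')
    also have "\<dots> = subst_atom (subst_atom (head C') \<theta>) \<sigma>'" using \<theta>(2) by simp
    also have "\<dots> = subst_atom (head C) ?\<tau>" unfolding hd by (simp add: subst_atom_comp \<sigma>)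
    finally have "der S P (Node C cs # ds2) (At (subst_atom A ?\<sigma>) # ?i ?\<sigma> G2) (a2 @ a3)"
      using der.Node[OF \<tau>(1) w b a2(3)] by simp
    from der_appendI[OF a1(2) this] have dd: "der S P ds (?i ?\<sigma> G) (map At G' :: ('p, 'f, 'v, 'x) item list)" using a1(1) a2(1) ds G by simp
    have mm: "ms = map (\<lambda>A. At (subst_atom A k)) G'" using IH(3) m1(1) \<tau>(6) by simp
    show ?thesis
      by (intro exI[of _ ?\<sigma>] exI[of _ G'] exI[of _ k] conjI res mm dd ballI fact wf\<sigma>) auto
  qed
qed

section \<open>Identity tiles and basic tiles satisfy the invariant\<close>

lemma tgt_ident [simp]: "tgt (ident ob :: ('p, 'f) arrow) = ob"
  and src_ident [simp]: "src (ident ob :: ('p, 'f) arrow) = ob"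
proof -
  have "srt_of (var_comp ob i :: ('p, 'f) component) = ob ! i" for i by (cases "ob ! i") (simp_all add: var_comp_def)
  then show "tgt (ident ob :: ('p, 'f) arrow) = ob" by (simp add: ident_def tgt_def comp_def map_nth)
qed (simp add: ident_def)

lemma nth_ident: "i < length ob \<Longrightarrow> tuple (ident ob) ! i = var_comp ob i"
  and length_tuple_ident [simp]: "length (tuple (ident ob)) = length ob"
  by (simp_all add: ident_def)

lemma wf_arrow_ident: "wf_arrow S (ident ob)"
proof -
  have "wf_comp S ob (var_comp ob i)" if "i < length ob" for i
    using that by (cases "ob ! i") (simp_all add: var_comp_def)
  then show ?thesis by (auto simp: wf_arrow_def ident_def)
qed

lemma is_obs_ident: "is_obs S (ident ob)"
proof -
  have "(\<exists>t. var_comp ob i = TC t) \<or> (\<exists>k. var_comp ob i = PC [PVar k])" for i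
    by (cases "ob ! i") (simp_all add: var_comp_def)
  then show ?thesis using wf_arrow_ident[of S ob] by (auto simp: is_obs_def wf_arrow_def ident_def)
qed

lemma is_conf_ident:
  fixes S :: "('p, 'f) signature"
  shows "is_conf S (ident ob)"
proof -
  have v: "pvars_comp (var_comp ob i :: ('p, 'f) component) = (if ob ! i = Pr then [i] else [])" for i
    by (cases "ob ! i") (simp_all add: var_comp_def)
  have "concat (map (\<lambda>i. if ob ! i = Pr then [i] else []) is) = filter (\<lambda>i. ob ! i = Pr) is" for "is"
    by (induction "is") auto
  then have "pvars (ident ob :: ('p, 'f) arrow) = filter (\<lambda>i. ob ! i = Pr) [0..<length ob]"
    by (simp add: pvars_def ident_def comp_def v)
  then show ?thesis using wf_arrow_ident[of S ob] by (auto simp: is_conf_alt)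
qed

lemma pvar_at_ident: "pvar_at (ident ob) j i \<longleftrightarrow> i = j \<and> j < length ob \<and> ob ! j = Pr"
  by (cases "ob ! j") (auto simp: pvar_at_def nth_ident var_comp_def)

lemma evc_ident:
  assumes "env S ob h" "j < length ob"
  shows "evc (tuple (ident ob) ! j) h = h ! j"
  using assms env_nth[OF assms] by (cases "ob ! j") (auto simp: nth_ident var_comp_def)

text \<open>Skeletons consist of leaves: nothing is resolved, and the trigger receives the evaluated
  configuration.\<close>

lemma good_id_conf:
  fixes P :: "('p, 'f, 'v) clause set"
  assumes c: "is_conf S a"
  shows "good S P a (ident (tgt a)) (ident (src a)) a"
proof -
  let ?D = "\<lambda>j. replicate (length (pc (tuple a ! j))) Leaf :: ('p, 'f, 'v) skeleton list"
  have wf: "wf_arrow S a" by (rule is_conf_wf[OF c])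
  have t: "typed S a (ident (tgt a)) (ident (src a)) a" using c by (simp add: typed_def is_obs_ident)
  have l: "linear_trigger (ident (tgt a)) a" unfolding linear_trigger_def by (auto simp: pvar_at_ident)
  have dl: "der S P (?D j) gs ms \<longleftrightarrow> length gs = length (?D j) \<and> ms = gs" for j and gs ms :: "('p, 'f, 'v, 'x) item list"
    by (rule der_all_Leaf) auto
  have "sound S P ?D a (ident (tgt a)) (ident (src a)) a"
    unfolding sound_def
  proof (intro allI impI conjI)
    fix h :: "('p, 'f, 'v) val list" assume "env S (src (ident (src a))) h"
    then have h: "env S (src a) h" by simp
    have ei: "ev (ident (src a)) h = h" by (rule ev_ident[OF h])
    have ea: "env S (tgt a) (ev a h)" by (rule env_ev[OF wf h])
    { fix j assume j: "j < length (tuple a)"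
      show "evc (tuple a ! j) (ev (ident (src a)) h) = evc (tuple (ident (tgt a)) ! j) (ev a h)"
        using evc_ident[OF ea, of j] j ei by (simp add: ev_def length_tuple) }
    fix j i assume "pvar_at (ident (tgt a)) j i"
    then have ij: "i = j" "j < length (tuple a)" "tgt a ! j = Pr" by (auto simp: pvar_at_ident length_tuple)
    then obtain w where w: "tuple a ! j = PC w" by (auto simp: tgt_nth_Pr)
    have mm: "map (itm (pidx (ident (src a) :: ('p, 'f) arrow)) h) w = map (itm id h) w"
    proof (rule itm_cong)
      fix m assume "PVar m \<in> set w"
      then have "wf_lit S (src a) (PVar m)" by (rule wf_PC[OF wf ij(2) w])
      then have "pvar_at (ident (src a) :: ('p, 'f) arrow) m m" by (simp add: pvar_at_ident)
      then show "pidx (ident (src a) :: ('p, 'f) arrow) m = id m" by (simp add: pvar_at_pidx)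
    qed
    show "der S P (?D j) (map (itm (pidx (ident (src a) :: ('p, 'f) arrow)) (ev (ident (src a)) h)) (pc (tuple a ! j))) (map (itm id h) (pc (tuple a ! i)))"
      unfolding ei ij(1) w component.sel mm by (subst der_all_Leaf) auto
  qed
  moreover have "complete_tile S P ?D a (ident (tgt a)) (ident (src a)) a"
    unfolding complete_tile_def
  proof (intro allI impI)
    fix \<alpha> \<beta> :: "('p, 'f, 'v) val list"
    assume \<alpha>: "env S (src a) \<alpha>" and "env S (src (ident (tgt a))) \<beta>" and sol: "solves S P ?D a (ident (tgt a)) \<alpha> \<beta>"
    then have \<beta>: "env S (tgt a) \<beta>" by simp
    have "\<beta> = ev a \<alpha>"
    proof (rule nth_equalityI)
      show "length \<beta> = length (ev a \<alpha>)" using env_length[OF \<beta>] by (simp add: ev_def length_tuple)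
      fix j assume "j < length \<beta>"
      then have j: "j < length (tuple a)" "j < length (tgt a)" using env_length[OF \<beta>] by (simp_all add: length_tuple)
      have e: "evc (tuple (ident (tgt a)) ! j) \<beta> = \<beta> ! j" by (rule evc_ident[OF \<beta> j(2)])
      show "\<beta> ! j = ev a \<alpha> ! j"
      proof (cases "tgt a ! j")
        case Tm
        then show ?thesis using sol j e unfolding solves_def by (simp add: ev_def)
      next
        case Pr
        then obtain w where w: "tuple a ! j = PC w" using j(1) by (auto simp: tgt_nth_Pr)
        obtain ms where ms: "der S P (?D j) (map (itm (\<lambda>m. vg (\<alpha> ! m)) \<alpha>) w) ms" "\<beta> ! j = VG (concat (map flat ms))"
          using sol j e Pr w unfolding solves_def by auto
        have leaf: "set (?D j) \<subseteq> {Leaf}" by auto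
        have "ms = map (itm (\<lambda>m. vg (\<alpha> ! m)) \<alpha>) w" using ms(1) unfolding der_all_Leaf[OF leaf] by simp
        then show ?thesis using ms(2) w j(1) concat_flat_itm[of \<alpha> w] by (simp add: ev_def)
      qed
    qed
    then show "\<exists>h. env S (src (ident (src a))) h \<and> \<alpha> = ev (ident (src a)) h \<and> \<beta> = ev a h"
      using \<alpha> ev_ident[OF \<alpha>] by (intro exI[of _ \<alpha>]) simp
  qed
  ultimately show ?thesis using t l unfolding good_def by blast
qed

text \<open>A component of sort \<open>p\<close> of the identity configuration is one variable,
  hence the constant skeleton \<open>[Leaf]\<close>; at the other positions only equality of terms
  is asked.\<close>

lemma good_id_obs:
  fixes P :: "('p, 'f, 'v) clause set"
  assumes ob: "is_obs S v"
  shows "good S P (ident (tgt v)) v v (ident (src v))"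
proof -
  let ?D = "\<lambda>j. [Leaf] :: ('p, 'f, 'v) skeleton list"
  have wf: "wf_arrow S v" by (rule is_obs_wf[OF ob])
  have t: "typed S (ident (tgt v)) v v (ident (src v))" using ob by (simp add: typed_def is_conf_ident)
  have l: "linear_trigger v (ident (src v))" unfolding linear_trigger_def by (auto simp: nth_ident var_comp_def)
  have "sound S P ?D (ident (tgt v)) v v (ident (src v))"
    unfolding sound_def
  proof (intro allI impI conjI)
    fix h :: "('p, 'f, 'v) val list" assume h: "env S (src v) h"
    have ei: "ev (ident (src v)) h = h" by (rule ev_ident[OF h])
    have ea: "env S (tgt v) (ev v h)" by (rule env_ev[OF wf h])
    { fix j assume j: "j < length (tuple (ident (tgt v)))"
      then show "evc (tuple (ident (tgt v)) ! j) (ev v h) = evc (tuple v ! j) (ev (ident (src v)) h)"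
        using evc_ident[OF ea, of j] ei by (simp add: ev_def length_tuple[symmetric]) }
    fix j i assume ji: "pvar_at v j i"
    note p = pvar_atD[OF ob ji]
    have "tuple (ident (tgt v) :: ('p, 'f) arrow) ! j = PC [PVar j]" "tuple (ident (src v) :: ('p, 'f) arrow) ! i = PC [PVar i]"
      using p by (simp_all add: nth_ident var_comp_def length_tuple)
    then show "der S P (?D j) (map (itm (pidx v) (ev v h)) (pc (tuple (ident (tgt v)) ! j))) (map (itm id h) (pc (tuple (ident (src v)) ! i)))"
      using pvar_at_pidx[OF ji] by (simp add: der_Leaf_iff)
  qed
  moreover have "complete_tile S P ?D (ident (tgt v)) v v (ident (src v))"
    unfolding complete_tile_def
  proof (intro allI impI)
    fix \<alpha> \<beta> :: "('p, 'f, 'v) val list"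
    assume "env S (src (ident (tgt v))) \<alpha>" and \<beta>: "env S (src v) \<beta>" and sol: "solves S P ?D (ident (tgt v)) v \<alpha> \<beta>"
    then have \<alpha>: "env S (tgt v) \<alpha>" by simp
    have "\<alpha> = ev v \<beta>"
    proof (rule nth_equalityI)
      show "length \<alpha> = length (ev v \<beta>)" using env_length[OF \<alpha>] by (simp add: ev_def length_tuple)
      fix j assume "j < length \<alpha>"
      then have j: "j < length (tuple v)" "j < length (tgt v)" using env_length[OF \<alpha>] by (simp_all add: length_tuple)
      have e: "evc (tuple (ident (tgt v)) ! j) \<alpha> = \<alpha> ! j" by (rule evc_ident[OF \<alpha> j(2)])
      show "\<alpha> ! j = ev v \<beta> ! j"
      proof (cases "tgt v ! j")
        case Tm
        then show ?thesis using sol j e unfolding solves_def by (simp add: ev_def)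
      next
        case Pr
        then have i: "tuple (ident (tgt v) :: ('p, 'f) arrow) ! j = PC [PVar j]" using j by (simp add: nth_ident var_comp_def)
        obtain ms where ms: "der S P [Leaf] [Ot (vg (\<alpha> ! j))] ms" "evc (tuple v ! j) \<beta> = VG (concat (map flat ms))"
          using sol j Pr i unfolding solves_def by auto
        then have "evc (tuple v ! j) \<beta> = VG (vg (\<alpha> ! j))" by (auto simp: der_Leaf_iff)
        then show ?thesis using env_nth[OF \<alpha> j(2)] Pr j by (auto simp: ev_def)
      qed
    qed
    then show "\<exists>h. env S (src v) h \<and> \<alpha> = ev v h \<and> \<beta> = ev (ident (src v)) h"
      using \<beta> ev_ident[OF \<beta>] by (intro exI[of _ \<beta>]) simp
  qed
  ultimately show ?thesis using t l unfolding good_def by blast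
qed

text \<open>Between powers of \<open>t\<close> the invariant is a statement on sets of terms: the
  square commutes and is a weak pullback.\<close>

lemma good_terms:
  fixes P :: "('p, 'f, 'v) clause set" and S :: "('p, 'f) signature"
  assumes t: "typed S s u v r" and Tm: "set (src u) \<subseteq> {Tm}" "set (tgt u) \<subseteq> {Tm}"
    and sd: "\<And>h :: ('p, 'f, 'v) val list. env S (src v) h \<Longrightarrow> ev s (ev v h) = ev u (ev r h)"
    and cp: "\<And>\<alpha> \<beta> :: ('p, 'f, 'v) val list. env S (src s) \<alpha> \<Longrightarrow> env S (src u) \<beta> \<Longrightarrow> ev s \<alpha> = ev u \<beta> \<Longrightarrow>
      \<exists>h. env S (src v) h \<and> \<alpha> = ev v h \<and> \<beta> = ev r h"
  shows "good S P s u v r"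
proof -
  note T = typedD[OF t]
  have tm: "tgt s ! j = Tm" if "j < length (tuple s)" for j
    using that Tm(2) T(9) by (metis length_tuple nth_mem singletonD subsetD)
  have np: "\<not> pvar_at u j i" for j i
    using pvar_atD(3,4)[OF T(3)] Tm(1) by (metis nth_mem singletonD srt.distinct(1) subsetD)
  have "linear_trigger u r" unfolding linear_trigger_def using Tm(1) by (metis nth_mem singletonD srt.distinct(1) subsetD)
  moreover have "sound S P (\<lambda>_. []) s u v r"
    unfolding sound_def
  proof (intro allI impI conjI)
    fix h :: "('p, 'f, 'v) val list" and j assume h: "env S (src v) h" and j: "j < length (tuple s)"
    show "evc (tuple s ! j) (ev v h) = evc (tuple u ! j) (ev r h)"
      using arg_cong[OF sd[OF h], of "\<lambda>l. l ! j"] j T(13) by (simp add: ev_def)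
  qed (use np in blast)
  moreover have "complete_tile S P (\<lambda>_. []) s u v r"
    unfolding complete_tile_def
  proof (intro allI impI)
    fix \<alpha> \<beta> :: "('p, 'f, 'v) val list"
    assume e: "env S (src s) \<alpha>" "env S (src u) \<beta>" and sol: "solves S P (\<lambda>_. []) s u \<alpha> \<beta>"
    have "ev s \<alpha> = ev u \<beta>"
    proof (rule nth_equalityI)
      show "length (ev s \<alpha>) = length (ev u \<beta>)" using T(13) by (simp add: ev_def)
      fix j assume "j < length (ev s \<alpha>)"
      then show "ev s \<alpha> ! j = ev u \<beta> ! j" using sol tm[of j] T(13) unfolding solves_def by (simp add: ev_def)
    qed
    then show "\<exists>h. env S (src v) h \<and> \<alpha> = ev v h \<and> \<beta> = ev r h" by (rule cp[OF e])
  qed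
  ultimately show ?thesis using t unfolding good_def by blast
qed

lemma env_tms: "env S (tms n) \<alpha> \<longleftrightarrow> (\<exists>ts. \<alpha> = map VT ts \<and> length ts = n \<and> (\<forall>t\<in>set ts. wf_trm S t))"
proof
  assume e: "env S (tms n) \<alpha>"
  have "VT (vt (\<alpha> ! i)) = \<alpha> ! i \<and> wf_trm S (vt (\<alpha> ! i))" if "i < n" for i
    using env_nth[OF e, of i] that by auto
  then have "\<forall>v\<in>set \<alpha>. VT (vt v) = v \<and> wf_trm S (vt v)" using env_length[OF e] by (auto simp: in_set_conv_nth)
  then show "\<exists>ts. \<alpha> = map VT ts \<and> length ts = n \<and> (\<forall>t\<in>set ts. wf_trm S t)"
    using env_length[OF e] by (intro exI[of _ "map vt \<alpha>"]) (auto simp: comp_def map_idI)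
qed (auto simp: env_def)

lemma ev_fun_arrow:
  assumes "length ts = farity S f"
  shows "ev (fun_arrow S f) (map VT ts) = [VT (Fun f ts)]"
  using assms by (auto simp: ev_def fun_arrow_def intro!: nth_equalityI)

lemma ev_dup:
  assumes "env S (tms n) h"
  shows "ev (dup (tms n)) h = h @ h"
proof -
  have "VT (vt (h ! i)) = h ! i" if "i < n" for i using env_nth[OF assms, of i] that by auto
  then have "map (\<lambda>i. evc (var_comp (tms n) i) h) [0..<n] = h"
    using env_length[OF assms] by (intro nth_equalityI) (auto simp: var_comp_def)
  then show ?thesis by (simp add: ev_def dup_def comp_def)
qed

lemma conf_obs_basic:
  shows "is_conf S (fun_arrow S f)" "is_obs S (fun_arrow S f)" "is_conf S (dup (tms n))" "is_obs S (dup (tms n))"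
    "is_conf S (symm (tms 1) (tms 1))" "is_obs S (symm (tms 1) (tms 1))"
proof -
  have f: "fun_arrow S f = terms_arrow [0..<farity S f] [Fun f (map Var [0..<farity S f])]"
    by (rule fun_arrow_terms_arrow[symmetric]) auto
  have wf: "wf_terms S [0..<farity S f] [Fun f (map Var [0..<farity S f])]" by auto
  show "is_conf S (fun_arrow S f)" "is_obs S (fun_arrow S f)" unfolding f by (rule is_conf_terms_arrow[OF wf], rule is_obs_terms_arrow[OF wf])
  have d: "dup (tms n) = terms_arrow [0..<n] (map Var ([0..<n] @ [0..<n]))" using dup_terms_arrow[of "[0..<n]"] by (metis distinct_upt length_upt diff_zero)
  have wf: "wf_terms S [0..<n] (map Var ([0..<n] @ [0..<n]))" by auto
  show "is_conf S (dup (tms n))" "is_obs S (dup (tms n))" unfolding d by (rule is_conf_terms_arrow[OF wf], rule is_obs_terms_arrow[OF wf])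
  have s: "symm (tms 1) (tms 1) = terms_arrow [0 :: nat, 1] [Var 1, Var 0]" by (rule symm_terms_arrow[symmetric]) simp
  have wf: "wf_terms S [0 :: nat, 1] [Var 1, Var 0]" by auto
  show "is_conf S (symm (tms 1) (tms 1))" "is_obs S (symm (tms 1) (tms 1))" unfolding s by (rule is_conf_terms_arrow[OF wf], rule is_obs_terms_arrow[OF wf])
qed

lemma src_tgt_basic [simp]:
  "src (fun_arrow S f) = tms (farity S f)" "tgt (fun_arrow S f) = [Tm]" "src (dup (tms n)) = tms n" "tgt (dup (tms n)) = tms n @ tms n"
  "src (symm (tms 1) (tms 1)) = tms 2" "tgt (symm (tms 1) (tms 1)) = tms 2"
  by (auto simp: fun_arrow_def tgt_def dup_def symm_def var_comp_def numeral_2_eq_2 intro!: nth_equalityI)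

lemma is_conf_goal_arrow:
  assumes "wf_goal S G" "vars_goal G \<subseteq> set xs"
  shows "is_conf S (goal_arrow xs G)"
proof -
  have "wf_goal S (subst_goal G (pos xs))" using assms(1) by (rule wf_subst_goal) (simp add: pos_def)
  moreover have "i < length xs" if "A \<in> set (subst_goal G (pos xs))" "i \<in> vars_atom A" for A i
    by (rule vars_goal_pos[OF assms(2)]) (use that in \<open>auto simp: vars_goal_def\<close>)
  ultimately show ?thesis by (auto simp: is_conf_def goal_arrow_def wf_goal_def comp_def concat_map_empty)
qed

lemma env_tms_1: "env S (tms 1) \<alpha> \<Longrightarrow> \<exists>t. \<alpha> = [VT t] \<and> wf_trm S t"
  unfolding env_tms by (auto simp: length_Suc_conv)

lemma env_tms_2: "env S (tms 2) \<alpha> \<Longrightarrow> \<exists>t u. \<alpha> = [VT t, VT u] \<and> wf_trm S t \<and> wf_trm S u"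
  unfolding env_tms by (auto simp: length_Suc_conv numeral_2_eq_2)

lemma env_tms_split:
  assumes "env S (tms n @ tms 1) \<alpha>"
  shows "\<exists>ts u. \<alpha> = map VT ts @ [VT u] \<and> length ts = n \<and> (\<forall>t\<in>set ts. wf_trm S t) \<and> wf_trm S u"
proof -
  obtain a b where ab: "\<alpha> = a @ b" "env S (tms n) a" "env S (tms 1) b" using env_split[OF assms] by blast
  obtain ts where "a = map VT ts" "length ts = n" "\<forall>t\<in>set ts. wf_trm S t" using ab(2) unfolding env_tms by blast
  moreover obtain u where "b = [VT u]" "wf_trm S u" using env_tms_1[OF ab(3)] by blast
  ultimately show ?thesis using ab(1) by blast
qed

lemma ev_dup_1: "ev (dup (tms 1)) [VT t] = [VT t, VT t]"
  by (simp add: ev_def dup_def var_comp_def)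

lemma ev_ident_1: "ev (ident (tms 1)) [VT t] = [VT t]"
  by (simp add: ev_def ident_def var_comp_def)

lemma ev_symm: "ev (symm (tms 1) (tms 1)) [VT t, VT u] = [VT u, VT t]"
  by (simp add: ev_def symm_def var_comp_def)

lemma ev_dup_ident: "ev (dup (tms 1) \<otimes> ident (tms 1)) [VT t, VT u] = [VT t, VT t, VT u]"
  by (simp add: ev_def par_def dup_def ident_def var_comp_def)

lemma ev_ident_dup: "ev (ident (tms 1) \<otimes> dup (tms 1)) [VT t, VT u] = [VT t, VT u, VT u]"
  by (simp add: ev_def par_def dup_def ident_def var_comp_def)

lemma ev_fun_par:
  assumes "length ts = farity S f"
  shows "ev (fun_arrow S f \<otimes> ident (tms 1)) (map VT ts @ [VT u]) = [VT (Fun f ts), VT u]"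
  unfolding ev_par[OF is_conf_wf[OF conf_obs_basic(1)], of "map VT ts" S f, simplified, OF assms]
  using ev_fun_arrow[OF assms] by (simp add: ev_def ident_def var_comp_def)

lemma ev_graph:
  assumes "length ts = farity S f" "\<forall>t\<in>set ts. wf_trm S t"
  shows "ev (dup (tms (farity S f)) ;; (ident (tms (farity S f)) \<otimes> fun_arrow S f)) (map VT ts) = map VT ts @ [VT (Fun f ts)]"
proof -
  have e: "env S (tms (farity S f)) (map VT ts)" using assms unfolding env_tms by blast
  have wf: "wf_arrow S (ident (tms (farity S f)) \<otimes> fun_arrow S f)"
    by (rule wf_arrow_par[OF wf_arrow_ident is_conf_wf[OF conf_obs_basic(1)]])
  have "ev (dup (tms (farity S f)) ;; (ident (tms (farity S f)) \<otimes> fun_arrow S f)) (map VT ts) =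
    ev (ident (tms (farity S f)) \<otimes> fun_arrow S f) (map VT ts @ map VT ts)"
    by (subst ev_seq[OF wf]) (simp_all add: ev_dup[OF e])
  also have "\<dots> = ev (ident (tms (farity S f))) (map VT ts) @ ev (fun_arrow S f) (map VT ts)"
    by (rule ev_par[OF wf_arrow_ident[of S]]) (simp add: assms)
  finally show ?thesis by (simp add: ev_ident[OF e] ev_fun_arrow[OF assms(1)])
qed

lemmas basic_intros = is_conf_par is_conf_seq is_obs_par is_obs_seq is_conf_ident is_obs_ident conf_obs_basic
lemmas basic_src = src_seq src_par src_ident src_tgt_basic

lemma good_fun_fun:
  fixes P :: "('p, 'f, 'v) clause set"
  shows "good S P (fun_arrow S f) (fun_arrow S f) (ident (tms (farity S f))) (ident (tms (farity S f)))"
proof (rule good_terms)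
  show "typed S (fun_arrow S f) (fun_arrow S f) (ident (tms (farity S f))) (ident (tms (farity S f)))"
    by (simp add: typed_def basic_intros)
  fix \<alpha> \<beta> :: "('p, 'f, 'v) val list"
  assume \<alpha>: "env S (src (fun_arrow S f)) \<alpha>" and \<beta>: "env S (src (fun_arrow S f)) \<beta>" and eq: "ev (fun_arrow S f) \<alpha> = ev (fun_arrow S f) \<beta>"
  obtain ts where ts: "\<alpha> = map VT ts" "length ts = farity S f" using \<alpha> unfolding basic_src env_tms by blast
  obtain us where us: "\<beta> = map VT us" "length us = farity S f" using \<beta> unfolding basic_src env_tms by blast
  have "\<alpha> = \<beta>" using eq unfolding ts(1) us(1) ev_fun_arrow[OF ts(2)] ev_fun_arrow[OF us(2)] by simp
  then show "\<exists>h. env S (src (ident (tms (farity S f)) :: ('p, 'f) arrow)) h \<and> \<alpha> = ev (ident (tms (farity S f))) h \<and> \<beta> = ev (ident (tms (farity S f))) h"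
    using \<alpha> unfolding basic_src by (intro exI[of _ \<alpha>]) (simp add: ev_ident)
qed auto

lemma typed_fun_dup:
  "typed S (fun_arrow S f \<otimes> ident (tms 1)) (dup (tms 1)) (dup (tms (farity S f)) ;; (ident (tms (farity S f)) \<otimes> fun_arrow S f)) (fun_arrow S f)"
  "typed S (dup (tms 1)) (fun_arrow S f \<otimes> ident (tms 1)) (fun_arrow S f) (dup (tms (farity S f)) ;; (ident (tms (farity S f)) \<otimes> fun_arrow S f))"
  unfolding typed_def by (intro conjI basic_intros; (simp only: src_seq src_par src_ident src_tgt_basic tgt_seq tgt_par tgt_ident)?; simp)+

text \<open>If the pair of \<open>f(ts)\<close> and \<open>x\<close> is a duplicated
  \<open>y\<close>, then both are \<open>y\<close>, so the arguments \<open>ts\<close> parametrize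
  all solutions.\<close>

lemma good_fun_dup:
  fixes P :: "('p, 'f, 'v) clause set"
  shows "good S P (fun_arrow S f \<otimes> ident (tms 1)) (dup (tms 1)) (dup (tms (farity S f)) ;; (ident (tms (farity S f)) \<otimes> fun_arrow S f)) (fun_arrow S f)"
    (is "good S P ?s ?u ?v ?r")
proof (rule good_terms[OF typed_fun_dup(1)])
  show "set (src ?u) \<subseteq> {Tm}" "set (tgt ?u) \<subseteq> {Tm}" unfolding src_tgt_basic by auto
next
  fix h :: "('p, 'f, 'v) val list" assume "env S (src ?v) h"
  then obtain ts where ts: "h = map VT ts" "length ts = farity S f" "\<forall>t\<in>set ts. wf_trm S t" unfolding basic_src env_tms by blast
  show "ev ?s (ev ?v h) = ev ?u (ev ?r h)"
    unfolding ts(1) ev_graph[OF ts(2,3)] ev_fun_par[OF ts(2)] ev_fun_arrow[OF ts(2)] ev_dup_1 ..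
next
  fix \<alpha> \<beta> :: "('p, 'f, 'v) val list"
  assume \<alpha>: "env S (src ?s) \<alpha>" and \<beta>: "env S (src ?u) \<beta>" and eq: "ev ?s \<alpha> = ev ?u \<beta>"
  obtain ts x where ts: "\<alpha> = map VT ts @ [VT x]" "length ts = farity S f" "\<forall>t\<in>set ts. wf_trm S t"
    using \<alpha> env_tms_split unfolding basic_src by blast
  obtain y where y: "\<beta> = [VT y]" using \<beta> env_tms_1 unfolding basic_src by blast
  have xy: "x = Fun f ts" "y = Fun f ts" using eq unfolding ts(1) y ev_fun_par[OF ts(2)] ev_dup_1 by auto
  have "env S (src ?v) (map VT ts)" unfolding basic_src env_tms using ts(2,3) by blast
  moreover have "\<alpha> = ev ?v (map VT ts)" unfolding ev_graph[OF ts(2,3)] ts(1) xy(1) ..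
  moreover have "\<beta> = ev ?r (map VT ts)" unfolding ev_fun_arrow[OF ts(2)] y xy(2) ..
  ultimately show "\<exists>h. env S (src ?v) h \<and> \<alpha> = ev ?v h \<and> \<beta> = ev ?r h" by blast
qed

lemma good_dup_fun:
  fixes P :: "('p, 'f, 'v) clause set"
  shows "good S P (dup (tms 1)) (fun_arrow S f \<otimes> ident (tms 1)) (fun_arrow S f) (dup (tms (farity S f)) ;; (ident (tms (farity S f)) \<otimes> fun_arrow S f))"
    (is "good S P ?s ?u ?v ?r")
proof (rule good_terms[OF typed_fun_dup(2)])
  show "set (src ?u) \<subseteq> {Tm}" "set (tgt ?u) \<subseteq> {Tm}" unfolding basic_src tgt_par tgt_ident by auto
next
  fix h :: "('p, 'f, 'v) val list" assume "env S (src ?v) h"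
  then obtain ts where ts: "h = map VT ts" "length ts = farity S f" "\<forall>t\<in>set ts. wf_trm S t" unfolding basic_src env_tms by blast
  show "ev ?s (ev ?v h) = ev ?u (ev ?r h)"
    unfolding ts(1) ev_graph[OF ts(2,3)] ev_fun_par[OF ts(2)] ev_fun_arrow[OF ts(2)] ev_dup_1 ..
next
  fix \<alpha> \<beta> :: "('p, 'f, 'v) val list"
  assume \<alpha>: "env S (src ?s) \<alpha>" and \<beta>: "env S (src ?u) \<beta>" and eq: "ev ?s \<alpha> = ev ?u \<beta>"
  obtain ts x where ts: "\<beta> = map VT ts @ [VT x]" "length ts = farity S f" "\<forall>t\<in>set ts. wf_trm S t"
    using \<beta> env_tms_split unfolding basic_src by blast
  obtain y where y: "\<alpha> = [VT y]" using \<alpha> env_tms_1 unfolding basic_src by blast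
  have xy: "x = Fun f ts" "y = Fun f ts" using eq unfolding ts(1) y ev_fun_par[OF ts(2)] ev_dup_1 by auto
  have "env S (src ?v) (map VT ts)" unfolding basic_src env_tms using ts(2,3) by blast
  moreover have "\<beta> = ev ?r (map VT ts)" unfolding ev_graph[OF ts(2,3)] ts(1) xy(1) ..
  moreover have "\<alpha> = ev ?v (map VT ts)" unfolding ev_fun_arrow[OF ts(2)] y xy(2) ..
  ultimately show "\<exists>h. env S (src ?v) h \<and> \<alpha> = ev ?v h \<and> \<beta> = ev ?r h" by blast
qed

lemma typed_dup_symm:
  "typed S (dup (tms 1)) (dup (tms 1)) (ident (tms 1)) (ident (tms 1))"
  "typed S (symm (tms 1) (tms 1)) (symm (tms 1) (tms 1)) (ident (tms 2)) (ident (tms 2))"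
  "typed S (dup (tms 1) \<otimes> ident (tms 1)) (ident (tms 1) \<otimes> dup (tms 1)) (dup (tms 1)) (dup (tms 1))"
  unfolding typed_def by (intro conjI basic_intros; (simp only: src_seq src_par src_ident src_tgt_basic tgt_seq tgt_par tgt_ident)?; simp)+

lemma good_dup_dup:
  fixes P :: "('p, 'f, 'v) clause set"
  shows "good S P (dup (tms 1)) (dup (tms 1)) (ident (tms 1)) (ident (tms 1))"
proof (rule good_terms[OF typed_dup_symm(1)])
  show "set (src (dup (tms 1))) \<subseteq> {Tm}" "set (tgt (dup (tms 1))) \<subseteq> {Tm}" unfolding src_tgt_basic by auto
next
  fix \<alpha> \<beta> :: "('p, 'f, 'v) val list"
  assume \<alpha>: "env S (src (dup (tms 1) :: ('p, 'f) arrow)) \<alpha>" and \<beta>: "env S (src (dup (tms 1) :: ('p, 'f) arrow)) \<beta>"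
    and eq: "ev (dup (tms 1)) \<alpha> = ev (dup (tms 1)) \<beta>"
  obtain x where x: "\<alpha> = [VT x]" using \<alpha> env_tms_1 unfolding basic_src by blast
  obtain y where y: "\<beta> = [VT y]" using \<beta> env_tms_1 unfolding basic_src by blast
  have "x = y" using eq unfolding x y ev_dup_1 by simp
  then show "\<exists>h. env S (src (ident (tms 1) :: ('p, 'f) arrow)) h \<and> \<alpha> = ev (ident (tms 1)) h \<and> \<beta> = ev (ident (tms 1)) h"
    using \<alpha> x y ev_ident_1 unfolding basic_src by metis
qed simp

lemma good_symm_symm:
  fixes P :: "('p, 'f, 'v) clause set"
  shows "good S P (symm (tms 1) (tms 1)) (symm (tms 1) (tms 1)) (ident (tms 2)) (ident (tms 2))"
proof (rule good_terms[OF typed_dup_symm(2)])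
  show "set (src (symm (tms 1) (tms 1))) \<subseteq> {Tm}" "set (tgt (symm (tms 1) (tms 1))) \<subseteq> {Tm}" unfolding src_tgt_basic by auto
next
  fix \<alpha> \<beta> :: "('p, 'f, 'v) val list"
  assume \<alpha>: "env S (src (symm (tms 1) (tms 1) :: ('p, 'f) arrow)) \<alpha>" and \<beta>: "env S (src (symm (tms 1) (tms 1) :: ('p, 'f) arrow)) \<beta>"
    and eq: "ev (symm (tms 1) (tms 1)) \<alpha> = ev (symm (tms 1) (tms 1)) \<beta>"
  obtain a b where x: "\<alpha> = [VT a, VT b]" using \<alpha> env_tms_2 unfolding basic_src by blast
  obtain c d where y: "\<beta> = [VT c, VT d]" using \<beta> env_tms_2 unfolding basic_src by blast
  have "\<alpha> = \<beta>" using eq unfolding x y ev_symm by simp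
  then show "\<exists>h. env S (src (ident (tms 2) :: ('p, 'f) arrow)) h \<and> \<alpha> = ev (ident (tms 2)) h \<and> \<beta> = ev (ident (tms 2)) h"
    using \<alpha> ev_ident unfolding basic_src by metis
qed simp

text \<open>Equality of the triples \<open>(a, a, b)\<close> and \<open>(c, d, d)\<close> makes all
  four terms equal, and one term parametrizes the solutions.\<close>

lemma good_dup_dup_shifted:
  fixes P :: "('p, 'f, 'v) clause set"
  shows "good S P (dup (tms 1) \<otimes> ident (tms 1)) (ident (tms 1) \<otimes> dup (tms 1)) (dup (tms 1)) (dup (tms 1))"
    (is "good S P ?s ?u ?v ?v")
proof (rule good_terms[OF typed_dup_symm(3)])
  show "set (src ?u) \<subseteq> {Tm}" "set (tgt ?u) \<subseteq> {Tm}" unfolding basic_src tgt_par tgt_ident by auto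
next
  fix h :: "('p, 'f, 'v) val list" assume "env S (src ?v) h"
  then obtain t where t: "h = [VT t]" using env_tms_1 unfolding basic_src by blast
  show "ev ?s (ev ?v h) = ev ?u (ev ?v h)" unfolding t ev_dup_1 ev_dup_ident ev_ident_dup ..
next
  fix \<alpha> \<beta> :: "('p, 'f, 'v) val list"
  assume \<alpha>: "env S (src ?s) \<alpha>" and \<beta>: "env S (src ?u) \<beta>" and eq: "ev ?s \<alpha> = ev ?u \<beta>"
  have two: "tms 1 @ tms 1 = tms 2" by (simp add: numeral_2_eq_2)
  obtain a b where x: "\<alpha> = [VT a, VT b]" "wf_trm S a" using \<alpha> env_tms_2 unfolding basic_src two by blast
  obtain c d where y: "\<beta> = [VT c, VT d]" using \<beta> env_tms_2 unfolding basic_src two by blast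
  have "a = c \<and> a = d \<and> b = d" using eq unfolding x y ev_dup_ident ev_ident_dup by auto
  then have "\<alpha> = ev ?v [VT a]" "\<beta> = ev ?v [VT a]" unfolding x(1) y ev_dup_1 by auto
  moreover have "env S (src ?v) [VT a]" unfolding basic_src env_tms using x(2) by (intro exI[of _ "[a]"]) simp
  ultimately show "\<exists>h. env S (src ?v) h \<and> \<alpha> = ev ?v h \<and> \<beta> = ev ?v h" by blast
qed

lemma ev_goal_arrow: "ev (goal_arrow xs G) h = [VG (subst_goal G (\<lambda>x. pos xs x \<cdot>\<^sub>t (\<lambda>i. vt (h ! i))))]"
  by (simp add: ev_def goal_arrow_def subst_goal_def subst_atom_comp comp_def)

lemma ev_terms_arrow: "ev (terms_arrow xs ts) h = map (\<lambda>t. VT (t \<cdot>\<^sub>t (\<lambda>x. pos xs x \<cdot>\<^sub>t (\<lambda>i. vt (h ! i))))) ts"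
  by (simp add: ev_def terms_arrow_def subst_trm_comp comp_def)

lemma pos_eval:
  fixes \<tau> :: "'v \<Rightarrow> ('f, 'w) trm"
  assumes "x \<in> set xs"
  shows "pos xs x \<cdot>\<^sub>t (\<lambda>i. vt (map (\<lambda>x. VT (\<tau> x)) xs ! i)) = \<tau> x"
proof -
  obtain i where "i < length xs" "xs ! i = x" "pos xs x = (Var i :: ('f, nat) trm)" using pos_obtain[OF assms] by metis
  then show ?thesis by simp
qed

lemma wf_pos_eval:
  assumes "env S (tms (length xs)) h" "x \<in> set xs"
  shows "wf_trm S (pos xs x \<cdot>\<^sub>t (\<lambda>i. vt (h ! i)))"
proof -
  obtain i where i: "i < length xs" "pos xs x = (Var i :: ('b, nat) trm)" using pos_obtain[OF assms(2)] by metis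
  then show ?thesis using env_nth[OF assms(1), of i] by auto
qed

lemma subst_atom_positions:
  assumes "\<And>i. i < length (args A) \<Longrightarrow> g i = args A ! i \<cdot>\<^sub>t \<tau>"
  shows "subst_atom (Atom (pred A) (map Var [0..<length (args A)])) g = subst_atom A \<tau>"
  using assms by (auto simp: subst_atom_def intro!: nth_equalityI)

text \<open>This is the basic tile that resolves: its skeleton is one node for \<open>C\<close> with
  a leaf for each body atom. A solution is an instance \<open>\<tau>\<close> of the clause, and as
  \<open>xs\<close> lists all clause variables, including those that occur in the body only,
  \<open>\<tau>\<close> is an environment for the effect.\<close>

lemma good_clause:
  fixes P :: "('p, 'f, 'v) clause set" and S :: "('p, 'f) signature"
  assumes wfP: "wf_program S P" and C: "C \<in> P" and xs: "enumerates xs (vars_clause C)"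
  shows "good S P (pred_arrow S (pred (head C))) (ident [Pr]) (terms_arrow xs (args (head C))) (goal_arrow xs (body C))"
    (is "good S P ?s ?u ?v ?r")
proof -
  have wf: "wf_atom S (head C)" "wf_goal S (body C)" using wfP C by (auto simp: wf_program_def)
  have len: "parity S (pred (head C)) = length (args (head C))" using wf(1) by (simp add: wf_atom_def)
  have vs: "set xs = vars_clause C" using xs by (simp add: enumerates_def)
  have s: "?s = Arrow (tms (length (args (head C)))) [PC [Lit (Atom (pred (head C)) (map Var [0..<length (args (head C))]))]]"
    by (simp add: pred_arrow_def len)
  have wt: "wf_terms S xs (args (head C))"
    using wf(1) vs by (auto simp: wf_terms_def wf_atom_def vars_clause_def vars_atom_def)
  have "is_conf S ?s" using len by (auto simp: s is_conf_def wf_atom_def vars_atom_def)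
  moreover have "is_conf S ?r" by (rule is_conf_goal_arrow[OF wf(2)]) (simp add: vs vars_clause_def)
  moreover have "tgt ?v = tms (length (args (head C)))" by (simp add: tgt_def terms_arrow_def comp_def map_replicate_const)
  ultimately have t: "typed S ?s ?u ?v ?r"
    by (simp add: typed_def is_obs_ident is_obs_terms_arrow[OF wt]) (simp add: s tgt_def goal_arrow_def)
  have l: "linear_trigger ?u ?r" unfolding linear_trigger_def by (auto simp: pvar_at_ident)
  let ?cs = "replicate (length (body C)) Leaf :: ('p, 'f, 'v) skeleton list"
  let ?D = "\<lambda>_ :: nat. [Node C ?cs]"
  let ?T = "\<lambda>(h :: ('p, 'f, 'v) val list) x. pos xs x \<cdot>\<^sub>t (\<lambda>i. vt (h ! i))"
  have "sound S P ?D ?s ?u ?v ?r"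
    unfolding sound_def
  proof (intro allI impI conjI)
    fix h :: "('p, 'f, 'v) val list" and j i
    assume "env S (src ?v) h" and ji: "pvar_at ?u j i"
    then have h: "env S (tms (length xs)) h" and ji: "j = 0" "i = 0" by (auto simp: pvar_at_ident)
    have w: "\<forall>x\<in>vars_clause C. wf_trm S (?T h x)" using wf_pos_eval[OF h] vs by blast
    have "subst_atom (Atom (pred (head C)) (map Var [0..<length (args (head C))])) (\<lambda>i. vt (ev ?v h ! i)) = subst_atom (head C) (?T h)"
      by (rule subst_atom_positions) (simp add: ev_terms_arrow)
    then have 1: "map (itm (pidx ?v) (ev ?v h)) (pc (tuple ?s ! j)) = [At (subst_atom (head C) (?T h))]"
      by (simp add: s ji)
    have 2: "map (itm id h) (pc (tuple ?r ! i)) = map (\<lambda>B. At (subst_atom B (?T h))) (body C)"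
      by (simp add: goal_arrow_def ji subst_goal_def subst_atom_comp)
    have "der S P ?cs (map (\<lambda>B. At (subst_atom B (?T h))) (body C)) (map (\<lambda>B. At (subst_atom B (?T h))) (body C) :: ('p, 'f, 'v, nat) item list)"
      by (subst der_all_Leaf) auto
    from der.Node[OF C w this der.Nil]
    show "der S P [Node C ?cs] (map (itm (pidx ?v) (ev ?v h)) (pc (tuple ?s ! j))) (map (itm id h) (pc (tuple ?r ! i)))"
      unfolding 1 2 by simp
  qed (auto simp: s tgt_def)
  moreover have "complete_tile S P ?D ?s ?u ?v ?r"
    unfolding complete_tile_def
  proof (intro allI impI)
    fix \<alpha> \<beta> :: "('p, 'f, 'v) val list"
    assume "env S (src ?s) \<alpha>" and \<beta>: "env S (src ?u) \<beta>" and sol: "solves S P ?D ?s ?u \<alpha> \<beta>"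
    then obtain ts where ts: "\<alpha> = map VT ts" "length ts = length (args (head C))" unfolding s arrow.sel env_tms by blast
    obtain g where g: "\<beta> = [VG g]" using env_length[OF \<beta>] env_nth[OF \<beta>, of 0] by (auto simp: length_Suc_conv)
    let ?A = "Atom (pred (head C)) (map Var [0..<length (args (head C))])"
    obtain ms where ms: "der S P [Node C ?cs] [At (subst_atom ?A (\<lambda>i. vt (\<alpha> ! i)))] ms" "evc (tuple ?u ! 0) \<beta> = VG (concat (map flat ms))"
      using sol unfolding solves_def by (auto simp: s tgt_def)
    from ms(1) obtain \<tau> n1 n2 where \<tau>: "\<forall>x\<in>vars_clause C. wf_trm S (\<tau> x)"
      "At (subst_atom ?A (\<lambda>i. vt (\<alpha> ! i))) = (At (subst_atom (head C) \<tau>) :: ('p, 'f, 'v, ('p, 'f, 'v) goal) item)"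
      "der S P ?cs (map (\<lambda>B. At (subst_atom B \<tau>)) (body C)) n1" "der S P [] [] n2" "ms = n1 @ n2" by (rule der_NodeE)
    have n1: "n1 = map (\<lambda>B. At (subst_atom B \<tau>)) (body C)" using \<tau>(3) by (subst (asm) der_all_Leaf) auto
    have mms: "ms = map (\<lambda>B. At (subst_atom B \<tau>)) (body C)" using \<tau>(4,5) n1 by simp
    have "evc (tuple ?u ! 0) \<beta> = VG g" unfolding g by (simp add: ident_def var_comp_def)
    then have gg: "g = subst_goal (body C) \<tau>" using ms(2) unfolding mms by (simp add: comp_def subst_goal_def)
    let ?h = "map (\<lambda>x. VT (\<tau> x)) xs :: ('p, 'f, 'v) val list"
    have T: "?T ?h x = \<tau> x" if "x \<in> vars_clause C" for x using pos_eval[of x xs \<tau>] that vs by simp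
    have at: "ts ! i = args (head C) ! i \<cdot>\<^sub>t \<tau>" if i: "i < length ts" for i
    proof -
      have "map (\<lambda>t. t \<cdot>\<^sub>t (\<lambda>i. vt (\<alpha> ! i))) (map Var [0..<length (args (head C))]) = map (\<lambda>t. t \<cdot>\<^sub>t \<tau>) (args (head C))"
        using \<tau>(2) by (simp add: subst_atom_def)
      from arg_cong[OF this, of "\<lambda>l. l ! i"] show ?thesis using i ts by simp
    qed
    have "env S (src ?v) ?h" using \<tau>(1) vs by (auto simp: env_tms intro!: exI[of _ "map \<tau> xs"])
    moreover have "\<alpha> = ev ?v ?h"
    proof (rule nth_equalityI)
      fix i assume "i < length \<alpha>"
      then have i: "i < length ts" "args (head C) ! i \<in> set (args (head C))" using ts by simp_all
      have "args (head C) ! i \<cdot>\<^sub>t ?T ?h = args (head C) ! i \<cdot>\<^sub>t \<tau>"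
        by (rule subst_trm_cong) (use T i(2) in \<open>auto simp: vars_clause_def vars_atom_def\<close>)
      then show "\<alpha> ! i = ev ?v ?h ! i" using at[OF i(1)] i(1) ts by (simp add: ev_terms_arrow)
    qed (simp add: ev_terms_arrow ts)
    moreover have "\<beta> = ev ?r ?h"
    proof -
      have "subst_goal (body C) (?T ?h) = subst_goal (body C) \<tau>" by (rule subst_goal_cong) (use T in \<open>auto simp: vars_clause_def\<close>)
      then show ?thesis unfolding g gg ev_goal_arrow by simp
    qed
    ultimately show "\<exists>h. env S (src ?v) h \<and> \<alpha> = ev ?v h \<and> \<beta> = ev ?r h" by blast
  qed
  ultimately show ?thesis using t l unfolding good_def by blast
qed

lemma tile_good:
  fixes P :: "('p, 'f, 'v) clause set"
  assumes "wf_program S P" "tile S P s u v r"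
  shows "good S P s u v r"
  using assms(2)
proof (induction rule: tile.induct)
  case (basic s u v r)
  then show ?case
    by cases (simp_all only: good_clause[OF assms(1)] good_fun_fun good_fun_dup good_dup_fun good_dup_dup good_symm_symm good_dup_dup_shifted)
qed (auto intro: good_id_conf good_id_obs good_horizontal good_vertical good_parallel)

subsection \<open>The correspondence\<close>

text \<open>Assigning distinct names \<open>zs\<close> to the variables of the effect gives a
  generic environment. Soundness there yields a derivation from an instance of \<open>G\<close>, the
  lifting lemma covers it by an SLD-derivation, and completeness shows that the computed answer and
  goal are in turn instances of the effect and the final configuration. Being instances of each
  other, the two agree up to a renaming, which the choice of \<open>ys\<close> undoes.\<close>

lemma tile_resolutions:
  fixes S :: "('p, 'f) signature" and P :: "('p, 'f, 'v :: infinite) clause set" and G :: "('p, 'f, 'v) goal"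
  assumes wfP: "wf_program S P" and wfG: "wf_goal S G" and xs: "enumerates xs (vars_goal G)"
    and tile: "tile S P (goal_arrow xs G) (ident [Pr]) \<theta> g'"
  shows "\<exists>\<sigma> G' ys. distinct ys \<and> (\<Union>x\<in>vars_goal G. vars_trm (\<sigma> x)) \<union> vars_goal G' \<subseteq> set ys \<and>
    \<theta> = subst_arrow ys xs \<sigma> \<and> g' = goal_arrow ys G' \<and> sld_steps S P G \<sigma> G'"
proof -
  let ?s = "goal_arrow xs G :: ('p, 'f) arrow" and ?u = "ident [Pr] :: ('p, 'f) arrow"
  have dxs: "distinct xs" and sxs: "set xs = vars_goal G" using xs by (simp_all add: enumerates_def)
  obtain D where t: "typed S ?s ?u \<theta> g'" and sd: "sound S P D ?s ?u \<theta> g'" and cp: "complete_tile S P D ?s ?u \<theta> g'"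
    using tile_good[OF wfP tile] unfolding good_def by blast
  note T = typedD[OF t]
  have s: "src ?s = tms (length xs)" "tuple ?s = [PC (map Lit (subst_goal G (pos xs)))]" by (simp_all add: goal_arrow_def)
  have pv: "pvar_at ?u 0 0" by (simp add: pvar_at_ident)
  have "tgt g' = [Pr]" using T(11) by simp
  then obtain w where w: "tuple g' = [PC w]"
    by (cases "tuple g'"; cases "hd (tuple g')") (auto simp: tgt_def)
  have "pvars_comp (tuple g' ! 0) = []" using sound_facts(3)[OF t sd pv] s(2) by (simp add: comp_def concat_map_empty)
  then have pw: "\<forall>l\<in>set w. pvars_lit l = []" using w by simp
  have "\<exists>A. l = Lit A" if "l \<in> set w" for l using pw that by (cases l) auto
  then obtain H where H: "w = map Lit H" using ex_map_conv[of w Lit] by blast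
  define d where "d = length (src g')"
  \<comment> \<open>The goal has no variable of sort \<open>p\<close>, and soundness passes this on
    to \<open>g'\<close>; its source is therefore a power of \<open>t\<close>.\<close>
  have "pvars g' = []" using pw w by (simp add: pvars_def concat_map_empty)
  then have nP: "\<not> (i < length (src g') \<and> src g' ! i = Pr)" for i using T(2) by (auto simp: is_conf_alt)
  have srcg: "src g' = tms d"
  proof (rule nth_equalityI)
    fix i assume i: "i < length (src g')"
    then show "src g' ! i = tms d ! i" using nP[of i] by (cases "src g' ! i") (auto simp: d_def)
  qed (simp add: d_def)
  then have src\<theta>: "src \<theta> = tms d" using T(12) by simp
  have tgt\<theta>: "map srt_of (tuple \<theta>) = tms (length xs)" using T(10) s(1) by (simp add: tgt_def)
  have "\<exists>t. c = TC t" if "c \<in> set (tuple \<theta>)" for c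
  proof -
    have "srt_of c \<in> set (tms (length xs))" using that tgt\<theta> by (metis image_eqI list.set_map)
    then show ?thesis by (cases c) auto
  qed
  then obtain ts where ts: "tuple \<theta> = map TC ts" using ex_map_conv[of "tuple \<theta>" TC] by blast
  have lts: "length ts = length xs" using arg_cong[OF tgt\<theta>, of length] ts by simp
  have vts: "vars_trm t \<subseteq> {..<d}" if "t \<in> set ts" for t
    using T(8) that ts src\<theta> by (auto simp: wf_arrow_def)
  have vH: "vars_goal H \<subseteq> {..<d}"
    using T(6) w H srcg by (auto simp: wf_arrow_def vars_goal_def)
  obtain zs :: "'v list" where zs: "distinct zs" "length zs = d" using ex_fresh_list[of "{}" d] by auto
  let ?h = "map (\<lambda>z. VT (Var z)) zs :: ('p, 'f, 'v) val list"
  have h: "env S (src \<theta>) ?h" unfolding src\<theta> env_tms by (rule exI[of _ "map Var zs"]) (use zs in auto)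
  have hi: "vt (?h ! i) = Var (zs ! i)" if "i < d" for i using that zs by simp
  define \<theta>\<^sub>0 where "\<theta>\<^sub>0 x = pos xs x \<cdot>\<^sub>t (\<lambda>i. vt (ev \<theta> ?h ! i))" for x
  have wf0: "wf_trm S (\<theta>\<^sub>0 x)" if "x \<in> vars_goal G" for x
    unfolding \<theta>\<^sub>0_def by (rule wf_pos_eval) (use env_ev[OF T(8) h] T(10) s(1) that sxs in auto)
  have \<theta>0: "\<theta>\<^sub>0 (xs ! j) = ts ! j \<cdot>\<^sub>t (\<lambda>i. vt (?h ! i))" if "j < length xs" for j
    using that lts by (simp add: \<theta>\<^sub>0_def pos_nth[OF dxs] ev_def ts)
  have "der S P (D 0) (map (itm (pidx \<theta>) (ev \<theta> ?h)) (pc (tuple ?s ! 0))) (map (itm id ?h) (pc (tuple g' ! 0)))"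
    using sd h pv unfolding sound_def by blast
  moreover have "map (itm (pidx \<theta>) (ev \<theta> ?h)) (pc (tuple ?s ! 0)) = map (\<lambda>A. At (subst_atom A \<theta>\<^sub>0)) G"
    unfolding s(2) by (simp add: subst_goal_def subst_atom_comp \<theta>\<^sub>0_def[abs_def])
  ultimately have "der S P (D 0) (map (\<lambda>A. At (subst_atom A \<theta>\<^sub>0)) G) (map (itm id ?h) (pc (tuple g' ! 0)))" by simp
  from resolution_lifting[OF wfP finite_vars_goal subset_refl wfG wf0 this]
  obtain \<sigma> G' k where res: "resolutions S P (vars_goal G) G \<sigma> G'" and fac: "\<forall>x\<in>vars_goal G. \<theta>\<^sub>0 x = \<sigma> x \<cdot>\<^sub>t k"
    and mm: "map (itm id ?h) (pc (tuple g' ! 0)) = map (\<lambda>A. At (subst_atom A k)) G'"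
    and dd: "der S P (D 0) (map (\<lambda>A. At (subst_atom A \<sigma>)) G) (map At G' :: ('p, 'f, 'v, nat) item list)"
    and wf\<sigma>: "\<forall>x\<in>vars_goal G. wf_trm S (\<sigma> x)" by blast
  let ?a = "map (\<lambda>x. VT (\<sigma> x)) xs :: ('p, 'f, 'v) val list"
  have "env S (src ?s) ?a" unfolding s(1) env_tms by (rule exI[of _ "map \<sigma> xs"]) (use wf\<sigma> sxs in auto)
  moreover have "env S (src ?u) [VG G']" by (simp add: env_def)
  moreover have "solves S P D ?s ?u ?a [VG G']"
  proof -
    have "subst_atom A (\<lambda>x. pos xs x \<cdot>\<^sub>t (\<lambda>i. vt (?a ! i))) = subst_atom A \<sigma>" if "A \<in> set G" for A
      by (rule subst_atom_cong, rule pos_eval) (use that sxs in \<open>auto simp: vars_goal_def\<close>)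
    then have i: "map (itm (\<lambda>m. vg (?a ! m)) ?a) (pc (tuple ?s ! 0)) = map (\<lambda>A. At (subst_atom A \<sigma>)) G"
      unfolding s(2) by (simp add: subst_goal_def subst_atom_comp)
    \<comment> \<open>All items are atoms, so the type of labels can be changed by means of any
      function.\<close>
    have "der S P (D 0) (map (\<lambda>A. At (subst_atom A \<sigma>)) G) (map At G' :: ('p, 'f, 'v, ('p, 'f, 'v) goal) item list)"
      using der_relabel[OF dd, of "\<lambda>_. []"] by (simp add: comp_def)
    moreover have "evc (tuple ?u ! 0) [VG G'] = VG (concat (map flat (map At G')))"
      by (simp add: ident_def var_comp_def comp_def)
    ultimately have "\<exists>ms. der S P (D 0) (map (itm (\<lambda>m. vg (?a ! m)) ?a) (pc (tuple ?s ! 0))) ms \<and>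
      evc (tuple ?u ! 0) [VG G'] = VG (concat (map flat ms))" unfolding i by blast
    moreover have "tgt ?s = [Pr]" "length (tuple ?s) = 1" using T(9) s(2) by simp_all
    ultimately show ?thesis unfolding solves_def by simp
  qed
  ultimately obtain h' where h': "?a = ev \<theta> h'" "[VG G'] = ev g' h'" using cp unfolding complete_tile_def by blast
  define q where "q i = vt (h' ! i)" for i
  have \<sigma>q: "\<sigma> (xs ! j) = ts ! j \<cdot>\<^sub>t q" if "j < length xs" for j
    using arg_cong[OF h'(1), of "\<lambda>l. l ! j"] that lts by (simp add: ev_def ts q_def[abs_def])
  have G'q: "G' = subst_goal H q"
    using h'(2) by (simp add: ev_def w H q_def[abs_def] comp_def subst_goal_def)
  let ?U = "(\<Union>t\<in>set ts. vars_trm t) \<union> vars_goal H"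
  have Ud: "?U \<subseteq> {..<d}" using vts vH by blast
  \<comment> \<open>On the variables that occur, \<open>q\<close> followed by \<open>k\<close> is
    the generic assignment, which makes \<open>q\<close> an injective map to variables
    there.\<close>
  have qk: "q i \<cdot>\<^sub>t k = Var (zs ! i)" if i: "i \<in> ?U" for i
  proof -
    have "(\<lambda>i. vt (?h ! i)) i = (\<lambda>i. q i \<cdot>\<^sub>t k) i"
    proof (cases "i \<in> vars_goal H")
      case True
      then obtain A where A: "A \<in> set H" "i \<in> vars_atom A" by (auto simp: vars_goal_def)
      have "\<forall>A\<in>set H. subst_atom A (\<lambda>i. vt (?h ! i)) = subst_atom A (\<lambda>i. q i \<cdot>\<^sub>t k)"
        using mm unfolding w H G'q by (simp add: subst_goal_def subst_atom_comp)
      then show ?thesis using subst_atom_eqD[OF _ A(2)] A(1) by blast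
    next
      case False
      then obtain j where j: "j < length xs" "i \<in> vars_trm (ts ! j)" using i lts by (auto simp: in_set_conv_nth)
      have "xs ! j \<in> vars_goal G" using nth_mem[OF j(1)] unfolding sxs .
      then have "ts ! j \<cdot>\<^sub>t (\<lambda>i. vt (?h ! i)) = ts ! j \<cdot>\<^sub>t (\<lambda>i. q i \<cdot>\<^sub>t k)"
        using fac \<theta>0[OF j(1)] \<sigma>q[OF j(1)] by (simp add: subst_trm_comp)
      then show ?thesis by (rule subst_trm_eqD[OF _ j(2)])
    qed
    then show ?thesis using hi[of i] Ud i by auto
  qed
  have "\<exists>y. q i = Var y" if "i \<in> ?U" for i using qk[OF that] by (cases "q i") auto
  then have "\<forall>i\<in>?U. \<exists>y. q i = Var y" by blast
  from bchoice[OF this] obtain y where y\<^sub>0: "\<forall>i\<in>?U. q i = Var (y i)" by blast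
  have y: "q i = Var (y i)" if "i \<in> ?U" for i using y\<^sub>0 that by blast
  have injy: "inj_on y ?U"
  proof (rule inj_onI)
    fix i j assume ij: "i \<in> ?U" "j \<in> ?U" "y i = y j"
    then have "zs ! i = zs ! j" using qk[OF ij(1)] qk[OF ij(2)] y[OF ij(1)] y[OF ij(2)] by simp
    then show "i = j" using zs Ud ij(1,2) nth_eq_iff_index_eq[OF zs(1)] by blast
  qed
  have finU: "finite ?U" by simp
  \<comment> \<open>Positions that occur neither in the effect nor in the final configuration must
    be named too, since \<open>ys\<close> has to have length \<open>d\<close>; they get names apart
    from the others.\<close>
  obtain \<rho> where \<rho>: "inj_on \<rho> ({..<d} - ?U)" "\<rho> ` ({..<d} - ?U) \<inter> y ` ?U = {}"
    using ex_fresh_renaming[of "{..<d} - ?U" "y ` ?U"] by auto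
  define y' where "y' i = (if i \<in> ?U then y i else \<rho> i)" for i
  have injy': "inj_on y' {..<d}"
  proof (rule inj_onI)
    fix i j assume ij: "i \<in> {..<d}" "j \<in> {..<d}" "y' i = y' j"
    show "i = j"
    proof (cases "i \<in> ?U"; cases "j \<in> ?U")
      assume "i \<in> ?U" "j \<in> ?U" then show ?thesis using ij(3) inj_onD[OF injy] unfolding y'_def by simp
    next
      assume a: "i \<in> ?U" "j \<notin> ?U"
      have "y i = \<rho> j" using ij(3) unfolding y'_def if_P[OF a(1)] if_not_P[OF a(2)] .
      moreover have "\<rho> j \<in> \<rho> ` ({..<d} - ?U)" by (rule imageI) (use ij(2) a(2) in blast)
      ultimately show ?thesis using \<rho>(2) imageI[OF a(1), of y] by (metis disjoint_iff)
    next
      assume a: "i \<notin> ?U" "j \<in> ?U"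
      have "\<rho> i = y j" using ij(3) unfolding y'_def if_P[OF a(2)] if_not_P[OF a(1)] .
      moreover have "\<rho> i \<in> \<rho> ` ({..<d} - ?U)" by (rule imageI) (use ij(1) a(1) in blast)
      ultimately show ?thesis using \<rho>(2) imageI[OF a(2), of y] by (metis disjoint_iff)
    next
      assume "i \<notin> ?U" "j \<notin> ?U" then show ?thesis using ij inj_onD[OF \<rho>(1)] unfolding y'_def by auto
    qed
  qed
  let ?ys = "map y' [0..<d]"
  have dys: "distinct ?ys" using injy' by (simp add: distinct_map lessThan_atLeast0)
  have qU: "q i = Var (y' i)" if "i \<in> ?U" for i unfolding y'_def using y[OF that] that by simp
  have qpos: "q i \<cdot>\<^sub>t pos ?ys = Var i" if "i \<in> ?U" for i
    using pos_nth[OF dys, of i] qU[OF that] that Ud by auto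
  have vq: "vars_trm (q i) \<subseteq> set ?ys" if "i \<in> ?U" for i using qU[OF that] that Ud by auto
  have tpos: "t \<cdot>\<^sub>t q \<cdot>\<^sub>t pos ?ys = t" if "t \<in> set ts" for t
  proof -
    have "t \<cdot>\<^sub>t q \<cdot>\<^sub>t pos ?ys = t \<cdot>\<^sub>t Var" unfolding subst_trm_comp by (rule subst_trm_cong, rule qpos) (use that in blast)
    then show ?thesis by simp
  qed
  have \<sigma>ts: "map \<sigma> xs = map (\<lambda>t. t \<cdot>\<^sub>t q) ts" using lts \<sigma>q by (intro nth_equalityI) auto
  have "map (\<lambda>t. TC (t \<cdot>\<^sub>t pos ?ys)) (map \<sigma> xs) = (map TC ts :: ('p, 'f) component list)" unfolding \<sigma>ts using tpos by simp
  then have 1: "\<theta> = subst_arrow ?ys xs \<sigma>"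
    using ts src\<theta> by (cases \<theta>) (simp add: subst_arrow_def terms_arrow_def)
  have "subst_goal (subst_goal H q) (pos ?ys) = subst_goal H Var" unfolding subst_goal_comp
    by (rule subst_goal_cong, rule qpos) blast
  then have 2: "g' = goal_arrow ?ys G'"
    using w H srcg by (cases g') (simp add: goal_arrow_def G'q)
  have "vars_trm (\<sigma> x) \<subseteq> set ?ys" if "x \<in> vars_goal G" for x
  proof -
    have "\<sigma> x \<in> set (map \<sigma> xs)" using that sxs by simp
    then obtain t where "t \<in> set ts" "\<sigma> x = t \<cdot>\<^sub>t q" unfolding \<sigma>ts by auto
    then show ?thesis unfolding vars_subst_trm[of t q, symmetric] using vq by (simp add: vars_subst_trm) blast
  qed
  moreover have "vars_goal G' \<subseteq> set ?ys" unfolding G'q vars_subst_goal using vq by blast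
  ultimately have "(\<Union>x\<in>vars_goal G. vars_trm (\<sigma> x)) \<union> vars_goal G' \<subseteq> set ?ys" by blast
  then show ?thesis using dys 1 2 res unfolding sld_steps_def by blast
qed

text \<open>Removing \<open>\<box>\<close> leaves the goal as it is, but \<open>ys\<close> may list
  its variables in another order than \<open>xs\<close>. The identity tile of the goal is therefore
  pasted to a permutation of the variables.\<close>

lemma rename_tile:
  fixes S :: "('p, 'f) signature" and P :: "('p, 'f, 'v) clause set" and G :: "('p, 'f, 'v) goal"
  assumes wfG: "wf_goal S G" and xs: "enumerates xs (vars_goal G)" and ys: "enumerates ys (vars_goal G)"
  shows "tile S P (goal_arrow xs G) (ident [Pr]) (subst_arrow ys xs Var) (goal_arrow ys G)"
proof -
  let ?s = "goal_arrow xs G :: ('p, 'f) arrow" and ?i = "terms_arrow xs (map Var xs) :: ('p, 'f) arrow"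
    and ?v = "terms_arrow ys (map Var xs) :: ('p, 'f) arrow"
  have dx: "distinct xs" "distinct ys" "set xs = vars_goal G" "set ys = vars_goal G" using xs ys by (simp_all add: enumerates_def)
  have c: "is_conf S ?s" by (rule is_conf_goal_arrow[OF wfG]) (simp add: dx)
  have st: "src ?s = tms (length xs)" "tgt ?s = [Pr]" by (simp_all add: goal_arrow_def tgt_def)
  have 1: "tile S P ?s (ident [Pr]) ?i ?s"
    using tile.id_conf[OF c, of P] unfolding st ident_terms_arrow[OF dx(1)] .
  have "mset ys = mset xs" using set_eq_iff_mset_eq_distinct[OF dx(2,1)] dx by simp
  then have 2: "tile S P ?i ?i ?v ?v" using tile_rename_perm[OF dx(1)] unfolding sym_tile_def by blast
  have eval: "a ;; ?s = goal_arrow ys G" if a: "a = ?v" for a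
  proof -
    have "subst_goal (subst_goal G (pos xs)) (\<lambda>i. tc ((map (\<lambda>t. TC (t \<cdot>\<^sub>t pos ys)) (map Var xs) :: ('p, 'f) component list) ! i)) = subst_goal G (pos ys)"
      unfolding subst_goal_comp
    proof (rule subst_goal_cong)
      fix x assume "x \<in> vars_goal G"
      then obtain i where "i < length xs" "xs ! i = x" "pos xs x = (Var i :: ('f, nat) trm)" using pos_obtain[of x xs] dx(3) by metis
      then show "pos xs x \<cdot>\<^sub>t (\<lambda>i. tc ((map (\<lambda>t. TC (t \<cdot>\<^sub>t pos ys)) (map Var xs) :: ('p, 'f) component list) ! i)) = pos ys x" by simp
    qed
    then show ?thesis unfolding a goal_arrow_def[of xs] seq_terms_arrow_goal by (simp add: goal_arrow_def)
  qed
  have "?i ;; ?s = ?s"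
  proof -
    have "subst_goal (subst_goal G (pos xs)) (\<lambda>i. tc ((map (\<lambda>t. TC (t \<cdot>\<^sub>t pos xs)) (map Var xs) :: ('p, 'f) component list) ! i)) = subst_goal G (pos xs)"
      unfolding subst_goal_comp
    proof (rule subst_goal_cong)
      fix x assume "x \<in> vars_goal G"
      then obtain i where "i < length xs" "xs ! i = x" "pos xs x = (Var i :: ('f, nat) trm)" using pos_obtain[of x xs] dx(3) by metis
      then show "pos xs x \<cdot>\<^sub>t (\<lambda>i. tc ((map (\<lambda>t. TC (t \<cdot>\<^sub>t pos xs)) (map Var xs) :: ('p, 'f) component list) ! i)) = pos xs x" by simp
    qed
    then show ?thesis unfolding goal_arrow_def[of xs] seq_terms_arrow_goal by simp
  qed
  then show ?thesis using tile.horizontal[OF 1 2] eval[OF refl] by (simp add: subst_arrow_def)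
qed

text \<open>Arrows have no variable names, so the restriction of \<open>\<sigma>\<close> and the new
  goal must be presented over one common list \<open>ys\<close>. In the first half its order is
  free, because tiles can permute their variables; in the second half the list is a witness that
  supplies a name for every variable of the given arrows.\<close>

theorem theorem4p6:
  fixes S :: "('p, 'f) signature"
    and P :: "('p, 'f, 'v::infinite) clause set"
    and G :: "('p, 'f, 'v) goal"
    and xs :: "'v list"
  assumes "wf_program S P"
    and "wf_goal S G"
    and "enumerates xs (vars_goal G)"
  shows "(\<forall>\<sigma> G' ys. sld_step S P G \<sigma> G' \<and>
           enumerates ys ((\<Union>x\<in>vars_goal G. vars_trm (\<sigma> x)) \<union> vars_goal G') \<longrightarrow>
           tile S P (goal_arrow xs G) (ident [Pr]) (subst_arrow ys xs \<sigma>) (goal_arrow ys G')) \<and>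
         (\<forall>\<theta> g'. tile S P (goal_arrow xs G) (ident [Pr]) \<theta> g' \<longrightarrow>
           (\<exists>\<sigma> G' ys. distinct ys \<and>
              (\<Union>x\<in>vars_goal G. vars_trm (\<sigma> x)) \<union> vars_goal G' \<subseteq> set ys \<and>
              \<theta> = subst_arrow ys xs \<sigma> \<and> g' = goal_arrow ys G' \<and>
              sld_steps S P G \<sigma> G'))"
proof (intro conjI allI impI)
  fix \<sigma> G' ys
  assume *: "sld_step S P G \<sigma> G' \<and> enumerates ys ((\<Union>x\<in>vars_goal G. vars_trm (\<sigma> x)) \<union> vars_goal G')"
  then obtain W' where "resolution S P (vars_goal G) G \<sigma> G' W'" and ys: "enumerates ys ((\<Union>x\<in>vars_goal G. vars_trm (\<sigma> x)) \<union> vars_goal G')"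
    unfolding sld_step_def by blast
  from this(1) show "tile S P (goal_arrow xs G) (ident [Pr]) (subst_arrow ys xs \<sigma>) (goal_arrow ys G')"
  proof cases
    case (resolve C C' A G1 G2)
    show ?thesis using resolve_tile[of S P G1 A G2 xs C C' \<sigma> ys] resolve assms ys by simp
  next
    case box_left
    then show ?thesis using rename_tile[OF assms(2,3), of ys P] ys by simp
  next
    case box_right
    then show ?thesis using rename_tile[OF assms(2,3), of ys P] ys by simp
  qed
next
  fix \<theta> g'
  assume "tile S P (goal_arrow xs G) (ident [Pr]) \<theta> g'"
  then show "\<exists>\<sigma> G' ys. distinct ys \<and> (\<Union>x\<in>vars_goal G. vars_trm (\<sigma> x)) \<union> vars_goal G' \<subseteq> set ys \<and>
      \<theta> = subst_arrow ys xs \<sigma> \<and> g' = goal_arrow ys G' \<and> sld_steps S P G \<sigma> G'"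
    by (rule tile_resolutions[OF assms])
qed

end
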